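(* Let $F$ be a field of characteristic zero, let $m,n$ be positive integers, $f=x^m+y^n+z^2$ and $A=F[[x,y,z]]/(f)$. For all integers $k,l$ with $1\le k\le m$ and $1\le l\le n$, let $W=W(\phi,\psi)=A^4/\operatorname{im}\phi$ and let $\overline{\nabla}^{\phi,\psi}:\mathbf{V}_W\to\operatorname{End}_F(W)$ be the $\mathbf{V}_W$-connection determined by $\overline{\nabla}_{\delta_i}(\overline a)=\overline{(\delta_i+A_i)a}$ for $i=0,1,2,3$, $a\in A^4$, where $\phi,\psi,\delta_i,A_i$ are as given in the context. Then $\overline{\nabla}^{\phi,\psi}$ is flat (its curvature vanishes); hence $c_1(W(\phi,\psi))=0$ in $\operatorname{H}^2(\mathbf{V}_W|_U,\mathcal{O}_U)$ for all the modules $W(\phi,\psi)$, where $U\subseteq\operatorname{Spec}(A)$ is the open subset where $W$ is locally free.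
   Context: Matrix factorization. For $1\le k\le m$ and $1\le l\le n$ put $$\phi=\begin{pmatrix} x^{m-k} & y^{n-l} & 0 & z \\ y^l & -x^k & z & 0 \\ z & 0 & -y^{n-l} & -x^k \\ 0 & z & x^{m-k} & -y^l\end{pmatrix},\qquad \psi=\begin{pmatrix} x^k & y^{n-l} & z & 0 \\ y^l & -x^{m-k} & 0 & z \\ 0 & z & -y^l & x^k \\ z & 0 & -x^{m-k} & -y^{n-l}\end{pmatrix}.$$ They satisfy $\phi\psi=\psi\phi=f\cdot I$, and $W(\phi,\psi)=A^4/\operatorname{im}\phi$ is a maximal Cohen-Macaulay $A$-module; $\overline{a}$ denotes the class of $a\in A^4$ in $W$. Derivations. $\operatorname{Der}_F(A)$ is generated as an $A$-module by $$\delta_0=2nx\partial_x+2my\partial_y+mnz\partial_z,\quad \delta_1=mx^{m-1}\partial_y-ny^{n-1}\partial_x,\quad \delta_2=-2z\partial_x+mx^{m-1}\partial_z,\quad \delta_3=-2z\partial_y+ny^{n-1}\partial_z,$$ acting coordinatewise on $A^4$. Linear Lie-Rinehart algebra. For an $A$-module $W$, $\mathbf{V}_W\subseteq\operatorname{Der}_F(A)$ is the kernel of the Kodaira-Spencer map $g:\operatorname{Der}_F(A)\to \operatorname{Ext}^1_A(W,W)=\operatorname{HH}^1(A,\operatorname{End}_F(W))$ sending $\delta$ to the class of the derivation $C(\delta)(a)(w)=\delta(a)w$ modulo the inner derivations $a\mapsto\varphi a-a\varphi$, $\varphi\in\operatorname{End}_F(W)$, where $(a\varphi)(w)=a\varphi(w)$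 and $(\varphi a)(w)=\varphi(aw)$. It is an $A$-submodule and Lie subalgebra of $\operatorname{Der}_F(A)$. For $W=W(\phi,\psi)$ one has $\mathbf{V}_W=\operatorname{Der}_F(A)$. A $\mathbf{V}_W$-connection on $W$ is an $A$-linear map $\nabla:\mathbf{V}_W\to\operatorname{End}_F(W)$ with $\nabla_\delta(aw)=a\nabla_\delta(w)+\delta(a)w$; its curvature is $R_\nabla(\delta\wedge\eta)=[\nabla_\delta,\nabla_\eta]-\nabla_{[\delta,\eta]}$, and $\nabla$ is flat if it is a homomorphism of Lie algebras, i.e. $R_\nabla=0$. Matrices. $$A_0=\operatorname{diag}\left(nk+ml-\tfrac12 mn,\ \tfrac32 mn-ml-nk,\ \tfrac12 mn+ml-nk,\ \tfrac12 mn+nk-ml\right),$$ $$A_1=\begin{pmatrix}0&b_2&0&0\\ b_1&0&0&0\\0&0&0&b_4\\0&0&b_3&0\end{pmatrix},\quad A_2=\begin{pmatrix}0&0&c_3&0\\0&0&0&c_4\\c_1&0&0&0\\0&c_2&0&0\end{pmatrix},\quad A_3=\begin{pmatrix}0&0&0&d_4\\0&0&d_3&0\\0&d_2&0&0\\d_1&0&0&0\end{pmatrix},$$ where $b_1=\frac14(mn-2nk-2ml)x^{k-1}y^{l-1}$, $b_2=\frac14(3mn-2ml-2nk)x^{m-k-1}y^{n-l-1}$, $b_3=\frac14(2nk-mn-2ml)x^{m-k-1}y^{l-1}$, $b_4=\frac14(2nk-2ml+mn)x^{k-1}y^{n-l-1}$; $c_1=\frac1n(\frac12mn-ml-nk)x^{k-1}$,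 $c_2=\frac1n(\frac32mn-ml-nk)x^{m-k-1}$, $c_3=\frac1n(\frac12mn+ml-nk)x^{m-k-1}$, $c_4=\frac1n(ml-nk-\frac12mn)x^{k-1}$; $d_1=\frac1m(\frac12mn-ml-nk)y^{l-1}$, $d_2=\frac1m(ml+nk-\frac32mn)y^{n-l-1}$, $d_3=\frac1m(\frac12mn+ml-nk)y^{l-1}$, $d_4=\frac1m(\frac12mn-ml+nk)y^{n-l-1}$. The paper's preceding theorem asserts that, for all $1\le k\le m$ and $1\le l\le n$, the formulas in the claim give a well-defined $\mathbf{V}_W$-connection on $W$. First Chern class. $\mathbf{V}_W|_U$ is the restriction to $U$ of the quasi-coherent sheaf associated to $\mathbf{V}_W$, with the Lie-Rinehart structure obtained by localization. The Chevalley-Hochschild complex is $\operatorname{C}^p(\mathbf{V}_W|_U,\mathcal{O}_U)=\operatorname{Hom}_{\mathcal{O}_U}(\wedge^p\mathbf{V}_W|_U,\mathcal{O}_U)$ (global homomorphisms of sheaves) with $$d^p\phi(g_1\wedge\cdots\wedge g_{p+1})=\sum_{i}(-1)^{i+1}g_i\,\phi(g_1\wedge\cdots\widehat{g_i}\cdots\wedge g_{p+1})+\sum_{i<j}(-1)^{i+j}\phi([g_i,g_j]\wedge\cdots\widehat{g_i}\cdots\widehat{g_j}\cdots\wedge g_{p+1}),$$ and $\operatorname{H}^i(\mathbf{V}_W|_U,\mathcal{O}_U)$ is its cohomology. For a finitely presented $A$-module $W$ admitting a $\mathbf{V}_W$-connection $\nabla$, $c_1(W)\in\operatorname{H}^2(\mathbf{V}_W|_U,\mathcal{O}_U)$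 is the class of the 2-cocycle $\operatorname{trace}\circ R_\nabla|_U$; it does not depend on $\nabla$.
   Formalization: The connection and its flatness are stated only when all entries of A_0,…,A_3 are power series (always if k<m and l<n); for k=m or l=n entries such as c_2 can contain x^{-1} or y^{-1} and the operators are undefined. c_1(W)=0 is stated for all 1≤k≤m, 1≤l≤n. *)

theory Defs
  imports
    "HOL-Algebra.Algebra"
    "HOL-Algebra.Algebraic_Closure_Type"
    "HOL-Computational_Algebra.Formal_Power_Series"
begin

section \<open>Modules, bases, traces\<close>

definition reg_module :: "('a, 'z) ring_scheme \<Rightarrow> ('a, 'a) module" where
  "reg_module R =
     \<lparr>carrier = carrier R, monoid.mult = monoid.mult R, monoid.one = \<one>\<^bsub>R\<^esub>,
      ring.zero = \<zero>\<^bsub>R\<^esub>, ring.add = add R, module.smult = monoid.mult R\<rparr>"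

text \<open>The record type \<^typ>\<open>('a, 'm) module\<close> extends the ring record; for modules which
  carry no multiplication, the fields \<open>mult\<close> and \<open>one\<close> are irrelevant and left unspecified.\<close>

definition free_module :: "('a, 'z) ring_scheme \<Rightarrow> nat \<Rightarrow> ('a, nat \<Rightarrow> 'a) module" where
  "free_module R r =
     \<lparr>carrier = {..<r} \<rightarrow>\<^sub>E carrier R, monoid.mult = undefined, monoid.one = undefined,
      ring.zero = (\<lambda>i\<in>{..<r}. \<zero>\<^bsub>R\<^esub>),
      ring.add = (\<lambda>u v. \<lambda>i\<in>{..<r}. u i \<oplus>\<^bsub>R\<^esub> v i),
      module.smult = (\<lambda>c v. \<lambda>i\<in>{..<r}. c \<otimes>\<^bsub>R\<^esub> v i)\<rparr>"

definition quot_module :: "('a, 'm) module \<Rightarrow> 'm set \<Rightarrow> ('a, 'm set) module" where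
  "quot_module M N =
     \<lparr>carrier = a_rcosets\<^bsub>M\<^esub> N, monoid.mult = undefined, monoid.one = undefined,
      ring.zero = N, ring.add = set_add M,
      module.smult = (\<lambda>c \<alpha>. \<Union>v\<in>\<alpha>. N +>\<^bsub>M\<^esub> (c \<odot>\<^bsub>M\<^esub> v))\<rparr>"

definition mat_vec ::
    "('a, 'z) ring_scheme \<Rightarrow> nat \<Rightarrow> (nat \<Rightarrow> nat \<Rightarrow> 'a) \<Rightarrow> (nat \<Rightarrow> 'a) \<Rightarrow> nat \<Rightarrow> 'a" where
  "mat_vec R r B v = (\<lambda>i\<in>{..<r}. \<Oplus>\<^bsub>R\<^esub>j\<in>{..<r}. B i j \<otimes>\<^bsub>R\<^esub> v j)"

definition is_basis ::
    "('a, 'z) ring_scheme \<Rightarrow> ('a, 'm) module \<Rightarrow> nat \<Rightarrow> (nat \<Rightarrow> 'm) \<Rightarrow> bool" where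
  "is_basis R M r e \<longleftrightarrow>
     e \<in> {..<r} \<rightarrow> carrier M \<and>
     (\<forall>v\<in>carrier M. \<exists>!c. c \<in> {..<r} \<rightarrow>\<^sub>E carrier R \<and>
        v = (\<Oplus>\<^bsub>M\<^esub>i\<in>{..<r}. c i \<odot>\<^bsub>M\<^esub> e i))"

definition coords ::
    "('a, 'z) ring_scheme \<Rightarrow> ('a, 'm) module \<Rightarrow> nat \<Rightarrow> (nat \<Rightarrow> 'm) \<Rightarrow> 'm \<Rightarrow> nat \<Rightarrow> 'a" where
  "coords R M r e v =
     (THE c. c \<in> {..<r} \<rightarrow>\<^sub>E carrier R \<and> v = (\<Oplus>\<^bsub>M\<^esub>i\<in>{..<r}. c i \<odot>\<^bsub>M\<^esub> e i))"

definition finite_free :: "('a, 'z) ring_scheme \<Rightarrow> ('a, 'm) module \<Rightarrow> bool" where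
  "finite_free R M \<longleftrightarrow> (\<exists>r e. is_basis R M r e)"

text \<open>Trace of an endomorphism of a module that is free of finite rank (computed in some basis).\<close>

definition trace :: "('a, 'z) ring_scheme \<Rightarrow> ('a, 'm) module \<Rightarrow> ('m \<Rightarrow> 'm) \<Rightarrow> 'a" where
  "trace R M T =
     (let (r, e) = (SOME (r, e). is_basis R M r e)
      in \<Oplus>\<^bsub>R\<^esub>i\<in>{..<r}. coords R M r e (T (e i)) i)"


section \<open>Localization and sheaves on the prime spectrum\<close>

text \<open>The fraction \<open>m/s\<close> in \<open>S\<^sup>-\<^sup>1M\<close>, as an equivalence class of pairs. The operations below are
  written as unions over all representatives, in the style of \<^const>\<open>rcoset_mult\<close>.\<close>

definition frac :: "'a set \<Rightarrow> ('a, 'm) module \<Rightarrow> 'm \<Rightarrow> 'a \<Rightarrow> ('m \<times> 'a) set" where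
  "frac S M m s =
     {(m', s'). m' \<in> carrier M \<and> s' \<in> S \<and>
        (\<exists>u\<in>S. u \<odot>\<^bsub>M\<^esub> (s' \<odot>\<^bsub>M\<^esub> m) = u \<odot>\<^bsub>M\<^esub> (s \<odot>\<^bsub>M\<^esub> m'))}"

definition loc_ring :: "('a, 'z) ring_scheme \<Rightarrow> 'a set \<Rightarrow> ('a \<times> 'a) set ring" where
  "loc_ring R S =
     \<lparr>carrier = {frac S (reg_module R) a s | a s. a \<in> carrier R \<and> s \<in> S},
      monoid.mult = (\<lambda>\<alpha> \<beta>. \<Union>(a, s)\<in>\<alpha>. \<Union>(b, t)\<in>\<beta>.
         frac S (reg_module R) (a \<otimes>\<^bsub>R\<^esub> b) (s \<otimes>\<^bsub>R\<^esub> t)),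
      monoid.one = frac S (reg_module R) \<one>\<^bsub>R\<^esub> \<one>\<^bsub>R\<^esub>,
      ring.zero = frac S (reg_module R) \<zero>\<^bsub>R\<^esub> \<one>\<^bsub>R\<^esub>,
      ring.add = (\<lambda>\<alpha> \<beta>. \<Union>(a, s)\<in>\<alpha>. \<Union>(b, t)\<in>\<beta>.
         frac S (reg_module R) (t \<otimes>\<^bsub>R\<^esub> a \<oplus>\<^bsub>R\<^esub> s \<otimes>\<^bsub>R\<^esub> b) (s \<otimes>\<^bsub>R\<^esub> t))\<rparr>"

definition loc_module ::
    "('a, 'z) ring_scheme \<Rightarrow> 'a set \<Rightarrow> ('a, 'm) module \<Rightarrow> (('a \<times> 'a) set, ('m \<times> 'a) set) module" where
  "loc_module R S M =
     \<lparr>carrier = {frac S M m s | m s. m \<in> carrier M \<and> s \<in> S},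
      monoid.mult = undefined, monoid.one = undefined,
      ring.zero = frac S M \<zero>\<^bsub>M\<^esub> \<one>\<^bsub>R\<^esub>,
      ring.add = (\<lambda>\<alpha> \<beta>. \<Union>(v, s)\<in>\<alpha>. \<Union>(w, t)\<in>\<beta>.
         frac S M (t \<odot>\<^bsub>M\<^esub> v \<oplus>\<^bsub>M\<^esub> s \<odot>\<^bsub>M\<^esub> w) (s \<otimes>\<^bsub>R\<^esub> t)),
      module.smult = (\<lambda>\<alpha> \<beta>. \<Union>(a, s)\<in>\<alpha>. \<Union>(v, t)\<in>\<beta>.
         frac S M (a \<odot>\<^bsub>M\<^esub> v) (s \<otimes>\<^bsub>R\<^esub> t))\<rparr>"

abbreviation stalk_ring :: "('a, 'z) ring_scheme \<Rightarrow> 'a set \<Rightarrow> ('a \<times> 'a) set ring" where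
  "stalk_ring R p \<equiv> loc_ring R (carrier R - p)"

abbreviation stalk ::
    "('a, 'z) ring_scheme \<Rightarrow> ('a, 'm) module \<Rightarrow> 'a set \<Rightarrow> (('a \<times> 'a) set, ('m \<times> 'a) set) module" where
  "stalk R M p \<equiv> loc_module R (carrier R - p) M"

definition Spec :: "('a, 'z) ring_scheme \<Rightarrow> 'a set set" where
  "Spec R = {p. primeideal p R}"

definition zariski_open :: "('a, 'z) ring_scheme \<Rightarrow> 'a set set \<Rightarrow> bool" where
  "zariski_open R N \<longleftrightarrow> (\<exists>E\<subseteq>carrier R. N = {p \<in> Spec R. \<not> E \<subseteq> p})"

definition opens_in :: "('a, 'z) ring_scheme \<Rightarrow> 'a set set \<Rightarrow> 'a set set set" where
  "opens_in R U = {N. zariski_open R N \<and> N \<subseteq> U}"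

text \<open>The points having a basic open neighbourhood \<open>D(g)\<close> on which the sheaf of \<open>M\<close> is free of
  finite rank.\<close>

definition locally_free_locus :: "('a, 'z) ring_scheme \<Rightarrow> ('a, 'm) module \<Rightarrow> 'a set set" where
  "locally_free_locus R M =
     {p \<in> Spec R. \<exists>g \<in> carrier R - p.
        let S = {g [^]\<^bsub>R\<^esub> i | i :: nat. True} in finite_free (loc_ring R S) (loc_module R S M)}"

text \<open>Sections over \<open>N\<close> of the quasi-coherent sheaf associated to \<open>M\<close>: families of elements of the
  stalks that are locally given by a fraction.\<close>

definition sections ::
    "('a, 'z) ring_scheme \<Rightarrow> ('a, 'm) module \<Rightarrow> 'a set set \<Rightarrow> ('a set \<Rightarrow> ('m \<times> 'a) set) set" where
  "sections R M N =
     {s \<in> (\<Pi>\<^sub>E p\<in>N. carrier (stalk R M p)).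
        \<forall>p\<in>N. \<exists>N'. zariski_open R N' \<and> p \<in> N' \<and> N' \<subseteq> N \<and>
          (\<exists>m\<in>carrier M. \<exists>g\<in>carrier R. \<forall>q\<in>N'. g \<notin> q \<and> s q = frac (carrier R - q) M m g)}"

definition sec_ring ::
    "('a, 'z) ring_scheme \<Rightarrow> 'a set set \<Rightarrow> ('a set \<Rightarrow> ('a \<times> 'a) set) ring" where
  "sec_ring R N =
     \<lparr>carrier = sections R (reg_module R) N,
      monoid.mult = (\<lambda>s t. \<lambda>p\<in>N. s p \<otimes>\<^bsub>stalk_ring R p\<^esub> t p),
      monoid.one = (\<lambda>p\<in>N. \<one>\<^bsub>stalk_ring R p\<^esub>),
      ring.zero = (\<lambda>p\<in>N. \<zero>\<^bsub>stalk_ring R p\<^esub>),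
      ring.add = (\<lambda>s t. \<lambda>p\<in>N. s p \<oplus>\<^bsub>stalk_ring R p\<^esub> t p)\<rparr>"

definition sec_module ::
    "('a, 'z) ring_scheme \<Rightarrow> ('a, 'm) module \<Rightarrow> 'a set set
      \<Rightarrow> ('a set \<Rightarrow> ('a \<times> 'a) set, 'a set \<Rightarrow> ('m \<times> 'a) set) module" where
  "sec_module R M N =
     \<lparr>carrier = sections R M N, monoid.mult = undefined, monoid.one = undefined,
      ring.zero = (\<lambda>p\<in>N. \<zero>\<^bsub>stalk R M p\<^esub>),
      ring.add = (\<lambda>s t. \<lambda>p\<in>N. s p \<oplus>\<^bsub>stalk R M p\<^esub> t p),
      module.smult = (\<lambda>c s. \<lambda>p\<in>N. c p \<odot>\<^bsub>stalk R M p\<^esub> s p)\<rparr>"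


section \<open>Derivations, the linear Lie-Rinehart algebra, connections\<close>

text \<open>An \<open>F\<close>-algebra \<open>A\<close> is a record of type \<^typ>\<open>('f, 'a) module\<close> whose scalar multiplication is
  the action of \<open>F\<close>, as in the locale \<^locale>\<open>algebra\<close>; \<open>F\<close> is the whole type \<open>'f\<close>. On an
  \<open>A\<close>-module, \<open>c \<in> F\<close> acts as \<open>c\<cdot>1\<^sub>A\<close>.\<close>

definition End_F :: "('f, 'a) module \<Rightarrow> ('a, 'w) module \<Rightarrow> ('w \<Rightarrow> 'w) set" where
  "End_F A W =
     {\<phi> \<in> carrier W \<rightarrow>\<^sub>E carrier W.
        (\<forall>v\<in>carrier W. \<forall>w\<in>carrier W. \<phi> (v \<oplus>\<^bsub>W\<^esub> w) = \<phi> v \<oplus>\<^bsub>W\<^esub> \<phi> w) \<and>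
        (\<forall>c. \<forall>w\<in>carrier W. \<phi> ((c \<odot>\<^bsub>A\<^esub> \<one>\<^bsub>A\<^esub>) \<odot>\<^bsub>W\<^esub> w) = (c \<odot>\<^bsub>A\<^esub> \<one>\<^bsub>A\<^esub>) \<odot>\<^bsub>W\<^esub> \<phi> w)}"

definition Der_F :: "('f, 'a) module \<Rightarrow> ('a \<Rightarrow> 'a) set" where
  "Der_F A =
     {\<delta> \<in> carrier A \<rightarrow>\<^sub>E carrier A.
        (\<forall>a\<in>carrier A. \<forall>b\<in>carrier A. \<delta> (a \<oplus>\<^bsub>A\<^esub> b) = \<delta> a \<oplus>\<^bsub>A\<^esub> \<delta> b) \<and>
        (\<forall>c. \<forall>a\<in>carrier A. \<delta> (c \<odot>\<^bsub>A\<^esub> a) = c \<odot>\<^bsub>A\<^esub> \<delta> a) \<and>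
        (\<forall>a\<in>carrier A. \<forall>b\<in>carrier A. \<delta> (a \<otimes>\<^bsub>A\<^esub> b) = \<delta> a \<otimes>\<^bsub>A\<^esub> b \<oplus>\<^bsub>A\<^esub> a \<otimes>\<^bsub>A\<^esub> \<delta> b)}"

definition lie_bracket :: "('a, 'z) ring_scheme \<Rightarrow> ('a \<Rightarrow> 'a) \<Rightarrow> ('a \<Rightarrow> 'a) \<Rightarrow> 'a \<Rightarrow> 'a" where
  "lie_bracket A \<delta> \<eta> = (\<lambda>a\<in>carrier A. \<delta> (\<eta> a) \<ominus>\<^bsub>A\<^esub> \<eta> (\<delta> a))"

definition ks_derivation :: "('f, 'a) module \<Rightarrow> ('a, 'w) module \<Rightarrow> ('a \<Rightarrow> 'a) \<Rightarrow> 'a \<Rightarrow> 'w \<Rightarrow> 'w" where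
  "ks_derivation A W \<delta> = (\<lambda>a\<in>carrier A. \<lambda>w\<in>carrier W. \<delta> a \<odot>\<^bsub>W\<^esub> w)"

definition inner_derivations :: "('f, 'a) module \<Rightarrow> ('a, 'w) module \<Rightarrow> ('a \<Rightarrow> 'w \<Rightarrow> 'w) set" where
  "inner_derivations A W =
     {\<lambda>a\<in>carrier A. \<lambda>w\<in>carrier W. a \<odot>\<^bsub>W\<^esub> \<phi> w \<ominus>\<^bsub>W\<^esub> \<phi> (a \<odot>\<^bsub>W\<^esub> w) | \<phi>. \<phi> \<in> End_F A W}"

text \<open>The kernel of the Kodaira-Spencer map: \<open>\<delta>\<close> is sent to zero in \<open>HH\<^sup>1(A, End\<^sub>F(W))\<close>, the
  quotient by the inner derivations, iff its derivation is inner.\<close>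

definition VW :: "('f, 'a) module \<Rightarrow> ('a, 'w) module \<Rightarrow> ('a, 'a \<Rightarrow> 'a) module" where
  "VW A W =
     \<lparr>carrier = {\<delta> \<in> Der_F A. ks_derivation A W \<delta> \<in> inner_derivations A W},
      monoid.mult = undefined, monoid.one = undefined,
      ring.zero = (\<lambda>a\<in>carrier A. \<zero>\<^bsub>A\<^esub>),
      ring.add = (\<lambda>\<delta> \<eta>. \<lambda>a\<in>carrier A. \<delta> a \<oplus>\<^bsub>A\<^esub> \<eta> a),
      module.smult = (\<lambda>b \<delta>. \<lambda>a\<in>carrier A. b \<otimes>\<^bsub>A\<^esub> \<delta> a)\<rparr>"

definition is_connection ::
    "('f, 'a) module \<Rightarrow> ('a, 'w) module \<Rightarrow> (('a \<Rightarrow> 'a) \<Rightarrow> 'w \<Rightarrow> 'w) \<Rightarrow> bool" where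
  "is_connection A W nab \<longleftrightarrow>
     nab \<in> carrier (VW A W) \<rightarrow>\<^sub>E End_F A W \<and>
     (\<forall>\<delta>\<in>carrier (VW A W). \<forall>\<eta>\<in>carrier (VW A W). \<forall>w\<in>carrier W.
        nab (\<delta> \<oplus>\<^bsub>VW A W\<^esub> \<eta>) w = nab \<delta> w \<oplus>\<^bsub>W\<^esub> nab \<eta> w) \<and>
     (\<forall>a\<in>carrier A. \<forall>\<delta>\<in>carrier (VW A W). \<forall>w\<in>carrier W.
        nab (a \<odot>\<^bsub>VW A W\<^esub> \<delta>) w = a \<odot>\<^bsub>W\<^esub> nab \<delta> w) \<and>
     (\<forall>\<delta>\<in>carrier (VW A W). \<forall>a\<in>carrier A. \<forall>w\<in>carrier W.
        nab \<delta> (a \<odot>\<^bsub>W\<^esub> w) = a \<odot>\<^bsub>W\<^esub> nab \<delta> w \<oplus>\<^bsub>W\<^esub> \<delta> a \<odot>\<^bsub>W\<^esub> w)"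

definition curvature ::
    "('f, 'a) module \<Rightarrow> ('a, 'w) module \<Rightarrow> (('a \<Rightarrow> 'a) \<Rightarrow> 'w \<Rightarrow> 'w)
      \<Rightarrow> ('a \<Rightarrow> 'a) \<Rightarrow> ('a \<Rightarrow> 'a) \<Rightarrow> 'w \<Rightarrow> 'w" where
  "curvature A W nab \<delta> \<eta> = (\<lambda>w\<in>carrier W.
     (nab \<delta> (nab \<eta> w) \<ominus>\<^bsub>W\<^esub> nab \<eta> (nab \<delta> w)) \<ominus>\<^bsub>W\<^esub> nab (lie_bracket A \<delta> \<eta>) w)"

definition flat ::
    "('f, 'a) module \<Rightarrow> ('a, 'w) module \<Rightarrow> (('a \<Rightarrow> 'a) \<Rightarrow> 'w \<Rightarrow> 'w) \<Rightarrow> bool" where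
  "flat A W nab \<longleftrightarrow>
     (\<forall>\<delta>\<in>carrier (VW A W). \<forall>\<eta>\<in>carrier (VW A W). \<forall>w\<in>carrier W.
        curvature A W nab \<delta> \<eta> w = \<zero>\<^bsub>W\<^esub>)"


section \<open>The Chevalley-Hochschild complex\<close>

text \<open>Here \<open>V\<close> is an \<open>A\<close>-module and Lie algebra of derivations of \<open>A\<close>. The localized structure is
  \<open>(\<delta>/s)(a/t) = (t\<cdot>\<delta>(a) - a\<cdot>\<delta>(t)) / (s t\<^sup>2)\<close> and
  \<open>[\<delta>/s, \<eta>/t] = (s t\<cdot>[\<delta>,\<eta>] - s \<delta>(t)\<cdot>\<eta> + t \<eta>(s)\<cdot>\<delta>) / (s\<^sup>2 t\<^sup>2)\<close>.\<close>

definition stalk_act ::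
    "('a, 'z) ring_scheme \<Rightarrow> 'a set \<Rightarrow> (('a \<Rightarrow> 'a) \<times> 'a) set \<Rightarrow> ('a \<times> 'a) set \<Rightarrow> ('a \<times> 'a) set" where
  "stalk_act A p \<alpha> \<beta> = (\<Union>(\<delta>, s)\<in>\<alpha>. \<Union>(a, t)\<in>\<beta>.
     frac (carrier A - p) (reg_module A)
       (t \<otimes>\<^bsub>A\<^esub> \<delta> a \<ominus>\<^bsub>A\<^esub> a \<otimes>\<^bsub>A\<^esub> \<delta> t) (s \<otimes>\<^bsub>A\<^esub> (t \<otimes>\<^bsub>A\<^esub> t)))"

definition stalk_bracket ::
    "('a, 'z) ring_scheme \<Rightarrow> ('a, 'a \<Rightarrow> 'a) module \<Rightarrow> 'a set
      \<Rightarrow> (('a \<Rightarrow> 'a) \<times> 'a) set \<Rightarrow> (('a \<Rightarrow> 'a) \<times> 'a) set \<Rightarrow> (('a \<Rightarrow> 'a) \<times> 'a) set" where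
  "stalk_bracket A V p \<alpha> \<beta> = (\<Union>(\<delta>, s)\<in>\<alpha>. \<Union>(\<eta>, t)\<in>\<beta>.
     frac (carrier A - p) V
       ((((s \<otimes>\<^bsub>A\<^esub> t) \<odot>\<^bsub>V\<^esub> lie_bracket A \<delta> \<eta>) \<ominus>\<^bsub>V\<^esub> ((s \<otimes>\<^bsub>A\<^esub> \<delta> t) \<odot>\<^bsub>V\<^esub> \<eta>))
          \<oplus>\<^bsub>V\<^esub> ((t \<otimes>\<^bsub>A\<^esub> \<eta> s) \<odot>\<^bsub>V\<^esub> \<delta>))
       ((s \<otimes>\<^bsub>A\<^esub> s) \<otimes>\<^bsub>A\<^esub> (t \<otimes>\<^bsub>A\<^esub> t)))"

definition sec_act ::
    "('a, 'z) ring_scheme \<Rightarrow> 'a set set \<Rightarrow> ('a set \<Rightarrow> (('a \<Rightarrow> 'a) \<times> 'a) set)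
      \<Rightarrow> ('a set \<Rightarrow> ('a \<times> 'a) set) \<Rightarrow> 'a set \<Rightarrow> ('a \<times> 'a) set" where
  "sec_act A N s a = (\<lambda>p\<in>N. stalk_act A p (s p) (a p))"

definition sec_bracket ::
    "('a, 'z) ring_scheme \<Rightarrow> ('a, 'a \<Rightarrow> 'a) module \<Rightarrow> 'a set set
      \<Rightarrow> ('a set \<Rightarrow> (('a \<Rightarrow> 'a) \<times> 'a) set) \<Rightarrow> ('a set \<Rightarrow> (('a \<Rightarrow> 'a) \<times> 'a) set)
      \<Rightarrow> 'a set \<Rightarrow> (('a \<Rightarrow> 'a) \<times> 'a) set" where
  "sec_bracket A V N s t = (\<lambda>p\<in>N. stalk_bracket A V p (s p) (t p))"

type_synonym 'a sec_tuple = "('a set \<Rightarrow> (('a \<Rightarrow> 'a) \<times> 'a) set) list"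

type_synonym 'a cochain = "'a set set \<Rightarrow> 'a sec_tuple \<Rightarrow> 'a set \<Rightarrow> ('a \<times> 'a) set"

definition tuples ::
    "('a, 'z) ring_scheme \<Rightarrow> ('a, 'a \<Rightarrow> 'a) module \<Rightarrow> 'a set set \<Rightarrow> nat \<Rightarrow> 'a sec_tuple set" where
  "tuples A V N p = {ss. length ss = p \<and> set ss \<subseteq> sections A V N}"

text \<open>A homomorphism of sheaves from the \<open>p\<close>-th exterior power of \<open>V|\<^sub>U\<close> (the sheaf associated to
  the presheaf of exterior powers of sections) to \<open>\<O>\<^sub>U\<close> is a family, over the open
  \<open>N \<subseteq> U\<close>, of alternating \<open>\<O>(N)\<close>-multilinear maps compatible with restriction.\<close>

definition cochains ::
    "('a, 'z) ring_scheme \<Rightarrow> ('a, 'a \<Rightarrow> 'a) module \<Rightarrow> 'a set set \<Rightarrow> nat \<Rightarrow> 'a cochain set" where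
  "cochains A V U p =
     {\<phi> \<in> (\<Pi>\<^sub>E N\<in>opens_in A U. tuples A V N p \<rightarrow>\<^sub>E sections A (reg_module A) N).
        (\<forall>N\<in>opens_in A U. \<forall>ss\<in>tuples A V N p. \<forall>i<p.
           \<forall>s\<in>sections A V N. \<forall>t\<in>sections A V N.
           \<phi> N (ss[i := s \<oplus>\<^bsub>sec_module A V N\<^esub> t])
             = \<phi> N (ss[i := s]) \<oplus>\<^bsub>sec_ring A N\<^esub> \<phi> N (ss[i := t])) \<and>
        (\<forall>N\<in>opens_in A U. \<forall>ss\<in>tuples A V N p. \<forall>i<p.
           \<forall>c\<in>sections A (reg_module A) N. \<forall>s\<in>sections A V N.
           \<phi> N (ss[i := c \<odot>\<^bsub>sec_module A V N\<^esub> s])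
             = c \<otimes>\<^bsub>sec_ring A N\<^esub> \<phi> N (ss[i := s])) \<and>
        (\<forall>N\<in>opens_in A U. \<forall>ss\<in>tuples A V N p. \<forall>j<p. \<forall>i<j.
           ss ! i = ss ! j \<longrightarrow> \<phi> N ss = \<zero>\<^bsub>sec_ring A N\<^esub>) \<and>
        (\<forall>N\<in>opens_in A U. \<forall>N'\<in>opens_in A N. \<forall>ss\<in>tuples A V N p.
           \<phi> N' (map (\<lambda>s. restrict s N') ss) = restrict (\<phi> N ss) N')}"

definition cochain_group ::
    "('a, 'z) ring_scheme \<Rightarrow> ('a, 'a \<Rightarrow> 'a) module \<Rightarrow> 'a set set \<Rightarrow> nat \<Rightarrow> 'a cochain monoid" where
  "cochain_group A V U p =
     \<lparr>carrier = cochains A V U p,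
      monoid.mult = (\<lambda>\<phi> \<psi>. \<lambda>N\<in>opens_in A U. \<lambda>ss\<in>tuples A V N p.
         \<phi> N ss \<oplus>\<^bsub>sec_ring A N\<^esub> \<psi> N ss),
      monoid.one = (\<lambda>N\<in>opens_in A U. \<lambda>ss\<in>tuples A V N p. \<zero>\<^bsub>sec_ring A N\<^esub>)\<rparr>"

definition alt_sign :: "('a, 'z) ring_scheme \<Rightarrow> nat \<Rightarrow> 'a \<Rightarrow> 'a" where
  "alt_sign R i a = (if even i then a else \<ominus>\<^bsub>R\<^esub> a)"

text \<open>Indices start at \<open>0\<close>, so the signs \<open>(-1)\<^sup>i\<^sup>+\<^sup>1\<close> and \<open>(-1)\<^sup>i\<^sup>+\<^sup>j\<close> of the formula with indices
  starting at \<open>1\<close> become \<open>(-1)\<^sup>i\<close> and \<open>(-1)\<^sup>i\<^sup>+\<^sup>j\<close>.\<close>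

definition cobd ::
    "('a, 'z) ring_scheme \<Rightarrow> ('a, 'a \<Rightarrow> 'a) module \<Rightarrow> 'a set set \<Rightarrow> nat \<Rightarrow> 'a cochain \<Rightarrow> 'a cochain" where
  "cobd A V U p \<phi> = (\<lambda>N\<in>opens_in A U. \<lambda>ss\<in>tuples A V N (Suc p).
     (\<Oplus>\<^bsub>sec_ring A N\<^esub>i\<in>{..p}.
        alt_sign (sec_ring A N) i (sec_act A N (ss ! i) (\<phi> N (nths ss (- {i}))))) \<oplus>\<^bsub>sec_ring A N\<^esub>
     (\<Oplus>\<^bsub>sec_ring A N\<^esub>ij\<in>{(i, j). i < j \<and> j \<le> p}.
        alt_sign (sec_ring A N) (fst ij + snd ij)
          (\<phi> N (sec_bracket A V N (ss ! fst ij) (ss ! snd ij) # nths ss (- {fst ij, snd ij})))))"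

definition cocycles ::
    "('a, 'z) ring_scheme \<Rightarrow> ('a, 'a \<Rightarrow> 'a) module \<Rightarrow> 'a set set \<Rightarrow> nat \<Rightarrow> 'a cochain set" where
  "cocycles A V U p =
     {\<phi> \<in> cochains A V U p. cobd A V U p \<phi> = \<one>\<^bsub>cochain_group A V U (Suc p)\<^esub>}"

definition coboundaries ::
    "('a, 'z) ring_scheme \<Rightarrow> ('a, 'a \<Rightarrow> 'a) module \<Rightarrow> 'a set set \<Rightarrow> nat \<Rightarrow> 'a cochain set" where
  "coboundaries A V U p =
     (case p of 0 \<Rightarrow> {\<one>\<^bsub>cochain_group A V U 0\<^esub>}
      | Suc q \<Rightarrow> cobd A V U q ` cochains A V U q)"

definition cohomology ::
    "('a, 'z) ring_scheme \<Rightarrow> ('a, 'a \<Rightarrow> 'a) module \<Rightarrow> 'a set set \<Rightarrow> nat \<Rightarrow> 'a cochain set monoid" where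
  "cohomology A V U p =
     (cochain_group A V U p)\<lparr>carrier := cocycles A V U p\<rparr> Mod (coboundaries A V U p)"


section \<open>The first Chern class\<close>

text \<open>The curvature at a point \<open>p\<close>: \<open>R(\<delta>/s, \<eta>/t)(w/u) = R(\<delta>, \<eta>)(w) / (s t u)\<close>.\<close>

definition stalk_curvature ::
    "('f, 'a) module \<Rightarrow> ('a, 'w) module \<Rightarrow> (('a \<Rightarrow> 'a) \<Rightarrow> 'w \<Rightarrow> 'w) \<Rightarrow> 'a set
      \<Rightarrow> (('a \<Rightarrow> 'a) \<times> 'a) set \<Rightarrow> (('a \<Rightarrow> 'a) \<times> 'a) set \<Rightarrow> ('w \<times> 'a) set \<Rightarrow> ('w \<times> 'a) set" where
  "stalk_curvature A W nab p \<alpha> \<beta> =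
     (\<lambda>\<gamma>\<in>carrier (stalk A W p). \<Union>(\<delta>, s)\<in>\<alpha>. \<Union>(\<eta>, t)\<in>\<beta>. \<Union>(w, u)\<in>\<gamma>.
        frac (carrier A - p) W (curvature A W nab \<delta> \<eta> w) ((s \<otimes>\<^bsub>A\<^esub> t) \<otimes>\<^bsub>A\<^esub> u))"

definition trace_curvature ::
    "('f, 'a) module \<Rightarrow> ('a, 'w) module \<Rightarrow> (('a \<Rightarrow> 'a) \<Rightarrow> 'w \<Rightarrow> 'w) \<Rightarrow> 'a set set \<Rightarrow> 'a cochain" where
  "trace_curvature A W nab U = (\<lambda>N\<in>opens_in A U. \<lambda>ss\<in>tuples A (VW A W) N 2. \<lambda>p\<in>N.
     trace (stalk_ring A p) (stalk A W p) (stalk_curvature A W nab p ((ss ! 0) p) ((ss ! 1) p)))"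

text \<open>The class, as a coset of the coboundaries, does not depend on the connection chosen; it is
  meaningful only if \<open>W\<close> admits one.\<close>

definition chern1 :: "('f, 'a) module \<Rightarrow> ('a, 'w) module \<Rightarrow> 'a cochain set" where
  "chern1 A W =
     (let U = locally_free_locus A W;
          V = VW A W;
          nab = (SOME nab. is_connection A W nab)
      in coboundaries A V U 2 #>\<^bsub>cochain_group A V U 2\<^esub> trace_curvature A W nab U)"


section \<open>The hypersurface ring and the matrix factorizations\<close>

type_synonym 'a ps3 = "'a fps fps fps"

text \<open>\<open>F[[x,y,z]]\<close> is realized as \<open>F[[x]][[y]][[z]]\<close>.\<close>

definition ps_const :: "'a::field_char_0 \<Rightarrow> 'a ps3" where
  "ps_const c = fps_const (fps_const (fps_const c))"

definition ps_x :: "'a::field_char_0 ps3" where "ps_x = fps_const (fps_const fps_X)"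

definition ps_y :: "'a::field_char_0 ps3" where "ps_y = fps_const fps_X"

definition ps_z :: "'a::field_char_0 ps3" where "ps_z = fps_X"

definition d_x :: "'a::field_char_0 ps3 \<Rightarrow> 'a ps3" where
  "d_x p = Abs_fps (\<lambda>i. Abs_fps (\<lambda>j. fps_deriv (p $ i $ j)))"

definition d_y :: "'a::field_char_0 ps3 \<Rightarrow> 'a ps3" where
  "d_y p = Abs_fps (\<lambda>i. fps_deriv (p $ i))"

definition d_z :: "'a::field_char_0 ps3 \<Rightarrow> 'a ps3" where
  "d_z p = fps_deriv p"

definition hyp_f :: "nat \<Rightarrow> nat \<Rightarrow> 'a::field_char_0 ps3" where
  "hyp_f m n = ps_x ^ m + ps_y ^ n + ps_z ^ 2"

definition PS :: "'a::field_char_0 ps3 ring" where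
  "PS = ring_of_type_algebra"

definition cls :: "nat \<Rightarrow> nat \<Rightarrow> 'a::field_char_0 ps3 \<Rightarrow> 'a ps3 set" where
  "cls m n p = (PIdl\<^bsub>PS\<^esub> (hyp_f m n)) +>\<^bsub>PS\<^esub> p"

definition hyp_ring :: "nat \<Rightarrow> nat \<Rightarrow> ('a::field_char_0, 'a ps3 set) module" where
  "hyp_ring m n =
     (let Q = PS Quot (PIdl\<^bsub>PS\<^esub> (hyp_f m n)) in
      \<lparr>carrier = carrier Q, monoid.mult = monoid.mult Q, monoid.one = \<one>\<^bsub>Q\<^esub>, ring.zero = \<zero>\<^bsub>Q\<^esub>, ring.add = add Q,
       module.smult = (\<lambda>c \<alpha>. cls m n (ps_const c) \<otimes>\<^bsub>Q\<^esub> \<alpha>)\<rparr>)"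

definition mat_cls :: "nat \<Rightarrow> nat \<Rightarrow> 'a::field_char_0 ps3 list list \<Rightarrow> nat \<Rightarrow> nat \<Rightarrow> 'a ps3 set" where
  "mat_cls m n B i j = cls m n (B ! i ! j)"

definition mf_phi :: "nat \<Rightarrow> nat \<Rightarrow> nat \<Rightarrow> nat \<Rightarrow> 'a::field_char_0 ps3 list list" where
  "mf_phi m n k l =
    [[ps_x ^ (m - k), ps_y ^ (n - l), 0, ps_z],
     [ps_y ^ l, - (ps_x ^ k), ps_z, 0],
     [ps_z, 0, - (ps_y ^ (n - l)), - (ps_x ^ k)],
     [0, ps_z, ps_x ^ (m - k), - (ps_y ^ l)]]"

definition mf_psi :: "nat \<Rightarrow> nat \<Rightarrow> nat \<Rightarrow> nat \<Rightarrow> 'a::field_char_0 ps3 list list" where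
  "mf_psi m n k l =
    [[ps_x ^ k, ps_y ^ (n - l), ps_z, 0],
     [ps_y ^ l, - (ps_x ^ (m - k)), 0, ps_z],
     [0, ps_z, - (ps_y ^ l), ps_x ^ k],
     [ps_z, 0, - (ps_x ^ (m - k)), - (ps_y ^ (n - l))]]"

lemma mf_phi_psi:
  assumes "k \<le> m" "l \<le> n" "i < 4" "j < 4"
  shows "(\<Sum>t<4. mf_phi m n k l ! i ! t * mf_psi m n k l ! t ! j)
           = (if i = j then hyp_f m n else (0 :: 'a::field_char_0 ps3))" (is ?P)
    and "(\<Sum>t<4. mf_psi m n k l ! i ! t * mf_phi m n k l ! t ! j)
           = (if i = j then hyp_f m n else (0 :: 'a::field_char_0 ps3))" (is ?Q)
proof -
  have xm: "(ps_x :: 'a ps3) ^ (m - k) * ps_x ^ k = ps_x ^ m"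
    and yn: "(ps_y :: 'a ps3) ^ (n - l) * ps_y ^ l = ps_y ^ n"
    using assms by (simp_all flip: power_add)
  have sum4: "(\<Sum>t<4. g t) = g 0 + g 1 + g 2 + g 3" for g :: "nat \<Rightarrow> 'a ps3"
    by (simp add: eval_nat_numeral)
  have "i \<in> {0, 1, 2, 3}" "j \<in> {0, 1, 2, 3}" using assms by auto
  then show ?P ?Q
    unfolding sum4 mf_phi_def mf_psi_def hyp_f_def
    by (auto simp: eval_nat_numeral algebra_simps simp flip: xm yn)
qed

text \<open>\<open>W(\<phi>,\<psi>)\<close> is the cokernel of \<open>\<phi>\<close>.\<close>

definition mf_image :: "nat \<Rightarrow> nat \<Rightarrow> nat \<Rightarrow> nat \<Rightarrow> (nat \<Rightarrow> 'a::field_char_0 ps3 set) set" where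
  "mf_image m n k l =
     mat_vec (hyp_ring m n) 4 (mat_cls m n (mf_phi m n k l)) ` carrier (free_module (hyp_ring m n) 4)"

definition mf_module ::
    "nat \<Rightarrow> nat \<Rightarrow> nat \<Rightarrow> nat \<Rightarrow> ('a::field_char_0 ps3 set, (nat \<Rightarrow> 'a ps3 set) set) module" where
  "mf_module m n k l = quot_module (free_module (hyp_ring m n) 4) (mf_image m n k l)"

definition mf_cls ::
    "nat \<Rightarrow> nat \<Rightarrow> nat \<Rightarrow> nat \<Rightarrow> (nat \<Rightarrow> 'a::field_char_0 ps3 set) \<Rightarrow> (nat \<Rightarrow> 'a ps3 set) set" where
  "mf_cls m n k l a = mf_image m n k l +>\<^bsub>free_module (hyp_ring m n) 4\<^esub> a"


section \<open>The derivations and the connection\<close>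

definition ps_delta :: "nat \<Rightarrow> nat \<Rightarrow> nat \<Rightarrow> 'a::field_char_0 ps3 \<Rightarrow> 'a ps3" where
  "ps_delta m n i p =
    [2 * of_nat n * ps_x * d_x p + 2 * of_nat m * ps_y * d_y p + of_nat (m * n) * ps_z * d_z p,
     of_nat m * ps_x ^ (m - 1) * d_y p - of_nat n * ps_y ^ (n - 1) * d_x p,
     - 2 * ps_z * d_x p + of_nat m * ps_x ^ (m - 1) * d_z p,
     - 2 * ps_z * d_y p + of_nat n * ps_y ^ (n - 1) * d_z p] ! i"

definition delta :: "nat \<Rightarrow> nat \<Rightarrow> nat \<Rightarrow> 'a::field_char_0 ps3 set \<Rightarrow> 'a ps3 set" where
  "delta m n i = (\<lambda>\<alpha>\<in>carrier (hyp_ring m n). \<Union>p\<in>\<alpha>. cls m n (ps_delta m n i p))"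

text \<open>The triple \<open>(c, i, j)\<close> stands for the Laurent monomial \<open>c x\<^sup>i y\<^sup>j\<close>. For \<open>k = m\<close> or \<open>l = n\<close> some of
  the formal exponents below equal \<open>-1\<close>; the monomial is then an element of the power series ring
  only if its coefficient vanishes.\<close>

type_synonym 'a monomial = "'a \<times> int \<times> int"

definition integral_monomial :: "'a::field_char_0 monomial \<Rightarrow> bool" where
  "integral_monomial t = (case t of (c, i, j) \<Rightarrow> c = 0 \<or> (0 \<le> i \<and> 0 \<le> j))"

definition ps_monomial :: "'a::field_char_0 monomial \<Rightarrow> 'a ps3" where
  "ps_monomial t = (case t of (c, i, j) \<Rightarrow> ps_const c * ps_x ^ nat i * ps_y ^ nat j)"

definition conn_monomials ::
    "nat \<Rightarrow> nat \<Rightarrow> nat \<Rightarrow> nat \<Rightarrow> nat \<Rightarrow> 'a::field_char_0 monomial list list" where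
  "conn_monomials m n k l i =
    (let mn = of_nat m * of_nat n; ml = of_nat m * of_nat l; nk = of_nat n * of_nat k;
         M = of_nat m; N = of_nat n;
         xk = int k - 1; xmk = int m - int k - 1; yl = int l - 1; ynl = int n - int l - 1;
         zz = (0, 0, 0);
         b1 = ((mn - 2 * nk - 2 * ml) / 4, xk, yl);
         b2 = ((3 * mn - 2 * ml - 2 * nk) / 4, xmk, ynl);
         b3 = ((2 * nk - mn - 2 * ml) / 4, xmk, yl);
         b4 = ((2 * nk - 2 * ml + mn) / 4, xk, ynl);
         c1 = ((mn / 2 - ml - nk) / N, xk, 0);
         c2 = ((3 * mn / 2 - ml - nk) / N, xmk, 0);
         c3 = ((mn / 2 + ml - nk) / N, xmk, 0);
         c4 = ((ml - nk - mn / 2) / N, xk, 0);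
         d1 = ((mn / 2 - ml - nk) / M, 0, yl);
         d2 = ((ml + nk - 3 * mn / 2) / M, 0, ynl);
         d3 = ((mn / 2 + ml - nk) / M, 0, yl);
         d4 = ((mn / 2 - ml + nk) / M, 0, ynl)
     in
      [[[(nk + ml - mn / 2, 0, 0), zz, zz, zz],
        [zz, (3 * mn / 2 - ml - nk, 0, 0), zz, zz],
        [zz, zz, (mn / 2 + ml - nk, 0, 0), zz],
        [zz, zz, zz, (mn / 2 + nk - ml, 0, 0)]],
       [[zz, b2, zz, zz],
        [b1, zz, zz, zz],
        [zz, zz, zz, b4],
        [zz, zz, b3, zz]],
       [[zz, zz, c3, zz],
        [zz, zz, zz, c4],
        [c1, zz, zz, zz],
        [zz, c2, zz, zz]],
       [[zz, zz, zz, d4],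
        [zz, zz, d3, zz],
        [zz, d2, zz, zz],
        [d1, zz, zz, zz]]] ! i)"

definition conn_mat :: "nat \<Rightarrow> nat \<Rightarrow> nat \<Rightarrow> nat \<Rightarrow> nat \<Rightarrow> 'a::field_char_0 ps3 list list" where
  "conn_mat m n k l i = map (map ps_monomial) (conn_monomials m n k l i)"

text \<open>All entries of \<open>A\<^sub>0, \<dots>, A\<^sub>3\<close> are power series. This holds whenever \<open>k < m\<close> and \<open>l < n\<close>.\<close>

definition conn_mats_integral :: "'a::field_char_0 itself \<Rightarrow> nat \<Rightarrow> nat \<Rightarrow> nat \<Rightarrow> nat \<Rightarrow> bool" where
  "conn_mats_integral F m n k l \<longleftrightarrow>
     (\<forall>i<4. \<forall>row\<in>set (conn_monomials m n k l i :: 'a monomial list list).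
        \<forall>t\<in>set row. integral_monomial t)"

lemma conn_mats_integralI:
  assumes "1 \<le> k" "k < m" "1 \<le> l" "l < n"
  shows "conn_mats_integral TYPE('a::field_char_0) m n k l"
proof -
  have "i < 4 \<Longrightarrow> i \<in> {0, 1, 2, 3}" for i :: nat by auto
  then show ?thesis using assms
    by (fastforce simp: conn_mats_integral_def conn_monomials_def integral_monomial_def Let_def)
qed

definition conn_op ::
    "nat \<Rightarrow> nat \<Rightarrow> nat \<Rightarrow> nat \<Rightarrow> nat \<Rightarrow> (nat \<Rightarrow> 'a::field_char_0 ps3 set) \<Rightarrow> nat \<Rightarrow> 'a ps3 set" where
  "conn_op m n k l i a =
     (\<lambda>j\<in>{..<4}. delta m n i (a j))
       \<oplus>\<^bsub>free_module (hyp_ring m n) 4\<^esub>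
     mat_vec (hyp_ring m n) 4 (mat_cls m n (conn_mat m n k l i)) a"

text \<open>\<open>nab\<close> sends the \<open>\<delta>\<^sub>i\<close> to the operators on the cokernel induced by \<open>\<delta>\<^sub>i + A\<^sub>i\<close>.\<close>

definition induced_by_conn_op ::
    "nat \<Rightarrow> nat \<Rightarrow> nat \<Rightarrow> nat \<Rightarrow>
      (('a::field_char_0 ps3 set \<Rightarrow> 'a ps3 set) \<Rightarrow> (nat \<Rightarrow> 'a ps3 set) set \<Rightarrow> (nat \<Rightarrow> 'a ps3 set) set)
      \<Rightarrow> bool" where
  "induced_by_conn_op m n k l nab \<longleftrightarrow>
     (\<forall>i<4. \<forall>a\<in>carrier (free_module (hyp_ring m n) 4).
        nab (delta m n i) (mf_cls m n k l a) = mf_cls m n k l (conn_op m n k l i a))"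

end

theory Submission
  imports Defs
begin

text \<open>Flatness comes down to one identity of matrices. In a derivation of \<open>A\<close> the coefficient of \<open>\<partial>\<^sub>z\<close> is determined by
  the other two, and \<open>-2z \<delta> = \<delta>(x) \<delta>\<^sub>2 + \<delta>(y) \<delta>\<^sub>3\<close> for every \<open>\<delta>\<close> (\<open>Der_scaled\<close>). The module \<open>W\<close> has no \<open>z\<close>-torsion,
  since \<open>v\<close> vanishes in \<open>W\<close> if and only if \<open>f\<close> divides \<open>\<psi> v\<close>, and \<open>z\<close> is not a zero divisor modulo \<open>f\<close>. Hence a
  connection on \<open>W\<close> is determined by its values at \<open>\<delta>\<^sub>2\<close> and \<open>\<delta>\<^sub>3\<close>, and its curvature, which is bilinear, vanishes if it
  vanishes at \<open>(\<delta>\<^sub>2, \<delta>\<^sub>3)\<close>. Now \<open>[\<delta>\<^sub>2, \<delta>\<^sub>3] = -2 \<delta>\<^sub>1\<close>, and \<open>\<delta>\<^sub>2\<close> and \<open>\<delta>\<^sub>3\<close> kill the entries of \<open>A\<^sub>3\<close> and \<open>A\<^sub>2\<close>, so that the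
  curvature there is \<open>[A\<^sub>2, A\<^sub>3] + 2 A\<^sub>1\<close>, which is zero (\<open>conn_mat_commutator\<close>).

  The connection itself is obtained from the same relation. The operators \<open>\<delta>\<^sub>2 + A\<^sub>2\<close> and \<open>\<delta>\<^sub>3 + A\<^sub>3\<close> preserve the image of
  \<open>\<phi>\<close> (\<open>null_dop2\<close>, \<open>null_dop3\<close>), and \<open>\<nabla>\<^sub>\<delta> v\<close> is the solution \<open>w\<close> of \<open>-2z w = \<delta>(x) \<nabla>\<^sub>2 v + \<delta>(y) \<nabla>\<^sub>3 v\<close>. It exists because the
  \<open>\<delta>\<^sub>i\<close> generate the derivations (\<open>Der_generated\<close>) and the operators \<open>\<delta>\<^sub>i + A\<^sub>i\<close> satisfy the relations that express
  \<open>2z \<delta>\<^sub>0\<close> and \<open>2z \<delta>\<^sub>1\<close> by \<open>\<delta>\<^sub>2\<close> and \<open>\<delta>\<^sub>3\<close> (\<open>dop_relation0\<close>, \<open>dop_relation1\<close>). Linearity and the Leibniz rule then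
  follow from uniqueness of the solution. If \<open>k = m\<close> or \<open>l = n\<close>, an entry of \<open>\<phi>\<close> is a unit and \<open>W\<close> is free of rank two
  (\<open>basis_boundary\<close>); the derivations act on the coordinates in a basis, which is a flat connection.

  The class \<open>c\<^sub>1(W)\<close> is represented by the trace of the curvature of an arbitrary connection \<open>\<nabla>\<close>. Let \<open>\<nabla>\<^sub>0\<close> be flat. The
  difference \<open>\<alpha> = \<nabla> - \<nabla>\<^sub>0\<close> is \<open>A\<close>-linear with values in the \<open>A\<close>-linear endomorphisms of \<open>W\<close>. On the open set where \<open>W\<close> is
  locally free, \<open>trace \<circ> \<alpha>\<close> is a cochain of degree one, and its coboundary is the trace of the curvature of \<open>\<nabla>\<close>
  (\<open>trace_curvature_coboundary\<close>). The reason is that \<open>trace [\<nabla>\<^sub>\<delta>, T] = \<delta> (trace T)\<close> for an endomorphism \<open>T\<close>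
  (\<open>loc_trace_commutator\<close>) and that commutators of endomorphisms have trace zero. All this is computed with
  numerators and denominators at the stalks, whose structure is described by \<open>stalk_act_eq\<close> and
  \<open>stalk_bracket_eq\<close>.\<close>


section \<open>Localization at a multiplicative set\<close>

lemma reg_module_simps [simp]:
  "carrier (reg_module R) = carrier R" "monoid.mult (reg_module R) = monoid.mult R"
  "\<one>\<^bsub>reg_module R\<^esub> = \<one>\<^bsub>R\<^esub>" "\<zero>\<^bsub>reg_module R\<^esub> = \<zero>\<^bsub>R\<^esub>" "add (reg_module R) = add R"
  "module.smult (reg_module R) = monoid.mult R"
  by (simp_all add: reg_module_def)

lemma (in cring) module_reg_module: "module R (reg_module R)"
proof (rule moduleI)
  show "abelian_group (reg_module R)"
    by (rule abelian_groupI) (auto simp: a_ac intro: l_neg)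
qed (auto simp: cring_axioms l_distr r_distr m_assoc)

lemma (in module) smult_left_commute:
  assumes "a \<in> carrier R" "b \<in> carrier R" "x \<in> carrier M"
  shows "a \<odot>\<^bsub>M\<^esub> (b \<odot>\<^bsub>M\<^esub> x) = b \<odot>\<^bsub>M\<^esub> (a \<odot>\<^bsub>M\<^esub> x)"
  using assms by (metis R.m_comm smult_assoc1)

locale mult_set = cring R for R (structure) +
  fixes S
  assumes S_subset: "S \<subseteq> carrier R" and one_in_S [simp, intro]: "\<one> \<in> S"
    and mult_in_S [simp, intro]: "\<lbrakk>a \<in> S; b \<in> S\<rbrakk> \<Longrightarrow> a \<otimes> b \<in> S"
begin

lemma S_carrier [simp, intro]: "s \<in> S \<Longrightarrow> s \<in> carrier R"
  using S_subset by auto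

abbreviation "Q \<equiv> loc_ring R S"
abbreviation "fr \<equiv> frac S (reg_module R)"

lemma frac_eqI:
  assumes "module R M" and c: "m \<in> carrier M" "m' \<in> carrier M" "s \<in> S" "s' \<in> S" "u \<in> S"
    and eq: "u \<odot>\<^bsub>M\<^esub> (s' \<odot>\<^bsub>M\<^esub> m) = u \<odot>\<^bsub>M\<^esub> (s \<odot>\<^bsub>M\<^esub> m')"
  shows "frac S M m s = frac S M m' s'"
proof -
  interpret M: module R M by fact
  have sub: "frac S M m s \<subseteq> frac S M m' s'"
    if c: "m \<in> carrier M" "m' \<in> carrier M" "s \<in> S" "s' \<in> S"
    and eq: "u \<odot>\<^bsub>M\<^esub> (s' \<odot>\<^bsub>M\<^esub> m) = u \<odot>\<^bsub>M\<^esub> (s \<odot>\<^bsub>M\<^esub> m')" for m m' s s'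
  proof (clarsimp simp: frac_def)
    fix n t v assume n: "n \<in> carrier M" "t \<in> S" "v \<in> S"
      and e: "v \<odot>\<^bsub>M\<^esub> (t \<odot>\<^bsub>M\<^esub> m) = v \<odot>\<^bsub>M\<^esub> (s \<odot>\<^bsub>M\<^esub> n)"
    have "(v \<otimes> u \<otimes> s) \<odot>\<^bsub>M\<^esub> (t \<odot>\<^bsub>M\<^esub> m') = v \<odot>\<^bsub>M\<^esub> (t \<odot>\<^bsub>M\<^esub> (u \<odot>\<^bsub>M\<^esub> (s \<odot>\<^bsub>M\<^esub> m')))"
      using n c \<open>u \<in> S\<close> by (simp add: M.smult_assoc1 M.smult_left_commute)
    also have "\<dots> = u \<odot>\<^bsub>M\<^esub> (s' \<odot>\<^bsub>M\<^esub> (v \<odot>\<^bsub>M\<^esub> (t \<odot>\<^bsub>M\<^esub> m)))"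
      unfolding eq[symmetric] using n c \<open>u \<in> S\<close> by (simp add: M.smult_left_commute)
    also have "\<dots> = (v \<otimes> u \<otimes> s) \<odot>\<^bsub>M\<^esub> (s' \<odot>\<^bsub>M\<^esub> n)"
      unfolding e using n c \<open>u \<in> S\<close> by (simp add: M.smult_assoc1 M.smult_left_commute)
    finally show "\<exists>w\<in>S. w \<odot>\<^bsub>M\<^esub> (t \<odot>\<^bsub>M\<^esub> m') = w \<odot>\<^bsub>M\<^esub> (s' \<odot>\<^bsub>M\<^esub> n)"
      using n c \<open>u \<in> S\<close> by blast
  qed
  show ?thesis using sub[of m m' s s'] sub[of m' m s' s] c eq by auto
qed

lemma frac_self: "\<lbrakk>m \<in> carrier M; s \<in> S\<rbrakk> \<Longrightarrow> (m, s) \<in> frac S M m s"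
  by (auto simp: frac_def)

lemma frac_eqD:
  assumes "frac S M m s = frac S M m' s'" "m' \<in> carrier M" "s' \<in> S"
  shows "\<exists>u\<in>S. u \<odot>\<^bsub>M\<^esub> (s' \<odot>\<^bsub>M\<^esub> m) = u \<odot>\<^bsub>M\<^esub> (s \<odot>\<^bsub>M\<^esub> m')"
  using frac_self[of m' M s'] assms(2,3) unfolding assms(1)[symmetric] by (auto simp: frac_def)

lemma frac_scale:
  assumes "module R M" "m \<in> carrier M" "s \<in> S" "u \<in> S"
  shows "frac S M (u \<odot>\<^bsub>M\<^esub> m) (u \<otimes> s) = frac S M m s"
proof -
  interpret M: module R M by fact
  show ?thesis using assms
    by (intro frac_eqI[of M _ _ _ _ \<one>]) (auto simp: M.smult_assoc1 M.smult_left_commute)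
qed

text \<open>Two representatives of a fraction have a common multiple, so an operation on representatives
  descends to fractions as soon as it is unchanged when numerator and denominator are multiplied
  by the same element of \<open>S\<close>.\<close>

lemma frac_UN:
  assumes "module R M" "m \<in> carrier M" "s \<in> S"
    and scale: "\<And>u m s. \<lbrakk>u \<in> S; m \<in> carrier M; s \<in> S\<rbrakk> \<Longrightarrow> g (u \<odot>\<^bsub>M\<^esub> m) (u \<otimes> s) = g m s"
  shows "(\<Union>(n, t)\<in>frac S M m s. g n t) = g m s"
proof -
  interpret M: module R M by fact
  have "g n t = g m s" if "(n, t) \<in> frac S M m s" for n t
  proof -
    from that obtain u where u: "n \<in> carrier M" "t \<in> S" "u \<in> S"
      "u \<odot>\<^bsub>M\<^esub> (t \<odot>\<^bsub>M\<^esub> m) = u \<odot>\<^bsub>M\<^esub> (s \<odot>\<^bsub>M\<^esub> n)" by (auto simp: frac_def)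
    have "(u \<otimes> s) \<odot>\<^bsub>M\<^esub> n = (u \<otimes> t) \<odot>\<^bsub>M\<^esub> m" using u assms by (simp add: M.smult_assoc1)
    moreover have "u \<otimes> s \<otimes> t = u \<otimes> t \<otimes> s" using u assms by (simp add: m_ac)
    ultimately show ?thesis
      using scale[of "u \<otimes> s" n t] scale[of "u \<otimes> t" m s] u assms(2,3) by simp
  qed
  then have "\<And>x. x \<in> frac S M m s \<Longrightarrow> (case x of (n, t) \<Rightarrow> g n t) = g m s" by auto
  moreover have "frac S M m s \<noteq> {}" using frac_self[of m M s] assms by auto
  ultimately show ?thesis by simp
qed

lemma frac_UN2:
  assumes M: "module R M" "m \<in> carrier M" "s \<in> S" and N: "module R N" "n \<in> carrier N" "t \<in> S"
    and scale1: "\<And>u m s n t. \<lbrakk>u \<in> S; m \<in> carrier M; s \<in> S; n \<in> carrier N; t \<in> S\<rbrakk>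
      \<Longrightarrow> g (u \<odot>\<^bsub>M\<^esub> m) (u \<otimes> s) n t = g m s n t"
    and scale2: "\<And>u m s n t. \<lbrakk>u \<in> S; m \<in> carrier M; s \<in> S; n \<in> carrier N; t \<in> S\<rbrakk>
      \<Longrightarrow> g m s (u \<odot>\<^bsub>N\<^esub> n) (u \<otimes> t) = g m s n t"
  shows "(\<Union>(m', s')\<in>frac S M m s. \<Union>(n', t')\<in>frac S N n t. g m' s' n' t') = g m s n t"
proof -
  interpret M: module R M by fact
  have inner: "(\<Union>(n', t')\<in>frac S N n t. g m s n' t') = g m s n t"
    if "m \<in> carrier M" "s \<in> S" for m s
    using frac_UN[OF N, of "g m s"] scale2 that by simp
  have "(\<Union>(m', s')\<in>frac S M m s. \<Union>(n', t')\<in>frac S N n t. g m' s' n' t')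
      = (\<Union>(n', t')\<in>frac S N n t. g m s n' t')"
    by (rule frac_UN[OF M]) (simp add: inner scale1 N)
  then show ?thesis using M by (simp add: inner)
qed

lemma loc_ring_carrierI [simp, intro]: "\<lbrakk>a \<in> carrier R; s \<in> S\<rbrakk> \<Longrightarrow> fr a s \<in> carrier Q"
  by (auto simp: loc_ring_def)

lemma loc_ring_carrierE:
  assumes "x \<in> carrier Q" obtains a s where "a \<in> carrier R" "s \<in> S" "x = fr a s"
  using assms by (auto simp: loc_ring_def)

lemma loc_module_carrierI [simp, intro]:
  "\<lbrakk>m \<in> carrier M; s \<in> S\<rbrakk> \<Longrightarrow> frac S M m s \<in> carrier (loc_module R S M)"
  by (auto simp: loc_module_def)

lemma loc_module_carrierE:
  assumes "x \<in> carrier (loc_module R S M)"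
  obtains m s where "m \<in> carrier M" "s \<in> S" "x = frac S M m s"
  using assms by (auto simp: loc_module_def)

lemma loc_module_add:
  assumes "module R M" "v \<in> carrier M" "w \<in> carrier M" "s \<in> S" "t \<in> S"
  shows "frac S M v s \<oplus>\<^bsub>loc_module R S M\<^esub> frac S M w t
    = frac S M (t \<odot>\<^bsub>M\<^esub> v \<oplus>\<^bsub>M\<^esub> s \<odot>\<^bsub>M\<^esub> w) (s \<otimes> t)"
proof -
  interpret M: module R M by fact
  have 1: "frac S M (t \<odot>\<^bsub>M\<^esub> (u \<odot>\<^bsub>M\<^esub> v) \<oplus>\<^bsub>M\<^esub> (u \<otimes> s) \<odot>\<^bsub>M\<^esub> w) (u \<otimes> s \<otimes> t)
      = frac S M (t \<odot>\<^bsub>M\<^esub> v \<oplus>\<^bsub>M\<^esub> s \<odot>\<^bsub>M\<^esub> w) (s \<otimes> t)"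
    if "u \<in> S" "v \<in> carrier M" "w \<in> carrier M" "s \<in> S" "t \<in> S" for u v w s t
    using that frac_scale[OF \<open>module R M\<close>, of "t \<odot>\<^bsub>M\<^esub> v \<oplus>\<^bsub>M\<^esub> s \<odot>\<^bsub>M\<^esub> w" "s \<otimes> t" u]
    by (simp add: M.smult_r_distr M.smult_assoc1 M.smult_left_commute m_ac)
  have 2: "frac S M ((u \<otimes> t) \<odot>\<^bsub>M\<^esub> v \<oplus>\<^bsub>M\<^esub> s \<odot>\<^bsub>M\<^esub> (u \<odot>\<^bsub>M\<^esub> w)) (s \<otimes> (u \<otimes> t))
      = frac S M (t \<odot>\<^bsub>M\<^esub> v \<oplus>\<^bsub>M\<^esub> s \<odot>\<^bsub>M\<^esub> w) (s \<otimes> t)"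
    if "u \<in> S" "v \<in> carrier M" "w \<in> carrier M" "s \<in> S" "t \<in> S" for u v w s t
    using 1[of u w v t s] that by (simp add: M.a_comm m_ac)
  show ?thesis unfolding loc_module_def using assms
    by (simp add: frac_UN2[OF assms(1) _ _ assms(1)] 1 2)
qed

lemma loc_module_smult:
  assumes "module R M" "a \<in> carrier R" "w \<in> carrier M" "s \<in> S" "t \<in> S"
  shows "fr a s \<odot>\<^bsub>loc_module R S M\<^esub> frac S M w t = frac S M (a \<odot>\<^bsub>M\<^esub> w) (s \<otimes> t)"
proof -
  interpret M: module R M by fact
  have 1: "frac S M ((u \<otimes> a) \<odot>\<^bsub>M\<^esub> w) (u \<otimes> s \<otimes> t) = frac S M (a \<odot>\<^bsub>M\<^esub> w) (s \<otimes> t)"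
   and 2: "frac S M (a \<odot>\<^bsub>M\<^esub> (u \<odot>\<^bsub>M\<^esub> w)) (s \<otimes> (u \<otimes> t)) = frac S M (a \<odot>\<^bsub>M\<^esub> w) (s \<otimes> t)"
    if "u \<in> S" "a \<in> carrier R" "w \<in> carrier M" "s \<in> S" "t \<in> S" for u a w s t
    using that frac_scale[OF \<open>module R M\<close>, of "a \<odot>\<^bsub>M\<^esub> w" "s \<otimes> t" u]
    by (simp_all add: M.smult_assoc1 M.smult_left_commute m_ac)
  have "(\<Union>(a, s)\<in>fr a s. \<Union>(w, t)\<in>frac S M w t. frac S M (a \<odot>\<^bsub>M\<^esub> w) (s \<otimes> t))
      = frac S M (a \<odot>\<^bsub>M\<^esub> w) (s \<otimes> t)"
    by (rule frac_UN2[where M = "reg_module R" and N = M])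
      (use assms in \<open>simp_all add: module_reg_module 1 2\<close>)
  then show ?thesis by (simp add: loc_module_def)
qed

lemma loc_module_zero: "\<zero>\<^bsub>loc_module R S M\<^esub> = frac S M \<zero>\<^bsub>M\<^esub> \<one>"
  by (simp add: loc_module_def)

lemma loc_ring_via_module:
  "carrier Q = carrier (loc_module R S (reg_module R))" "add Q = add (loc_module R S (reg_module R))"
  "ring.zero Q = ring.zero (loc_module R S (reg_module R))" "monoid.mult Q = module.smult (loc_module R S (reg_module R))"
  by (simp_all add: loc_ring_def loc_module_def)

lemma loc_ring_one: "\<one>\<^bsub>Q\<^esub> = fr \<one> \<one>"
  and loc_ring_zero: "\<zero>\<^bsub>Q\<^esub> = fr \<zero> \<one>"
  by (simp_all add: loc_ring_def)

lemma loc_ring_add: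
  assumes "a \<in> carrier R" "b \<in> carrier R" "s \<in> S" "t \<in> S"
  shows "fr a s \<oplus>\<^bsub>Q\<^esub> fr b t = fr (t \<otimes> a \<oplus> s \<otimes> b) (s \<otimes> t)"
  using loc_module_add[OF module_reg_module, of a b s t] assms by (simp add: loc_ring_via_module)

lemma loc_ring_mult:
  assumes "a \<in> carrier R" "b \<in> carrier R" "s \<in> S" "t \<in> S"
  shows "fr a s \<otimes>\<^bsub>Q\<^esub> fr b t = fr (a \<otimes> b) (s \<otimes> t)"
  using loc_module_smult[OF module_reg_module, of a b s t] assms by (simp add: loc_ring_via_module)

lemma loc_module_abelian_group:
  assumes "module R M" shows "abelian_group (loc_module R S M)"
proof -
  interpret M: module R M by fact
  let ?L = "loc_module R S M"
  note add = loc_module_add[OF assms] and E = loc_module_carrierE[where M = M]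
  have z: "frac S M \<zero>\<^bsub>M\<^esub> s = \<zero>\<^bsub>?L\<^esub>" if "s \<in> S" for s
    unfolding loc_module_zero using that
    by (intro frac_eqI[OF assms, of _ _ _ _ \<one>]) auto
  show ?thesis
  proof (rule abelian_groupI)
    fix x y assume x: "x \<in> carrier ?L" and y: "y \<in> carrier ?L"
    from x y show "x \<oplus>\<^bsub>?L\<^esub> y \<in> carrier ?L" by (auto elim!: E simp: add)
    from x y show "x \<oplus>\<^bsub>?L\<^esub> y = y \<oplus>\<^bsub>?L\<^esub> x" by (auto elim!: E simp: add M.a_comm m_comm)
    from x show "\<zero>\<^bsub>?L\<^esub> \<oplus>\<^bsub>?L\<^esub> x = x" by (auto elim!: E simp: add loc_module_zero)
    fix z assume z: "z \<in> carrier ?L"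
    from x y z show "x \<oplus>\<^bsub>?L\<^esub> y \<oplus>\<^bsub>?L\<^esub> z = x \<oplus>\<^bsub>?L\<^esub> (y \<oplus>\<^bsub>?L\<^esub> z)"
      by (auto elim!: E simp: add M.smult_r_distr M.a_assoc m_assoc M.smult_left_commute
          M.smult_assoc1)
  next
    show "\<zero>\<^bsub>?L\<^esub> \<in> carrier ?L" by (simp add: loc_module_zero loc_module_carrierI)
    fix x assume "x \<in> carrier ?L"
    then obtain m s where m: "m \<in> carrier M" "s \<in> S" "x = frac S M m s" by (rule E)
    then have "frac S M (\<ominus>\<^bsub>M\<^esub> m) s \<oplus>\<^bsub>?L\<^esub> x = \<zero>\<^bsub>?L\<^esub>"
      by (simp add: add M.smult_r_minus M.l_neg z)
    with m show "\<exists>y\<in>carrier ?L. y \<oplus>\<^bsub>?L\<^esub> x = \<zero>\<^bsub>?L\<^esub>" by (intro bexI) auto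
  qed
qed

lemma loc_ring_cring: "cring Q"
proof (rule cringI)
  interpret L: abelian_group "loc_module R S (reg_module R)"
    by (rule loc_module_abelian_group[OF module_reg_module])
  show "abelian_group Q"
    by (rule abelian_groupI)
      (auto simp: loc_ring_via_module L.a_ac intro: L.l_neg)
  show "comm_monoid Q"
    by (rule comm_monoidI; (auto elim!: loc_ring_carrierE simp: loc_ring_mult loc_ring_one m_ac)?)
  fix x y z assume "x \<in> carrier Q" "y \<in> carrier Q" "z \<in> carrier Q"
  then obtain a b c s t u where *: "a \<in> carrier R" "b \<in> carrier R" "c \<in> carrier R"
      "s \<in> S" "t \<in> S" "u \<in> S" "x = fr a s" "y = fr b t" "z = fr c u"
    by (elim loc_ring_carrierE) blast
  have "fr ((t \<otimes> a \<oplus> s \<otimes> b) \<otimes> c) (s \<otimes> t \<otimes> u) =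
      fr (u \<otimes> ((t \<otimes> a \<oplus> s \<otimes> b) \<otimes> c)) (u \<otimes> (s \<otimes> t \<otimes> u))"
    using * by (intro frac_scale[OF module_reg_module, symmetric, simplified]) auto
  with * show "(x \<oplus>\<^bsub>Q\<^esub> y) \<otimes>\<^bsub>Q\<^esub> z = x \<otimes>\<^bsub>Q\<^esub> z \<oplus>\<^bsub>Q\<^esub> y \<otimes>\<^bsub>Q\<^esub> z"
    by (simp add: loc_ring_mult loc_ring_add l_distr r_distr m_ac)
qed

lemma loc_module_module:
  assumes "module R M" shows "module Q (loc_module R S M)"
proof -
  interpret M: module R M by fact
  let ?L = "loc_module R S M"
  note add = loc_module_add[OF assms] and E = loc_module_carrierE[where M = M]
  note sm = loc_module_smult[OF assms]
  show ?thesis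
  proof (rule moduleI[OF loc_ring_cring loc_module_abelian_group[OF assms]])
    fix x v assume "x \<in> carrier Q" "v \<in> carrier ?L"
    then show "x \<odot>\<^bsub>?L\<^esub> v \<in> carrier ?L"
      by (auto elim!: loc_ring_carrierE E simp: sm loc_module_carrierI)
  next
    fix x y v assume "x \<in> carrier Q" "y \<in> carrier Q" "v \<in> carrier ?L"
    then obtain a s b t m u where *: "a \<in> carrier R" "s \<in> S" "x = fr a s"
      "b \<in> carrier R" "t \<in> S" "y = fr b t" "m \<in> carrier M" "u \<in> S" "v = frac S M m u"
      by (elim loc_ring_carrierE E) blast
    show "(x \<otimes>\<^bsub>Q\<^esub> y) \<odot>\<^bsub>?L\<^esub> v = x \<odot>\<^bsub>?L\<^esub> (y \<odot>\<^bsub>?L\<^esub> v)"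
      using * by (simp add: sm loc_ring_mult M.smult_assoc1 m_assoc)
    show "(x \<oplus>\<^bsub>Q\<^esub> y) \<odot>\<^bsub>?L\<^esub> v = x \<odot>\<^bsub>?L\<^esub> v \<oplus>\<^bsub>?L\<^esub> y \<odot>\<^bsub>?L\<^esub> v"
      using * frac_scale[OF assms, of "(t \<otimes> a \<oplus> s \<otimes> b) \<odot>\<^bsub>M\<^esub> m" "s \<otimes> t \<otimes> u" u]
      by (simp add: sm loc_ring_add add M.smult_l_distr M.smult_r_distr M.smult_assoc1
          M.smult_left_commute m_ac)
  next
    fix x v w assume "x \<in> carrier Q" "v \<in> carrier ?L" "w \<in> carrier ?L"
    then obtain a s m u n r where *: "a \<in> carrier R" "s \<in> S" "x = fr a s"
      "m \<in> carrier M" "u \<in> S" "v = frac S M m u" "n \<in> carrier M" "r \<in> S" "w = frac S M n r"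
      by (elim loc_ring_carrierE E) blast
    show "x \<odot>\<^bsub>?L\<^esub> (v \<oplus>\<^bsub>?L\<^esub> w) = x \<odot>\<^bsub>?L\<^esub> v \<oplus>\<^bsub>?L\<^esub> x \<odot>\<^bsub>?L\<^esub> w"
      using * frac_scale[OF assms, of "a \<odot>\<^bsub>M\<^esub> (r \<odot>\<^bsub>M\<^esub> m \<oplus>\<^bsub>M\<^esub> u \<odot>\<^bsub>M\<^esub> n)" "s \<otimes> (u \<otimes> r)" s]
      by (simp add: sm add M.smult_r_distr M.smult_assoc1 M.smult_left_commute m_ac)
  next
    fix v assume "v \<in> carrier ?L"
    then show "\<one>\<^bsub>Q\<^esub> \<odot>\<^bsub>?L\<^esub> v = v" by (auto elim!: E simp: sm loc_ring_one)
  qed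
qed

end

section \<open>Linear combinations and traces\<close>

lemma (in abelian_monoid) finsum_swap:
  assumes "finite I" "finite J" "\<And>i j. \<lbrakk>i \<in> I; j \<in> J\<rbrakk> \<Longrightarrow> f i j \<in> carrier G"
  shows "(\<Oplus>i\<in>I. \<Oplus>j\<in>J. f i j) = (\<Oplus>j\<in>J. \<Oplus>i\<in>I. f i j)"
  using assms(1,3)
proof (induction rule: finite_induct)
  case (insert i I)
  then have "(\<Oplus>i\<in>insert i I. \<Oplus>j\<in>J. f i j) = (\<Oplus>j\<in>J. f i j) \<oplus> (\<Oplus>j\<in>J. \<Oplus>i\<in>I. f i j)"
    by (subst finsum_insert) (auto simp: Pi_iff)
  also have "\<dots> = (\<Oplus>j\<in>J. f i j \<oplus> (\<Oplus>i\<in>I. f i j))"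
    using insert by (subst finsum_addf) (auto simp: Pi_iff)
  also have "\<dots> = (\<Oplus>j\<in>J. \<Oplus>i\<in>insert i I. f i j)"
    using insert by (intro finsum_cong') (auto simp: Pi_iff)
  finally show ?case .
qed simp

lemma (in module) finsum_smult_rdistr:
  assumes "finite I" "f \<in> I \<rightarrow> carrier R" "x \<in> carrier M"
  shows "(\<Oplus>i\<in>I. f i) \<odot>\<^bsub>M\<^esub> x = (\<Oplus>\<^bsub>M\<^esub>i\<in>I. f i \<odot>\<^bsub>M\<^esub> x)"
  using assms
proof (induction rule: finite_induct)
  case (insert i I)
  then have "(\<Oplus>j\<in>insert i I. f j) \<odot>\<^bsub>M\<^esub> x = f i \<odot>\<^bsub>M\<^esub> x \<oplus>\<^bsub>M\<^esub> (\<Oplus>\<^bsub>M\<^esub>j\<in>I. f j \<odot>\<^bsub>M\<^esub> x)"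
    by (subst R.finsum_insert) (auto simp: Pi_iff smult_l_distr)
  then show ?case using insert by (subst M.finsum_insert) (auto simp: Pi_iff)
qed simp

lemma (in module) lin_comb_lin_comb:
  fixes b :: "nat \<Rightarrow> nat \<Rightarrow> 'a"
  assumes a: "\<And>i. i < r \<Longrightarrow> a i \<in> carrier R"
    and b: "\<And>i j. \<lbrakk>i < r; j < q\<rbrakk> \<Longrightarrow> b j i \<in> carrier R"
    and e: "\<And>j. j < q \<Longrightarrow> e j \<in> carrier M"
  shows "(\<Oplus>\<^bsub>M\<^esub>i\<in>{..<r}. a i \<odot>\<^bsub>M\<^esub> (\<Oplus>\<^bsub>M\<^esub>j\<in>{..<q}. b j i \<odot>\<^bsub>M\<^esub> e j))
    = (\<Oplus>\<^bsub>M\<^esub>j\<in>{..<q}. (\<Oplus>i\<in>{..<r}. b j i \<otimes> a i) \<odot>\<^bsub>M\<^esub> e j)"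
proof -
  have "(\<Oplus>\<^bsub>M\<^esub>i\<in>{..<r}. a i \<odot>\<^bsub>M\<^esub> (\<Oplus>\<^bsub>M\<^esub>j\<in>{..<q}. b j i \<odot>\<^bsub>M\<^esub> e j))
      = (\<Oplus>\<^bsub>M\<^esub>i\<in>{..<r}. \<Oplus>\<^bsub>M\<^esub>j\<in>{..<q}. (b j i \<otimes> a i) \<odot>\<^bsub>M\<^esub> e j)"
  proof (intro M.finsum_cong' refl)
    fix i assume i: "i \<in> {..<r}"
    have "a i \<odot>\<^bsub>M\<^esub> (\<Oplus>\<^bsub>M\<^esub>j\<in>{..<q}. b j i \<odot>\<^bsub>M\<^esub> e j) = (\<Oplus>\<^bsub>M\<^esub>j\<in>{..<q}. a i \<odot>\<^bsub>M\<^esub> (b j i \<odot>\<^bsub>M\<^esub> e j))"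
      using i by (intro finsum_smult_ldistr) (auto simp: assms)
    also have "\<dots> = (\<Oplus>\<^bsub>M\<^esub>j\<in>{..<q}. (b j i \<otimes> a i) \<odot>\<^bsub>M\<^esub> e j)"
      using i by (intro M.finsum_cong') (auto simp: assms R.m_comm simp flip: smult_assoc1)
    finally show "a i \<odot>\<^bsub>M\<^esub> (\<Oplus>\<^bsub>M\<^esub>j\<in>{..<q}. b j i \<odot>\<^bsub>M\<^esub> e j)
        = (\<Oplus>\<^bsub>M\<^esub>j\<in>{..<q}. (b j i \<otimes> a i) \<odot>\<^bsub>M\<^esub> e j)" .
  qed (auto simp: assms intro!: M.finsum_closed)
  also have "\<dots> = (\<Oplus>\<^bsub>M\<^esub>j\<in>{..<q}. \<Oplus>\<^bsub>M\<^esub>i\<in>{..<r}. (b j i \<otimes> a i) \<odot>\<^bsub>M\<^esub> e j)"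
    by (intro M.finsum_swap) (auto simp: assms)
  also have "\<dots> = (\<Oplus>\<^bsub>M\<^esub>j\<in>{..<q}. (\<Oplus>i\<in>{..<r}. b j i \<otimes> a i) \<odot>\<^bsub>M\<^esub> e j)"
    by (intro M.finsum_cong') (auto simp: assms finsum_smult_rdistr Pi_iff)
  finally show ?thesis .
qed

locale plain_module = module R M
  for R (structure) and M :: "('a, 'm) module" (structure)

definition module_endo :: "('a, 'z) ring_scheme \<Rightarrow> ('a, 'm) module \<Rightarrow> ('m \<Rightarrow> 'm) \<Rightarrow> bool" where
  "module_endo R M T \<longleftrightarrow> T \<in> carrier M \<rightarrow> carrier M \<and>
     (\<forall>v\<in>carrier M. \<forall>w\<in>carrier M. T (v \<oplus>\<^bsub>M\<^esub> w) = T v \<oplus>\<^bsub>M\<^esub> T w) \<and>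
     (\<forall>a\<in>carrier R. \<forall>v\<in>carrier M. T (a \<odot>\<^bsub>M\<^esub> v) = a \<odot>\<^bsub>M\<^esub> T v)"

lemma module_endoD:
  assumes "module_endo R M T"
  shows "v \<in> carrier M \<Longrightarrow> T v \<in> carrier M"
    and "\<lbrakk>v \<in> carrier M; w \<in> carrier M\<rbrakk> \<Longrightarrow> T (v \<oplus>\<^bsub>M\<^esub> w) = T v \<oplus>\<^bsub>M\<^esub> T w"
    and "\<lbrakk>a \<in> carrier R; v \<in> carrier M\<rbrakk> \<Longrightarrow> T (a \<odot>\<^bsub>M\<^esub> v) = a \<odot>\<^bsub>M\<^esub> T v"
  using assms by (auto simp: module_endo_def)

lemma (in abelian_group) additive_zero:
  assumes "T \<in> carrier G \<rightarrow> carrier G"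
    and "\<And>v w. \<lbrakk>v \<in> carrier G; w \<in> carrier G\<rbrakk> \<Longrightarrow> T (v \<oplus> w) = T v \<oplus> T w"
  shows "T \<zero> = \<zero>"
proof -
  have T0: "T \<zero> \<in> carrier G" using assms by auto
  have "T \<zero> \<oplus> T \<zero> = T \<zero>" using assms(2)[of \<zero> \<zero>] by simp
  then show ?thesis using T0 by (metis add.l_cancel_one' )
qed

lemma (in abelian_group) additive_finsum:
  assumes "finite I" "T \<in> carrier G \<rightarrow> carrier G"
    and "\<And>v w. \<lbrakk>v \<in> carrier G; w \<in> carrier G\<rbrakk> \<Longrightarrow> T (v \<oplus> w) = T v \<oplus> T w"
    and "f \<in> I \<rightarrow> carrier G"
  shows "T (\<Oplus>i\<in>I. f i) = (\<Oplus>i\<in>I. T (f i))"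
  using assms(1,4)
proof (induction rule: finite_induct)
  case empty
  then show ?case using additive_zero[of T] assms by simp
next
  case (insert i I)
  then show ?case using assms(2,3)
    by (subst (1 2) finsum_insert) (auto simp: Pi_iff)
qed

lemma (in plain_module) module_endo_lin_comb:
  assumes T: "module_endo R M T" and "finite I"
    and "a \<in> I \<rightarrow> carrier R" "e \<in> I \<rightarrow> carrier M"
  shows "T (\<Oplus>\<^bsub>M\<^esub>i\<in>I. a i \<odot>\<^bsub>M\<^esub> e i) = (\<Oplus>\<^bsub>M\<^esub>i\<in>I. a i \<odot>\<^bsub>M\<^esub> T (e i))"
proof -
  have "T (\<Oplus>\<^bsub>M\<^esub>i\<in>I. a i \<odot>\<^bsub>M\<^esub> e i) = (\<Oplus>\<^bsub>M\<^esub>i\<in>I. T (a i \<odot>\<^bsub>M\<^esub> e i))"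
    using assms by (intro M.additive_finsum) (auto simp: module_endoD[OF T])
  also have "\<dots> = (\<Oplus>\<^bsub>M\<^esub>i\<in>I. a i \<odot>\<^bsub>M\<^esub> T (e i))"
    using assms by (intro M.finsum_cong') (auto simp: module_endoD[OF T] Pi_iff)
  finally show ?thesis .
qed

lemma (in plain_module) coords_in:
  assumes "is_basis R M r e" "v \<in> carrier M"
  shows "coords R M r e v \<in> {..<r} \<rightarrow>\<^sub>E carrier R"
    and "v = (\<Oplus>\<^bsub>M\<^esub>i\<in>{..<r}. coords R M r e v i \<odot>\<^bsub>M\<^esub> e i)"
proof -
  have "\<exists>!c. c \<in> {..<r} \<rightarrow>\<^sub>E carrier R \<and> v = (\<Oplus>\<^bsub>M\<^esub>i\<in>{..<r}. c i \<odot>\<^bsub>M\<^esub> e i)"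
    using assms by (auto simp: is_basis_def)
  from theI'[OF this] show "coords R M r e v \<in> {..<r} \<rightarrow>\<^sub>E carrier R"
    and "v = (\<Oplus>\<^bsub>M\<^esub>i\<in>{..<r}. coords R M r e v i \<odot>\<^bsub>M\<^esub> e i)"
    unfolding coords_def by auto
qed

lemma (in plain_module) coords_eqI:
  assumes B: "is_basis R M r e" and c: "\<And>i. i < r \<Longrightarrow> c i \<in> carrier R"
    and v: "v = (\<Oplus>\<^bsub>M\<^esub>i\<in>{..<r}. c i \<odot>\<^bsub>M\<^esub> e i)" and i: "i < r"
  shows "coords R M r e v i = c i"
proof -
  have e: "e \<in> {..<r} \<rightarrow> carrier M" using B by (auto simp: is_basis_def)
  have vM: "v \<in> carrier M" unfolding v using c e by (intro M.finsum_closed) (auto simp: Pi_iff)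
  then have "\<exists>!c. c \<in> {..<r} \<rightarrow>\<^sub>E carrier R \<and> v = (\<Oplus>\<^bsub>M\<^esub>i\<in>{..<r}. c i \<odot>\<^bsub>M\<^esub> e i)"
    using B by (auto simp: is_basis_def)
  moreover have "restrict c {..<r} \<in> {..<r} \<rightarrow>\<^sub>E carrier R" using c by auto
  moreover have "v = (\<Oplus>\<^bsub>M\<^esub>i\<in>{..<r}. restrict c {..<r} i \<odot>\<^bsub>M\<^esub> e i)"
    unfolding v using c e by (intro M.finsum_cong') (auto simp: Pi_iff)
  ultimately have "coords R M r e v = restrict c {..<r}"
    using coords_in[OF B vM] by blast
  then show ?thesis using i by simp
qed

lemma (in cring) finsum_delta:
  assumes "finite I" "j \<in> I" "f \<in> I \<rightarrow> carrier R"
  shows "(\<Oplus>i\<in>I. f i \<otimes> (if i = j then \<one> else \<zero>)) = f j"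
proof -
  have "(\<Oplus>i\<in>I. f i \<otimes> (if i = j then \<one> else \<zero>)) = (\<Oplus>i\<in>I. if j = i then f i else \<zero>)"
    using assms by (intro finsum_cong') (auto simp: Pi_iff)
  then show ?thesis using assms add.finprod_singleton[of j I f] by simp
qed

text \<open>Changing the basis conjugates the matrix of \<open>T\<close> by the transition matrices \<open>P\<close> and \<open>Q\<close>;
  the trace only sees the product \<open>P Q = 1\<close>, so the two ranks need not be compared.\<close>

lemma (in plain_module) trace_eq:
  assumes B: "is_basis R M r e" and T: "module_endo R M T"
    and c: "\<And>i j. \<lbrakk>i < r; j < r\<rbrakk> \<Longrightarrow> c j i \<in> carrier R"
    and Te: "\<And>i. i < r \<Longrightarrow> T (e i) = (\<Oplus>\<^bsub>M\<^esub>j\<in>{..<r}. c j i \<odot>\<^bsub>M\<^esub> e j)"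
  shows "trace R M T = (\<Oplus>i\<in>{..<r}. c i i)"
proof -
  obtain q b where qb: "(SOME (r, e). is_basis R M r e) = (q, b)" by fastforce
  have "case (SOME (r, e). is_basis R M r e) of (r, e) \<Rightarrow> is_basis R M r e"
    by (rule someI[of "\<lambda>(r, e). is_basis R M r e" "(r, e)"]) (use B in simp)
  then have B': "is_basis R M q b" by (simp add: qb)
  have eM [simp]: "e i \<in> carrier M" if "i < r" for i using B that by (auto simp: is_basis_def)
  have bM [simp]: "b i \<in> carrier M" if "i < q" for i using B' that by (auto simp: is_basis_def)
  define P where "P j i = coords R M r e (b i) j" for i j
  define Q where "Q j i = coords R M q b (e i) j" for i j
  have P [simp]: "P j i \<in> carrier R" if "i < q" "j < r" for i j
    using coords_in[OF B, of "b i"] that by (auto simp: P_def)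
  have Q [simp]: "Q j i \<in> carrier R" if "i < r" "j < q" for i j
    using coords_in[OF B', of "e i"] that by (auto simp: Q_def)
  note c [simp]
  have bP: "b i = (\<Oplus>\<^bsub>M\<^esub>j\<in>{..<r}. P j i \<odot>\<^bsub>M\<^esub> e j)" if "i < q" for i
    using coords_in(2)[OF B, of "b i"] that by (simp add: P_def)
  have eQ: "e i = (\<Oplus>\<^bsub>M\<^esub>j\<in>{..<q}. Q j i \<odot>\<^bsub>M\<^esub> b j)" if "i < r" for i
    using coords_in(2)[OF B', of "e i"] that by (simp add: Q_def)
  have PQ: "(\<Oplus>i\<in>{..<q}. P j i \<otimes> Q i k) = (if k = j then \<one> else \<zero>)" if jk: "j < r" "k < r" for j k
  proof -
    have "e k = (\<Oplus>\<^bsub>M\<^esub>i\<in>{..<q}. Q i k \<odot>\<^bsub>M\<^esub> (\<Oplus>\<^bsub>M\<^esub>j\<in>{..<r}. P j i \<odot>\<^bsub>M\<^esub> e j))"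
      using jk by (subst eQ, simp) (intro M.finsum_cong', auto intro!: M.finsum_closed simp flip: bP)
    also have "\<dots> = (\<Oplus>\<^bsub>M\<^esub>j\<in>{..<r}. (\<Oplus>i\<in>{..<q}. P j i \<otimes> Q i k) \<odot>\<^bsub>M\<^esub> e j)"
      using jk by (intro lin_comb_lin_comb) auto
    finally have 1: "coords R M r e (e k) j = (\<Oplus>i\<in>{..<q}. P j i \<otimes> Q i k)"
      using jk by (intro coords_eqI[OF B]) (auto intro!: R.finsum_closed)
    have "e k = (\<Oplus>\<^bsub>M\<^esub>j\<in>{..<r}. if k = j then e j else \<zero>\<^bsub>M\<^esub>)"
      using jk M.add.finprod_singleton[of k "{..<r}" e] by auto
    also have "\<dots> = (\<Oplus>\<^bsub>M\<^esub>j\<in>{..<r}. (if k = j then \<one> else \<zero>) \<odot>\<^bsub>M\<^esub> e j)"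
      by (intro M.finsum_cong') auto
    finally have "coords R M r e (e k) j = (if k = j then \<one> else \<zero>)"
      using jk by (intro coords_eqI[OF B]) auto
    with 1 show ?thesis by simp
  qed
  have Tb: "T (b i) = (\<Oplus>\<^bsub>M\<^esub>k\<in>{..<q}. (\<Oplus>l\<in>{..<r}. Q k l \<otimes> (\<Oplus>j\<in>{..<r}. c l j \<otimes> P j i)) \<odot>\<^bsub>M\<^esub> b k)"
    if i: "i < q" for i
  proof -
    have "T (b i) = (\<Oplus>\<^bsub>M\<^esub>j\<in>{..<r}. P j i \<odot>\<^bsub>M\<^esub> T (e j))"
      using i by (subst bP) (auto intro!: module_endo_lin_comb[OF T])
    also have "\<dots> = (\<Oplus>\<^bsub>M\<^esub>j\<in>{..<r}. P j i \<odot>\<^bsub>M\<^esub> (\<Oplus>\<^bsub>M\<^esub>l\<in>{..<r}. c l j \<odot>\<^bsub>M\<^esub> e l))"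
      using i by (intro M.finsum_cong') (auto intro!: M.finsum_closed simp: Te)
    also have "\<dots> = (\<Oplus>\<^bsub>M\<^esub>l\<in>{..<r}. (\<Oplus>j\<in>{..<r}. c l j \<otimes> P j i) \<odot>\<^bsub>M\<^esub> e l)"
      using i by (intro lin_comb_lin_comb) auto
    also have "\<dots> = (\<Oplus>\<^bsub>M\<^esub>l\<in>{..<r}. (\<Oplus>j\<in>{..<r}. c l j \<otimes> P j i) \<odot>\<^bsub>M\<^esub> (\<Oplus>\<^bsub>M\<^esub>k\<in>{..<q}. Q k l \<odot>\<^bsub>M\<^esub> b k))"
      using i by (intro M.finsum_cong') (auto intro!: M.finsum_closed R.finsum_closed simp flip: eQ)
    also have "\<dots> = (\<Oplus>\<^bsub>M\<^esub>k\<in>{..<q}. (\<Oplus>l\<in>{..<r}. Q k l \<otimes> (\<Oplus>j\<in>{..<r}. c l j \<otimes> P j i)) \<odot>\<^bsub>M\<^esub> b k)"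
      using i by (intro lin_comb_lin_comb) (auto intro!: R.finsum_closed)
    finally show ?thesis .
  qed
  have "trace R M T = (\<Oplus>i\<in>{..<q}. coords R M q b (T (b i)) i)"
    by (simp add: trace_def qb)
  also have "\<dots> = (\<Oplus>i\<in>{..<q}. \<Oplus>l\<in>{..<r}. Q i l \<otimes> (\<Oplus>j\<in>{..<r}. c l j \<otimes> P j i))"
  proof (intro R.finsum_cong' refl)
    fix i assume i: "i \<in> {..<q}"
    show "coords R M q b (T (b i)) i = (\<Oplus>l\<in>{..<r}. Q i l \<otimes> (\<Oplus>j\<in>{..<r}. c l j \<otimes> P j i))"
      using i by (intro coords_eqI[OF B' _ Tb]) (auto intro!: R.finsum_closed)
  qed (auto intro!: R.finsum_closed)
  also have "\<dots> = (\<Oplus>i\<in>{..<q}. \<Oplus>l\<in>{..<r}. \<Oplus>j\<in>{..<r}. c l j \<otimes> (P j i \<otimes> Q i l))"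
    by (intro R.finsum_cong' refl) (auto intro!: R.finsum_closed R.finsum_cong'
        simp: R.finsum_rdistr Pi_iff R.m_ac)
  also have "\<dots> = (\<Oplus>l\<in>{..<r}. \<Oplus>i\<in>{..<q}. \<Oplus>j\<in>{..<r}. c l j \<otimes> (P j i \<otimes> Q i l))"
    by (intro R.finsum_swap) (auto intro!: R.finsum_closed)
  also have "\<dots> = (\<Oplus>l\<in>{..<r}. \<Oplus>j\<in>{..<r}. \<Oplus>i\<in>{..<q}. c l j \<otimes> (P j i \<otimes> Q i l))"
    by (intro R.finsum_cong' refl R.finsum_swap) (auto intro!: R.finsum_closed)
  also have "\<dots> = (\<Oplus>l\<in>{..<r}. \<Oplus>j\<in>{..<r}. c l j \<otimes> (if j = l then \<one> else \<zero>))"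
    by (intro R.finsum_cong' refl) (auto intro!: R.finsum_closed simp: PQ Pi_iff
        simp flip: R.finsum_rdistr)
  also have "\<dots> = (\<Oplus>l\<in>{..<r}. c l l)"
    by (intro R.finsum_cong' refl) (auto simp: R.finsum_delta Pi_iff)
  finally show ?thesis .
qed


section \<open>Local bases and local traces\<close>

text \<open>Finitely many conditions, each of which holds up to some element of \<open>S\<close>, hold up to a common one. This
  is how finitely many denominators are cleared at once.\<close>

lemma common_multiple:
  assumes "mult_set R S" "\<And>i. i < (r::nat) \<Longrightarrow> \<exists>s\<in>S. P i s"
    and "\<And>i s u. \<lbrakk>i < r; s \<in> S; u \<in> S; P i s\<rbrakk> \<Longrightarrow> P i (u \<otimes>\<^bsub>R\<^esub> s)"
  shows "\<exists>s\<in>S. \<forall>i<r. P i s"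
  using assms(2,3)
proof (induction r)
  case 0
  then show ?case using mult_set.one_in_S[OF assms(1)] by blast
next
  case (Suc r)
  interpret mult_set R S by fact
  have "\<exists>s\<in>S. \<forall>i<r. P i s" by (rule Suc.IH) (auto intro: Suc.prems)
  then obtain s where s: "s \<in> S" "\<forall>i<r. P i s" by auto
  obtain t where t: "t \<in> S" "P r t" using Suc.prems(1)[of r] by auto
  have "P i (s \<otimes>\<^bsub>R\<^esub> t)" if "i < Suc r" for i
  proof (cases "i = r")
    case False
    then have "P i (t \<otimes>\<^bsub>R\<^esub> s)" using s t that Suc.prems(2)[of i s t] by auto
    then show ?thesis using s t by (simp add: m_comm)
  qed (use s t Suc.prems(2)[of r t s] in auto)
  then show ?case using s t by blast
qed

text \<open>The images of \<open>w\<close> form a basis of the localization at \<open>S\<close>, expressed with numerators only. Since a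
  derivation acts on \<open>R\<close> and \<open>M\<close> and not on fractions, computations with connections are done in this form.\<close>

definition local_basis ::
    "('a, 'z) ring_scheme \<Rightarrow> 'a set \<Rightarrow> ('a, 'm) module \<Rightarrow> nat \<Rightarrow> (nat \<Rightarrow> 'm) \<Rightarrow> bool" where
  "local_basis R S M r w \<longleftrightarrow> w \<in> {..<r} \<rightarrow> carrier M \<and>
     (\<forall>v\<in>carrier M. \<exists>s\<in>S. \<exists>c\<in>{..<r} \<rightarrow> carrier R.
        s \<odot>\<^bsub>M\<^esub> v = (\<Oplus>\<^bsub>M\<^esub>i\<in>{..<r}. c i \<odot>\<^bsub>M\<^esub> w i)) \<and>
     (\<forall>c\<in>{..<r} \<rightarrow> carrier R. (\<Oplus>\<^bsub>M\<^esub>i\<in>{..<r}. c i \<odot>\<^bsub>M\<^esub> w i) = \<zero>\<^bsub>M\<^esub> \<longrightarrow>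
        (\<exists>s\<in>S. \<forall>i<r. s \<otimes>\<^bsub>R\<^esub> c i = \<zero>\<^bsub>R\<^esub>))"

lemma local_basis_indep:
  assumes "local_basis R S M r w" "c \<in> {..<r} \<rightarrow> carrier R"
    and "(\<Oplus>\<^bsub>M\<^esub>i\<in>{..<r}. c i \<odot>\<^bsub>M\<^esub> w i) = \<zero>\<^bsub>M\<^esub>"
  shows "\<exists>s\<in>S. \<forall>i<r. s \<otimes>\<^bsub>R\<^esub> c i = \<zero>\<^bsub>R\<^esub>"
  using assms by (auto simp: local_basis_def)

lemma local_basis_mono: "\<lbrakk>local_basis R S M r w; S \<subseteq> S'\<rbrakk> \<Longrightarrow> local_basis R S' M r w"
  unfolding local_basis_def by (meson subsetD)

locale loc_data = R?: mult_set R S + M?: plain_module R M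
  for R :: "('a, 'z) ring_scheme" (structure) and S and M :: "('a, 'm) module"
begin

abbreviation "L \<equiv> loc_module R S M"
abbreviation "fm \<equiv> frac S M"

lemma module_M: "module R M" by unfold_locales

sublocale Q: cring Q by (rule loc_ring_cring)
sublocale L: plain_module Q L
  unfolding plain_module_def by (rule loc_module_module[OF module_M])

lemma fm_add_same: "\<lbrakk>v \<in> carrier M; w \<in> carrier M; d \<in> S\<rbrakk> \<Longrightarrow> fm v d \<oplus>\<^bsub>L\<^esub> fm w d = fm (v \<oplus>\<^bsub>M\<^esub> w) d"
  using frac_scale[OF module_M, of "v \<oplus>\<^bsub>M\<^esub> w" d d]
  by (simp add: loc_module_add[OF module_M] smult_r_distr)

lemma fm_zero: "d \<in> S \<Longrightarrow> fm \<zero>\<^bsub>M\<^esub> d = \<zero>\<^bsub>L\<^esub>"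
  unfolding loc_module_zero by (intro frac_eqI[OF module_M, of _ _ _ _ \<one>]) auto

lemma fr_zero: "d \<in> S \<Longrightarrow> fr \<zero> d = \<zero>\<^bsub>Q\<^esub>"
  unfolding loc_ring_zero by (intro frac_eqI[OF module_reg_module, of _ _ _ _ \<one>]) auto

lemma fr_add_same: "\<lbrakk>a \<in> carrier R; b \<in> carrier R; d \<in> S\<rbrakk> \<Longrightarrow> fr a d \<oplus>\<^bsub>Q\<^esub> fr b d = fr (a \<oplus> b) d"
  using frac_scale[OF module_reg_module, of "a \<oplus> b" d d]
  by (simp add: loc_ring_add r_distr)

lemma fr_scale: "\<lbrakk>a \<in> carrier R; d \<in> S; u \<in> S\<rbrakk> \<Longrightarrow> fr (u \<otimes> a) (u \<otimes> d) = fr a d"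
  using frac_scale[OF module_reg_module, of a d u] by simp

lemma finsum_fm:
  assumes "finite I" "m \<in> I \<rightarrow> carrier M" "d \<in> S"
  shows "(\<Oplus>\<^bsub>L\<^esub>i\<in>I. fm (m i) d) = fm (\<Oplus>\<^bsub>M\<^esub>i\<in>I. m i) d"
  using assms
proof (induction rule: finite_induct)
  case (insert i I)
  then show ?case
    by (subst L.M.finsum_insert) (auto simp: Pi_iff fm_add_same loc_module_carrierI
        intro!: M.finsum_closed)
qed (simp add: fm_zero)

lemma finsum_fr:
  assumes "finite I" "a \<in> I \<rightarrow> carrier R" "d \<in> S"
  shows "(\<Oplus>\<^bsub>Q\<^esub>i\<in>I. fr (a i) d) = fr (\<Oplus>i\<in>I. a i) d"
  using assms
proof (induction rule: finite_induct)
  case (insert i I)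
  then show ?case
    by (subst Q.finsum_insert) (auto simp: Pi_iff fr_add_same)
qed (simp add: fr_zero)

lemma lin_comb_fm:
  assumes "a \<in> {..<r} \<rightarrow> carrier R" "w \<in> {..<r} \<rightarrow> carrier M" "d \<in> S"
  shows "(\<Oplus>\<^bsub>L\<^esub>i\<in>{..<r::nat}. fr (a i) d \<odot>\<^bsub>L\<^esub> fm (w i) \<one>) = fm (\<Oplus>\<^bsub>M\<^esub>i\<in>{..<r}. a i \<odot>\<^bsub>M\<^esub> w i) d"
proof -
  have "(\<Oplus>\<^bsub>L\<^esub>i\<in>{..<r}. fr (a i) d \<odot>\<^bsub>L\<^esub> fm (w i) \<one>) = (\<Oplus>\<^bsub>L\<^esub>i\<in>{..<r}. fm (a i \<odot>\<^bsub>M\<^esub> w i) d)"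
    using assms by (intro L.M.finsum_cong') (auto simp: Pi_iff loc_module_smult[OF module_M])
  also have "\<dots> = fm (\<Oplus>\<^bsub>M\<^esub>i\<in>{..<r}. a i \<odot>\<^bsub>M\<^esub> w i) d"
    using assms by (intro finsum_fm) auto
  finally show ?thesis .
qed

lemma common_denominator:
  assumes "\<And>i. i < r \<Longrightarrow> c i \<in> carrier Q"
  obtains d a where "d \<in> S" "a \<in> {..<r::nat} \<rightarrow> carrier R" "\<And>i. i < r \<Longrightarrow> c i = fr (a i) d"
proof -
  have "\<exists>d\<in>S. \<forall>i<r. \<exists>a\<in>carrier R. c i = fr a d"
  proof (rule common_multiple)
    show "mult_set R S" by unfold_locales
    show "\<exists>s\<in>S. \<exists>a\<in>carrier R. c i = fr a s" if "i < r" for i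
      using loc_ring_carrierE[OF assms[OF that]] by metis
    show "\<exists>a\<in>carrier R. c i = fr a (u \<otimes> s)"
      if "s \<in> S" "u \<in> S" "\<exists>a\<in>carrier R. c i = fr a s" for i s u
      using that by (metis S_carrier fr_scale m_closed)
  qed
  then obtain d where d: "d \<in> S" and *: "\<forall>i<r. \<exists>a\<in>carrier R. c i = fr a d" by auto
  from * obtain a where "\<forall>i<r. a i \<in> carrier R \<and> c i = fr (a i) d" by metis
  with d show ?thesis using that[of d a] by auto
qed

lemma is_basis_of_local_basis:
  assumes B: "local_basis R S M r w"
  shows "is_basis Q L r (\<lambda>i. fm (w i) \<one>)"
  unfolding is_basis_def
proof (intro conjI ballI)
  have w: "w \<in> {..<r} \<rightarrow> carrier M" using B by (simp add: local_basis_def)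
  then show "(\<lambda>i. fm (w i) \<one>) \<in> {..<r} \<rightarrow> carrier L" by (auto intro!: loc_module_carrierI)
  fix x assume "x \<in> carrier L"
  then obtain m s where m: "m \<in> carrier M" "s \<in> S" and x: "x = fm m s"
    by (rule loc_module_carrierE)
  obtain t c where tc: "t \<in> S" "c \<in> {..<r} \<rightarrow> carrier R"
    and tm: "t \<odot>\<^bsub>M\<^esub> m = (\<Oplus>\<^bsub>M\<^esub>i\<in>{..<r}. c i \<odot>\<^bsub>M\<^esub> w i)"
    using B m unfolding local_basis_def by meson
  show "\<exists>!c. c \<in> {..<r} \<rightarrow>\<^sub>E carrier Q \<and> x = (\<Oplus>\<^bsub>L\<^esub>i\<in>{..<r}. c i \<odot>\<^bsub>L\<^esub> fm (w i) \<one>)"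
  proof (rule ex_ex1I)
    let ?c = "\<lambda>i\<in>{..<r}. fr (c i) (t \<otimes> s)"
    have "(\<Oplus>\<^bsub>L\<^esub>i\<in>{..<r}. ?c i \<odot>\<^bsub>L\<^esub> fm (w i) \<one>) = (\<Oplus>\<^bsub>L\<^esub>i\<in>{..<r}. fr (c i) (t \<otimes> s) \<odot>\<^bsub>L\<^esub> fm (w i) \<one>)"
      using tc m w by (intro L.M.finsum_cong') (auto simp: Pi_iff intro!: L.smult_closed loc_module_carrierI)
    also have "\<dots> = fm (t \<odot>\<^bsub>M\<^esub> m) (t \<otimes> s)" using tc m w by (subst lin_comb_fm) (auto simp: tm)
    also have "\<dots> = x" using tc m by (simp add: x frac_scale[OF module_M])
    finally have "x = (\<Oplus>\<^bsub>L\<^esub>i\<in>{..<r}. ?c i \<odot>\<^bsub>L\<^esub> fm (w i) \<one>)" ..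
    moreover have "?c \<in> {..<r} \<rightarrow>\<^sub>E carrier Q" using tc m by (auto simp: Pi_iff)
    ultimately show "\<exists>c. c \<in> {..<r} \<rightarrow>\<^sub>E carrier Q \<and> x = (\<Oplus>\<^bsub>L\<^esub>i\<in>{..<r}. c i \<odot>\<^bsub>L\<^esub> fm (w i) \<one>)"
      by blast
  next
    fix c c'
    assume c: "c \<in> {..<r} \<rightarrow>\<^sub>E carrier Q \<and> x = (\<Oplus>\<^bsub>L\<^esub>i\<in>{..<r}. c i \<odot>\<^bsub>L\<^esub> fm (w i) \<one>)"
      and c': "c' \<in> {..<r} \<rightarrow>\<^sub>E carrier Q \<and> x = (\<Oplus>\<^bsub>L\<^esub>i\<in>{..<r}. c' i \<odot>\<^bsub>L\<^esub> fm (w i) \<one>)"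
    obtain d a where d: "d \<in> S" "a \<in> {..<r} \<rightarrow> carrier R" "\<And>i. i < r \<Longrightarrow> c i = fr (a i) d"
      using common_denominator[of r c] c by auto
    obtain d' a' where d': "d' \<in> S" "a' \<in> {..<r} \<rightarrow> carrier R" "\<And>i. i < r \<Longrightarrow> c' i = fr (a' i) d'"
      using common_denominator[of r c'] c' by auto
    have sum: "(\<Oplus>\<^bsub>L\<^esub>i\<in>{..<r}. c i \<odot>\<^bsub>L\<^esub> fm (w i) \<one>) = fm (\<Oplus>\<^bsub>M\<^esub>i\<in>{..<r}. a i \<odot>\<^bsub>M\<^esub> w i) d"
      if "d \<in> S" "a \<in> {..<r} \<rightarrow> carrier R" "\<And>i. i < r \<Longrightarrow> c i = fr (a i) d" for c d a
    proof -
      have "(\<Oplus>\<^bsub>L\<^esub>i\<in>{..<r}. c i \<odot>\<^bsub>L\<^esub> fm (w i) \<one>) = (\<Oplus>\<^bsub>L\<^esub>i\<in>{..<r}. fr (a i) d \<odot>\<^bsub>L\<^esub> fm (w i) \<one>)"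
        using that w by (intro L.M.finsum_cong') (auto intro!: L.smult_closed loc_module_carrierI simp: Pi_iff)
      then show ?thesis using that w by (simp add: lin_comb_fm)
    qed
    have aw: "(\<Oplus>\<^bsub>M\<^esub>i\<in>{..<r}. a i \<odot>\<^bsub>M\<^esub> w i) \<in> carrier M" "(\<Oplus>\<^bsub>M\<^esub>i\<in>{..<r}. a' i \<odot>\<^bsub>M\<^esub> w i) \<in> carrier M"
      using d d' w by (auto intro!: M.finsum_closed simp: Pi_iff)
    have "fm (\<Oplus>\<^bsub>M\<^esub>i\<in>{..<r}. a i \<odot>\<^bsub>M\<^esub> w i) d = fm (\<Oplus>\<^bsub>M\<^esub>i\<in>{..<r}. a' i \<odot>\<^bsub>M\<^esub> w i) d'"
      using c c' sum[OF d] sum[OF d'] by simp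
    then obtain u where u: "u \<in> S" and eq: "u \<odot>\<^bsub>M\<^esub> (d' \<odot>\<^bsub>M\<^esub> (\<Oplus>\<^bsub>M\<^esub>i\<in>{..<r}. a i \<odot>\<^bsub>M\<^esub> w i))
        = u \<odot>\<^bsub>M\<^esub> (d \<odot>\<^bsub>M\<^esub> (\<Oplus>\<^bsub>M\<^esub>i\<in>{..<r}. a' i \<odot>\<^bsub>M\<^esub> w i))"
      using frac_eqD[OF _ aw(2) d'(1)] by blast
    let ?g = "\<lambda>i. u \<otimes> d' \<otimes> a i \<oplus> (\<ominus> (u \<otimes> d)) \<otimes> a' i"
    have pull: "(\<Oplus>\<^bsub>M\<^esub>i\<in>{..<r}. (b \<otimes> a i) \<odot>\<^bsub>M\<^esub> w i) = b \<odot>\<^bsub>M\<^esub> (\<Oplus>\<^bsub>M\<^esub>i\<in>{..<r}. a i \<odot>\<^bsub>M\<^esub> w i)"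
      if "a \<in> {..<r} \<rightarrow> carrier R" "b \<in> carrier R" for a b
      using that w by (subst finsum_smult_ldistr) (auto intro!: M.finsum_cong' simp: smult_assoc1 Pi_iff)
    have "(\<Oplus>\<^bsub>M\<^esub>i\<in>{..<r}. ?g i \<odot>\<^bsub>M\<^esub> w i)
        = (\<Oplus>\<^bsub>M\<^esub>i\<in>{..<r}. (u \<otimes> d' \<otimes> a i) \<odot>\<^bsub>M\<^esub> w i \<oplus>\<^bsub>M\<^esub> ((\<ominus> (u \<otimes> d)) \<otimes> a' i) \<odot>\<^bsub>M\<^esub> w i)"
      using d d' w u by (intro M.finsum_cong') (auto simp: smult_l_distr Pi_iff)
    also have "\<dots> = (u \<otimes> d') \<odot>\<^bsub>M\<^esub> (\<Oplus>\<^bsub>M\<^esub>i\<in>{..<r}. a i \<odot>\<^bsub>M\<^esub> w i)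
        \<oplus>\<^bsub>M\<^esub> (\<ominus> (u \<otimes> d)) \<odot>\<^bsub>M\<^esub> (\<Oplus>\<^bsub>M\<^esub>i\<in>{..<r}. a' i \<odot>\<^bsub>M\<^esub> w i)"
      using d d' w u by (subst M.finsum_addf) (auto simp: pull Pi_iff)
    also have "\<dots> = \<zero>\<^bsub>M\<^esub>"
      using u d d' aw eq by (simp add: smult_l_minus smult_assoc1 M.r_neg)
    finally have "(\<Oplus>\<^bsub>M\<^esub>i\<in>{..<r}. ?g i \<odot>\<^bsub>M\<^esub> w i) = \<zero>\<^bsub>M\<^esub>" .
    moreover have "?g \<in> {..<r} \<rightarrow> carrier R" using d d' u by (auto simp: Pi_iff)
    ultimately obtain s where s: "s \<in> S" "\<forall>i<r. s \<otimes> ?g i = \<zero>"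
      using local_basis_indep[OF B, of ?g] by blast
    have "c i = c' i" if i: "i < r" for i
    proof -
      have ai: "a i \<in> carrier R" "a' i \<in> carrier R" using d d' i by auto
      have "s \<otimes> (u \<otimes> d' \<otimes> a i) \<oplus> \<ominus> (s \<otimes> (u \<otimes> d \<otimes> a' i)) = \<zero>"
        using s i ai u d d' by (auto simp: r_distr l_minus r_minus)
      then have "s \<otimes> (u \<otimes> d' \<otimes> a i) = s \<otimes> (u \<otimes> d \<otimes> a' i)"
        using s i ai u d d' by (subst r_right_minus_eq[symmetric]) (simp_all add: a_minus_def del: r_right_minus_eq)
      then have "fr (a i) d = fr (a' i) d'"
        using s i ai u d d' by (intro frac_eqI[OF module_reg_module, of _ _ _ _ "s \<otimes> u"]) (auto simp: m_assoc)
      then show ?thesis using d d' i by simp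
    qed
    then show "c = c'" using c c' by (intro PiE_ext[of c "{..<r}" _ c']) auto
  qed
qed

lemma local_basis_of_is_basis:
  assumes B: "is_basis Q L r e"
  shows "\<exists>w. local_basis R S M r w"
proof -
  have "\<exists>m s. m \<in> carrier M \<and> s \<in> S \<and> e i = fm m s" if "i < r" for i
  proof -
    have "e i \<in> carrier L" using B that by (auto simp: is_basis_def)
    then obtain m s where "m \<in> carrier M" "s \<in> S" "e i = fm m s" by (rule loc_module_carrierE)
    then show ?thesis by blast
  qed
  then obtain w d where wd: "\<And>i. i < r \<Longrightarrow> w i \<in> carrier M" "\<And>i. i < r \<Longrightarrow> d i \<in> S"
    "\<And>i. i < r \<Longrightarrow> e i = fm (w i) (d i)" by metis
  have "local_basis R S M r w"
    unfolding local_basis_def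
  proof (intro conjI ballI impI)
    show "w \<in> {..<r} \<rightarrow> carrier M" using wd by auto
    fix v assume v: "v \<in> carrier M"
    define c where "c i = coords Q L r e (fm v \<one>) i \<otimes>\<^bsub>Q\<^esub> fr \<one> (d i)" for i
    have co: "coords Q L r e (fm v \<one>) \<in> {..<r} \<rightarrow>\<^sub>E carrier Q"
      and co': "fm v \<one> = (\<Oplus>\<^bsub>L\<^esub>i\<in>{..<r}. coords Q L r e (fm v \<one>) i \<odot>\<^bsub>L\<^esub> e i)"
      using L.coords_in[OF B, of "fm v \<one>"] v by (auto intro: loc_module_carrierI)
    have "c i \<in> carrier Q" if "i < r" for i unfolding c_def using that wd co by (auto simp: PiE_iff)
    then obtain a t where a: "t \<in> S" "a \<in> {..<r} \<rightarrow> carrier R" "\<And>i. i < r \<Longrightarrow> c i = fr (a i) t"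
      using common_denominator[of r c] by auto
    have "fm v \<one> = (\<Oplus>\<^bsub>L\<^esub>i\<in>{..<r}. fr (a i) t \<odot>\<^bsub>L\<^esub> fm (w i) \<one>)"
    proof (subst co', intro L.M.finsum_cong' refl)
      fix i assume i: "i \<in> {..<r}"
      have "e i = fr \<one> (d i) \<odot>\<^bsub>L\<^esub> fm (w i) \<one>" using i wd by (simp add: loc_module_smult[OF module_M])
      then show "coords Q L r e (fm v \<one>) i \<odot>\<^bsub>L\<^esub> e i = fr (a i) t \<odot>\<^bsub>L\<^esub> fm (w i) \<one>"
        using i a wd co by (auto simp: c_def L.smult_assoc1 PiE_iff loc_module_carrierI simp flip: a(3))
    qed (use a wd in \<open>auto intro!: L.smult_closed loc_module_carrierI simp: Pi_iff\<close>)
    also have "\<dots> = fm (\<Oplus>\<^bsub>M\<^esub>i\<in>{..<r}. a i \<odot>\<^bsub>M\<^esub> w i) t"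
      using a wd by (intro lin_comb_fm) auto
    finally obtain u where u: "u \<in> S"
      "u \<odot>\<^bsub>M\<^esub> (t \<odot>\<^bsub>M\<^esub> v) = u \<odot>\<^bsub>M\<^esub> (\<one> \<odot>\<^bsub>M\<^esub> (\<Oplus>\<^bsub>M\<^esub>i\<in>{..<r}. a i \<odot>\<^bsub>M\<^esub> w i))"
      using frac_eqD[of M v \<one> "\<Oplus>\<^bsub>M\<^esub>i\<in>{..<r}. a i \<odot>\<^bsub>M\<^esub> w i" t] a wd
      by (auto simp: Pi_iff intro!: M.finsum_closed)
    have aw: "(\<Oplus>\<^bsub>M\<^esub>i\<in>{..<r}. a i \<odot>\<^bsub>M\<^esub> w i) \<in> carrier M"
      using a wd by (auto intro!: M.finsum_closed simp: Pi_iff)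
    have "(u \<otimes> t) \<odot>\<^bsub>M\<^esub> v = (\<Oplus>\<^bsub>M\<^esub>i\<in>{..<r}. (u \<otimes> a i) \<odot>\<^bsub>M\<^esub> w i)"
    proof -
      have "(u \<otimes> t) \<odot>\<^bsub>M\<^esub> v = u \<odot>\<^bsub>M\<^esub> (\<Oplus>\<^bsub>M\<^esub>i\<in>{..<r}. a i \<odot>\<^bsub>M\<^esub> w i)"
        using u a v aw by (simp add: smult_assoc1)
      also have "\<dots> = (\<Oplus>\<^bsub>M\<^esub>i\<in>{..<r}. u \<odot>\<^bsub>M\<^esub> (a i \<odot>\<^bsub>M\<^esub> w i))"
        using u a wd by (subst finsum_smult_ldistr) (auto simp: Pi_iff)
      also have "\<dots> = (\<Oplus>\<^bsub>M\<^esub>i\<in>{..<r}. (u \<otimes> a i) \<odot>\<^bsub>M\<^esub> w i)"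
        using u a wd by (intro M.finsum_cong') (auto simp: smult_assoc1 Pi_iff)
      finally show ?thesis .
    qed
    then show "\<exists>s\<in>S. \<exists>c\<in>{..<r} \<rightarrow> carrier R. s \<odot>\<^bsub>M\<^esub> v = (\<Oplus>\<^bsub>M\<^esub>i\<in>{..<r}. c i \<odot>\<^bsub>M\<^esub> w i)"
      using u a by (intro bexI[of _ "u \<otimes> t"] bexI[of _ "\<lambda>i. u \<otimes> a i"]) (auto simp: Pi_iff)
  next
    fix c assume c: "c \<in> {..<r} \<rightarrow> carrier R" and cw: "(\<Oplus>\<^bsub>M\<^esub>i\<in>{..<r}. c i \<odot>\<^bsub>M\<^esub> w i) = \<zero>\<^bsub>M\<^esub>"
    have eL: "e i \<in> carrier L" if "i < r" for i using wd that by (auto intro: loc_module_carrierI)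
    have "(\<Oplus>\<^bsub>L\<^esub>i\<in>{..<r}. fr (c i \<otimes> d i) \<one> \<odot>\<^bsub>L\<^esub> e i) = (\<Oplus>\<^bsub>L\<^esub>i\<in>{..<r}. fm (c i \<odot>\<^bsub>M\<^esub> w i) \<one>)"
    proof (intro L.M.finsum_cong' refl)
      fix i assume i: "i \<in> {..<r}"
      then have ci: "c i \<in> carrier R" "w i \<in> carrier M" "d i \<in> S" using c wd by auto
      have "fr (c i \<otimes> d i) \<one> \<odot>\<^bsub>L\<^esub> e i = fm ((c i \<otimes> d i) \<odot>\<^bsub>M\<^esub> w i) (\<one> \<otimes> d i)"
        using ci wd i by (simp add: loc_module_smult[OF module_M])
      also have "\<dots> = fm (c i \<odot>\<^bsub>M\<^esub> w i) \<one>"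
        using ci frac_scale[OF module_M, of "c i \<odot>\<^bsub>M\<^esub> w i" \<one> "d i"]
        by (simp add: m_comm smult_assoc1[symmetric])
      finally show "fr (c i \<otimes> d i) \<one> \<odot>\<^bsub>L\<^esub> e i = fm (c i \<odot>\<^bsub>M\<^esub> w i) \<one>" .
    qed (use c wd in \<open>auto intro!: loc_module_carrierI simp: Pi_iff\<close>)
    also have "\<dots> = \<zero>\<^bsub>L\<^esub>"
      using c wd by (subst finsum_fm) (auto simp: cw fm_zero Pi_iff)
    finally have z1: "\<zero>\<^bsub>L\<^esub> = (\<Oplus>\<^bsub>L\<^esub>i\<in>{..<r}. fr (c i \<otimes> d i) \<one> \<odot>\<^bsub>L\<^esub> e i)" ..
    have "(\<Oplus>\<^bsub>L\<^esub>i\<in>{..<r}. \<zero>\<^bsub>Q\<^esub> \<odot>\<^bsub>L\<^esub> e i) = (\<Oplus>\<^bsub>L\<^esub>i\<in>{..<r}. \<zero>\<^bsub>L\<^esub>)"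
      using eL by (intro L.M.finsum_cong') auto
    then have z2: "\<zero>\<^bsub>L\<^esub> = (\<Oplus>\<^bsub>L\<^esub>i\<in>{..<r}. \<zero>\<^bsub>Q\<^esub> \<odot>\<^bsub>L\<^esub> e i)" by simp
    have z: "fr (c i \<otimes> d i) \<one> = \<zero>\<^bsub>Q\<^esub>" if i: "i < r" for i
      using L.coords_eqI[OF B _ z1 i] L.coords_eqI[OF B _ z2 i] c wd by (auto simp: Pi_iff)
    show "\<exists>s\<in>S. \<forall>i<r. s \<otimes> c i = \<zero>"
    proof (rule common_multiple)
      show "mult_set R S" by unfold_locales
      fix i assume i: "i < r"
      then have ci: "c i \<in> carrier R" "d i \<in> S" using c wd by auto
      obtain u where "u \<in> S" "u \<otimes> (c i \<otimes> d i) = \<zero>"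
        using z[OF i] ci frac_eqD[of "reg_module R" "c i \<otimes> d i" \<one> \<zero> \<one>]
        by (auto simp: loc_ring_zero)
      then show "\<exists>s\<in>S. s \<otimes> c i = \<zero>"
        using ci by (intro bexI[of _ "u \<otimes> d i"]) (auto simp: m_ac)
      fix s u assume "s \<in> S" "u \<in> S" "s \<otimes> c i = \<zero>"
      then show "u \<otimes> s \<otimes> c i = \<zero>" using ci by (simp add: m_assoc)
    qed
  qed
  then show ?thesis by blast
qed

end

section \<open>Derivations, connections and local traces\<close>

definition is_derivation :: "('a, 'z) ring_scheme \<Rightarrow> ('a \<Rightarrow> 'a) \<Rightarrow> bool" where
  "is_derivation R D \<longleftrightarrow> D \<in> carrier R \<rightarrow> carrier R \<and>
     (\<forall>a\<in>carrier R. \<forall>b\<in>carrier R. D (a \<oplus>\<^bsub>R\<^esub> b) = D a \<oplus>\<^bsub>R\<^esub> D b) \<and>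
     (\<forall>a\<in>carrier R. \<forall>b\<in>carrier R. D (a \<otimes>\<^bsub>R\<^esub> b) = D a \<otimes>\<^bsub>R\<^esub> b \<oplus>\<^bsub>R\<^esub> a \<otimes>\<^bsub>R\<^esub> D b)"

lemma is_derivationD:
  assumes "is_derivation R D"
  shows "a \<in> carrier R \<Longrightarrow> D a \<in> carrier R"
    and "\<lbrakk>a \<in> carrier R; b \<in> carrier R\<rbrakk> \<Longrightarrow> D (a \<oplus>\<^bsub>R\<^esub> b) = D a \<oplus>\<^bsub>R\<^esub> D b"
    and "\<lbrakk>a \<in> carrier R; b \<in> carrier R\<rbrakk> \<Longrightarrow> D (a \<otimes>\<^bsub>R\<^esub> b) = D a \<otimes>\<^bsub>R\<^esub> b \<oplus>\<^bsub>R\<^esub> a \<otimes>\<^bsub>R\<^esub> D b"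
  using assms by (auto simp: is_derivation_def)

definition connection_along ::
    "('a, 'z) ring_scheme \<Rightarrow> ('a, 'm) module \<Rightarrow> ('a \<Rightarrow> 'a) \<Rightarrow> ('m \<Rightarrow> 'm) \<Rightarrow> bool" where
  "connection_along R M D N \<longleftrightarrow> N \<in> carrier M \<rightarrow> carrier M \<and>
     (\<forall>v\<in>carrier M. \<forall>w\<in>carrier M. N (v \<oplus>\<^bsub>M\<^esub> w) = N v \<oplus>\<^bsub>M\<^esub> N w) \<and>
     (\<forall>a\<in>carrier R. \<forall>v\<in>carrier M. N (a \<odot>\<^bsub>M\<^esub> v) = a \<odot>\<^bsub>M\<^esub> N v \<oplus>\<^bsub>M\<^esub> D a \<odot>\<^bsub>M\<^esub> v)"

lemma connection_alongD:
  assumes "connection_along R M D N"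
  shows "v \<in> carrier M \<Longrightarrow> N v \<in> carrier M"
    and "\<lbrakk>v \<in> carrier M; w \<in> carrier M\<rbrakk> \<Longrightarrow> N (v \<oplus>\<^bsub>M\<^esub> w) = N v \<oplus>\<^bsub>M\<^esub> N w"
    and "\<lbrakk>a \<in> carrier R; v \<in> carrier M\<rbrakk> \<Longrightarrow> N (a \<odot>\<^bsub>M\<^esub> v) = a \<odot>\<^bsub>M\<^esub> N v \<oplus>\<^bsub>M\<^esub> D a \<odot>\<^bsub>M\<^esub> v"
  using assms by (auto simp: connection_along_def)

lemma (in cring) zero_derivation: "is_derivation R (\<lambda>_. \<zero>)"
  by (simp add: is_derivation_def)

lemma (in plain_module) connection_along_zero:
  "connection_along R M (\<lambda>_. \<zero>\<^bsub>R\<^esub>) T \<longleftrightarrow> module_endo R M T"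
  unfolding connection_along_def module_endo_def by (auto simp: Pi_iff)

lemma (in abelian_group) minus_cancel_left:
  "\<lbrakk>x \<in> carrier G; y \<in> carrier G; z \<in> carrier G\<rbrakk> \<Longrightarrow> (x \<oplus> y) \<ominus> (x \<oplus> z) = y \<ominus> z"
proof -
  assume c: "x \<in> carrier G" "y \<in> carrier G" "z \<in> carrier G"
  then have "x \<oplus> y \<oplus> \<ominus> x = y" by (simp add: a_comm[of x y] a_assoc r_neg)
  then show ?thesis using c by (simp add: minus_eq minus_add flip: a_assoc)
qed

context mult_set
begin

text \<open>The derivation \<open>D\<close> of \<open>R\<close> extended to the localization by the quotient rule.\<close>

definition loc_der :: "('a \<Rightarrow> 'a) \<Rightarrow> ('a \<times> 'a) set \<Rightarrow> ('a \<times> 'a) set" where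
  "loc_der D x = (\<Union>(a, t)\<in>x. fr (t \<otimes> D a \<ominus> a \<otimes> D t) (t \<otimes> t))"

lemma loc_der_scale:
  assumes D: "is_derivation R D" and c: "u \<in> S" "a \<in> carrier R" "t \<in> S"
  shows "fr ((u \<otimes> t) \<otimes> D (u \<otimes> a) \<ominus> (u \<otimes> a) \<otimes> D (u \<otimes> t)) ((u \<otimes> t) \<otimes> (u \<otimes> t))
    = fr (t \<otimes> D a \<ominus> a \<otimes> D t) (t \<otimes> t)"
proof -
  note [simp] = is_derivationD(1)[OF D]
  have 1: "(u \<otimes> t) \<otimes> D (u \<otimes> a) = (u \<otimes> t \<otimes> a) \<otimes> D u \<oplus> u \<otimes> u \<otimes> (t \<otimes> D a)"
    "(u \<otimes> a) \<otimes> D (u \<otimes> t) = (u \<otimes> t \<otimes> a) \<otimes> D u \<oplus> u \<otimes> u \<otimes> (a \<otimes> D t)"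
    using c by (simp_all add: is_derivationD(3)[OF D] r_distr m_ac a_ac)
  have "(u \<otimes> t) \<otimes> D (u \<otimes> a) \<ominus> (u \<otimes> a) \<otimes> D (u \<otimes> t) = u \<otimes> u \<otimes> (t \<otimes> D a \<ominus> a \<otimes> D t)"
    unfolding 1 using c by (subst minus_cancel_left) (auto simp: minus_eq r_distr r_minus)
  moreover have "(u \<otimes> t) \<otimes> (u \<otimes> t) = u \<otimes> u \<otimes> (t \<otimes> t)" using c by (simp add: m_ac)
  ultimately show ?thesis
    using frac_scale[OF module_reg_module, of "t \<otimes> D a \<ominus> a \<otimes> D t" "t \<otimes> t" "u \<otimes> u"] c by simp
qed

lemma loc_der_fr:
  assumes D: "is_derivation R D" and c: "a \<in> carrier R" "t \<in> S"
  shows "loc_der D (fr a t) = fr (t \<otimes> D a \<ominus> a \<otimes> D t) (t \<otimes> t)"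
  unfolding loc_der_def
  by (rule frac_UN[OF module_reg_module]) (use c in \<open>simp_all add: loc_der_scale[OF D]\<close>)

lemma loc_der_closed:
  assumes D: "is_derivation R D" and "x \<in> carrier Q" shows "loc_der D x \<in> carrier Q"
proof -
  obtain a t where "a \<in> carrier R" "t \<in> S" "x = fr a t" using assms(2) by (rule loc_ring_carrierE)
  then show ?thesis using is_derivationD(1)[OF D] by (simp add: loc_der_fr[OF D])
qed

lemma loc_der_add:
  assumes D: "is_derivation R D" and "x \<in> carrier Q" "y \<in> carrier Q"
  shows "loc_der D (x \<oplus>\<^bsub>Q\<^esub> y) = loc_der D x \<oplus>\<^bsub>Q\<^esub> loc_der D y"
proof -
  note [simp] = is_derivationD(1)[OF D]
  obtain a s b t where c: "a \<in> carrier R" "s \<in> S" "x = fr a s" "b \<in> carrier R" "t \<in> S" "y = fr b t"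
    using assms by (metis loc_ring_carrierE)
  define a' b' d where "a' = t \<otimes> a" and "b' = s \<otimes> b" and "d = s \<otimes> t"
  have c': "a' \<in> carrier R" "b' \<in> carrier R" "d \<in> S" using c by (auto simp: a'_def b'_def d_def)
  have x: "x = fr a' d" and y: "y = fr b' d"
    using c frac_scale[OF module_reg_module, of a s t] frac_scale[OF module_reg_module, of b t s]
    by (auto simp: a'_def b'_def d_def m_ac)
  have same: "fr p e \<oplus>\<^bsub>Q\<^esub> fr q e = fr (p \<oplus> q) e" if "p \<in> carrier R" "q \<in> carrier R" "e \<in> S" for p q e
    using that frac_scale[OF module_reg_module, of "p \<oplus> q" e e] by (simp add: loc_ring_add r_distr)
  show ?thesis unfolding x y using c'
    by (simp add: same loc_der_fr[OF D] is_derivationD(2)[OF D] minus_eq r_distr l_distr minus_add a_ac)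
qed

lemma loc_der_mult:
  assumes D: "is_derivation R D" and "x \<in> carrier Q" "y \<in> carrier Q"
  shows "loc_der D (x \<otimes>\<^bsub>Q\<^esub> y) = loc_der D x \<otimes>\<^bsub>Q\<^esub> y \<oplus>\<^bsub>Q\<^esub> x \<otimes>\<^bsub>Q\<^esub> loc_der D y"
proof -
  note [simp] = is_derivationD(1)[OF D]
  obtain a t b u where c: "a \<in> carrier R" "t \<in> S" "x = fr a t" "b \<in> carrier R" "u \<in> S" "y = fr b u"
    using assms by (metis loc_ring_carrierE)
  let ?n = "(t \<otimes> u) \<otimes> D (a \<otimes> b) \<ominus> (a \<otimes> b) \<otimes> D (t \<otimes> u)"
  have "fr ((t \<otimes> u) \<otimes> ?n) ((t \<otimes> u) \<otimes> ((t \<otimes> u) \<otimes> (t \<otimes> u))) = fr ?n ((t \<otimes> u) \<otimes> (t \<otimes> u))"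
    using frac_scale[OF module_reg_module, of ?n "(t \<otimes> u) \<otimes> (t \<otimes> u)" "t \<otimes> u"] c by simp
  moreover have "(t \<otimes> u) \<otimes> ?n = (t \<otimes> (u \<otimes> u)) \<otimes> ((t \<otimes> D a \<ominus> a \<otimes> D t) \<otimes> b)
      \<oplus> (t \<otimes> t \<otimes> u) \<otimes> (a \<otimes> (u \<otimes> D b \<ominus> b \<otimes> D u))"
    using c by (simp add: is_derivationD(3)[OF D] minus_eq r_distr l_distr minus_add r_minus l_minus a_ac m_ac)
  ultimately show ?thesis using c
    by (simp add: loc_der_fr[OF D] loc_ring_mult loc_ring_add m_ac)
qed

end

text \<open>\<open>s T\<close> has the matrix \<open>a\<close> in the local basis and \<open>c\<close> is its trace, so that \<open>c/s\<close> is the trace of the localized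
  map. \<open>T\<close> need not be linear: connections are handled in the same way.\<close>

definition local_trace ::
    "('a, 'z) ring_scheme \<Rightarrow> 'a set \<Rightarrow> ('a, 'm) module \<Rightarrow> nat \<Rightarrow> (nat \<Rightarrow> 'm) \<Rightarrow> ('m \<Rightarrow> 'm)
      \<Rightarrow> 'a \<Rightarrow> 'a \<Rightarrow> bool" where
  "local_trace R S M r w T c s \<longleftrightarrow> s \<in> S \<and> (\<exists>a. (\<forall>i<r. \<forall>j<r. a j i \<in> carrier R) \<and>
     (\<forall>i<r. s \<odot>\<^bsub>M\<^esub> T (w i) = (\<Oplus>\<^bsub>M\<^esub>j\<in>{..<r}. a j i \<odot>\<^bsub>M\<^esub> w j)) \<and> c = (\<Oplus>\<^bsub>R\<^esub>i\<in>{..<r}. a i i))"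

lemma local_traceE:
  assumes "local_trace R S M r w T c s"
  obtains a where "s \<in> S" "\<And>i j. \<lbrakk>i < r; j < r\<rbrakk> \<Longrightarrow> a j i \<in> carrier R"
    "\<And>i. i < r \<Longrightarrow> s \<odot>\<^bsub>M\<^esub> T (w i) = (\<Oplus>\<^bsub>M\<^esub>j\<in>{..<r}. a j i \<odot>\<^bsub>M\<^esub> w j)"
    "c = (\<Oplus>\<^bsub>R\<^esub>i\<in>{..<r}. a i i)"
  using assms by (auto simp: local_trace_def)

lemma (in cring) finsum_lin2:
  assumes "a \<in> I \<rightarrow> carrier R" "b \<in> I \<rightarrow> carrier R" "x \<in> carrier R" "y \<in> carrier R" "finite I"
  shows "(\<Oplus>i\<in>I. x \<otimes> a i \<oplus> y \<otimes> b i) = x \<otimes> (\<Oplus>i\<in>I. a i) \<oplus> y \<otimes> (\<Oplus>i\<in>I. b i)"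
  using assms by (simp add: finsum_addf finsum_rdistr Pi_iff)

lemma (in plain_module) lin_comb2:
  assumes "a \<in> I \<rightarrow> carrier R" "b \<in> I \<rightarrow> carrier R" "w \<in> I \<rightarrow> carrier M" "x \<in> carrier R"
    "y \<in> carrier R" "finite I"
  shows "(\<Oplus>\<^bsub>M\<^esub>i\<in>I. (x \<otimes> a i \<oplus> y \<otimes> b i) \<odot>\<^bsub>M\<^esub> w i)
    = x \<odot>\<^bsub>M\<^esub> (\<Oplus>\<^bsub>M\<^esub>i\<in>I. a i \<odot>\<^bsub>M\<^esub> w i) \<oplus>\<^bsub>M\<^esub> y \<odot>\<^bsub>M\<^esub> (\<Oplus>\<^bsub>M\<^esub>i\<in>I. b i \<odot>\<^bsub>M\<^esub> w i)"
proof -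
  have "(\<Oplus>\<^bsub>M\<^esub>i\<in>I. (x \<otimes> a i \<oplus> y \<otimes> b i) \<odot>\<^bsub>M\<^esub> w i)
      = (\<Oplus>\<^bsub>M\<^esub>i\<in>I. x \<odot>\<^bsub>M\<^esub> (a i \<odot>\<^bsub>M\<^esub> w i) \<oplus>\<^bsub>M\<^esub> y \<odot>\<^bsub>M\<^esub> (b i \<odot>\<^bsub>M\<^esub> w i))"
    using assms by (intro M.finsum_cong') (auto simp: Pi_iff smult_l_distr smult_assoc1)
  also have "\<dots> = (\<Oplus>\<^bsub>M\<^esub>i\<in>I. x \<odot>\<^bsub>M\<^esub> (a i \<odot>\<^bsub>M\<^esub> w i)) \<oplus>\<^bsub>M\<^esub> (\<Oplus>\<^bsub>M\<^esub>i\<in>I. y \<odot>\<^bsub>M\<^esub> (b i \<odot>\<^bsub>M\<^esub> w i))"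
    using assms by (intro M.finsum_addf) (auto simp: Pi_iff)
  also have "\<dots> = x \<odot>\<^bsub>M\<^esub> (\<Oplus>\<^bsub>M\<^esub>i\<in>I. a i \<odot>\<^bsub>M\<^esub> w i) \<oplus>\<^bsub>M\<^esub> y \<odot>\<^bsub>M\<^esub> (\<Oplus>\<^bsub>M\<^esub>i\<in>I. b i \<odot>\<^bsub>M\<^esub> w i)"
    using assms by (subst (1 2) finsum_smult_ldistr) (auto simp: Pi_iff)
  finally show ?thesis .
qed

lemma (in plain_module) lin_comb_lin_comb':
  fixes b :: "nat \<Rightarrow> nat \<Rightarrow> 'a"
  assumes "\<And>i. i < r \<Longrightarrow> a i \<in> carrier R"
    and "\<And>i j. \<lbrakk>i < r; j < q\<rbrakk> \<Longrightarrow> b j i \<in> carrier R"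
    and "\<And>j. j < q \<Longrightarrow> e j \<in> carrier M"
    and "\<And>i. i < r \<Longrightarrow> f i = (\<Oplus>\<^bsub>M\<^esub>j\<in>{..<q}. b j i \<odot>\<^bsub>M\<^esub> e j)"
  shows "(\<Oplus>\<^bsub>M\<^esub>i\<in>{..<r}. a i \<odot>\<^bsub>M\<^esub> f i)
    = (\<Oplus>\<^bsub>M\<^esub>j\<in>{..<q}. (\<Oplus>i\<in>{..<r}. b j i \<otimes> a i) \<odot>\<^bsub>M\<^esub> e j)"
  using assms
  by (subst lin_comb_lin_comb[symmetric])
    (auto intro!: M.finsum_cong' smult_closed M.finsum_closed)

definition (in loc_data) loc_trace :: "('m \<Rightarrow> 'm) \<Rightarrow> ('a \<times> 'a) set" where
  "loc_trace T = trace Q L (\<lambda>x\<in>carrier L. \<Union>(v, u)\<in>x. fm (T v) u)"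

lemma (in loc_data) loc_trace_cong:
  assumes "\<And>v. v \<in> carrier M \<Longrightarrow> T v = T' v"
  shows "loc_trace T = loc_trace T'"
proof -
  have "(\<Union>(v, u)\<in>x. fm (T v) u) = (\<Union>(v, u)\<in>x. fm (T' v) u)" if x: "x \<in> carrier L" for x
  proof -
    obtain m s where "m \<in> carrier M" "s \<in> S" "x = fm m s" using x by (rule loc_module_carrierE)
    then have "\<And>v u. (v, u) \<in> x \<Longrightarrow> v \<in> carrier M" by (auto simp: frac_def)
    then show ?thesis using assms by (intro SUP_cong) auto
  qed
  then have "(\<lambda>x\<in>carrier L. \<Union>(v, u)\<in>x. fm (T v) u) = (\<lambda>x\<in>carrier L. \<Union>(v, u)\<in>x. fm (T' v) u)"
    by (intro restrict_ext) auto
  then show ?thesis by (simp add: loc_trace_def)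
qed

locale loc_free = loc_data R S M
  for R :: "('a, 'z) ring_scheme" (structure) and S and M :: "('a, 'm) module" +
  fixes r :: nat and w :: "nat \<Rightarrow> 'm"
  assumes basis: "local_basis R S M r w"
begin

lemma w_in: "w \<in> {..<r} \<rightarrow> carrier M"
  using basis by (simp add: local_basis_def)

lemma w_closed [simp]: "i < r \<Longrightarrow> w i \<in> carrier M"
  using w_in by auto

abbreviation "lt \<equiv> local_trace R S M r w"

lemma lt_closed: "lt T c s \<Longrightarrow> s \<in> S \<and> c \<in> carrier R"
  by (elim local_traceE) (auto intro!: R.finsum_closed)

text \<open>The matrices for the finitely many basis vectors have a common denominator.\<close>

lemma lt_exists:
  assumes T: "T \<in> carrier M \<rightarrow> carrier M"
  shows "\<exists>c s. lt T c s"
proof -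
  have "\<exists>s\<in>S. \<forall>i<r. \<exists>c\<in>{..<r} \<rightarrow> carrier R. s \<odot>\<^bsub>M\<^esub> T (w i) = (\<Oplus>\<^bsub>M\<^esub>j\<in>{..<r}. c j \<odot>\<^bsub>M\<^esub> w j)"
  proof (rule common_multiple)
    show "mult_set R S" by unfold_locales
    fix i assume i: "i < r"
    then have Tw: "T (w i) \<in> carrier M" using T by auto
    then show "\<exists>s\<in>S. \<exists>c\<in>{..<r} \<rightarrow> carrier R. s \<odot>\<^bsub>M\<^esub> T (w i) = (\<Oplus>\<^bsub>M\<^esub>j\<in>{..<r}. c j \<odot>\<^bsub>M\<^esub> w j)"
      using basis by (auto simp: local_basis_def)
    fix s u assume su: "s \<in> S" "u \<in> S"
      and "\<exists>c\<in>{..<r} \<rightarrow> carrier R. s \<odot>\<^bsub>M\<^esub> T (w i) = (\<Oplus>\<^bsub>M\<^esub>j\<in>{..<r}. c j \<odot>\<^bsub>M\<^esub> w j)"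
    then obtain c where c: "c \<in> {..<r} \<rightarrow> carrier R"
      "s \<odot>\<^bsub>M\<^esub> T (w i) = (\<Oplus>\<^bsub>M\<^esub>j\<in>{..<r}. c j \<odot>\<^bsub>M\<^esub> w j)" by blast
    have "(u \<otimes> s) \<odot>\<^bsub>M\<^esub> T (w i) = (\<Oplus>\<^bsub>M\<^esub>j\<in>{..<r}. (u \<otimes> c j \<oplus> \<zero> \<otimes> c j) \<odot>\<^bsub>M\<^esub> w j)"
      using su c w_in Tw M.finsum_closed[of "\<lambda>j. c j \<odot>\<^bsub>M\<^esub> w j" "{..<r}"]
      by (subst lin_comb2) (auto simp: smult_assoc1 Pi_iff)
    then show "\<exists>c\<in>{..<r} \<rightarrow> carrier R. (u \<otimes> s) \<odot>\<^bsub>M\<^esub> T (w i) = (\<Oplus>\<^bsub>M\<^esub>j\<in>{..<r}. c j \<odot>\<^bsub>M\<^esub> w j)"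
      using su c by (intro bexI[of _ "\<lambda>j. u \<otimes> c j \<oplus> \<zero> \<otimes> c j"]) (auto simp: Pi_iff)
  qed
  then obtain s where s: "s \<in> S"
    and *: "\<forall>i<r. \<exists>c\<in>{..<r} \<rightarrow> carrier R. s \<odot>\<^bsub>M\<^esub> T (w i) = (\<Oplus>\<^bsub>M\<^esub>j\<in>{..<r}. c j \<odot>\<^bsub>M\<^esub> w j)" by blast
  from * have "\<forall>i. \<exists>c. i < r \<longrightarrow> c \<in> {..<r} \<rightarrow> carrier R \<and> s \<odot>\<^bsub>M\<^esub> T (w i) = (\<Oplus>\<^bsub>M\<^esub>j\<in>{..<r}. c j \<odot>\<^bsub>M\<^esub> w j)"
    by blast
  then obtain a where a: "\<And>i. i < r \<Longrightarrow> a i \<in> {..<r} \<rightarrow> carrier R"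
    "\<And>i. i < r \<Longrightarrow> s \<odot>\<^bsub>M\<^esub> T (w i) = (\<Oplus>\<^bsub>M\<^esub>j\<in>{..<r}. a i j \<odot>\<^bsub>M\<^esub> w j)" by metis
  then have "lt T (\<Oplus>i\<in>{..<r}. a i i) s"
    unfolding local_trace_def using s by (intro conjI exI[of _ "\<lambda>j i. a i j"]) auto
  then show ?thesis by blast
qed

text \<open>Two local traces are combined over the product of their denominators.\<close>

lemma lt_lin:
  assumes T1: "lt T1 c1 s1" "T1 \<in> carrier M \<rightarrow> carrier M"
    and T2: "lt T2 c2 s2" "T2 \<in> carrier M \<rightarrow> carrier M"
    and x: "x \<in> carrier R" "y \<in> carrier R"
  shows "lt (\<lambda>v. x \<odot>\<^bsub>M\<^esub> T1 v \<oplus>\<^bsub>M\<^esub> y \<odot>\<^bsub>M\<^esub> T2 v) ((s2 \<otimes> x) \<otimes> c1 \<oplus> (s1 \<otimes> y) \<otimes> c2) (s1 \<otimes> s2)"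
proof -
  obtain a where a: "s1 \<in> S" "\<And>i j. \<lbrakk>i < r; j < r\<rbrakk> \<Longrightarrow> a j i \<in> carrier R"
    "\<And>i. i < r \<Longrightarrow> s1 \<odot>\<^bsub>M\<^esub> T1 (w i) = (\<Oplus>\<^bsub>M\<^esub>j\<in>{..<r}. a j i \<odot>\<^bsub>M\<^esub> w j)"
    "c1 = (\<Oplus>i\<in>{..<r}. a i i)" using T1(1) by (rule local_traceE) blast
  obtain b where b: "s2 \<in> S" "\<And>i j. \<lbrakk>i < r; j < r\<rbrakk> \<Longrightarrow> b j i \<in> carrier R"
    "\<And>i. i < r \<Longrightarrow> s2 \<odot>\<^bsub>M\<^esub> T2 (w i) = (\<Oplus>\<^bsub>M\<^esub>j\<in>{..<r}. b j i \<odot>\<^bsub>M\<^esub> w j)"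
    "c2 = (\<Oplus>i\<in>{..<r}. b i i)" using T2(1) by (rule local_traceE) blast
  let ?e = "\<lambda>j i. (s2 \<otimes> x) \<otimes> a j i \<oplus> (s1 \<otimes> y) \<otimes> b j i"
  show ?thesis unfolding local_trace_def
  proof (intro conjI exI[of _ ?e] allI impI)
    show "s1 \<otimes> s2 \<in> S" using a b by simp
    show "?e j i \<in> carrier R" if "i < r" "j < r" for i j using a b x that by simp
    show "(s2 \<otimes> x) \<otimes> c1 \<oplus> (s1 \<otimes> y) \<otimes> c2 = (\<Oplus>i\<in>{..<r}. ?e i i)"
      unfolding a(4) b(4) using a(1,2) b(1,2) x by (subst finsum_lin2) auto
    fix i assume i: "i < r"
    have Tw: "T1 (w i) \<in> carrier M" "T2 (w i) \<in> carrier M" using T1 T2 i by auto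
    have "(s1 \<otimes> s2) \<odot>\<^bsub>M\<^esub> (x \<odot>\<^bsub>M\<^esub> T1 (w i) \<oplus>\<^bsub>M\<^esub> y \<odot>\<^bsub>M\<^esub> T2 (w i))
        = (s2 \<otimes> x) \<odot>\<^bsub>M\<^esub> (s1 \<odot>\<^bsub>M\<^esub> T1 (w i)) \<oplus>\<^bsub>M\<^esub> (s1 \<otimes> y) \<odot>\<^bsub>M\<^esub> (s2 \<odot>\<^bsub>M\<^esub> T2 (w i))"
      using Tw a(1) b(1) x by (simp add: smult_r_distr smult_assoc1 smult_left_commute)
    also have "\<dots> = (\<Oplus>\<^bsub>M\<^esub>j\<in>{..<r}. ?e j i \<odot>\<^bsub>M\<^esub> w j)"
      unfolding a(3)[OF i] b(3)[OF i] using a(1,2) b(1,2) x i w_in by (subst lin_comb2) auto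
    finally show "(s1 \<otimes> s2) \<odot>\<^bsub>M\<^esub> (x \<odot>\<^bsub>M\<^esub> T1 (w i) \<oplus>\<^bsub>M\<^esub> y \<odot>\<^bsub>M\<^esub> T2 (w i))
        = (\<Oplus>\<^bsub>M\<^esub>j\<in>{..<r}. ?e j i \<odot>\<^bsub>M\<^esub> w j)" .
  qed
qed

text \<open>If \<open>s T = a\<close> and \<open>t N = g\<close> in the local basis, then \<open>[N, T]\<close> has, up to the denominator
  \<open>t s\<^sup>2\<close>, the matrix \<open>t (s D(a) - D(s) a) + s (g a - a g)\<close>: the entrywise quotient rule plus a
  commutator of matrices, which has trace zero.\<close>

lemma lt_commutator:
  assumes D: "is_derivation R D" and N: "connection_along R M D N"
    and T: "module_endo R M T" and lt: "lt T c s"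
  shows "\<exists>t\<in>S. lt (\<lambda>v. N (T v) \<ominus>\<^bsub>M\<^esub> T (N v)) (t \<otimes> (s \<otimes> D c \<ominus> c \<otimes> D s)) (t \<otimes> (s \<otimes> s))"
proof -
  note [simp] = is_derivationD(1)[OF D] connection_alongD(1)[OF N] module_endoD(1)[OF T]
  obtain a where a: "s \<in> S" "\<And>i j. \<lbrakk>i < r; j < r\<rbrakk> \<Longrightarrow> a j i \<in> carrier R"
    "\<And>i. i < r \<Longrightarrow> s \<odot>\<^bsub>M\<^esub> T (w i) = (\<Oplus>\<^bsub>M\<^esub>j\<in>{..<r}. a j i \<odot>\<^bsub>M\<^esub> w j)"
    "c = (\<Oplus>i\<in>{..<r}. a i i)" using lt by (rule local_traceE) blast
  obtain d t where "lt N d t" using lt_exists[of N] by auto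
  then obtain g where g: "t \<in> S" "\<And>i j. \<lbrakk>i < r; j < r\<rbrakk> \<Longrightarrow> g j i \<in> carrier R"
    "\<And>i. i < r \<Longrightarrow> t \<odot>\<^bsub>M\<^esub> N (w i) = (\<Oplus>\<^bsub>M\<^esub>j\<in>{..<r}. g j i \<odot>\<^bsub>M\<^esub> w j)"
    by (rule local_traceE) blast
  note [simp] = a(1,2) g(1,2)
  define ga where "ga l i = (\<Oplus>j\<in>{..<r}. g l j \<otimes> a j i)" for l i
  define ag where "ag l i = (\<Oplus>j\<in>{..<r}. a l j \<otimes> g j i)" for l i
  have [simp]: "ga l i \<in> carrier R" "ag l i \<in> carrier R" if "l < r" "i < r" for l i
    using that by (auto simp: ga_def ag_def intro!: R.finsum_closed)
  define e where "e l i = \<one> \<otimes> (s \<otimes> ga l i \<oplus> (\<ominus> s) \<otimes> ag l i)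
      \<oplus> \<one> \<otimes> ((t \<otimes> s) \<otimes> D (a l i) \<oplus> (\<ominus> (t \<otimes> D s)) \<otimes> a l i)" for l i
  have e [simp]: "e l i \<in> carrier R" if "l < r" "i < r" for l i
    using that by (simp add: e_def)
  have "c \<in> carrier R" using a by (auto intro!: R.finsum_closed)
  have gaM [simp]: "(\<Oplus>\<^bsub>M\<^esub>j\<in>{..<r}. f j i \<odot>\<^bsub>M\<^esub> w j) \<in> carrier M"
    if "\<And>j. j < r \<Longrightarrow> f j i \<in> carrier R" for f i
    using that by (auto intro!: M.finsum_closed)
  have NT: "(t \<otimes> (s \<otimes> s)) \<odot>\<^bsub>M\<^esub> N (T (w i)) = s \<odot>\<^bsub>M\<^esub> (\<Oplus>\<^bsub>M\<^esub>l\<in>{..<r}. ga l i \<odot>\<^bsub>M\<^esub> w l)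
      \<oplus>\<^bsub>M\<^esub> ((t \<otimes> s) \<odot>\<^bsub>M\<^esub> (\<Oplus>\<^bsub>M\<^esub>l\<in>{..<r}. D (a l i) \<odot>\<^bsub>M\<^esub> w l)
      \<oplus>\<^bsub>M\<^esub> (\<ominus> (t \<otimes> D s)) \<odot>\<^bsub>M\<^esub> (\<Oplus>\<^bsub>M\<^esub>l\<in>{..<r}. a l i \<odot>\<^bsub>M\<^esub> w l))" if i: "i < r" for i
  proof -
    have "N (s \<odot>\<^bsub>M\<^esub> T (w i)) = s \<odot>\<^bsub>M\<^esub> N (T (w i)) \<oplus>\<^bsub>M\<^esub> D s \<odot>\<^bsub>M\<^esub> T (w i)"
      using i by (simp add: connection_alongD(3)[OF N])
    moreover have "N (s \<odot>\<^bsub>M\<^esub> T (w i)) = (\<Oplus>\<^bsub>M\<^esub>j\<in>{..<r}. N (a j i \<odot>\<^bsub>M\<^esub> w j))"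
      unfolding a(3)[OF i] using i
      by (intro M.additive_finsum) (auto simp: connection_alongD(2)[OF N])
    moreover have "\<dots> = (\<Oplus>\<^bsub>M\<^esub>j\<in>{..<r}. a j i \<odot>\<^bsub>M\<^esub> N (w j) \<oplus>\<^bsub>M\<^esub> D (a j i) \<odot>\<^bsub>M\<^esub> w j)"
      using i by (intro M.finsum_cong') (auto simp: connection_alongD(3)[OF N])
    moreover have "\<dots> = (\<Oplus>\<^bsub>M\<^esub>j\<in>{..<r}. a j i \<odot>\<^bsub>M\<^esub> N (w j)) \<oplus>\<^bsub>M\<^esub> (\<Oplus>\<^bsub>M\<^esub>j\<in>{..<r}. D (a j i) \<odot>\<^bsub>M\<^esub> w j)"
      using i by (intro M.finsum_addf) auto
    moreover have "t \<odot>\<^bsub>M\<^esub> (\<Oplus>\<^bsub>M\<^esub>j\<in>{..<r}. a j i \<odot>\<^bsub>M\<^esub> N (w j)) = (\<Oplus>\<^bsub>M\<^esub>l\<in>{..<r}. ga l i \<odot>\<^bsub>M\<^esub> w l)"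
    proof -
      have "t \<odot>\<^bsub>M\<^esub> (\<Oplus>\<^bsub>M\<^esub>j\<in>{..<r}. a j i \<odot>\<^bsub>M\<^esub> N (w j)) = (\<Oplus>\<^bsub>M\<^esub>j\<in>{..<r}. t \<odot>\<^bsub>M\<^esub> (a j i \<odot>\<^bsub>M\<^esub> N (w j)))"
        using i by (subst finsum_smult_ldistr) auto
      also have "\<dots> = (\<Oplus>\<^bsub>M\<^esub>j\<in>{..<r}. a j i \<odot>\<^bsub>M\<^esub> (t \<odot>\<^bsub>M\<^esub> N (w j)))"
        using i by (intro M.finsum_cong') (auto simp: smult_left_commute)
      also have "\<dots> = (\<Oplus>\<^bsub>M\<^esub>l\<in>{..<r}. ga l i \<odot>\<^bsub>M\<^esub> w l)"
        unfolding ga_def using i g(3) by (intro lin_comb_lin_comb') auto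
      finally show ?thesis .
    qed
    ultimately have eq: "s \<odot>\<^bsub>M\<^esub> N (T (w i)) \<oplus>\<^bsub>M\<^esub> D s \<odot>\<^bsub>M\<^esub> T (w i)
        = (\<Oplus>\<^bsub>M\<^esub>j\<in>{..<r}. a j i \<odot>\<^bsub>M\<^esub> N (w j)) \<oplus>\<^bsub>M\<^esub> (\<Oplus>\<^bsub>M\<^esub>j\<in>{..<r}. D (a j i) \<odot>\<^bsub>M\<^esub> w j)"
      and tG: "t \<odot>\<^bsub>M\<^esub> (\<Oplus>\<^bsub>M\<^esub>j\<in>{..<r}. a j i \<odot>\<^bsub>M\<^esub> N (w j)) = (\<Oplus>\<^bsub>M\<^esub>l\<in>{..<r}. ga l i \<odot>\<^bsub>M\<^esub> w l)" by auto
    define nx ny where "nx = N (T (w i))" and "ny = T (w i)"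
    define ng nh where "ng = (\<Oplus>\<^bsub>M\<^esub>j\<in>{..<r}. a j i \<odot>\<^bsub>M\<^esub> N (w j))"
      and "nh = (\<Oplus>\<^bsub>M\<^esub>j\<in>{..<r}. D (a j i) \<odot>\<^bsub>M\<^esub> w j)"
    have [simp]: "nx \<in> carrier M" "ny \<in> carrier M" "ng \<in> carrier M" "nh \<in> carrier M"
      using i by (auto simp: nx_def ny_def ng_def nh_def intro!: M.finsum_closed)
    have "(t \<otimes> s) \<odot>\<^bsub>M\<^esub> (s \<odot>\<^bsub>M\<^esub> nx \<oplus>\<^bsub>M\<^esub> D s \<odot>\<^bsub>M\<^esub> ny) = (t \<otimes> s) \<odot>\<^bsub>M\<^esub> (ng \<oplus>\<^bsub>M\<^esub> nh)"
      using eq by (simp add: nx_def ny_def ng_def nh_def)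
    then have "(t \<otimes> (s \<otimes> s)) \<odot>\<^bsub>M\<^esub> nx \<oplus>\<^bsub>M\<^esub> (t \<otimes> D s) \<odot>\<^bsub>M\<^esub> (s \<odot>\<^bsub>M\<^esub> ny)
        = s \<odot>\<^bsub>M\<^esub> (t \<odot>\<^bsub>M\<^esub> ng) \<oplus>\<^bsub>M\<^esub> (t \<otimes> s) \<odot>\<^bsub>M\<^esub> nh"
      by (simp add: smult_r_distr smult_assoc1 smult_left_commute)
    then have "(t \<otimes> (s \<otimes> s)) \<odot>\<^bsub>M\<^esub> nx = s \<odot>\<^bsub>M\<^esub> (t \<odot>\<^bsub>M\<^esub> ng) \<oplus>\<^bsub>M\<^esub> (t \<otimes> s) \<odot>\<^bsub>M\<^esub> nh
        \<ominus>\<^bsub>M\<^esub> (t \<otimes> D s) \<odot>\<^bsub>M\<^esub> (s \<odot>\<^bsub>M\<^esub> ny)"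
      by (metis M.add.inv_solve_right M.minus_eq M.add.m_closed S_carrier \<open>ng \<in> carrier M\<close>
          \<open>nh \<in> carrier M\<close> \<open>nx \<in> carrier M\<close> \<open>ny \<in> carrier M\<close> a(1) g(1) is_derivationD(1)[OF D]
          m_closed smult_closed)
    then show ?thesis
      using i tG a(3)[OF i] by (simp add: nx_def ny_def ng_def nh_def smult_l_minus M.minus_eq M.a_assoc)
  qed
  have TN: "(t \<otimes> (s \<otimes> s)) \<odot>\<^bsub>M\<^esub> T (N (w i)) = s \<odot>\<^bsub>M\<^esub> (\<Oplus>\<^bsub>M\<^esub>l\<in>{..<r}. ag l i \<odot>\<^bsub>M\<^esub> w l)"
    if i: "i < r" for i
  proof -
    have "(t \<otimes> (s \<otimes> s)) \<odot>\<^bsub>M\<^esub> T (N (w i)) = s \<odot>\<^bsub>M\<^esub> (s \<odot>\<^bsub>M\<^esub> T (t \<odot>\<^bsub>M\<^esub> N (w i)))"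
      using i by (simp add: module_endoD(3)[OF T] smult_assoc1 smult_left_commute)
    also have "T (t \<odot>\<^bsub>M\<^esub> N (w i)) = (\<Oplus>\<^bsub>M\<^esub>j\<in>{..<r}. g j i \<odot>\<^bsub>M\<^esub> T (w j))"
      unfolding g(3)[OF i] using i w_in by (intro module_endo_lin_comb[OF T]) auto
    also have "s \<odot>\<^bsub>M\<^esub> \<dots> = (\<Oplus>\<^bsub>M\<^esub>j\<in>{..<r}. s \<odot>\<^bsub>M\<^esub> (g j i \<odot>\<^bsub>M\<^esub> T (w j)))"
      using i by (subst finsum_smult_ldistr) auto
    also have "\<dots> = (\<Oplus>\<^bsub>M\<^esub>j\<in>{..<r}. g j i \<odot>\<^bsub>M\<^esub> (s \<odot>\<^bsub>M\<^esub> T (w j)))"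
      using i by (intro M.finsum_cong') (auto simp: smult_left_commute)
    also have "\<dots> = (\<Oplus>\<^bsub>M\<^esub>l\<in>{..<r}. ag l i \<odot>\<^bsub>M\<^esub> w l)"
      unfolding ag_def using i a(3) by (intro lin_comb_lin_comb') auto
    finally show ?thesis .
  qed
  have "lt (\<lambda>v. N (T v) \<ominus>\<^bsub>M\<^esub> T (N v)) (t \<otimes> (s \<otimes> D c \<ominus> c \<otimes> D s)) (t \<otimes> (s \<otimes> s))"
    unfolding local_trace_def
  proof (intro conjI exI[of _ e] allI impI)
    show "e l i \<in> carrier R" if "i < r" "l < r" for l i using that by simp
    fix i assume i: "i < r"
    have "(\<Oplus>\<^bsub>M\<^esub>l\<in>{..<r}. e l i \<odot>\<^bsub>M\<^esub> w l) = (s \<odot>\<^bsub>M\<^esub> (\<Oplus>\<^bsub>M\<^esub>l\<in>{..<r}. ga l i \<odot>\<^bsub>M\<^esub> w l)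
        \<oplus>\<^bsub>M\<^esub> (\<ominus> s) \<odot>\<^bsub>M\<^esub> (\<Oplus>\<^bsub>M\<^esub>l\<in>{..<r}. ag l i \<odot>\<^bsub>M\<^esub> w l))
        \<oplus>\<^bsub>M\<^esub> ((t \<otimes> s) \<odot>\<^bsub>M\<^esub> (\<Oplus>\<^bsub>M\<^esub>l\<in>{..<r}. D (a l i) \<odot>\<^bsub>M\<^esub> w l)
        \<oplus>\<^bsub>M\<^esub> (\<ominus> (t \<otimes> D s)) \<odot>\<^bsub>M\<^esub> (\<Oplus>\<^bsub>M\<^esub>l\<in>{..<r}. a l i \<odot>\<^bsub>M\<^esub> w l))"
      unfolding e_def using i w_in by (simp add: lin_comb2)
    also have "\<dots> = (t \<otimes> (s \<otimes> s)) \<odot>\<^bsub>M\<^esub> (N (T (w i)) \<ominus>\<^bsub>M\<^esub> T (N (w i)))"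
      using i by (simp add: M.minus_eq smult_r_distr smult_r_minus NT TN smult_l_minus M.a_ac)
    finally show "(t \<otimes> (s \<otimes> s)) \<odot>\<^bsub>M\<^esub> (N (T (w i)) \<ominus>\<^bsub>M\<^esub> T (N (w i)))
        = (\<Oplus>\<^bsub>M\<^esub>l\<in>{..<r}. e l i \<odot>\<^bsub>M\<^esub> w l)" ..
  next
    have tr: "(\<Oplus>i\<in>{..<r}. ga i i) = (\<Oplus>i\<in>{..<r}. ag i i)"
    proof -
      have "(\<Oplus>i\<in>{..<r}. ga i i) = (\<Oplus>j\<in>{..<r}. \<Oplus>i\<in>{..<r}. g i j \<otimes> a j i)"
        unfolding ga_def by (intro R.finsum_swap) auto
      also have "\<dots> = (\<Oplus>i\<in>{..<r}. ag i i)"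
        unfolding ag_def by (intro R.finsum_cong' refl) (auto intro!: R.finsum_closed R.finsum_cong' simp: m_comm)
      finally show ?thesis .
    qed
    have Dc: "D c = (\<Oplus>i\<in>{..<r}. D (a i i))"
      unfolding a(4) by (intro R.additive_finsum) (auto simp: is_derivationD(2)[OF D])
    have [simp]: "(\<Oplus>i\<in>{..<r}. ag i i) \<in> carrier R" by (auto intro!: R.finsum_closed)
    have "(\<Oplus>i\<in>{..<r}. e i i) = (s \<otimes> (\<Oplus>i\<in>{..<r}. ga i i) \<oplus> (\<ominus> s) \<otimes> (\<Oplus>i\<in>{..<r}. ag i i))
        \<oplus> ((t \<otimes> s) \<otimes> D c \<oplus> (\<ominus> (t \<otimes> D s)) \<otimes> c)"
    proof -
      have "(\<Oplus>i\<in>{..<r}. e i i) = \<one> \<otimes> (\<Oplus>i\<in>{..<r}. s \<otimes> ga i i \<oplus> (\<ominus> s) \<otimes> ag i i)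
          \<oplus> \<one> \<otimes> (\<Oplus>i\<in>{..<r}. (t \<otimes> s) \<otimes> D (a i i) \<oplus> (\<ominus> (t \<otimes> D s)) \<otimes> a i i)"
        unfolding e_def by (rule R.finsum_lin2) auto
      then show ?thesis using \<open>c \<in> carrier R\<close>
        by (simp add: R.finsum_lin2 Pi_iff tr Dc[symmetric] a(4)[symmetric] del: R.finsum_addf)
    qed
    also have "\<dots> = (t \<otimes> s) \<otimes> D c \<oplus> (\<ominus> (t \<otimes> D s)) \<otimes> c"
      using \<open>c \<in> carrier R\<close> by (simp add: tr l_minus R.r_neg)
    also have "\<dots> = t \<otimes> (s \<otimes> D c \<ominus> c \<otimes> D s)"
      using \<open>c \<in> carrier R\<close> by (simp add: R.minus_eq r_distr l_minus r_minus m_ac)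
    finally show "t \<otimes> (s \<otimes> D c \<ominus> c \<otimes> D s) = (\<Oplus>i\<in>{..<r}. e i i)" ..
  qed simp_all
  then show ?thesis using g(1) by blast
qed

lemma trace_localized:
  assumes T: "module_endo R M T" and lt: "lt T c s" and d: "d \<in> S"
    and F: "\<And>v u. \<lbrakk>v \<in> carrier M; u \<in> S\<rbrakk> \<Longrightarrow> F (fm v u) = fm (T v) (d \<otimes> u)"
  shows "trace Q L F = fr c (s \<otimes> d)"
proof -
  note [simp] = module_endoD(1)[OF T] d
  obtain a where a: "s \<in> S" "\<And>i j. \<lbrakk>i < r; j < r\<rbrakk> \<Longrightarrow> a j i \<in> carrier R"
    "\<And>i. i < r \<Longrightarrow> s \<odot>\<^bsub>M\<^esub> T (w i) = (\<Oplus>\<^bsub>M\<^esub>j\<in>{..<r}. a j i \<odot>\<^bsub>M\<^esub> w j)"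
    "c = (\<Oplus>i\<in>{..<r}. a i i)" using lt by (rule local_traceE) blast
  note [simp] = a(1,2)
  have endo: "module_endo Q L F"
    unfolding module_endo_def
  proof (intro conjI ballI)
    show "F \<in> carrier L \<rightarrow> carrier L"
      by (auto elim!: loc_module_carrierE intro!: loc_module_carrierI simp: F)
    fix x assume "x \<in> carrier L"
    then obtain m u where x: "m \<in> carrier M" "u \<in> S" "x = fm m u" by (rule loc_module_carrierE)
    { fix y assume "y \<in> carrier L"
      then obtain n t where y: "n \<in> carrier M" "t \<in> S" "y = fm n t" by (rule loc_module_carrierE)
      have "fm (T (t \<odot>\<^bsub>M\<^esub> m \<oplus>\<^bsub>M\<^esub> u \<odot>\<^bsub>M\<^esub> n)) (d \<otimes> (u \<otimes> t))
          = fm (d \<odot>\<^bsub>M\<^esub> T (t \<odot>\<^bsub>M\<^esub> m \<oplus>\<^bsub>M\<^esub> u \<odot>\<^bsub>M\<^esub> n)) (d \<otimes> (d \<otimes> (u \<otimes> t)))"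
        using x y by (intro frac_scale[OF module_M, symmetric]) auto
      then show "F (x \<oplus>\<^bsub>L\<^esub> y) = F x \<oplus>\<^bsub>L\<^esub> F y"
        using x y by (simp add: loc_module_add[OF module_M] F module_endoD(2,3)[OF T] smult_r_distr
            smult_assoc1 smult_left_commute m_ac) }
    fix p assume "p \<in> carrier Q"
    then obtain b t where p: "b \<in> carrier R" "t \<in> S" "p = fr b t" by (rule loc_ring_carrierE)
    then show "F (p \<odot>\<^bsub>L\<^esub> x) = p \<odot>\<^bsub>L\<^esub> F x"
      using x by (simp add: loc_module_smult[OF module_M] F module_endoD(3)[OF T] m_ac)
  qed
  have "trace Q L F = (\<Oplus>\<^bsub>Q\<^esub>i\<in>{..<r}. fr (a i i) (s \<otimes> d))"
  proof (rule L.trace_eq[OF is_basis_of_local_basis[OF basis] endo,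
        where c = "\<lambda>j i. fr (a j i) (s \<otimes> d)"])
    fix i assume i: "i < r"
    have "F (fm (w i) \<one>) = fm (s \<odot>\<^bsub>M\<^esub> T (w i)) (s \<otimes> d)"
      using i frac_scale[OF module_M, of "T (w i)" d s] by (simp add: F)
    also have "\<dots> = (\<Oplus>\<^bsub>L\<^esub>j\<in>{..<r}. fr (a j i) (s \<otimes> d) \<odot>\<^bsub>L\<^esub> fm (w j) \<one>)"
      unfolding a(3)[OF i] using i w_in by (intro lin_comb_fm[symmetric]) auto
    finally show "F (fm (w i) \<one>) = (\<Oplus>\<^bsub>L\<^esub>j\<in>{..<r}. fr (a j i) (s \<otimes> d) \<odot>\<^bsub>L\<^esub> fm (w j) \<one>)" .
  qed simp
  also have "\<dots> = fr c (s \<otimes> d)" unfolding a(4) by (rule finsum_fr) auto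
  finally show ?thesis .
qed

lemma loc_trace_eq:
  assumes T: "module_endo R M T" and lt: "lt T c s"
  shows "loc_trace T = fr c s"
proof -
  have "loc_trace T = fr c (s \<otimes> \<one>)"
    unfolding loc_trace_def
    by (rule trace_localized[OF T lt one_in_S])
      (use module_endoD[OF T] in \<open>simp_all add: frac_UN[OF module_M] frac_scale[OF module_M] loc_module_carrierI\<close>)
  then show ?thesis using lt lt_closed by simp
qed

lemma trace_scaled:
  assumes T: "module_endo R M T" and d: "d \<in> S"
    and F: "\<And>v u. \<lbrakk>v \<in> carrier M; u \<in> S\<rbrakk> \<Longrightarrow> F (fm v u) = fm (T v) (d \<otimes> u)"
  shows "trace Q L F = fr \<one> d \<otimes>\<^bsub>Q\<^esub> loc_trace T"
proof -
  obtain c s where lt: "lt T c s" using lt_exists[of T] T by (auto simp: module_endo_def)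
  then have "s \<in> S" "c \<in> carrier R" using lt_closed by auto
  then show ?thesis
    using trace_localized[OF T lt d F] d loc_trace_eq[OF T lt] by (simp add: loc_ring_mult m_comm)
qed

lemma loc_trace_closed:
  assumes "module_endo R M T" shows "loc_trace T \<in> carrier Q"
proof -
  obtain c s where lt: "lt T c s" using lt_exists[of T] assms by (auto simp: module_endo_def)
  then show ?thesis using loc_trace_eq[OF assms lt] lt_closed[OF lt] by simp
qed

lemma module_endo_lin:
  assumes "module_endo R M T1" "module_endo R M T2" "x \<in> carrier R" "y \<in> carrier R"
  shows "module_endo R M (\<lambda>v. x \<odot>\<^bsub>M\<^esub> T1 v \<oplus>\<^bsub>M\<^esub> y \<odot>\<^bsub>M\<^esub> T2 v)"
  using assms unfolding module_endo_def
  by (auto simp: smult_r_distr smult_left_commute M.a_ac Pi_iff)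

lemma loc_trace_lin:
  assumes T1: "module_endo R M T1" and T2: "module_endo R M T2"
    and x: "x \<in> carrier R" "y \<in> carrier R"
  shows "loc_trace (\<lambda>v. x \<odot>\<^bsub>M\<^esub> T1 v \<oplus>\<^bsub>M\<^esub> y \<odot>\<^bsub>M\<^esub> T2 v)
    = fr x \<one> \<otimes>\<^bsub>Q\<^esub> loc_trace T1 \<oplus>\<^bsub>Q\<^esub> fr y \<one> \<otimes>\<^bsub>Q\<^esub> loc_trace T2"
proof -
  obtain c1 s1 where 1: "lt T1 c1 s1" using lt_exists[of T1] T1 by (auto simp: module_endo_def)
  obtain c2 s2 where 2: "lt T2 c2 s2" using lt_exists[of T2] T2 by (auto simp: module_endo_def)
  note c = lt_closed[OF 1] lt_closed[OF 2]
  have T: "T1 \<in> carrier M \<rightarrow> carrier M" "T2 \<in> carrier M \<rightarrow> carrier M"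
    using T1 T2 by (auto simp: module_endo_def)
  show ?thesis
    using c x loc_trace_eq[OF module_endo_lin[OF T1 T2 x] lt_lin[OF 1 T(1) 2 T(2) x]]
    by (simp add: loc_trace_eq[OF T1 1] loc_trace_eq[OF T2 2] loc_ring_mult loc_ring_add m_assoc)
qed

lemma module_endo_commutator:
  assumes D: "is_derivation R D" and N: "connection_along R M D N" and T: "module_endo R M T"
  shows "module_endo R M (\<lambda>v. N (T v) \<ominus>\<^bsub>M\<^esub> T (N v))"
proof -
  note [simp] = is_derivationD(1)[OF D] connection_alongD[OF N] module_endoD[OF T]
  have 1: "(a \<oplus>\<^bsub>M\<^esub> b) \<ominus>\<^bsub>M\<^esub> (a' \<oplus>\<^bsub>M\<^esub> b') = (a \<ominus>\<^bsub>M\<^esub> a') \<oplus>\<^bsub>M\<^esub> (b \<ominus>\<^bsub>M\<^esub> b')"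
    if "a \<in> carrier M" "b \<in> carrier M" "a' \<in> carrier M" "b' \<in> carrier M" for a b a' b'
    using that by (simp add: M.minus_eq M.minus_add M.a_ac)
  show ?thesis unfolding module_endo_def
    by (auto simp: 1) (simp add: M.minus_eq M.r_neg smult_r_distr smult_r_minus)
qed

text \<open>The trace is horizontal: the connection on endomorphisms induced by \<open>N\<close> corresponds under the trace to the
  derivation \<open>D\<close>.\<close>

lemma loc_trace_commutator:
  assumes D: "is_derivation R D" and N: "connection_along R M D N" and T: "module_endo R M T"
  shows "loc_trace (\<lambda>v. N (T v) \<ominus>\<^bsub>M\<^esub> T (N v)) = loc_der D (loc_trace T)"
proof -
  obtain c s where 1: "lt T c s" using lt_exists[of T] T by (auto simp: module_endo_def)
  have c: "c \<in> carrier R" "s \<in> S" using lt_closed[OF 1] by auto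
  obtain t where t: "t \<in> S"
    and lt: "lt (\<lambda>v. N (T v) \<ominus>\<^bsub>M\<^esub> T (N v)) (t \<otimes> (s \<otimes> D c \<ominus> c \<otimes> D s)) (t \<otimes> (s \<otimes> s))"
    using lt_commutator[OF D N T 1] by blast
  have "loc_trace (\<lambda>v. N (T v) \<ominus>\<^bsub>M\<^esub> T (N v)) = fr (s \<otimes> D c \<ominus> c \<otimes> D s) (s \<otimes> s)"
    using loc_trace_eq[OF module_endo_commutator[OF D N T] lt] c t is_derivationD(1)[OF D]
    by (simp add: fr_scale)
  then show ?thesis using c by (simp add: loc_trace_eq[OF T 1] loc_der_fr[OF D])
qed

lemma loc_trace_minus:
  assumes T1: "module_endo R M T1" and T2: "module_endo R M T2"
  shows "loc_trace (\<lambda>v. T1 v \<ominus>\<^bsub>M\<^esub> T2 v) = loc_trace T1 \<ominus>\<^bsub>Q\<^esub> loc_trace T2"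
    and "module_endo R M (\<lambda>v. T1 v \<ominus>\<^bsub>M\<^esub> T2 v)"
proof -
  have m: "fr (\<ominus> \<one>) \<one> = \<ominus>\<^bsub>Q\<^esub> \<one>\<^bsub>Q\<^esub>"
    by (rule Q.minus_equality[symmetric]) (auto simp: loc_ring_one fr_add_same R.l_neg fr_zero)
  have "loc_trace (\<lambda>v. T1 v \<ominus>\<^bsub>M\<^esub> T2 v) = loc_trace (\<lambda>v. \<one> \<odot>\<^bsub>M\<^esub> T1 v \<oplus>\<^bsub>M\<^esub> (\<ominus> \<one>) \<odot>\<^bsub>M\<^esub> T2 v)"
    using module_endoD(1)[OF T1] module_endoD(1)[OF T2]
    by (intro loc_trace_cong) (simp add: M.minus_eq smult_l_minus)
  also have "\<dots> = loc_trace T1 \<ominus>\<^bsub>Q\<^esub> loc_trace T2"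
    using loc_trace_closed[OF T1] loc_trace_closed[OF T2]
    by (simp add: loc_trace_lin[OF T1 T2] m Q.l_minus Q.minus_eq flip: loc_ring_one)
  finally show "loc_trace (\<lambda>v. T1 v \<ominus>\<^bsub>M\<^esub> T2 v) = loc_trace T1 \<ominus>\<^bsub>Q\<^esub> loc_trace T2" .
  have *: "T1 v \<ominus>\<^bsub>M\<^esub> T2 v = \<one> \<odot>\<^bsub>M\<^esub> T1 v \<oplus>\<^bsub>M\<^esub> (\<ominus> \<one>) \<odot>\<^bsub>M\<^esub> T2 v" if "v \<in> carrier M" for v
    using that module_endoD(1)[OF T1] module_endoD(1)[OF T2] by (simp add: M.minus_eq smult_l_minus)
  show "module_endo R M (\<lambda>v. T1 v \<ominus>\<^bsub>M\<^esub> T2 v)"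
    using module_endo_lin[OF T1 T2, of \<one> "\<ominus> \<one>"] unfolding module_endo_def by (simp add: * Pi_iff)
qed

end

section \<open>The Lie-Rinehart algebra of a module\<close>

locale algebra_module = plain_module A W
  for A :: "('f, 'a) module" (structure) and W :: "('a, 'w) module" +
  assumes scalar_closed [simp]: "c \<odot>\<^bsub>A\<^esub> \<one> \<in> carrier A"
    and scalar_mult: "a \<in> carrier A \<Longrightarrow> c \<odot>\<^bsub>A\<^esub> a = (c \<odot>\<^bsub>A\<^esub> \<one>) \<otimes> a"
begin

abbreviation "V \<equiv> VW A W"

lemma derivation_one:
  assumes "is_derivation A D" shows "D \<one> = \<zero>"
proof -
  have "D \<one> \<oplus> D \<one> = D \<one>"
    using is_derivationD(3)[OF assms, of \<one> \<one>] is_derivationD(1)[OF assms] by simp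
  then show ?thesis using is_derivationD(1)[OF assms, of \<one>]
    by (metis R.add.r_cancel_one' R.one_closed)
qed

lemma Der_F_iff:
  "\<delta> \<in> Der_F A \<longleftrightarrow> \<delta> \<in> extensional (carrier A) \<and> is_derivation A \<delta> \<and> (\<forall>c. \<delta> (c \<odot>\<^bsub>A\<^esub> \<one>) = \<zero>)"
proof
  assume D: "\<delta> \<in> Der_F A"
  then have d: "is_derivation A \<delta>" by (auto simp: Der_F_def is_derivation_def)
  have "\<delta> (c \<odot>\<^bsub>A\<^esub> \<one>) = c \<odot>\<^bsub>A\<^esub> \<delta> \<one>" for c using D by (auto simp: Der_F_def)
  then have "\<delta> (c \<odot>\<^bsub>A\<^esub> \<one>) = \<zero>" for c
    using derivation_one[OF d] scalar_mult[of \<zero> c] by simp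
  then show "\<delta> \<in> extensional (carrier A) \<and> is_derivation A \<delta> \<and> (\<forall>c. \<delta> (c \<odot>\<^bsub>A\<^esub> \<one>) = \<zero>)"
    using D d by (auto simp: Der_F_def PiE_iff)
next
  assume D: "\<delta> \<in> extensional (carrier A) \<and> is_derivation A \<delta> \<and> (\<forall>c. \<delta> (c \<odot>\<^bsub>A\<^esub> \<one>) = \<zero>)"
  then have d: "is_derivation A \<delta>" by simp
  have "\<delta> (c \<odot>\<^bsub>A\<^esub> a) = c \<odot>\<^bsub>A\<^esub> \<delta> a" if "a \<in> carrier A" for c a
    using that D is_derivationD[OF d]
    by (simp add: scalar_mult[of a c] scalar_mult[of "\<delta> a" c])
  then show "\<delta> \<in> Der_F A" using D d by (auto simp: Der_F_def is_derivation_def PiE_iff)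
qed

text \<open>Kodaira-Spencer classes measure the obstruction to lifting \<open>\<delta>\<close> to \<open>W\<close>: an endomorphism \<open>\<phi>\<close> whose inner derivation
  is that of \<open>\<delta>\<close> satisfies \<open>\<delta>(a) w = a \<phi>(w) - \<phi>(a w)\<close>, which is the Leibniz rule for \<open>-\<phi>\<close>.\<close>

lemma VW_iff: "\<delta> \<in> carrier V \<longleftrightarrow> \<delta> \<in> Der_F A \<and> (\<exists>N. connection_along A W \<delta> N)"
proof (intro iffI conjI)
  assume V: "\<delta> \<in> carrier V"
  then show D: "\<delta> \<in> Der_F A" by (simp add: VW_def)
  then have dA: "\<delta> a \<in> carrier A" if "a \<in> carrier A" for a
    using that by (auto simp: Der_F_iff is_derivationD)
  from V obtain \<phi> where ph: "\<phi> \<in> End_F A W" and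
    ks: "ks_derivation A W \<delta> = (\<lambda>a\<in>carrier A. \<lambda>w\<in>carrier W. a \<odot>\<^bsub>W\<^esub> \<phi> w \<ominus>\<^bsub>W\<^esub> \<phi> (a \<odot>\<^bsub>W\<^esub> w))"
    by (auto simp: VW_def inner_derivations_def)
  have eq: "\<delta> a \<odot>\<^bsub>W\<^esub> w = a \<odot>\<^bsub>W\<^esub> \<phi> w \<ominus>\<^bsub>W\<^esub> \<phi> (a \<odot>\<^bsub>W\<^esub> w)"
    if "a \<in> carrier A" "w \<in> carrier W" for a w
    using that fun_cong[OF fun_cong[OF ks, of a], of w] by (simp add: ks_derivation_def)
  have p: "\<phi> w \<in> carrier W" if "w \<in> carrier W" for w using ph that by (auto simp: End_F_def)
  have "connection_along A W \<delta> (\<lambda>w. \<ominus>\<^bsub>W\<^esub> \<phi> w)"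
    unfolding connection_along_def
  proof (intro conjI ballI)
    fix v w assume "v \<in> carrier W" "w \<in> carrier W"
    then show "\<ominus>\<^bsub>W\<^esub> \<phi> (v \<oplus>\<^bsub>W\<^esub> w) = \<ominus>\<^bsub>W\<^esub> \<phi> v \<oplus>\<^bsub>W\<^esub> \<ominus>\<^bsub>W\<^esub> \<phi> w"
      using ph by (simp add: End_F_def p M.minus_add)
  next
    fix a w assume aw: "a \<in> carrier A" "w \<in> carrier W"
    then show "\<ominus>\<^bsub>W\<^esub> \<phi> (a \<odot>\<^bsub>W\<^esub> w) = a \<odot>\<^bsub>W\<^esub> (\<ominus>\<^bsub>W\<^esub> \<phi> w) \<oplus>\<^bsub>W\<^esub> \<delta> a \<odot>\<^bsub>W\<^esub> w"
      by (simp add: eq p smult_r_minus M.minus_eq M.r_neg1)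
  qed (auto simp: p)
  then show "\<exists>N. connection_along A W \<delta> N" by blast
next
  assume "\<delta> \<in> Der_F A \<and> (\<exists>N. connection_along A W \<delta> N)"
  then obtain N where D: "\<delta> \<in> Der_F A" and N: "connection_along A W \<delta> N" by blast
  note [simp] = connection_alongD(1)[OF N]
  have dA [simp]: "\<delta> a \<in> carrier A" if "a \<in> carrier A" for a
    using that D by (auto simp: Der_F_iff is_derivationD)
  let ?p = "\<lambda>w\<in>carrier W. \<ominus>\<^bsub>W\<^esub> N w"
  have "?p \<in> End_F A W"
    using D by (auto simp: End_F_def connection_alongD[OF N] M.minus_add Der_F_iff smult_r_minus)
  moreover have "ks_derivation A W \<delta>
      = (\<lambda>a\<in>carrier A. \<lambda>w\<in>carrier W. a \<odot>\<^bsub>W\<^esub> ?p w \<ominus>\<^bsub>W\<^esub> ?p (a \<odot>\<^bsub>W\<^esub> w))"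
    unfolding ks_derivation_def
    by (intro restrict_ext)
      (simp add: connection_alongD(3)[OF N] smult_r_minus M.minus_eq M.minus_add M.r_neg1)
  ultimately have "ks_derivation A W \<delta> \<in> inner_derivations A W"
    unfolding inner_derivations_def by blast
  then show "\<delta> \<in> carrier V" using D by (simp add: VW_def)
qed

lemma V_derivation: "\<delta> \<in> carrier V \<Longrightarrow> is_derivation A \<delta>"
  by (simp add: VW_iff Der_F_iff)

lemma V_closed [simp]: "\<lbrakk>\<delta> \<in> carrier V; a \<in> carrier A\<rbrakk> \<Longrightarrow> \<delta> a \<in> carrier A"
  using V_derivation is_derivationD(1) by metis

lemma V_extensional: "\<delta> \<in> carrier V \<Longrightarrow> \<delta> \<in> extensional (carrier A)"
  by (simp add: VW_iff Der_F_iff)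

lemma V_eqI:
  "\<lbrakk>\<delta> \<in> carrier V; \<eta> \<in> carrier V; \<And>a. a \<in> carrier A \<Longrightarrow> \<delta> a = \<eta> a\<rbrakk> \<Longrightarrow> \<delta> = \<eta>"
  using V_extensional extensionalityI by metis

lemma V_apply:
  "a \<in> carrier A \<Longrightarrow> (\<delta> \<oplus>\<^bsub>V\<^esub> \<eta>) a = \<delta> a \<oplus> \<eta> a"
  "a \<in> carrier A \<Longrightarrow> (b \<odot>\<^bsub>V\<^esub> \<delta>) a = b \<otimes> \<delta> a"
  "a \<in> carrier A \<Longrightarrow> \<zero>\<^bsub>V\<^esub> a = \<zero>"
  "a \<in> carrier A \<Longrightarrow> lie_bracket A \<delta> \<eta> a = \<delta> (\<eta> a) \<ominus> \<eta> (\<delta> a)"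
  by (simp_all add: VW_def lie_bracket_def)

lemma V_ext_ops:
  "\<delta> \<oplus>\<^bsub>V\<^esub> \<eta> \<in> extensional (carrier A)" "b \<odot>\<^bsub>V\<^esub> \<delta> \<in> extensional (carrier A)"
  "\<zero>\<^bsub>V\<^esub> \<in> extensional (carrier A)" "lie_bracket A \<delta> \<eta> \<in> extensional (carrier A)"
  by (simp_all add: VW_def lie_bracket_def)

lemma V_add_closed:
  assumes "\<delta> \<in> carrier V" "\<eta> \<in> carrier V" shows "\<delta> \<oplus>\<^bsub>V\<^esub> \<eta> \<in> carrier V"
proof -
  obtain N N' where N: "connection_along A W \<delta> N" and N': "connection_along A W \<eta> N'"
    using assms by (auto simp: VW_iff)
  note [simp] = connection_alongD(1)[OF N] connection_alongD(1)[OF N'] assms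
  note d = is_derivationD[OF V_derivation[OF assms(1)]] is_derivationD[OF V_derivation[OF assms(2)]]
  have "is_derivation A (\<delta> \<oplus>\<^bsub>V\<^esub> \<eta>)"
    unfolding is_derivation_def by (auto simp: V_apply d R.l_distr R.r_distr R.a_ac)
  moreover have "connection_along A W (\<delta> \<oplus>\<^bsub>V\<^esub> \<eta>) (\<lambda>w. N w \<oplus>\<^bsub>W\<^esub> N' w)"
    unfolding connection_along_def
    by (auto simp: connection_alongD[OF N] connection_alongD[OF N'] V_apply M.a_ac
        smult_r_distr smult_l_distr)
  ultimately show ?thesis using assms by (auto simp: VW_iff Der_F_iff V_ext_ops V_apply)
qed

lemma V_smult_closed:
  assumes "\<delta> \<in> carrier V" "b \<in> carrier A" shows "b \<odot>\<^bsub>V\<^esub> \<delta> \<in> carrier V"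
proof -
  obtain N where N: "connection_along A W \<delta> N" using assms by (auto simp: VW_iff)
  note [simp] = connection_alongD(1)[OF N] assms
  note d = is_derivationD[OF V_derivation[OF assms(1)]]
  have "is_derivation A (b \<odot>\<^bsub>V\<^esub> \<delta>)"
    unfolding is_derivation_def by (auto simp: V_apply d R.r_distr R.m_ac)
  moreover have "connection_along A W (b \<odot>\<^bsub>V\<^esub> \<delta>) (\<lambda>w. b \<odot>\<^bsub>W\<^esub> N w)"
    unfolding connection_along_def
    by (auto simp: connection_alongD[OF N] V_apply smult_r_distr smult_assoc1 smult_left_commute)
  ultimately show ?thesis using assms by (auto simp: VW_iff Der_F_iff V_ext_ops V_apply)
qed

lemma V_zero_closed: "\<zero>\<^bsub>V\<^esub> \<in> carrier V"
proof -
  have "is_derivation A \<zero>\<^bsub>V\<^esub>" by (simp add: is_derivation_def V_apply)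
  moreover have "connection_along A W \<zero>\<^bsub>V\<^esub> (\<lambda>w. \<zero>\<^bsub>W\<^esub>)" by (simp add: connection_along_def V_apply)
  ultimately show ?thesis by (auto simp: VW_iff Der_F_iff V_ext_ops V_apply)
qed

lemma connection_along_bracket:
  assumes V: "\<delta> \<in> carrier V" "\<eta> \<in> carrier V"
    and N: "connection_along A W \<delta> N" and N': "connection_along A W \<eta> N'"
  shows "connection_along A W (lie_bracket A \<delta> \<eta>) (\<lambda>w. N (N' w) \<ominus>\<^bsub>W\<^esub> N' (N w))"
proof -
  note [simp] = connection_alongD(1)[OF N] connection_alongD(1)[OF N'] V
  show ?thesis
    unfolding connection_along_def
  proof (intro conjI ballI)
    fix v w assume "v \<in> carrier W" "w \<in> carrier W"
    then show "N (N' (v \<oplus>\<^bsub>W\<^esub> w)) \<ominus>\<^bsub>W\<^esub> N' (N (v \<oplus>\<^bsub>W\<^esub> w))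
        = (N (N' v) \<ominus>\<^bsub>W\<^esub> N' (N v)) \<oplus>\<^bsub>W\<^esub> (N (N' w) \<ominus>\<^bsub>W\<^esub> N' (N w))"
      by (simp add: connection_alongD[OF N] connection_alongD[OF N'] M.minus_eq M.minus_add M.a_ac)
  next
    fix a w assume aw: "a \<in> carrier A" "w \<in> carrier W"
    have "N (N' (a \<odot>\<^bsub>W\<^esub> w)) \<ominus>\<^bsub>W\<^esub> N' (N (a \<odot>\<^bsub>W\<^esub> w))
        = ((\<delta> a \<odot>\<^bsub>W\<^esub> N' w \<oplus>\<^bsub>W\<^esub> \<eta> a \<odot>\<^bsub>W\<^esub> N w) \<oplus>\<^bsub>W\<^esub> (a \<odot>\<^bsub>W\<^esub> N (N' w) \<oplus>\<^bsub>W\<^esub> \<delta> (\<eta> a) \<odot>\<^bsub>W\<^esub> w))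
        \<ominus>\<^bsub>W\<^esub> ((\<delta> a \<odot>\<^bsub>W\<^esub> N' w \<oplus>\<^bsub>W\<^esub> \<eta> a \<odot>\<^bsub>W\<^esub> N w) \<oplus>\<^bsub>W\<^esub> (a \<odot>\<^bsub>W\<^esub> N' (N w) \<oplus>\<^bsub>W\<^esub> \<eta> (\<delta> a) \<odot>\<^bsub>W\<^esub> w))"
      using aw by (simp add: connection_alongD[OF N] connection_alongD[OF N'] M.a_ac)
    also have "\<dots> = a \<odot>\<^bsub>W\<^esub> (N (N' w) \<ominus>\<^bsub>W\<^esub> N' (N w)) \<oplus>\<^bsub>W\<^esub> lie_bracket A \<delta> \<eta> a \<odot>\<^bsub>W\<^esub> w"
      using aw by (subst M.minus_cancel_left)
        (auto simp: V_apply M.minus_eq R.minus_eq M.minus_add M.a_ac smult_r_distr smult_l_distr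
          smult_l_minus smult_r_minus)
    finally show "N (N' (a \<odot>\<^bsub>W\<^esub> w)) \<ominus>\<^bsub>W\<^esub> N' (N (a \<odot>\<^bsub>W\<^esub> w))
        = a \<odot>\<^bsub>W\<^esub> (N (N' w) \<ominus>\<^bsub>W\<^esub> N' (N w)) \<oplus>\<^bsub>W\<^esub> lie_bracket A \<delta> \<eta> a \<odot>\<^bsub>W\<^esub> w" .
  qed auto
qed

lemma V_bracket_closed:
  assumes "\<delta> \<in> carrier V" "\<eta> \<in> carrier V" shows "lie_bracket A \<delta> \<eta> \<in> carrier V"
proof -
  obtain N N' where N: "connection_along A W \<delta> N" and N': "connection_along A W \<eta> N'"
    using assms by (auto simp: VW_iff)
  note [simp] = connection_alongD(1)[OF N] connection_alongD(1)[OF N'] assms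
  note d = is_derivationD[OF V_derivation[OF assms(1)]] is_derivationD[OF V_derivation[OF assms(2)]]
  have "is_derivation A (lie_bracket A \<delta> \<eta>)"
    unfolding is_derivation_def
  proof (intro conjI ballI)
    fix a b assume ab: "a \<in> carrier A" "b \<in> carrier A"
    then show "lie_bracket A \<delta> \<eta> (a \<oplus> b) = lie_bracket A \<delta> \<eta> a \<oplus> lie_bracket A \<delta> \<eta> b"
      by (simp add: V_apply d R.minus_eq R.minus_add R.a_ac)
    have "lie_bracket A \<delta> \<eta> (a \<otimes> b) = ((\<delta> a \<otimes> \<eta> b \<oplus> \<eta> a \<otimes> \<delta> b) \<oplus> (\<delta> (\<eta> a) \<otimes> b \<oplus> a \<otimes> \<delta> (\<eta> b)))
        \<ominus> ((\<delta> a \<otimes> \<eta> b \<oplus> \<eta> a \<otimes> \<delta> b) \<oplus> (\<eta> (\<delta> a) \<otimes> b \<oplus> a \<otimes> \<eta> (\<delta> b)))"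
      using ab by (simp add: V_apply d R.a_ac)
    also have "\<dots> = lie_bracket A \<delta> \<eta> a \<otimes> b \<oplus> a \<otimes> lie_bracket A \<delta> \<eta> b"
      using ab by (subst R.minus_cancel_left)
        (auto simp: V_apply R.minus_eq R.minus_add R.a_ac R.l_distr R.r_distr R.l_minus R.r_minus)
    finally show "lie_bracket A \<delta> \<eta> (a \<otimes> b) = lie_bracket A \<delta> \<eta> a \<otimes> b \<oplus> a \<otimes> lie_bracket A \<delta> \<eta> b" .
  qed (auto simp: V_apply)
  moreover have "connection_along A W (lie_bracket A \<delta> \<eta>) (\<lambda>w. N (N' w) \<ominus>\<^bsub>W\<^esub> N' (N w))"
    by (rule connection_along_bracket[OF assms N N'])
  moreover have "lie_bracket A \<delta> \<eta> (c \<odot>\<^bsub>A\<^esub> \<one>) = \<zero>" for c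
  proof -
    have "\<delta> \<zero> = \<zero>" "\<eta> \<zero> = \<zero>" using R.additive_zero[of \<delta>] R.additive_zero[of \<eta>] d by auto
    moreover have "\<delta> (c \<odot>\<^bsub>A\<^esub> \<one>) = \<zero>" "\<eta> (c \<odot>\<^bsub>A\<^esub> \<one>) = \<zero>"
      using assms by (auto simp: VW_iff Der_F_iff)
    ultimately show ?thesis by (simp add: V_apply)
  qed
  ultimately show ?thesis by (auto simp: VW_iff Der_F_iff V_ext_ops)
qed

lemma V_module: "module A V"
proof (rule moduleI[OF R.is_cring])
  note [simp] = V_add_closed V_smult_closed V_zero_closed
  show "abelian_group V"
  proof (rule abelian_groupI)
    fix \<delta> assume d: "\<delta> \<in> carrier V"
    show "\<exists>\<eta>\<in>carrier V. \<eta> \<oplus>\<^bsub>V\<^esub> \<delta> = \<zero>\<^bsub>V\<^esub>"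
      using d by (intro bexI[of _ "(\<ominus> \<one>) \<odot>\<^bsub>V\<^esub> \<delta>"] V_eqI) (auto simp: V_apply R.l_minus R.l_neg)
  qed (auto intro!: V_eqI simp: V_apply R.a_ac)
qed (auto intro!: V_eqI simp: V_apply R.l_distr R.r_distr R.m_assoc V_smult_closed V_add_closed)

sublocale V: plain_module A V
  unfolding plain_module_def by (rule V_module)

lemma V_minus_apply:
  assumes "\<delta> \<in> carrier V" "\<eta> \<in> carrier V" "a \<in> carrier A"
  shows "(\<delta> \<ominus>\<^bsub>V\<^esub> \<eta>) a = \<delta> a \<ominus> \<eta> a"
proof -
  have "\<ominus>\<^bsub>V\<^esub> \<eta> = (\<ominus> \<one>) \<odot>\<^bsub>V\<^esub> \<eta>" using assms V.smult_l_minus[of \<one> \<eta>] by simp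
  then show ?thesis using assms by (simp add: V.M.minus_eq V_apply R.minus_eq R.l_minus)
qed

lemma connection_along_nab:
  assumes "is_connection A W nab" "\<delta> \<in> carrier V"
  shows "connection_along A W \<delta> (nab \<delta>)"
  using assms by (fastforce simp: is_connection_def connection_along_def End_F_def Pi_iff PiE_iff)

lemma connection_add:
  assumes "is_connection A W nab" "\<delta> \<in> carrier V" "\<eta> \<in> carrier V" "w \<in> carrier W"
  shows "nab (\<delta> \<oplus>\<^bsub>V\<^esub> \<eta>) w = nab \<delta> w \<oplus>\<^bsub>W\<^esub> nab \<eta> w"
  using assms by (simp add: is_connection_def)

lemma connection_smult:
  assumes "is_connection A W nab" "\<delta> \<in> carrier V" "a \<in> carrier A" "w \<in> carrier W"
  shows "nab (a \<odot>\<^bsub>V\<^esub> \<delta>) w = a \<odot>\<^bsub>W\<^esub> nab \<delta> w"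
  using assms by (simp add: is_connection_def)

text \<open>The inhomogeneous terms of the two Leibniz rules cancel.\<close>

lemma module_endo_diff:
  assumes d: "\<delta> \<in> carrier V" and N: "connection_along A W \<delta> N" and N': "connection_along A W \<delta> N'"
  shows "module_endo A W (\<lambda>w. N w \<ominus>\<^bsub>W\<^esub> N' w)"
proof -
  note [simp] = connection_alongD[OF N] connection_alongD[OF N'] d
  have 1: "(a \<oplus>\<^bsub>W\<^esub> b) \<ominus>\<^bsub>W\<^esub> (a' \<oplus>\<^bsub>W\<^esub> b') = (a \<ominus>\<^bsub>W\<^esub> a') \<oplus>\<^bsub>W\<^esub> (b \<ominus>\<^bsub>W\<^esub> b')"
    if "a \<in> carrier W" "b \<in> carrier W" "a' \<in> carrier W" "b' \<in> carrier W" for a b a' b'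
    using that by (simp add: M.minus_eq M.minus_add M.a_ac)
  show ?thesis unfolding module_endo_def
    by (auto simp: 1) (simp add: M.minus_eq M.r_neg smult_r_distr smult_r_minus)
qed

subsection \<open>Curvature\<close>

context
  fixes nab assumes conn: "is_connection A W nab"
begin

lemma nab_closed [simp]: "\<lbrakk>\<delta> \<in> carrier V; w \<in> carrier W\<rbrakk> \<Longrightarrow> nab \<delta> w \<in> carrier W"
  using connection_alongD(1)[OF connection_along_nab[OF conn]] .

text \<open>Both \<open>[\<nabla>\<^sub>\<delta>, \<nabla>\<^sub>\<eta>]\<close> and \<open>\<nabla>\<close> at \<open>[\<delta>, \<eta>]\<close> satisfy the Leibniz rule along \<open>[\<delta>, \<eta>]\<close>.\<close>

lemma curvature_endo:
  assumes "\<delta> \<in> carrier V" "\<eta> \<in> carrier V"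
  shows "module_endo A W (curvature A W nab \<delta> \<eta>)"
proof -
  have "module_endo A W (\<lambda>w. (nab \<delta> (nab \<eta> w) \<ominus>\<^bsub>W\<^esub> nab \<eta> (nab \<delta> w)) \<ominus>\<^bsub>W\<^esub> nab (lie_bracket A \<delta> \<eta>) w)"
    using assms by (intro module_endo_diff[of "lie_bracket A \<delta> \<eta>"] connection_along_bracket
        connection_along_nab[OF conn] V_bracket_closed)
  then show ?thesis by (auto simp: module_endo_def curvature_def)
qed

lemma curvature_swap:
  assumes V: "\<delta> \<in> carrier V" "\<eta> \<in> carrier V" and w: "w \<in> carrier W"
  shows "curvature A W nab \<eta> \<delta> w = \<ominus>\<^bsub>W\<^esub> curvature A W nab \<delta> \<eta> w"
proof -
  note b = V_bracket_closed[OF V]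
  have "lie_bracket A \<eta> \<delta> = (\<ominus> \<one>) \<odot>\<^bsub>V\<^esub> lie_bracket A \<delta> \<eta>"
    using V b by (intro V_eqI V_bracket_closed V_smult_closed)
      (auto simp: V_apply R.l_minus R.minus_eq R.minus_add R.a_comm)
  then have "nab (lie_bracket A \<eta> \<delta>) w = \<ominus>\<^bsub>W\<^esub> nab (lie_bracket A \<delta> \<eta>) w"
    using V b w by (simp add: connection_smult[OF conn] smult_l_minus)
  then show ?thesis using V w b
    by (simp add: curvature_def M.minus_eq M.minus_add M.a_ac)
qed

text \<open>The term \<open>\<delta>(c) \<nabla>\<^sub>\<eta>\<close> of the Leibniz rule is cancelled by the same term in \<open>[\<delta>, c \<eta>] = c [\<delta>, \<eta>] + \<delta>(c) \<eta>\<close>.\<close>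

lemma curvature_smult_right:
  assumes V: "\<delta> \<in> carrier V" "\<eta> \<in> carrier V" and c: "c \<in> carrier A" "w \<in> carrier W"
  shows "curvature A W nab \<delta> (c \<odot>\<^bsub>V\<^esub> \<eta>) w = c \<odot>\<^bsub>W\<^esub> curvature A W nab \<delta> \<eta> w"
proof -
  note d = is_derivationD[OF V_derivation[OF V(1)]]
  note b = V_bracket_closed[OF V]
  have "lie_bracket A \<delta> (c \<odot>\<^bsub>V\<^esub> \<eta>) = c \<odot>\<^bsub>V\<^esub> lie_bracket A \<delta> \<eta> \<oplus>\<^bsub>V\<^esub> \<delta> c \<odot>\<^bsub>V\<^esub> \<eta>"
    using V b c by (intro V_eqI V_bracket_closed V_smult_closed V_add_closed)
      (auto simp: V_apply d R.minus_eq R.r_distr R.r_minus R.a_ac)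
  then have "nab (lie_bracket A \<delta> (c \<odot>\<^bsub>V\<^esub> \<eta>)) w
      = c \<odot>\<^bsub>W\<^esub> nab (lie_bracket A \<delta> \<eta>) w \<oplus>\<^bsub>W\<^esub> \<delta> c \<odot>\<^bsub>W\<^esub> nab \<eta> w"
    using V b c by (simp add: connection_add[OF conn] connection_smult[OF conn] V_smult_closed)
  moreover have "((p \<oplus>\<^bsub>W\<^esub> e) \<ominus>\<^bsub>W\<^esub> q) \<ominus>\<^bsub>W\<^esub> (z \<oplus>\<^bsub>W\<^esub> e) = (p \<ominus>\<^bsub>W\<^esub> q) \<ominus>\<^bsub>W\<^esub> z"
    if "p \<in> carrier W" "q \<in> carrier W" "z \<in> carrier W" "e \<in> carrier W" for p q z e
  proof -
    have "((p \<oplus>\<^bsub>W\<^esub> e) \<ominus>\<^bsub>W\<^esub> q) \<ominus>\<^bsub>W\<^esub> (z \<oplus>\<^bsub>W\<^esub> e) = (e \<oplus>\<^bsub>W\<^esub> (p \<ominus>\<^bsub>W\<^esub> q)) \<ominus>\<^bsub>W\<^esub> (e \<oplus>\<^bsub>W\<^esub> z)"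
      using that by (simp add: M.minus_eq M.minus_add M.a_ac)
    then show ?thesis using that by (simp add: M.minus_cancel_left)
  qed
  ultimately show ?thesis using V b c connection_alongD(3)[OF connection_along_nab[OF conn V(1)]]
    by (simp add: curvature_def connection_smult[OF conn] M.minus_eq smult_r_distr smult_r_minus)
qed

lemma curvature_add_right:
  assumes V: "\<delta> \<in> carrier V" "\<eta> \<in> carrier V" "\<eta>' \<in> carrier V" and w: "w \<in> carrier W"
  shows "curvature A W nab \<delta> (\<eta> \<oplus>\<^bsub>V\<^esub> \<eta>') w = curvature A W nab \<delta> \<eta> w \<oplus>\<^bsub>W\<^esub> curvature A W nab \<delta> \<eta>' w"
proof -
  note d = is_derivationD[OF V_derivation[OF V(1)]]
  note b = V_bracket_closed[OF V(1,2)] V_bracket_closed[OF V(1,3)]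
  have "lie_bracket A \<delta> (\<eta> \<oplus>\<^bsub>V\<^esub> \<eta>') = lie_bracket A \<delta> \<eta> \<oplus>\<^bsub>V\<^esub> lie_bracket A \<delta> \<eta>'"
    using V b by (intro V_eqI V_bracket_closed V_add_closed)
      (auto simp: V_apply d R.minus_eq R.minus_add R.a_ac)
  then show ?thesis using V w b connection_alongD(2)[OF connection_along_nab[OF conn V(1)]]
    by (simp add: curvature_def connection_add[OF conn] M.minus_eq M.minus_add M.a_ac)
qed

lemma curvature_smult_left:
  assumes V: "\<delta> \<in> carrier V" "\<eta> \<in> carrier V" and c: "c \<in> carrier A" "w \<in> carrier W"
  shows "curvature A W nab (c \<odot>\<^bsub>V\<^esub> \<delta>) \<eta> w = c \<odot>\<^bsub>W\<^esub> curvature A W nab \<delta> \<eta> w"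
  using curvature_swap[of \<eta> "c \<odot>\<^bsub>V\<^esub> \<delta>" w] curvature_swap[of \<eta> \<delta> w]
    curvature_smult_right[of \<eta> \<delta> c w] module_endoD(1)[OF curvature_endo[of \<eta> \<delta>], of w] V c
  by (simp add: V_smult_closed smult_r_minus)

lemma curvature_add_left:
  assumes V: "\<delta> \<in> carrier V" "\<delta>' \<in> carrier V" "\<eta> \<in> carrier V" and w: "w \<in> carrier W"
  shows "curvature A W nab (\<delta> \<oplus>\<^bsub>V\<^esub> \<delta>') \<eta> w = curvature A W nab \<delta> \<eta> w \<oplus>\<^bsub>W\<^esub> curvature A W nab \<delta>' \<eta> w"
  using curvature_swap[of \<eta> "\<delta> \<oplus>\<^bsub>V\<^esub> \<delta>'" w] curvature_swap[of \<eta> \<delta> w] curvature_swap[of \<eta> \<delta>' w]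
    curvature_add_right[of \<eta> \<delta> \<delta>' w] module_endoD(1)[OF curvature_endo[of \<eta> \<delta>], of w]
    module_endoD(1)[OF curvature_endo[of \<eta> \<delta>'], of w] V w
  by (simp add: V_add_closed M.minus_add)

lemma curvature_self:
  assumes V: "\<delta> \<in> carrier V" and w: "w \<in> carrier W"
  shows "curvature A W nab \<delta> \<delta> w = \<zero>\<^bsub>W\<^esub>"
proof -
  have "lie_bracket A \<delta> \<delta> = \<zero> \<odot>\<^bsub>V\<^esub> \<delta>"
    using V by (intro V_eqI V_bracket_closed V_smult_closed) (auto simp: V_apply R.minus_eq R.r_neg)
  then have "nab (lie_bracket A \<delta> \<delta>) w = \<zero>\<^bsub>W\<^esub>"
    using connection_smult[OF conn V, of \<zero> w] V w by simp
  then show ?thesis using V w by (simp add: curvature_def M.minus_eq M.r_neg)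
qed

end

end

section \<open>Sections of sheaves on the spectrum\<close>

lemma zariski_open_subset_Spec: "zariski_open R N \<Longrightarrow> N \<subseteq> Spec R"
  by (auto simp: zariski_open_def)

lemma opens_inD: "N \<in> opens_in R U \<Longrightarrow> zariski_open R N" "N \<in> opens_in R U \<Longrightarrow> N \<subseteq> U"
  by (auto simp: opens_in_def)

context cring
begin

lemma mult_set_compl_prime:
  assumes "p \<in> Spec R" shows "mult_set R (carrier R - p)"
proof -
  interpret P: primeideal p R using assms by (simp add: Spec_def)
  show ?thesis
  proof unfold_locales
    show "\<one> \<in> carrier R - p" using P.I_notcarr P.one_imp_carrier by auto
    show "a \<otimes> b \<in> carrier R - p" if "a \<in> carrier R - p" "b \<in> carrier R - p" for a b
      using that P.I_prime by blast
  qed auto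
qed

lemma zariski_open_Int:
  assumes "zariski_open R N" "zariski_open R N'" shows "zariski_open R (N \<inter> N')"
proof -
  obtain E F where EF: "E \<subseteq> carrier R" "N = {p \<in> Spec R. \<not> E \<subseteq> p}"
    "F \<subseteq> carrier R" "N' = {p \<in> Spec R. \<not> F \<subseteq> p}"
    using assms by (auto simp: zariski_open_def)
  define G where "G = {a \<otimes> b | a b. a \<in> E \<and> b \<in> F}"
  have "\<not> G \<subseteq> p \<longleftrightarrow> \<not> E \<subseteq> p \<and> \<not> F \<subseteq> p" if "p \<in> Spec R" for p
  proof -
    interpret P: primeideal p R using that by (simp add: Spec_def)
    show ?thesis
    proof
      assume "\<not> G \<subseteq> p"
      then obtain a b where "a \<in> E" "b \<in> F" "a \<otimes> b \<notin> p" by (auto simp: G_def)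
      then show "\<not> E \<subseteq> p \<and> \<not> F \<subseteq> p" using EF P.I_l_closed P.I_r_closed by blast
    next
      assume "\<not> E \<subseteq> p \<and> \<not> F \<subseteq> p"
      then obtain a b where ab: "a \<in> E" "a \<notin> p" "b \<in> F" "b \<notin> p" by blast
      then have "a \<otimes> b \<notin> p" using P.I_prime EF by blast
      then show "\<not> G \<subseteq> p" using ab by (auto simp: G_def)
    qed
  qed
  then have "N \<inter> N' = {p \<in> Spec R. \<not> G \<subseteq> p}" unfolding EF(2,4) by blast
  moreover have "G \<subseteq> carrier R" using EF(1,3) by (auto simp: G_def)
  ultimately show ?thesis unfolding zariski_open_def by blast
qed

lemma zariski_open_basic:
  assumes "g \<in> carrier R" shows "zariski_open R {p \<in> Spec R. g \<notin> p}"
  unfolding zariski_open_def using assms by (intro exI[of _ "{g}"]) auto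

lemma sections_ext: "s \<in> sections R M N \<Longrightarrow> s \<in> extensional N"
  by (auto simp: sections_def PiE_iff)

lemma sections_locE:
  assumes "s \<in> sections R M N" "p \<in> N"
  obtains N' m g where "zariski_open R N'" "p \<in> N'" "N' \<subseteq> N" "m \<in> carrier M" "g \<in> carrier R"
    "\<And>q. q \<in> N' \<Longrightarrow> g \<notin> q" "\<And>q. q \<in> N' \<Longrightarrow> s q = frac (carrier R - q) M m g"
proof -
  have "\<exists>N'. zariski_open R N' \<and> p \<in> N' \<and> N' \<subseteq> N \<and>
      (\<exists>m\<in>carrier M. \<exists>g\<in>carrier R. \<forall>q\<in>N'. g \<notin> q \<and> s q = frac (carrier R - q) M m g)"
    using assms by (simp add: sections_def)
  then obtain N' m g where *: "zariski_open R N'" "p \<in> N'" "N' \<subseteq> N" "m \<in> carrier M" "g \<in> carrier R"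
    "\<forall>q\<in>N'. g \<notin> q \<and> s q = frac (carrier R - q) M m g" by (elim exE conjE bexE)
  show ?thesis by (rule that[OF *(1-5)]) (use *(6) in auto)
qed

lemma sections_stalk:
  assumes "s \<in> sections R M N" "p \<in> N" shows "s p \<in> carrier (stalk R M p)"
  using assms by (auto simp: sections_def PiE_iff)

lemma sectionsI:
  assumes "s \<in> extensional N"
    and "\<And>p. p \<in> N \<Longrightarrow> \<exists>N'. zariski_open R N' \<and> p \<in> N' \<and> N' \<subseteq> N \<and>
      (\<exists>m\<in>carrier M. \<exists>g\<in>carrier R. \<forall>q\<in>N'. g \<notin> q \<and> s q = frac (carrier R - q) M m g)"
  shows "s \<in> sections R M N"
proof -
  have "s p \<in> carrier (stalk R M p)" if p: "p \<in> N" for p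
  proof -
    obtain N' m g where *: "p \<in> N'" "m \<in> carrier M" "g \<in> carrier R"
      "\<forall>q\<in>N'. g \<notin> q \<and> s q = frac (carrier R - q) M m g"
      using assms(2)[OF p] by (elim exE conjE bexE)
    then show ?thesis unfolding loc_module_def by auto
  qed
  then show ?thesis using assms unfolding sections_def by (auto simp: PiE_iff)
qed

lemma sections_restrict:
  assumes "s \<in> sections R M N" "zariski_open R N'" "N' \<subseteq> N"
  shows "restrict s N' \<in> sections R M N'"
proof (rule sectionsI)
  fix p assume p: "p \<in> N'"
  obtain N'' m g where *: "zariski_open R N''" "p \<in> N''" "N'' \<subseteq> N" "m \<in> carrier M" "g \<in> carrier R"
    "\<And>q. q \<in> N'' \<Longrightarrow> g \<notin> q" "\<And>q. q \<in> N'' \<Longrightarrow> s q = frac (carrier R - q) M m g"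
    using sections_locE[OF assms(1), of p] assms p by blast
  show "\<exists>N''. zariski_open R N'' \<and> p \<in> N'' \<and> N'' \<subseteq> N' \<and>
      (\<exists>m\<in>carrier M. \<exists>g\<in>carrier R. \<forall>q\<in>N''. g \<notin> q \<and> restrict s N' q = frac (carrier R - q) M m g)"
    by (intro exI[of _ "N' \<inter> N''"] conjI bexI[of _ m] bexI[of _ g])
      (use * p assms zariski_open_Int in auto)
qed simp

text \<open>An operation on stalks that is given by one formula on representing fractions takes sections
  to sections.\<close>

lemma sections_binop:
  assumes N: "zariski_open R N" and s: "s \<in> sections R M1 N" and t: "t \<in> sections R M2 N"
    and F: "\<And>m g n h. \<lbrakk>m \<in> carrier M1; g \<in> carrier R; n \<in> carrier M2; h \<in> carrier R\<rbrakk> \<Longrightarrow>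
      \<exists>k\<in>carrier M3. \<exists>e\<in>carrier R. \<forall>q\<in>Spec R. g \<notin> q \<longrightarrow> h \<notin> q \<longrightarrow> e \<notin> q \<and>
        F q (frac (carrier R - q) M1 m g) (frac (carrier R - q) M2 n h) = frac (carrier R - q) M3 k e"
  shows "(\<lambda>p\<in>N. F p (s p) (t p)) \<in> sections R M3 N"
proof (rule sectionsI)
  fix p assume p: "p \<in> N"
  obtain N1 m g where 1: "zariski_open R N1" "p \<in> N1" "N1 \<subseteq> N" "m \<in> carrier M1" "g \<in> carrier R"
    "\<And>q. q \<in> N1 \<Longrightarrow> g \<notin> q" "\<And>q. q \<in> N1 \<Longrightarrow> s q = frac (carrier R - q) M1 m g"
    using sections_locE[OF s p] by blast
  obtain N2 n h where 2: "zariski_open R N2" "p \<in> N2" "N2 \<subseteq> N" "n \<in> carrier M2" "h \<in> carrier R"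
    "\<And>q. q \<in> N2 \<Longrightarrow> h \<notin> q" "\<And>q. q \<in> N2 \<Longrightarrow> t q = frac (carrier R - q) M2 n h"
    using sections_locE[OF t p] by blast
  obtain k e where ke: "k \<in> carrier M3" "e \<in> carrier R"
    "\<forall>q\<in>Spec R. g \<notin> q \<longrightarrow> h \<notin> q \<longrightarrow> e \<notin> q \<and>
      F q (frac (carrier R - q) M1 m g) (frac (carrier R - q) M2 n h) = frac (carrier R - q) M3 k e"
    using F[OF 1(4,5) 2(4,5)] by blast
  have sp: "N \<subseteq> Spec R" using N by (rule zariski_open_subset_Spec)
  show "\<exists>N'. zariski_open R N' \<and> p \<in> N' \<and> N' \<subseteq> N \<and> (\<exists>m\<in>carrier M3. \<exists>g\<in>carrier R. \<forall>q\<in>N'. g \<notin> q \<and>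
      (\<lambda>p\<in>N. F p (s p) (t p)) q = frac (carrier R - q) M3 m g)"
  proof (intro exI[of _ "N1 \<inter> N2"] conjI bexI[of _ k] bexI[of _ e] ballI)
    fix q assume q: "q \<in> N1 \<inter> N2"
    then have "q \<in> Spec R" "q \<in> N" "g \<notin> q" "h \<notin> q" using 1 2 sp by auto
    then show "e \<notin> q" "(\<lambda>p\<in>N. F p (s p) (t p)) q = frac (carrier R - q) M3 k e"
      using ke(3) q 1(7) 2(7) by auto
  qed (use 1 2 ke zariski_open_Int in auto)
qed simp

lemma sections_unop:
  assumes N: "zariski_open R N" and s: "s \<in> sections R M1 N"
    and F: "\<And>m g. \<lbrakk>m \<in> carrier M1; g \<in> carrier R\<rbrakk> \<Longrightarrow>
      \<exists>k\<in>carrier M3. \<exists>e\<in>carrier R. \<forall>q\<in>Spec R. g \<notin> q \<longrightarrow> e \<notin> q \<and>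
        F q (frac (carrier R - q) M1 m g) = frac (carrier R - q) M3 k e"
  shows "(\<lambda>p\<in>N. F p (s p)) \<in> sections R M3 N"
proof (rule sections_binop[OF N s s, where F = "\<lambda>p x y. F p x"])
  fix m g n h assume c: "m \<in> carrier M1" "g \<in> carrier R"
  show "\<exists>k\<in>carrier M3. \<exists>e\<in>carrier R. \<forall>q\<in>Spec R. g \<notin> q \<longrightarrow> h \<notin> q \<longrightarrow> e \<notin> q \<and>
      F q (frac (carrier R - q) M1 m g) = frac (carrier R - q) M3 k e"
  proof -
    obtain k e where ke: "k \<in> carrier M3" "e \<in> carrier R"
      "\<forall>q\<in>Spec R. g \<notin> q \<longrightarrow> e \<notin> q \<and>
        F q (frac (carrier R - q) M1 m g) = frac (carrier R - q) M3 k e"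
      using F[OF c] by (elim bexE)
    then show ?thesis by (intro bexI[OF _ ke(1)] bexI[OF _ ke(2)]) simp
  qed
qed

lemma not_in_prime_mult: "\<lbrakk>q \<in> Spec R; g \<in> carrier R; h \<in> carrier R; g \<notin> q; h \<notin> q\<rbrakk> \<Longrightarrow> g \<otimes> h \<notin> q"
  using primeideal.I_prime by (fastforce simp: Spec_def)

lemma stalk_cring: "p \<in> Spec R \<Longrightarrow> cring (stalk_ring R p)"
  using mult_set.loc_ring_cring[OF mult_set_compl_prime] .

abbreviation "Osec N \<equiv> sections R (reg_module R) N"

lemma Osec_stalk: "\<lbrakk>s \<in> Osec N; p \<in> N\<rbrakk> \<Longrightarrow> s p \<in> carrier (stalk_ring R p)"
  using sections_stalk[of s "reg_module R" N p] by (simp add: loc_ring_def loc_module_def)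

lemma stalk_ring_ops:
  assumes "q \<in> Spec R" "a \<in> carrier R" "b \<in> carrier R" "g \<in> carrier R - q" "h \<in> carrier R - q"
  shows "frac (carrier R - q) (reg_module R) a g \<oplus>\<^bsub>stalk_ring R q\<^esub> frac (carrier R - q) (reg_module R) b h
      = frac (carrier R - q) (reg_module R) (h \<otimes> a \<oplus> g \<otimes> b) (g \<otimes> h)"
    and "frac (carrier R - q) (reg_module R) a g \<otimes>\<^bsub>stalk_ring R q\<^esub> frac (carrier R - q) (reg_module R) b h
      = frac (carrier R - q) (reg_module R) (a \<otimes> b) (g \<otimes> h)"
    and "\<ominus>\<^bsub>stalk_ring R q\<^esub> frac (carrier R - q) (reg_module R) a g
      = frac (carrier R - q) (reg_module R) (\<ominus> a) g"
proof -
  interpret mult_set R "carrier R - q" using assms(1) by (rule mult_set_compl_prime)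
  interpret K: cring "stalk_ring R q" by (rule loc_ring_cring)
  show "frac (carrier R - q) (reg_module R) a g \<oplus>\<^bsub>stalk_ring R q\<^esub> frac (carrier R - q) (reg_module R) b h
      = frac (carrier R - q) (reg_module R) (h \<otimes> a \<oplus> g \<otimes> b) (g \<otimes> h)"
    "frac (carrier R - q) (reg_module R) a g \<otimes>\<^bsub>stalk_ring R q\<^esub> frac (carrier R - q) (reg_module R) b h
      = frac (carrier R - q) (reg_module R) (a \<otimes> b) (g \<otimes> h)"
    using assms by (simp_all add: loc_ring_add loc_ring_mult)
  have gg: "g \<otimes> g \<in> carrier R - q" "\<one> \<in> carrier R - q"
    using mult_in_S[OF assms(4) assms(4)] by (auto simp: one_in_S[simplified])
  have "frac (carrier R - q) (reg_module R) (g \<otimes> \<ominus> a \<oplus> g \<otimes> a) (g \<otimes> g) = \<zero>\<^bsub>stalk_ring R q\<^esub>"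
    unfolding loc_ring_zero using assms gg
    by (intro frac_eqI[OF module_reg_module, of _ _ _ _ \<one>]) (auto simp: l_neg simp flip: r_distr)
  then show "\<ominus>\<^bsub>stalk_ring R q\<^esub> frac (carrier R - q) (reg_module R) a g
      = frac (carrier R - q) (reg_module R) (\<ominus> a) g"
    using assms by (intro K.minus_equality) (auto simp: loc_ring_add)
qed

lemma sec_ring_sel [simp]:
  "carrier (sec_ring R N) = Osec N"
  "x \<oplus>\<^bsub>sec_ring R N\<^esub> y = (\<lambda>p\<in>N. x p \<oplus>\<^bsub>stalk_ring R p\<^esub> y p)"
  "x \<otimes>\<^bsub>sec_ring R N\<^esub> y = (\<lambda>p\<in>N. x p \<otimes>\<^bsub>stalk_ring R p\<^esub> y p)"
  "\<zero>\<^bsub>sec_ring R N\<^esub> = (\<lambda>p\<in>N. \<zero>\<^bsub>stalk_ring R p\<^esub>)"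
  "\<one>\<^bsub>sec_ring R N\<^esub> = (\<lambda>p\<in>N. \<one>\<^bsub>stalk_ring R p\<^esub>)"
  by (simp_all add: sec_ring_def)

lemma Osec_closed:
  assumes N: "zariski_open R N"
  shows "\<lbrakk>x \<in> Osec N; y \<in> Osec N\<rbrakk> \<Longrightarrow> (\<lambda>p\<in>N. x p \<oplus>\<^bsub>stalk_ring R p\<^esub> y p) \<in> Osec N"
    and "\<lbrakk>x \<in> Osec N; y \<in> Osec N\<rbrakk> \<Longrightarrow> (\<lambda>p\<in>N. x p \<otimes>\<^bsub>stalk_ring R p\<^esub> y p) \<in> Osec N"
    and "x \<in> Osec N \<Longrightarrow> (\<lambda>p\<in>N. \<ominus>\<^bsub>stalk_ring R p\<^esub> x p) \<in> Osec N"
    and "(\<lambda>p\<in>N. \<zero>\<^bsub>stalk_ring R p\<^esub>) \<in> Osec N"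
    and "(\<lambda>p\<in>N. \<one>\<^bsub>stalk_ring R p\<^esub>) \<in> Osec N"
proof -
  show "(\<lambda>p\<in>N. x p \<oplus>\<^bsub>stalk_ring R p\<^esub> y p) \<in> Osec N" if "x \<in> Osec N" "y \<in> Osec N"
  proof (rule sections_binop[OF N that])
    fix m g n h assume c: "m \<in> carrier (reg_module R)" "g \<in> carrier R"
      "n \<in> carrier (reg_module R)" "h \<in> carrier R"
    show "\<exists>k\<in>carrier (reg_module R). \<exists>e\<in>carrier R. \<forall>q\<in>Spec R. g \<notin> q \<longrightarrow> h \<notin> q \<longrightarrow> e \<notin> q \<and>
      frac (carrier R - q) (reg_module R) m g \<oplus>\<^bsub>stalk_ring R q\<^esub> frac (carrier R - q) (reg_module R) n h
        = frac (carrier R - q) (reg_module R) k e"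
      by (intro bexI[of _ "h \<otimes> m \<oplus> g \<otimes> n"] bexI[of _ "g \<otimes> h"])
        (use c in \<open>auto simp: stalk_ring_ops not_in_prime_mult\<close>)
  qed
  show "(\<lambda>p\<in>N. x p \<otimes>\<^bsub>stalk_ring R p\<^esub> y p) \<in> Osec N" if "x \<in> Osec N" "y \<in> Osec N"
  proof (rule sections_binop[OF N that])
    fix m g n h assume c: "m \<in> carrier (reg_module R)" "g \<in> carrier R"
      "n \<in> carrier (reg_module R)" "h \<in> carrier R"
    show "\<exists>k\<in>carrier (reg_module R). \<exists>e\<in>carrier R. \<forall>q\<in>Spec R. g \<notin> q \<longrightarrow> h \<notin> q \<longrightarrow> e \<notin> q \<and>
      frac (carrier R - q) (reg_module R) m g \<otimes>\<^bsub>stalk_ring R q\<^esub> frac (carrier R - q) (reg_module R) n h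
        = frac (carrier R - q) (reg_module R) k e"
      by (intro bexI[of _ "m \<otimes> n"] bexI[of _ "g \<otimes> h"])
        (use c in \<open>auto simp: stalk_ring_ops not_in_prime_mult\<close>)
  qed
  show "(\<lambda>p\<in>N. \<ominus>\<^bsub>stalk_ring R p\<^esub> x p) \<in> Osec N" if "x \<in> Osec N"
  proof (rule sections_unop[OF N that])
    fix m g assume c: "m \<in> carrier (reg_module R)" "g \<in> carrier R"
    show "\<exists>k\<in>carrier (reg_module R). \<exists>e\<in>carrier R. \<forall>q\<in>Spec R. g \<notin> q \<longrightarrow> e \<notin> q \<and>
      \<ominus>\<^bsub>stalk_ring R q\<^esub> frac (carrier R - q) (reg_module R) m g = frac (carrier R - q) (reg_module R) k e"
      by (intro bexI[of _ "\<ominus> m"] bexI[of _ g]) (use c in \<open>auto simp: stalk_ring_ops\<close>)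
  qed
  have "\<one> \<notin> q" if "q \<in> N" for q
    using mult_set.one_in_S[OF mult_set_compl_prime] zariski_open_subset_Spec[OF N] that by blast
  moreover have "(\<lambda>p\<in>N. frac (carrier R - p) (reg_module R) a \<one>) \<in> Osec N"
    if "a \<in> carrier R" "\<And>q. q \<in> N \<Longrightarrow> \<one> \<notin> q" for a
    by (rule sectionsI, simp, intro exI[of _ N] conjI bexI[of _ a] bexI[of _ \<one>])
      (use that N in auto)
  ultimately show "(\<lambda>p\<in>N. \<zero>\<^bsub>stalk_ring R p\<^esub>) \<in> Osec N" "(\<lambda>p\<in>N. \<one>\<^bsub>stalk_ring R p\<^esub>) \<in> Osec N"
    by (simp_all add: loc_ring_def)
qed

lemma sec_ring_eqI:
  "\<lbrakk>x \<in> extensional N; y \<in> extensional N; \<And>p. p \<in> N \<Longrightarrow> x p = y p\<rbrakk> \<Longrightarrow> x = y"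
  by (rule extensionalityI)

lemma sec_ring_cring:
  assumes N: "zariski_open R N" shows "cring (sec_ring R N)"
proof -
  have K: "cring (stalk_ring R p)" if "p \<in> N" for p
    using stalk_cring zariski_open_subset_Spec[OF N] that by blast
  note Kr = cring.cring_simprules[OF K]
  show ?thesis
  proof (rule cringI)
  show "abelian_group (sec_ring R N)"
  proof (rule abelian_groupI)
    fix x assume x: "x \<in> carrier (sec_ring R N)"
    then show "\<exists>y\<in>carrier (sec_ring R N). y \<oplus>\<^bsub>sec_ring R N\<^esub> x = \<zero>\<^bsub>sec_ring R N\<^esub>"
      by (intro bexI[of _ "\<lambda>p\<in>N. \<ominus>\<^bsub>stalk_ring R p\<^esub> x p"])
        (auto simp: Osec_closed[OF N] Kr Osec_stalk intro!: restrict_ext)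
    show "\<zero>\<^bsub>sec_ring R N\<^esub> \<oplus>\<^bsub>sec_ring R N\<^esub> x = x"
      by (rule sec_ring_eqI[of _ N]) (use x in \<open>auto simp: Kr Osec_stalk sections_ext\<close>)
  qed (auto simp: Osec_closed[OF N] Kr Osec_stalk intro!: restrict_ext)
  show "comm_monoid (sec_ring R N)"
  proof (rule comm_monoidI)
    fix x assume x: "x \<in> carrier (sec_ring R N)"
    show "\<one>\<^bsub>sec_ring R N\<^esub> \<otimes>\<^bsub>sec_ring R N\<^esub> x = x"
      by (rule sec_ring_eqI[of _ N])
        (use x monoid.l_one[OF ring.is_monoid[OF cring.axioms(1)[OF K]]] in \<open>auto simp: Osec_stalk sections_ext\<close>)
  qed (auto simp: Osec_closed[OF N] Kr Osec_stalk intro!: restrict_ext)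
  qed (auto simp: Osec_closed[OF N] Kr Osec_stalk intro!: restrict_ext)
qed

lemma sec_ring_a_inv:
  assumes N: "zariski_open R N" and x: "x \<in> Osec N"
  shows "\<ominus>\<^bsub>sec_ring R N\<^esub> x = (\<lambda>p\<in>N. \<ominus>\<^bsub>stalk_ring R p\<^esub> x p)"
proof -
  interpret O: cring "sec_ring R N" by (rule sec_ring_cring[OF N])
  have "ring (stalk_ring R p)" if "p \<in> N" for p
    using stalk_cring zariski_open_subset_Spec[OF N] that cring.axioms(1) by blast
  then show ?thesis using x
    by (intro O.minus_equality) (auto simp: Osec_closed[OF N] Osec_stalk ring.ring_simprules intro!: restrict_ext)
qed

end

section \<open>The stalks of the Lie-Rinehart algebra\<close>

lemma (in abelian_group) minus_minus_add_cancel: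
  assumes "p \<in> carrier G" "q \<in> carrier G" "r \<in> carrier G" "x \<in> carrier G" "y \<in> carrier G"
  shows "((p \<ominus> (x \<oplus> q)) \<ominus> r) \<oplus> (x \<oplus> y) = ((p \<ominus> q) \<ominus> r) \<oplus> y"
    and "(((x \<oplus> p) \<ominus> q) \<ominus> (x \<oplus> r)) \<oplus> y = ((p \<ominus> q) \<ominus> r) \<oplus> y"
proof -
  have "((p \<ominus> (x \<oplus> q)) \<ominus> r) \<oplus> (x \<oplus> y) = (x \<ominus> x) \<oplus> (((p \<ominus> q) \<ominus> r) \<oplus> y)"
    "(((x \<oplus> p) \<ominus> q) \<ominus> (x \<oplus> r)) \<oplus> y = (x \<ominus> x) \<oplus> (((p \<ominus> q) \<ominus> r) \<oplus> y)"
    using assms by (simp_all add: minus_eq minus_add a_ac del: r_neg)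
  then show "((p \<ominus> (x \<oplus> q)) \<ominus> r) \<oplus> (x \<oplus> y) = ((p \<ominus> q) \<ominus> r) \<oplus> y"
    "(((x \<oplus> p) \<ominus> q) \<ominus> (x \<oplus> r)) \<oplus> y = ((p \<ominus> q) \<ominus> r) \<oplus> y"
    using assms by (simp_all add: minus_eq r_neg)
qed

lemma (in abelian_group) coboundary_cancel:
  assumes "a \<in> carrier G" "b \<in> carrier G" "k \<in> carrier G" "l \<in> carrier G" "z \<in> carrier G"
  shows "((\<ominus> k \<oplus> a) \<ominus> (\<ominus> l \<oplus> b)) \<ominus> ((z \<ominus> k) \<oplus> l) = (a \<ominus> b) \<ominus> z"
proof -
  have "((\<ominus> k \<oplus> a) \<ominus> (\<ominus> l \<oplus> b)) \<ominus> ((z \<ominus> k) \<oplus> l) = (k \<oplus> \<ominus> k) \<oplus> ((l \<oplus> \<ominus> l) \<oplus> ((a \<ominus> b) \<ominus> z))"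
    using assms by (simp add: minus_eq minus_add a_ac del: r_neg)
  then show ?thesis using assms by (simp add: r_neg)
qed

context algebra_module
begin

abbreviation "compl p \<equiv> carrier A - p"
abbreviation "frA p \<equiv> frac (compl p) (reg_module A)"
abbreviation "frV p \<equiv> frac (compl p) V"

text \<open>The numerator of \<open>[\<delta>/s, \<eta>/t]\<close> over the denominator \<open>s\<^sup>2 t\<^sup>2\<close>.\<close>

definition bracket_num :: "('a \<Rightarrow> 'a) \<Rightarrow> 'a \<Rightarrow> ('a \<Rightarrow> 'a) \<Rightarrow> 'a \<Rightarrow> 'a \<Rightarrow> 'a" where
  "bracket_num \<delta> s \<eta> t = (((s \<otimes> t) \<odot>\<^bsub>V\<^esub> lie_bracket A \<delta> \<eta>) \<ominus>\<^bsub>V\<^esub> ((s \<otimes> \<delta> t) \<odot>\<^bsub>V\<^esub> \<eta>))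
     \<oplus>\<^bsub>V\<^esub> ((t \<otimes> \<eta> s) \<odot>\<^bsub>V\<^esub> \<delta>)"

lemma bracket_num_closed:
  "\<lbrakk>\<delta> \<in> carrier V; \<eta> \<in> carrier V; s \<in> carrier A; t \<in> carrier A\<rbrakk> \<Longrightarrow> bracket_num \<delta> s \<eta> t \<in> carrier V"
  by (simp add: bracket_num_def V_bracket_closed)

lemma bracket_num_apply:
  assumes "\<delta> \<in> carrier V" "\<eta> \<in> carrier V" "s \<in> carrier A" "t \<in> carrier A" "a \<in> carrier A"
  shows "bracket_num \<delta> s \<eta> t a = ((s \<otimes> t) \<otimes> (\<delta> (\<eta> a) \<ominus> \<eta> (\<delta> a)) \<ominus> (s \<otimes> \<delta> t) \<otimes> \<eta> a)
    \<oplus> (t \<otimes> \<eta> s) \<otimes> \<delta> a"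
  using assms by (simp add: bracket_num_def V_apply V_minus_apply V_bracket_closed)

lemma bracket_num_scale1:
  assumes c: "\<delta> \<in> carrier V" "\<eta> \<in> carrier V" "s \<in> carrier A" "t \<in> carrier A" "u \<in> carrier A"
  shows "bracket_num (u \<odot>\<^bsub>V\<^esub> \<delta>) (u \<otimes> s) \<eta> t = (u \<otimes> u) \<odot>\<^bsub>V\<^esub> bracket_num \<delta> s \<eta> t"
proof (rule V_eqI)
  fix a assume a: "a \<in> carrier A"
  note d = is_derivationD(3)[OF V_derivation[OF c(2)]]
  let ?x = "(u \<otimes> s \<otimes> t) \<otimes> (\<eta> u \<otimes> \<delta> a)" and ?y = "(u \<otimes> u) \<otimes> ((t \<otimes> \<eta> s) \<otimes> \<delta> a)"
  let ?p = "(u \<otimes> s \<otimes> t) \<otimes> (u \<otimes> \<delta> (\<eta> a))" and ?q = "(u \<otimes> s \<otimes> t) \<otimes> (u \<otimes> \<eta> (\<delta> a))"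
  let ?r = "(u \<otimes> u) \<otimes> ((s \<otimes> \<delta> t) \<otimes> \<eta> a)"
  have "bracket_num (u \<odot>\<^bsub>V\<^esub> \<delta>) (u \<otimes> s) \<eta> t a = ((?p \<ominus> (?x \<oplus> ?q)) \<ominus> ?r) \<oplus> (?x \<oplus> ?y)"
    using a c by (simp add: bracket_num_apply V_apply d R.minus_eq R.r_distr R.l_distr R.r_minus R.m_ac R.a_ac)
  also have "\<dots> = ((?p \<ominus> ?q) \<ominus> ?r) \<oplus> ?y"
    using a c by (intro R.minus_minus_add_cancel) auto
  also have "\<dots> = ((u \<otimes> u) \<odot>\<^bsub>V\<^esub> bracket_num \<delta> s \<eta> t) a"
    using a c by (simp add: bracket_num_apply V_apply R.minus_eq R.r_distr R.r_minus R.m_ac)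
  finally show "bracket_num (u \<odot>\<^bsub>V\<^esub> \<delta>) (u \<otimes> s) \<eta> t a = ((u \<otimes> u) \<odot>\<^bsub>V\<^esub> bracket_num \<delta> s \<eta> t) a" .
qed (use c in \<open>auto intro: bracket_num_closed\<close>)

lemma bracket_num_scale2:
  assumes c: "\<delta> \<in> carrier V" "\<eta> \<in> carrier V" "s \<in> carrier A" "t \<in> carrier A" "u \<in> carrier A"
  shows "bracket_num \<delta> s (u \<odot>\<^bsub>V\<^esub> \<eta>) (u \<otimes> t) = (u \<otimes> u) \<odot>\<^bsub>V\<^esub> bracket_num \<delta> s \<eta> t"
proof (rule V_eqI)
  fix a assume a: "a \<in> carrier A"
  note d = is_derivationD(3)[OF V_derivation[OF c(1)]]
  let ?x = "(u \<otimes> s \<otimes> t) \<otimes> (\<delta> u \<otimes> \<eta> a)" and ?y = "(u \<otimes> u) \<otimes> ((t \<otimes> \<eta> s) \<otimes> \<delta> a)"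
  let ?p = "(u \<otimes> s \<otimes> t) \<otimes> (u \<otimes> \<delta> (\<eta> a))" and ?q = "(u \<otimes> s \<otimes> t) \<otimes> (u \<otimes> \<eta> (\<delta> a))"
  let ?r = "(u \<otimes> u) \<otimes> ((s \<otimes> \<delta> t) \<otimes> \<eta> a)"
  have "bracket_num \<delta> s (u \<odot>\<^bsub>V\<^esub> \<eta>) (u \<otimes> t) a = (((?x \<oplus> ?p) \<ominus> ?q) \<ominus> (?x \<oplus> ?r)) \<oplus> ?y"
    using a c by (simp add: bracket_num_apply V_apply d R.minus_eq R.r_distr R.l_distr R.r_minus R.m_ac R.minus_add R.a_ac)
  also have "\<dots> = ((?p \<ominus> ?q) \<ominus> ?r) \<oplus> ?y"
    using a c by (intro R.minus_minus_add_cancel) auto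
  also have "\<dots> = ((u \<otimes> u) \<odot>\<^bsub>V\<^esub> bracket_num \<delta> s \<eta> t) a"
    using a c by (simp add: bracket_num_apply V_apply R.minus_eq R.r_distr R.r_minus R.m_ac)
  finally show "bracket_num \<delta> s (u \<odot>\<^bsub>V\<^esub> \<eta>) (u \<otimes> t) a = ((u \<otimes> u) \<odot>\<^bsub>V\<^esub> bracket_num \<delta> s \<eta> t) a" .
qed (use c in \<open>auto intro: bracket_num_closed\<close>)

text \<open>The bracket is defined as a union over all representatives. It is evaluated at one of them, because enlarging a
  fraction by \<open>u\<close> multiplies numerator and denominator of the bracket by \<open>u\<^sup>2\<close>.\<close>

lemma stalk_bracket_eq:
  assumes p: "p \<in> Spec A" and c: "\<delta> \<in> carrier V" "\<eta> \<in> carrier V" "s \<in> compl p" "t \<in> compl p"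
  shows "stalk_bracket A V p (frV p \<delta> s) (frV p \<eta> t)
    = frV p (bracket_num \<delta> s \<eta> t) ((s \<otimes> s) \<otimes> (t \<otimes> t))"
proof -
  interpret P: mult_set A "compl p" using p by (rule R.mult_set_compl_prime)
  note [simp del] = P.S_carrier
  have sc: "frV p ((u \<otimes> u) \<odot>\<^bsub>V\<^esub> b) d = frV p b e"
    if "u \<in> compl p" "b \<in> carrier V" "e \<in> compl p" "d = (u \<otimes> u) \<otimes> e" for u b e d
    unfolding that(4) by (rule P.frac_scale[OF V_module that(2,3) P.mult_in_S[OF that(1) that(1)]])
  have c': "s \<in> carrier A" if "s \<in> compl p" for s using that by simp
  show ?thesis
    unfolding stalk_bracket_def bracket_num_def[symmetric]
  proof (rule P.frac_UN2[OF V_module _ _ V_module])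
    fix u \<delta> s \<eta> t assume *: "u \<in> compl p" "\<delta> \<in> carrier V" "s \<in> compl p" "\<eta> \<in> carrier V" "t \<in> compl p"
    have e: "(s \<otimes> s) \<otimes> (t \<otimes> t) \<in> compl p" using * by (intro P.mult_in_S)
    note ** = c'[OF *(1)] c'[OF *(3)] c'[OF *(5)]
    show "frV p (bracket_num (u \<odot>\<^bsub>V\<^esub> \<delta>) (u \<otimes> s) \<eta> t) ((u \<otimes> s \<otimes> (u \<otimes> s)) \<otimes> (t \<otimes> t))
        = frV p (bracket_num \<delta> s \<eta> t) ((s \<otimes> s) \<otimes> (t \<otimes> t))"
      unfolding bracket_num_scale1[OF *(2,4) **(2,3,1)]
      by (rule sc[OF *(1) bracket_num_closed[OF *(2,4) **(2,3)] e]) (use ** in \<open>simp add: R.m_ac\<close>)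
    show "frV p (bracket_num \<delta> s (u \<odot>\<^bsub>V\<^esub> \<eta>) (u \<otimes> t)) ((s \<otimes> s) \<otimes> (u \<otimes> t \<otimes> (u \<otimes> t)))
        = frV p (bracket_num \<delta> s \<eta> t) ((s \<otimes> s) \<otimes> (t \<otimes> t))"
      unfolding bracket_num_scale2[OF *(2,4) **(2,3,1)]
      by (rule sc[OF *(1) bracket_num_closed[OF *(2,4) **(2,3)] e]) (use ** in \<open>simp add: R.m_ac\<close>)
  qed (use c in auto)
qed

text \<open>The action of \<open>\<delta>/s\<close> is the extension of \<open>\<delta>\<close> by the quotient rule, divided by \<open>s\<close>.\<close>

lemma stalk_act_eq:
  assumes p: "p \<in> Spec A" and c: "\<delta> \<in> carrier V" "s \<in> compl p" and x: "x \<in> carrier (stalk_ring A p)"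
  shows "stalk_act A p (frV p \<delta> s) x = frA p \<one> s \<otimes>\<^bsub>stalk_ring A p\<^esub> mult_set.loc_der A (compl p) \<delta> x"
proof -
  interpret P: mult_set A "compl p" using p by (rule R.mult_set_compl_prime)
  note [simp del] = P.S_carrier
  obtain a t where x: "a \<in> carrier A" "t \<in> compl p" "x = frA p a t"
    using x by (rule P.loc_ring_carrierE)
  have c': "s \<in> carrier A" if "s \<in> compl p" for s using that by simp
  have num: "t \<otimes> \<delta> a \<ominus> a \<otimes> \<delta> t \<in> carrier A"
    if "\<delta> \<in> carrier V" "a \<in> carrier A" "t \<in> compl p" for \<delta> a t using that by simp
  have "stalk_act A p (frV p \<delta> s) x = frA p (t \<otimes> \<delta> a \<ominus> a \<otimes> \<delta> t) (s \<otimes> (t \<otimes> t))"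
    unfolding stalk_act_def x(3)
  proof (rule P.frac_UN2[OF V_module _ _ R.module_reg_module])
    fix u \<delta> s a t assume *: "u \<in> compl p" "\<delta> \<in> carrier V" "s \<in> compl p"
      "a \<in> carrier (reg_module A)" "t \<in> compl p"
    have tt: "t \<otimes> t \<in> compl p" "s \<otimes> (t \<otimes> t) \<in> compl p" using * by (auto intro: P.mult_in_S simp del: Diff_iff)
    note ** = c'[OF *(1)] c'[OF *(3)] c'[OF *(5)] *(4)[simplified]
    have "t \<otimes> (u \<odot>\<^bsub>V\<^esub> \<delta>) a \<ominus> a \<otimes> (u \<odot>\<^bsub>V\<^esub> \<delta>) t = u \<otimes> (t \<otimes> \<delta> a \<ominus> a \<otimes> \<delta> t)"
      using * ** by (simp add: V_apply R.minus_eq R.r_distr R.r_minus R.m_ac)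
    moreover have "u \<otimes> s \<otimes> (t \<otimes> t) = u \<otimes> (s \<otimes> (t \<otimes> t))" using ** by (simp add: R.m_ac)
    ultimately show "frA p (t \<otimes> (u \<odot>\<^bsub>V\<^esub> \<delta>) a \<ominus> a \<otimes> (u \<odot>\<^bsub>V\<^esub> \<delta>) t) (u \<otimes> s \<otimes> (t \<otimes> t))
        = frA p (t \<otimes> \<delta> a \<ominus> a \<otimes> \<delta> t) (s \<otimes> (t \<otimes> t))"
      using P.frac_scale[OF R.module_reg_module, of "t \<otimes> \<delta> a \<ominus> a \<otimes> \<delta> t", OF _ tt(2) *(1)] num * ** by simp
    have e: "frA p n d \<otimes>\<^bsub>stalk_ring A p\<^esub> frA p \<one> s = frA p n (s \<otimes> d)"
      if "n \<in> carrier A" "d \<in> compl p" for n d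
      using that *(3) ** P.loc_ring_mult[of n \<one> d s] P.one_in_S by (simp add: R.m_comm)
    have ut: "u \<otimes> t \<in> compl p" "u \<otimes> t \<otimes> (u \<otimes> t) \<in> compl p" using * by (auto intro: P.mult_in_S simp del: Diff_iff)
    have ua: "u \<otimes> a \<in> carrier A" using ** by simp
    have "frA p ((u \<otimes> t) \<otimes> \<delta> (u \<otimes> a) \<ominus> (u \<otimes> a) \<otimes> \<delta> (u \<otimes> t)) (s \<otimes> ((u \<otimes> t) \<otimes> (u \<otimes> t)))
        = frA p (t \<otimes> \<delta> a \<ominus> a \<otimes> \<delta> t) (s \<otimes> (t \<otimes> t))"
      using e[OF num[OF *(2) ua ut(1)] ut(2)] e[OF num[OF *(2) **(4) *(5)] tt(1)]
      unfolding P.loc_der_scale[OF V_derivation[OF *(2)] *(1) **(4) *(5)] by (rule trans[OF sym])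
    then show "frA p ((u \<otimes> t) \<otimes> \<delta> (u \<odot>\<^bsub>reg_module A\<^esub> a) \<ominus> (u \<odot>\<^bsub>reg_module A\<^esub> a) \<otimes> \<delta> (u \<otimes> t))
        (s \<otimes> ((u \<otimes> t) \<otimes> (u \<otimes> t))) = frA p (t \<otimes> \<delta> a \<ominus> a \<otimes> \<delta> t) (s \<otimes> (t \<otimes> t))" by simp
  qed (use c x in auto)
  also have "\<dots> = frA p \<one> s \<otimes>\<^bsub>stalk_ring A p\<^esub> frA p (t \<otimes> \<delta> a \<ominus> a \<otimes> \<delta> t) (t \<otimes> t)"
    using P.loc_ring_mult[of \<one> "t \<otimes> \<delta> a \<ominus> a \<otimes> \<delta> t" s "t \<otimes> t"] c x P.mult_in_S[OF x(2) x(2)] num[OF c(1) x(1,2)]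
    by simp
  finally show ?thesis using P.loc_der_fr[OF V_derivation[OF c(1)] x(1,2)] by (simp add: x(3))
qed

end

section \<open>The first Chern class of a module with a flat connection\<close>

lemma (in cring) mult_set_powers:
  assumes "g \<in> carrier R" shows "mult_set R {g [^] i | i :: nat. True}"
proof unfold_locales
  show "\<one> \<in> {g [^] i | i :: nat. True}" by (auto intro!: exI[of _ "0 :: nat"])
  fix a b assume "a \<in> {g [^] i | i :: nat. True}" "b \<in> {g [^] i | i :: nat. True}"
  then show "a \<otimes> b \<in> {g [^] i | i :: nat. True}" using assms by (auto simp: nat_pow_mult)
qed (use assms in auto)

lemma (in cring) powers_subset_compl:
  assumes "g \<in> carrier R" "q \<in> Spec R" "g \<notin> q"
  shows "{g [^] i | i :: nat. True} \<subseteq> carrier R - q"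
proof -
  interpret P: mult_set R "carrier R - q" using assms(2) by (rule mult_set_compl_prime)
  have g: "g \<in> carrier R - q" using assms by blast
  have "g [^] (i :: nat) \<in> carrier R - q" for i
  proof (induction i)
    case 0 show ?case unfolding nat_pow_0 by (rule P.one_in_S)
  next
    case (Suc i) show ?case unfolding nat_pow_Suc by (rule P.mult_in_S[OF Suc g])
  qed
  then show ?thesis by auto
qed

context algebra_module
begin

abbreviation "U \<equiv> locally_free_locus A W"

lemma locus_subset_Spec: "U \<subseteq> Spec A"
  by (auto simp: locally_free_locus_def)

lemma locus_local_basis:
  assumes "p \<in> U"
  obtains g r w where "g \<in> compl p" "local_basis A {g [^] i | i :: nat. True} W r w"
proof -
  obtain g where g: "g \<in> compl p"
    and "finite_free (loc_ring A {g [^] i | i :: nat. True}) (loc_module A {g [^] i | i :: nat. True} W)"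
    using assms by (auto simp: locally_free_locus_def Let_def)
  then obtain r e where B: "is_basis (loc_ring A {g [^] i | i :: nat. True})
      (loc_module A {g [^] i | i :: nat. True} W) r e" by (auto simp: finite_free_def)
  interpret P: mult_set A "{g [^] i | i :: nat. True}" using g by (intro R.mult_set_powers) auto
  interpret loc_data A "{g [^] i | i :: nat. True}" W by unfold_locales
  show ?thesis using local_basis_of_is_basis[OF B] g that by blast
qed

text \<open>A basis over a basic open neighbourhood is also one at the point itself.\<close>

lemma locus_loc_free:
  assumes "p \<in> U" obtains r w where "loc_free A (compl p) W r w"
proof -
  obtain g r w where g: "g \<in> compl p" "local_basis A {g [^] i | i :: nat. True} W r w"
    using assms by (rule locus_local_basis)
  have p: "p \<in> Spec A" using assms locus_subset_Spec by auto
  interpret P: mult_set A "compl p" using p by (rule R.mult_set_compl_prime)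
  note [simp del] = P.S_carrier
  have "local_basis A (compl p) W r w"
    using g p by (intro local_basis_mono[OF g(2)] R.powers_subset_compl) auto
  then have "loc_free A (compl p) W r w" by unfold_locales
  then show ?thesis by (rule that)
qed

abbreviation "K p \<equiv> stalk_ring A p"
abbreviation "tau p \<equiv> loc_data.loc_trace A (compl p) W"

text \<open>For a map \<open>\<beta>\<close> from \<open>V\<close> to the \<open>A\<close>-linear endomorphisms of \<open>W\<close>, the value
  \<open>trace (\<beta>(\<delta>)) / s\<close> of the induced map at \<open>\<xi> = \<delta>/s\<close> in the stalk at \<open>p\<close>.\<close>

definition stalk_trace ::
    "(('a \<Rightarrow> 'a) \<Rightarrow> 'w \<Rightarrow> 'w) \<Rightarrow> 'a set \<Rightarrow> (('a \<Rightarrow> 'a) \<times> 'a) set \<Rightarrow> ('a \<times> 'a) set" where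
  "stalk_trace \<beta> p \<xi> = trace (K p) (stalk A W p)
     (\<lambda>\<gamma>\<in>carrier (stalk A W p). \<Union>(\<delta>, s)\<in>\<xi>. \<Union>(w, u)\<in>\<gamma>. frac (compl p) W (\<beta> \<delta> w) (s \<otimes> u))"

text \<open>The differences of two connections are of this form.\<close>

definition linear_form :: "(('a \<Rightarrow> 'a) \<Rightarrow> 'w \<Rightarrow> 'w) \<Rightarrow> bool" where
  "linear_form \<beta> \<longleftrightarrow> (\<forall>\<delta>\<in>carrier V. module_endo A W (\<beta> \<delta>)) \<and>
     (\<forall>\<delta>\<in>carrier V. \<forall>\<eta>\<in>carrier V. \<forall>w\<in>carrier W. \<beta> (\<delta> \<oplus>\<^bsub>V\<^esub> \<eta>) w = \<beta> \<delta> w \<oplus>\<^bsub>W\<^esub> \<beta> \<eta> w) \<and>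
     (\<forall>a\<in>carrier A. \<forall>\<delta>\<in>carrier V. \<forall>w\<in>carrier W. \<beta> (a \<odot>\<^bsub>V\<^esub> \<delta>) w = a \<odot>\<^bsub>W\<^esub> \<beta> \<delta> w)"

lemma linear_formD:
  assumes "linear_form \<beta>" "\<delta> \<in> carrier V"
  shows "module_endo A W (\<beta> \<delta>)"
    and "\<lbrakk>\<eta> \<in> carrier V; w \<in> carrier W\<rbrakk> \<Longrightarrow> \<beta> (\<delta> \<oplus>\<^bsub>V\<^esub> \<eta>) w = \<beta> \<delta> w \<oplus>\<^bsub>W\<^esub> \<beta> \<eta> w"
    and "\<lbrakk>a \<in> carrier A; w \<in> carrier W\<rbrakk> \<Longrightarrow> \<beta> (a \<odot>\<^bsub>V\<^esub> \<delta>) w = a \<odot>\<^bsub>W\<^esub> \<beta> \<delta> w"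
    and "w \<in> carrier W \<Longrightarrow> \<beta> \<delta> w \<in> carrier W"
  using assms module_endoD(1)[of A W "\<beta> \<delta>" w] by (auto simp: linear_form_def)

lemma stalk_trace_eq:
  assumes b: "linear_form \<beta>" and p: "p \<in> U" and c: "\<delta> \<in> carrier V" "s \<in> compl p"
  shows "stalk_trace \<beta> p (frV p \<delta> s) = frA p \<one> s \<otimes>\<^bsub>K p\<^esub> tau p (\<beta> \<delta>)"
proof -
  obtain r w where "loc_free A (compl p) W r w" using p by (rule locus_loc_free)
  then interpret P: loc_free A "compl p" W r w .
  note [simp del] = P.S_carrier
  have c': "s \<in> carrier A" if "s \<in> compl p" for s using that by simp
  show ?thesis unfolding stalk_trace_def
  proof (rule P.trace_scaled)
    show "module_endo A W (\<beta> \<delta>)" by (rule linear_formD(1)[OF b c(1)])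
    fix v u assume vu: "v \<in> carrier W" "u \<in> compl p"
    have "(\<Union>(\<delta>, s)\<in>frV p \<delta> s. \<Union>(w, u)\<in>P.fm v u. P.fm (\<beta> \<delta> w) (s \<otimes> u)) = P.fm (\<beta> \<delta> v) (s \<otimes> u)"
    proof (rule P.frac_UN2[OF V_module c P.module_M vu])
      fix x \<delta> s v u assume *: "x \<in> compl p" "\<delta> \<in> carrier V" "s \<in> compl p" "v \<in> carrier W" "u \<in> compl p"
      have su: "s \<otimes> u \<in> compl p" using * by (intro P.mult_in_S)
      note e = P.frac_scale[OF P.module_M linear_formD(4)[OF b *(2,4)] su *(1)]
      show "P.fm (\<beta> (x \<odot>\<^bsub>V\<^esub> \<delta>) v) (x \<otimes> s \<otimes> u) = P.fm (\<beta> \<delta> v) (s \<otimes> u)"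
        using e * c'[OF *(1)] c'[OF *(3)] c'[OF *(5)] by (simp add: linear_formD(3)[OF b] R.m_assoc)
      show "P.fm (\<beta> \<delta> (x \<odot>\<^bsub>W\<^esub> v)) (s \<otimes> (x \<otimes> u)) = P.fm (\<beta> \<delta> v) (s \<otimes> u)"
        using e * c'[OF *(1)] c'[OF *(3)] c'[OF *(5)]
        by (simp add: module_endoD(3)[OF linear_formD(1)[OF b]] R.m_lcomm)
    qed
    then show "(\<lambda>\<gamma>\<in>carrier P.L. \<Union>(\<delta>, s)\<in>frV p \<delta> s. \<Union>(w, u)\<in>\<gamma>. P.fm (\<beta> \<delta> w) (s \<otimes> u)) (P.fm v u)
        = P.fm (\<beta> \<delta> v) (s \<otimes> u)" using vu by (simp add: P.loc_module_carrierI)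
  qed (rule c(2))
qed

lemma tau_closed:
  assumes "p \<in> U" "module_endo A W T" shows "tau p T \<in> carrier (K p)"
proof -
  obtain r w where "loc_free A (compl p) W r w" using assms(1) by (rule locus_loc_free)
  then interpret P: loc_free A "compl p" W r w .
  show ?thesis by (rule P.loc_trace_closed[OF assms(2)])
qed

lemma frA_closed: "\<lbrakk>p \<in> Spec A; a \<in> carrier A; s \<in> compl p\<rbrakk> \<Longrightarrow> frA p a s \<in> carrier (K p)"
  by (auto simp: loc_ring_def)

text \<open>Around a point of \<open>U\<close> the module is free over a basic open set \<open>D(g)\<close>, and there the trace is given by one
  fraction, computed in one local basis.\<close>

lemma stalk_trace_section:
  assumes b: "linear_form \<beta>" and N: "zariski_open A N" "N \<subseteq> U" and s: "\<xi> \<in> sections A V N"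
  shows "(\<lambda>p\<in>N. stalk_trace \<beta> p (\<xi> p)) \<in> sections A (reg_module A) N"
proof (rule R.sectionsI)
  fix p assume p: "p \<in> N"
  obtain N' \<delta> g where 1: "zariski_open A N'" "p \<in> N'" "N' \<subseteq> N" "\<delta> \<in> carrier V" "g \<in> carrier A"
    "\<And>q. q \<in> N' \<Longrightarrow> g \<notin> q" "\<And>q. q \<in> N' \<Longrightarrow> \<xi> q = frV q \<delta> g"
    using R.sections_locE[OF s p] by blast
  obtain h r w where h: "h \<in> compl p" "local_basis A {h [^] i | i :: nat. True} W r w"
    using locus_local_basis[of p] p N by blast
  let ?S = "{h [^] i | i :: nat. True}"
  interpret H: mult_set A ?S using h by (intro R.mult_set_powers) auto
  interpret H: loc_free A ?S W r w using h(2) by unfold_locales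
  note T = linear_formD(1)[OF b 1(4)]
  obtain c d where lt: "H.lt (\<beta> \<delta>) c d" using H.lt_exists[of "\<beta> \<delta>"] T by (auto simp: module_endo_def)
  have cd: "c \<in> carrier A" "d \<in> ?S" using H.lt_closed[OF lt] by auto
  have dA: "d \<in> carrier A" using cd(2) h(1) by auto
  let ?N = "N' \<inter> {q \<in> Spec A. h \<notin> q}"
  have oN: "zariski_open A ?N" using 1 h by (intro R.zariski_open_Int R.zariski_open_basic) auto
  have val: "g \<otimes> d \<notin> q \<and> stalk_trace \<beta> q (\<xi> q) = frA q c (g \<otimes> d)" if q: "q \<in> ?N" for q
  proof -
    have qS: "q \<in> Spec A" "h \<notin> q" "q \<in> U" "g \<in> compl q" using q 1 N by auto
    have sub: "?S \<subseteq> compl q" using qS h by (intro R.powers_subset_compl) auto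
    interpret P: mult_set A "compl q" using qS(1) by (rule R.mult_set_compl_prime)
    interpret P: loc_free A "compl q" W r w
      using local_basis_mono[OF h(2) sub] by unfold_locales
    note [simp del] = P.S_carrier H.S_carrier
    have d: "d \<in> compl q" using cd sub by auto
    have "P.lt (\<beta> \<delta>) c d" using lt d by (auto simp: local_trace_def)
    then have "tau q (\<beta> \<delta>) = frA q c d" by (rule P.loc_trace_eq[OF T])
    then have "stalk_trace \<beta> q (\<xi> q) = frA q \<one> g \<otimes>\<^bsub>K q\<^esub> frA q c d"
      using q 1 stalk_trace_eq[OF b qS(3) 1(4) qS(4)] by simp
    also have "\<dots> = frA q c (g \<otimes> d)"
      using P.loc_ring_mult[of \<one> c g d] qS d cd by simp
    finally show ?thesis using P.mult_in_S[OF qS(4) d] by simp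
  qed
  show "\<exists>N'. zariski_open A N' \<and> p \<in> N' \<and> N' \<subseteq> N \<and> (\<exists>m\<in>carrier (reg_module A). \<exists>g\<in>carrier A.
      \<forall>q\<in>N'. g \<notin> q \<and> (\<lambda>p\<in>N. stalk_trace \<beta> p (\<xi> p)) q = frA q m g)"
  proof (rule exI[of _ ?N], intro conjI, goal_cases)
    case 2 show ?case using 1(2) h(1) p N(2) locus_subset_Spec by blast
  next
    case 3 show ?case using 1(3) by blast
  next
    case 4 show ?case
    proof (rule bexI[of _ c], rule bexI[of _ "g \<otimes> d"], intro ballI conjI)
      fix q assume q: "q \<in> ?N"
      then have "q \<in> N" using 1(3) by blast
      then show "g \<otimes> d \<notin> q" "(\<lambda>p\<in>N. stalk_trace \<beta> p (\<xi> p)) q = frA q c (g \<otimes> d)"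
        using val[OF q] by simp_all
    qed (use 1(5) cd(1) dA in \<open>simp_all\<close>)
  qed (rule oN)
qed simp

lemma stalk_trace_add:
  assumes b: "linear_form \<beta>" and p: "p \<in> U" and x: "x \<in> carrier (stalk A V p)" "y \<in> carrier (stalk A V p)"
  shows "stalk_trace \<beta> p (x \<oplus>\<^bsub>stalk A V p\<^esub> y) = stalk_trace \<beta> p x \<oplus>\<^bsub>K p\<^esub> stalk_trace \<beta> p y"
proof -
  obtain r w where "loc_free A (compl p) W r w" using p by (rule locus_loc_free)
  then interpret P: loc_free A "compl p" W r w .
  note [simp del] = P.S_carrier
  obtain \<delta> s where d: "\<delta> \<in> carrier V" "s \<in> compl p" "x = frV p \<delta> s" using x(1) by (rule P.loc_module_carrierE)
  obtain \<eta> t where e: "\<eta> \<in> carrier V" "t \<in> compl p" "y = frV p \<eta> t" using x(2) by (rule P.loc_module_carrierE)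
  have st: "s \<in> carrier A" "t \<in> carrier A" "s \<otimes> t \<in> compl p" using d e P.mult_in_S by auto
  note endo = linear_formD(1)[OF b d(1)] linear_formD(1)[OF b e(1)]
  note cl = tau_closed[OF p endo(1)] tau_closed[OF p endo(2)]
  have "tau p (\<beta> (t \<odot>\<^bsub>V\<^esub> \<delta> \<oplus>\<^bsub>V\<^esub> s \<odot>\<^bsub>V\<^esub> \<eta>)) = tau p (\<lambda>v. t \<odot>\<^bsub>W\<^esub> \<beta> \<delta> v \<oplus>\<^bsub>W\<^esub> s \<odot>\<^bsub>W\<^esub> \<beta> \<eta> v)"
    using d e st by (intro P.loc_trace_cong) (simp add: linear_formD[OF b])
  also have "\<dots> = frA p t \<one> \<otimes>\<^bsub>K p\<^esub> tau p (\<beta> \<delta>) \<oplus>\<^bsub>K p\<^esub> frA p s \<one> \<otimes>\<^bsub>K p\<^esub> tau p (\<beta> \<eta>)"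
    using endo st by (intro P.loc_trace_lin) auto
  finally have *: "tau p (\<beta> (t \<odot>\<^bsub>V\<^esub> \<delta> \<oplus>\<^bsub>V\<^esub> s \<odot>\<^bsub>V\<^esub> \<eta>))
      = frA p t \<one> \<otimes>\<^bsub>K p\<^esub> tau p (\<beta> \<delta>) \<oplus>\<^bsub>K p\<^esub> frA p s \<one> \<otimes>\<^bsub>K p\<^esub> tau p (\<beta> \<eta>)" .
  note one = P.one_in_S
  have f: "frA p \<one> (s \<otimes> t) \<otimes>\<^bsub>K p\<^esub> frA p t \<one> = frA p \<one> s" "frA p \<one> (s \<otimes> t) \<otimes>\<^bsub>K p\<^esub> frA p s \<one> = frA p \<one> t"
    using P.loc_ring_mult[OF _ _ st(3) one, of \<one> t] P.loc_ring_mult[OF _ _ st(3) one, of \<one> s]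
      P.fr_scale[of \<one> s t] P.fr_scale[of \<one> t s] d e st by (simp_all add: R.m_comm)
  have "stalk_trace \<beta> p (x \<oplus>\<^bsub>stalk A V p\<^esub> y)
      = frA p \<one> (s \<otimes> t) \<otimes>\<^bsub>K p\<^esub> tau p (\<beta> (t \<odot>\<^bsub>V\<^esub> \<delta> \<oplus>\<^bsub>V\<^esub> s \<odot>\<^bsub>V\<^esub> \<eta>))"
    unfolding d(3) e(3) using d e st
    by (subst P.loc_module_add[OF V_module]) (auto simp: stalk_trace_eq[OF b p] simp del: Diff_iff)
  also have "\<dots> = (frA p \<one> (s \<otimes> t) \<otimes>\<^bsub>K p\<^esub> frA p t \<one>) \<otimes>\<^bsub>K p\<^esub> tau p (\<beta> \<delta>)
      \<oplus>\<^bsub>K p\<^esub> (frA p \<one> (s \<otimes> t) \<otimes>\<^bsub>K p\<^esub> frA p s \<one>) \<otimes>\<^bsub>K p\<^esub> tau p (\<beta> \<eta>)"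
    unfolding * using st cl one by (simp add: P.Q.r_distr P.Q.m_assoc del: Diff_iff)
  finally show ?thesis using d e by (simp only: f stalk_trace_eq[OF b p])
qed

lemma stalk_trace_smult:
  assumes b: "linear_form \<beta>" and p: "p \<in> U" and x: "c \<in> carrier (K p)" "y \<in> carrier (stalk A V p)"
  shows "stalk_trace \<beta> p (c \<odot>\<^bsub>stalk A V p\<^esub> y) = c \<otimes>\<^bsub>K p\<^esub> stalk_trace \<beta> p y"
proof -
  obtain r w where "loc_free A (compl p) W r w" using p by (rule locus_loc_free)
  then interpret P: loc_free A "compl p" W r w .
  note [simp del] = P.S_carrier
  obtain a s where d: "a \<in> carrier A" "s \<in> compl p" "c = frA p a s" using x(1) by (rule P.loc_ring_carrierE)
  obtain \<eta> t where e: "\<eta> \<in> carrier V" "t \<in> compl p" "y = frV p \<eta> t" using x(2) by (rule P.loc_module_carrierE)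
  have st: "s \<in> carrier A" "t \<in> carrier A" "s \<otimes> t \<in> compl p" using d e P.mult_in_S by auto
  note endo = linear_formD(1)[OF b e(1)]
  note cl = tau_closed[OF p endo]
  note one = P.one_in_S
  have "tau p (\<beta> (a \<odot>\<^bsub>V\<^esub> \<eta>)) = tau p (\<lambda>v. a \<odot>\<^bsub>W\<^esub> \<beta> \<eta> v \<oplus>\<^bsub>W\<^esub> \<zero> \<odot>\<^bsub>W\<^esub> \<beta> \<eta> v)"
    using d e st by (intro P.loc_trace_cong) (simp add: linear_formD[OF b])
  also have "\<dots> = frA p a \<one> \<otimes>\<^bsub>K p\<^esub> tau p (\<beta> \<eta>) \<oplus>\<^bsub>K p\<^esub> frA p \<zero> \<one> \<otimes>\<^bsub>K p\<^esub> tau p (\<beta> \<eta>)"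
    using endo d by (intro P.loc_trace_lin) auto
  also have "\<dots> = frA p a \<one> \<otimes>\<^bsub>K p\<^esub> tau p (\<beta> \<eta>)"
    using cl d one P.fr_zero[OF one] by (simp del: Diff_iff)
  finally have *: "tau p (\<beta> (a \<odot>\<^bsub>V\<^esub> \<eta>)) = frA p a \<one> \<otimes>\<^bsub>K p\<^esub> tau p (\<beta> \<eta>)" .
  have "stalk_trace \<beta> p (c \<odot>\<^bsub>stalk A V p\<^esub> y) = frA p \<one> (s \<otimes> t) \<otimes>\<^bsub>K p\<^esub> tau p (\<beta> (a \<odot>\<^bsub>V\<^esub> \<eta>))"
    unfolding d(3) e(3) using d e st
    by (subst P.loc_module_smult[OF V_module]) (auto simp: stalk_trace_eq[OF b p] simp del: Diff_iff)
  also have "\<dots> = (frA p \<one> (s \<otimes> t) \<otimes>\<^bsub>K p\<^esub> frA p a \<one>) \<otimes>\<^bsub>K p\<^esub> tau p (\<beta> \<eta>)"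
    unfolding * using st cl one d by (simp add: P.Q.m_assoc del: Diff_iff)
  also have "frA p \<one> (s \<otimes> t) \<otimes>\<^bsub>K p\<^esub> frA p a \<one> = frA p a s \<otimes>\<^bsub>K p\<^esub> frA p \<one> t"
    using P.loc_ring_mult[OF _ _ st(3) one, of \<one> a] P.loc_ring_mult[OF _ _ d(2) e(2), of a \<one>] d st by simp
  also have "(frA p a s \<otimes>\<^bsub>K p\<^esub> frA p \<one> t) \<otimes>\<^bsub>K p\<^esub> tau p (\<beta> \<eta>) = frA p a s \<otimes>\<^bsub>K p\<^esub> (frA p \<one> t \<otimes>\<^bsub>K p\<^esub> tau p (\<beta> \<eta>))"
    using cl d e by (intro P.Q.m_assoc) (auto simp del: Diff_iff)
  finally show ?thesis using d e by (simp only: stalk_trace_eq[OF b p])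
qed

text \<open>The element \<open>trace \<circ> \<beta>\<close> of the Chevalley-Hochschild complex in degree one.\<close>

definition trace_cochain :: "(('a \<Rightarrow> 'a) \<Rightarrow> 'w \<Rightarrow> 'w) \<Rightarrow> 'a cochain" where
  "trace_cochain \<beta> = (\<lambda>N\<in>opens_in A U. \<lambda>ss\<in>tuples A V N 1. \<lambda>p\<in>N. stalk_trace \<beta> p ((ss ! 0) p))"

lemma tuples1: "ss \<in> tuples A V N 1 \<longleftrightarrow> (\<exists>s\<in>sections A V N. ss = [s])"
  by (auto simp: tuples_def length_Suc_conv)

lemmas tuples1' = tuples1[simplified]

lemma tuples2: "ss \<in> tuples A V N 2 \<longleftrightarrow> (\<exists>s\<in>sections A V N. \<exists>t\<in>sections A V N. ss = [s, t])"
  by (auto simp: tuples_def length_Suc_conv numeral_2_eq_2)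

lemma sec_V_closed:
  assumes N: "zariski_open A N"
  shows "\<lbrakk>s \<in> sections A V N; t \<in> sections A V N\<rbrakk> \<Longrightarrow> (\<lambda>p\<in>N. s p \<oplus>\<^bsub>stalk A V p\<^esub> t p) \<in> sections A V N"
    and "\<lbrakk>c \<in> sections A (reg_module A) N; s \<in> sections A V N\<rbrakk>
      \<Longrightarrow> (\<lambda>p\<in>N. c p \<odot>\<^bsub>stalk A V p\<^esub> s p) \<in> sections A V N"
    and "\<lbrakk>s \<in> sections A V N; t \<in> sections A V N\<rbrakk> \<Longrightarrow> sec_bracket A V N s t \<in> sections A V N"
    and "\<lbrakk>s \<in> sections A V N; c \<in> sections A (reg_module A) N\<rbrakk> \<Longrightarrow> sec_act A N s c \<in> sections A (reg_module A) N"
proof -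
  have *: "mult_set A (compl q)" "g \<otimes> h \<notin> q" if "q \<in> Spec A" "g \<in> carrier A" "h \<in> carrier A" "g \<notin> q" "h \<notin> q" for q g h
    using R.mult_set_compl_prime R.not_in_prime_mult that by auto
  show "(\<lambda>p\<in>N. s p \<oplus>\<^bsub>stalk A V p\<^esub> t p) \<in> sections A V N" if "s \<in> sections A V N" "t \<in> sections A V N"
  proof (rule R.sections_binop[OF N that])
    fix m g n h assume c: "m \<in> carrier V" "g \<in> carrier A" "n \<in> carrier V" "h \<in> carrier A"
    show "\<exists>k\<in>carrier V. \<exists>e\<in>carrier A. \<forall>q\<in>Spec A. g \<notin> q \<longrightarrow> h \<notin> q \<longrightarrow> e \<notin> q \<and>
        frV q m g \<oplus>\<^bsub>stalk A V q\<^esub> frV q n h = frV q k e"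
      by (intro bexI[of _ "h \<odot>\<^bsub>V\<^esub> m \<oplus>\<^bsub>V\<^esub> g \<odot>\<^bsub>V\<^esub> n"] bexI[of _ "g \<otimes> h"])
        (use c in \<open>auto simp: * mult_set.loc_module_add[OF *(1) V_module]\<close>)
  qed
  show "(\<lambda>p\<in>N. c p \<odot>\<^bsub>stalk A V p\<^esub> s p) \<in> sections A V N"
    if "c \<in> sections A (reg_module A) N" "s \<in> sections A V N"
  proof (rule R.sections_binop[OF N that])
    fix m g n h assume c: "m \<in> carrier (reg_module A)" "g \<in> carrier A" "n \<in> carrier V" "h \<in> carrier A"
    show "\<exists>k\<in>carrier V. \<exists>e\<in>carrier A. \<forall>q\<in>Spec A. g \<notin> q \<longrightarrow> h \<notin> q \<longrightarrow> e \<notin> q \<and>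
        frA q m g \<odot>\<^bsub>stalk A V q\<^esub> frV q n h = frV q k e"
      by (intro bexI[of _ "m \<odot>\<^bsub>V\<^esub> n"] bexI[of _ "g \<otimes> h"])
        (use c in \<open>auto simp: * mult_set.loc_module_smult[OF *(1) V_module]\<close>)
  qed
  show "sec_bracket A V N s t \<in> sections A V N" if "s \<in> sections A V N" "t \<in> sections A V N"
    unfolding sec_bracket_def
  proof (rule R.sections_binop[OF N that])
    fix m g n h assume c: "m \<in> carrier V" "g \<in> carrier A" "n \<in> carrier V" "h \<in> carrier A"
    show "\<exists>k\<in>carrier V. \<exists>e\<in>carrier A. \<forall>q\<in>Spec A. g \<notin> q \<longrightarrow> h \<notin> q \<longrightarrow> e \<notin> q \<and>
        stalk_bracket A V q (frV q m g) (frV q n h) = frV q k e"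
      by (intro bexI[of _ "bracket_num m g n h"] bexI[of _ "(g \<otimes> g) \<otimes> (h \<otimes> h)"])
        (use c in \<open>auto simp: * stalk_bracket_eq bracket_num_closed\<close>)
  qed
  show "sec_act A N s c \<in> sections A (reg_module A) N"
    if "s \<in> sections A V N" "c \<in> sections A (reg_module A) N"
    unfolding sec_act_def
  proof (rule R.sections_binop[OF N that])
    fix m g n h assume c: "m \<in> carrier V" "g \<in> carrier A" "n \<in> carrier (reg_module A)" "h \<in> carrier A"
    show "\<exists>k\<in>carrier (reg_module A). \<exists>e\<in>carrier A. \<forall>q\<in>Spec A. g \<notin> q \<longrightarrow> h \<notin> q \<longrightarrow> e \<notin> q \<and>
        stalk_act A q (frV q m g) (frA q n h) = frA q k e"
    proof (rule bexI[of _ "h \<otimes> m n \<ominus> n \<otimes> m h"], rule bexI[of _ "g \<otimes> (h \<otimes> h)"], intro ballI impI conjI)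
      fix q assume q: "q \<in> Spec A" "g \<notin> q" "h \<notin> q"
      interpret P: mult_set A "compl q" using q(1) by (rule R.mult_set_compl_prime)
      note [simp del] = P.S_carrier
      show "g \<otimes> (h \<otimes> h) \<notin> q" using q c by (simp add: *)
      have hh: "h \<otimes> h \<in> compl q" "g \<in> compl q" using q c by (auto simp: *)
      show "stalk_act A q (frV q m g) (frA q n h) = frA q (h \<otimes> m n \<ominus> n \<otimes> m h) (g \<otimes> (h \<otimes> h))"
        using q c hh P.loc_ring_mult[OF _ _ hh(2,1), of \<one> "h \<otimes> m n \<ominus> n \<otimes> m h"]
        by (simp add: stalk_act_eq P.loc_der_fr[OF V_derivation] frA_closed)
    qed (use c in auto)
  qed
qed

lemma trace_cochain_cochain:
  assumes b: "linear_form \<beta>" shows "trace_cochain \<beta> \<in> cochains A V U 1"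
proof -
  have app: "trace_cochain \<beta> N [s] = (\<lambda>p\<in>N. stalk_trace \<beta> p (s p))"
    if "N \<in> opens_in A U" "s \<in> sections A V N" for N s
    using that by (simp add: trace_cochain_def tuples1')
  have sub: "N' \<in> opens_in A U" if "N \<in> opens_in A U" "N' \<in> opens_in A N" for N N'
    using that by (auto simp: opens_in_def)
  have pU: "p \<in> U" if "N \<in> opens_in A U" "p \<in> N" for N p using that opens_inD by blast
  show ?thesis
    unfolding cochains_def
  proof (intro CollectI conjI ballI allI impI)
    show "trace_cochain \<beta> \<in> (\<Pi>\<^sub>E N\<in>opens_in A U. tuples A V N 1 \<rightarrow>\<^sub>E sections A (reg_module A) N)"
      by (auto simp: trace_cochain_def tuples1' intro!: stalk_trace_section[OF b]
          intro: opens_inD(1) opens_inD(2)[THEN subsetD])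
  next
    fix N ss and i :: nat and s t
    assume *: "N \<in> opens_in A U" "ss \<in> tuples A V N 1" "i < 1" "s \<in> sections A V N" "t \<in> sections A V N"
    note N = opens_inD(1)[OF *(1)]
    note st = sec_V_closed(1)[OF N *(4,5)]
    show "trace_cochain \<beta> N (ss[i := s \<oplus>\<^bsub>sec_module A V N\<^esub> t])
        = trace_cochain \<beta> N (ss[i := s]) \<oplus>\<^bsub>sec_ring A N\<^esub> trace_cochain \<beta> N (ss[i := t])"
      using * st by (auto simp: tuples1' sec_module_def app R.sections_stalk pU stalk_trace_add[OF b]
          intro!: restrict_ext)
  next
    fix N ss and i :: nat and c s
    assume *: "N \<in> opens_in A U" "ss \<in> tuples A V N 1" "i < 1"
      "c \<in> sections A (reg_module A) N" "s \<in> sections A V N"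
    note N = opens_inD(1)[OF *(1)]
    note st = sec_V_closed(2)[OF N *(4,5)]
    show "trace_cochain \<beta> N (ss[i := c \<odot>\<^bsub>sec_module A V N\<^esub> s])
        = c \<otimes>\<^bsub>sec_ring A N\<^esub> trace_cochain \<beta> N (ss[i := s])"
      using * st by (auto simp: tuples1' sec_module_def app R.sections_stalk R.Osec_stalk pU
          stalk_trace_smult[OF b] intro!: restrict_ext)
  next
    fix N N' ss
    assume *: "N \<in> opens_in A U" "N' \<in> opens_in A N" "ss \<in> tuples A V N 1"
    then obtain s where s: "s \<in> sections A V N" "ss = [s]" by (auto simp: tuples1')
    have N': "N' \<in> opens_in A U" "zariski_open A N'" "N' \<subseteq> N" using * sub opens_inD by blast+
    then have "restrict s N' \<in> sections A V N'" using s by (intro R.sections_restrict)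
    then show "trace_cochain \<beta> N' (map (\<lambda>s. restrict s N') ss) = restrict (trace_cochain \<beta> N ss) N'"
      using s N' * by (auto simp: app Int_absorb1[OF N'(3)] intro!: restrict_ext)
  qed auto
qed

end

lemma (in abelian_monoid) finsum_01:
  "\<lbrakk>f (0 :: nat) \<in> carrier G; f 1 \<in> carrier G\<rbrakk> \<Longrightarrow> (\<Oplus>i\<in>{0, 1}. f i) = f 0 \<oplus> f 1"
  by (subst finsum_insert) auto

lemma (in abelian_monoid) finsum_single: "f x \<in> carrier G \<Longrightarrow> (\<Oplus>i\<in>{x}. f i) = f x"
  by (subst finsum_insert) auto

context algebra_module
begin

lemma sec_ring_props:
  assumes N: "zariski_open A N"
  shows "cring (sec_ring A N)"
    and "x \<in> sections A (reg_module A) N \<Longrightarrow> \<ominus>\<^bsub>sec_ring A N\<^esub> x \<in> sections A (reg_module A) N"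
  using R.sec_ring_cring[OF N] R.Osec_closed(3)[OF N] by (auto simp: R.sec_ring_a_inv[OF N])

lemma cobd1_apply:
  assumes N: "N \<in> opens_in A U'" and st: "s \<in> sections A V N" "t \<in> sections A V N"
    and ph: "\<phi> N [s] \<in> sections A (reg_module A) N" "\<phi> N [t] \<in> sections A (reg_module A) N"
      "\<phi> N [sec_bracket A V N s t] \<in> sections A (reg_module A) N"
  shows "cobd A V U' 1 \<phi> N [s, t] = (\<lambda>p\<in>N.
    (stalk_act A p (s p) (\<phi> N [t] p) \<ominus>\<^bsub>K p\<^esub> stalk_act A p (t p) (\<phi> N [s] p))
      \<ominus>\<^bsub>K p\<^esub> \<phi> N [sec_bracket A V N s t] p)"
proof -
  have oN: "zariski_open A N" using N by (rule opens_inD)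
  interpret O: cring "sec_ring A N" by (rule sec_ring_props[OF oN])
  note act = sec_V_closed(4)[OF oN]
  have tup: "[s, t] \<in> tuples A V N (Suc 1)" using st by (simp add: tuples_def)
  have pairs: "{(i, j). i < j \<and> j \<le> (1 :: nat)} = {(0, 1)}" by auto
  have le1: "{..1 :: nat} = {0, 1}" by auto
  let ?f = "\<lambda>i. alt_sign (sec_ring A N) i (sec_act A N ([s, t] ! i) (\<phi> N (nths [s, t] (- {i}))))"
  have f: "?f 0 = sec_act A N s (\<phi> N [t])" "?f 1 = \<ominus>\<^bsub>sec_ring A N\<^esub> sec_act A N t (\<phi> N [s])"
    by (simp_all add: alt_sign_def nths_Cons)
  have c: "?f 0 \<in> carrier (sec_ring A N)" "?f 1 \<in> carrier (sec_ring A N)"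
    unfolding f using st ph act sec_ring_props(2)[OF oN] by auto
  have sum1: "(\<Oplus>\<^bsub>sec_ring A N\<^esub>i\<in>{..1}. ?f i) = sec_act A N s (\<phi> N [t])
      \<oplus>\<^bsub>sec_ring A N\<^esub> \<ominus>\<^bsub>sec_ring A N\<^esub> sec_act A N t (\<phi> N [s])"
    unfolding le1 f[symmetric] by (rule O.finsum_01[OF c])
  let ?g = "\<lambda>ij. alt_sign (sec_ring A N) (fst ij + snd ij)
          (\<phi> N (sec_bracket A V N ([s, t] ! fst ij) ([s, t] ! snd ij) # nths [s, t] (- {fst ij, snd ij})))"
  have g: "?g (0, 1) = \<ominus>\<^bsub>sec_ring A N\<^esub> \<phi> N [sec_bracket A V N s t]"
    by (simp add: alt_sign_def nths_Cons)
  have gc: "?g (0, 1) \<in> carrier (sec_ring A N)"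
    unfolding g using ph sec_V_closed(3)[OF oN st] sec_ring_props(2)[OF oN] by auto
  have sum2: "(\<Oplus>\<^bsub>sec_ring A N\<^esub>ij\<in>{(i, j). i < j \<and> j \<le> (1 :: nat)}. ?g ij)
      = \<ominus>\<^bsub>sec_ring A N\<^esub> \<phi> N [sec_bracket A V N s t]"
    unfolding pairs g[symmetric] by (rule O.finsum_single[where f = ?g, OF gc])
  have "cobd A V U' 1 \<phi> N [s, t] = (sec_act A N s (\<phi> N [t])
      \<oplus>\<^bsub>sec_ring A N\<^esub> \<ominus>\<^bsub>sec_ring A N\<^esub> sec_act A N t (\<phi> N [s]))
      \<oplus>\<^bsub>sec_ring A N\<^esub> \<ominus>\<^bsub>sec_ring A N\<^esub> \<phi> N [sec_bracket A V N s t]"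
    using N tup unfolding cobd_def by (simp only: restrict_apply' sum1 sum2)
  also have "\<dots> = (\<lambda>p\<in>N. (stalk_act A p (s p) (\<phi> N [t] p) \<ominus>\<^bsub>K p\<^esub> stalk_act A p (t p) (\<phi> N [s] p))
      \<ominus>\<^bsub>K p\<^esub> \<phi> N [sec_bracket A V N s t] p)"
    using st ph act[of t "\<phi> N [s]"] sec_V_closed(3)[OF oN st]
    by (auto simp: R.sec_ring_a_inv[OF oN] sec_act_def a_minus_def intro!: restrict_ext)
  finally show ?thesis .
qed

lemma cochains_sections:
  assumes "\<phi> \<in> cochains A V U' 1" "N \<in> opens_in A U'" "x \<in> sections A V N"
  shows "\<phi> N [x] \<in> sections A (reg_module A) N"
proof -
  have "\<phi> \<in> (\<Pi>\<^sub>E N\<in>opens_in A U'. tuples A V N 1 \<rightarrow>\<^sub>E sections A (reg_module A) N)"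
    using assms(1) by (simp add: cochains_def)
  then have "\<phi> N \<in> tuples A V N 1 \<rightarrow>\<^sub>E sections A (reg_module A) N" using assms(2) by (rule PiE_mem)
  then show ?thesis by (rule PiE_mem[where x = "[x]"]) (use assms(3) in \<open>simp add: tuples1'\<close>)
qed

lemma stalk_act_add:
  assumes p: "p \<in> Spec A" and x: "x \<in> carrier (stalk A V p)"
    and y: "y \<in> carrier (K p)" "z \<in> carrier (K p)"
  shows "stalk_act A p x (y \<oplus>\<^bsub>K p\<^esub> z) = stalk_act A p x y \<oplus>\<^bsub>K p\<^esub> stalk_act A p x z"
    and "stalk_act A p x y \<in> carrier (K p)"
proof -
  interpret P: mult_set A "compl p" using p by (rule R.mult_set_compl_prime)
  note [simp del] = P.S_carrier
  interpret Q: cring "K p" by (rule P.loc_ring_cring)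
  obtain \<delta> s where d: "\<delta> \<in> carrier V" "s \<in> compl p" "x = frV p \<delta> s" using x by (rule P.loc_module_carrierE)
  note D = V_derivation[OF d(1)]
  show "stalk_act A p x (y \<oplus>\<^bsub>K p\<^esub> z) = stalk_act A p x y \<oplus>\<^bsub>K p\<^esub> stalk_act A p x z"
    "stalk_act A p x y \<in> carrier (K p)"
    using d(2) y by (simp_all add: d(3) stalk_act_eq[OF p d(1,2)] P.loc_der_add[OF D] P.loc_der_closed[OF D]
        Q.r_distr frA_closed[OF p] del: Diff_iff)
qed

text \<open>The proofs that cochains are closed under addition and under subtraction differ only in the operation on the
  stalks, which is the parameter \<open>h\<close>.\<close>

lemma cochain_combine:
  assumes \<phi>: "\<phi> \<in> cochains A V U' 1" and \<psi>: "\<psi> \<in> cochains A V U' 1"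
    and op: "\<And>p x y x' y'. \<lbrakk>p \<in> Spec A; x \<in> carrier (K p); y \<in> carrier (K p); x' \<in> carrier (K p); y' \<in> carrier (K p)\<rbrakk>
      \<Longrightarrow> h p (x \<oplus>\<^bsub>K p\<^esub> x') (y \<oplus>\<^bsub>K p\<^esub> y') = h p x y \<oplus>\<^bsub>K p\<^esub> h p x' y'"
      "\<And>p c x y. \<lbrakk>p \<in> Spec A; c \<in> carrier (K p); x \<in> carrier (K p); y \<in> carrier (K p)\<rbrakk>
      \<Longrightarrow> h p (c \<otimes>\<^bsub>K p\<^esub> x) (c \<otimes>\<^bsub>K p\<^esub> y) = c \<otimes>\<^bsub>K p\<^esub> h p x y"
      "\<And>N x y. \<lbrakk>zariski_open A N; x \<in> sections A (reg_module A) N; y \<in> sections A (reg_module A) N\<rbrakk>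
      \<Longrightarrow> (\<lambda>p\<in>N. h p (x p) (y p)) \<in> sections A (reg_module A) N"
  shows "(\<lambda>N\<in>opens_in A U'. \<lambda>ss\<in>tuples A V N 1. \<lambda>p\<in>N. h p (\<phi> N ss p) (\<psi> N ss p)) \<in> cochains A V U' 1"
    (is "?\<chi> \<in> _")
proof -
  have app: "?\<chi> N [s] = (\<lambda>p\<in>N. h p (\<phi> N [s] p) (\<psi> N [s] p))"
    if "N \<in> opens_in A U'" "s \<in> sections A V N" for N s
    using that by (simp add: tuples1')
  note sec = cochains_sections[OF \<phi>] cochains_sections[OF \<psi>]
  have upd: "ss[i := x] = [x]" if "ss \<in> tuples A V N 1" "i < 1" for ss i x N
    using that by (auto simp: tuples1')
  have sp: "p \<in> Spec A" if "N \<in> opens_in A U'" "p \<in> N" for N p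
    using that opens_inD(1) zariski_open_subset_Spec by blast
  have sub: "N' \<in> opens_in A U'" if "N \<in> opens_in A U'" "N' \<in> opens_in A N" for N N'
    using that by (auto simp: opens_in_def)
  have add: "\<chi> N [s \<oplus>\<^bsub>sec_module A V N\<^esub> t] = \<chi> N [s] \<oplus>\<^bsub>sec_ring A N\<^esub> \<chi> N [t]"
    if "\<chi> \<in> cochains A V U' 1" "N \<in> opens_in A U'" "s \<in> sections A V N" "t \<in> sections A V N" for \<chi> N s t
  proof -
    have "\<forall>N\<in>opens_in A U'. \<forall>ss\<in>tuples A V N 1. \<forall>i<1. \<forall>s\<in>sections A V N. \<forall>t\<in>sections A V N.
        \<chi> N (ss[i := s \<oplus>\<^bsub>sec_module A V N\<^esub> t]) = \<chi> N (ss[i := s]) \<oplus>\<^bsub>sec_ring A N\<^esub> \<chi> N (ss[i := t])"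
      using that(1) by (simp add: cochains_def)
    from this[rule_format, of N "[s]" 0 s t] show ?thesis using that by (simp add: tuples1')
  qed
  have smult: "\<chi> N [c \<odot>\<^bsub>sec_module A V N\<^esub> s] = c \<otimes>\<^bsub>sec_ring A N\<^esub> \<chi> N [s]"
    if "\<chi> \<in> cochains A V U' 1" "N \<in> opens_in A U'" "c \<in> sections A (reg_module A) N" "s \<in> sections A V N" for \<chi> N c s
  proof -
    have "\<forall>N\<in>opens_in A U'. \<forall>ss\<in>tuples A V N 1. \<forall>i<1. \<forall>c\<in>sections A (reg_module A) N. \<forall>s\<in>sections A V N.
        \<chi> N (ss[i := c \<odot>\<^bsub>sec_module A V N\<^esub> s]) = c \<otimes>\<^bsub>sec_ring A N\<^esub> \<chi> N (ss[i := s])"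
      using that(1) by (simp add: cochains_def)
    from this[rule_format, of N "[s]" 0 c s] show ?thesis using that by (simp add: tuples1')
  qed
  have res: "\<chi> N' [restrict s N'] = restrict (\<chi> N [s]) N'"
    if "\<chi> \<in> cochains A V U' 1" "N \<in> opens_in A U'" "N' \<in> opens_in A N" "s \<in> sections A V N" for \<chi> N N' s
  proof -
    have "\<forall>N\<in>opens_in A U'. \<forall>N'\<in>opens_in A N. \<forall>ss\<in>tuples A V N 1.
        \<chi> N' (map (\<lambda>s. restrict s N') ss) = restrict (\<chi> N ss) N'"
      using that(1) by (simp add: cochains_def)
    from this[rule_format, of N N' "[s]"] show ?thesis using that by (simp add: tuples1')
  qed
  show ?thesis
    unfolding cochains_def
  proof (intro CollectI conjI ballI allI impI)
    show "?\<chi> \<in> (\<Pi>\<^sub>E N\<in>opens_in A U'. tuples A V N 1 \<rightarrow>\<^sub>E sections A (reg_module A) N)"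
      by (auto simp: tuples1' intro!: op(3) sec intro: opens_inD(1))
  next
    fix N ss and i :: nat and s t
    assume *: "N \<in> opens_in A U'" "ss \<in> tuples A V N 1" "i < 1" "s \<in> sections A V N" "t \<in> sections A V N"
    have st: "s \<oplus>\<^bsub>sec_module A V N\<^esub> t \<in> sections A V N"
      using sec_V_closed(1)[OF opens_inD(1)[OF *(1)] *(4,5)] by (simp add: sec_module_def)
    have "?\<chi> N [s \<oplus>\<^bsub>sec_module A V N\<^esub> t] = ?\<chi> N [s] \<oplus>\<^bsub>sec_ring A N\<^esub> ?\<chi> N [t]"
      unfolding app[OF *(1) st] app[OF *(1,4)] app[OF *(1,5)] add[OF \<phi> *(1,4,5)] add[OF \<psi> *(1,4,5)]
      using sp[OF *(1)] sec[OF *(1,4)] sec[OF *(1,5)]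
      by (auto simp: op(1) R.Osec_stalk intro!: restrict_ext)
    then show "?\<chi> N (ss[i := s \<oplus>\<^bsub>sec_module A V N\<^esub> t]) = ?\<chi> N (ss[i := s]) \<oplus>\<^bsub>sec_ring A N\<^esub> ?\<chi> N (ss[i := t])"
      unfolding upd[OF *(2,3)] .
  next
    fix N ss and i :: nat and c s
    assume *: "N \<in> opens_in A U'" "ss \<in> tuples A V N 1" "i < 1"
      "c \<in> sections A (reg_module A) N" "s \<in> sections A V N"
    have st: "c \<odot>\<^bsub>sec_module A V N\<^esub> s \<in> sections A V N"
      using sec_V_closed(2)[OF opens_inD(1)[OF *(1)] *(4,5)] by (simp add: sec_module_def)
    have "?\<chi> N [c \<odot>\<^bsub>sec_module A V N\<^esub> s] = c \<otimes>\<^bsub>sec_ring A N\<^esub> ?\<chi> N [s]"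
      unfolding app[OF *(1) st] app[OF *(1,5)] smult[OF \<phi> *(1,4,5)] smult[OF \<psi> *(1,4,5)]
      using sp[OF *(1)] sec[OF *(1,5)] *(4)
      by (auto simp: op(2) R.Osec_stalk intro!: restrict_ext)
    then show "?\<chi> N (ss[i := c \<odot>\<^bsub>sec_module A V N\<^esub> s]) = c \<otimes>\<^bsub>sec_ring A N\<^esub> ?\<chi> N (ss[i := s])"
      unfolding upd[OF *(2,3)] .
  next
    fix N N' ss
    assume *: "N \<in> opens_in A U'" "N' \<in> opens_in A N" "ss \<in> tuples A V N 1"
    then obtain s where s: "s \<in> sections A V N" "ss = [s]" by (auto simp: tuples1')
    have N': "N' \<in> opens_in A U'" "zariski_open A N'" "N' \<subseteq> N" using * sub opens_inD by blast+
    then have r: "restrict s N' \<in> sections A V N'" using s by (intro R.sections_restrict)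
    have "?\<chi> N' [restrict s N'] = restrict (?\<chi> N [s]) N'"
      unfolding app[OF *(1) s(1)] app[OF N'(1) r] res[OF \<phi> *(1,2) s(1)] res[OF \<psi> *(1,2) s(1)]
      using N'(3) by (auto simp: Int_absorb1[OF N'(3)] intro!: restrict_ext)
    then show "?\<chi> N' (map (\<lambda>s. restrict s N') ss) = restrict (?\<chi> N ss) N'"
      unfolding s(2) by simp
  qed auto
qed

lemma cochain_mult_apply:
  "\<phi> \<otimes>\<^bsub>cochain_group A V U' q\<^esub> \<psi> = (\<lambda>N\<in>opens_in A U'. \<lambda>ss\<in>tuples A V N q. \<lambda>p\<in>N.
    \<phi> N ss p \<oplus>\<^bsub>K p\<^esub> \<psi> N ss p)"
  by (simp add: cochain_group_def)

lemma cochain1_add_closed: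
  assumes "\<phi> \<in> cochains A V U' 1" "\<psi> \<in> cochains A V U' 1"
  shows "\<phi> \<otimes>\<^bsub>cochain_group A V U' 1\<^esub> \<psi> \<in> cochains A V U' 1"
  unfolding cochain_mult_apply
proof (rule cochain_combine[OF assms])
  fix p x y x' y'
  assume p: "p \<in> Spec A" and c: "x \<in> carrier (K p)" "y \<in> carrier (K p)" "x' \<in> carrier (K p)" "y' \<in> carrier (K p)"
  interpret Q: cring "K p" using p by (rule R.stalk_cring)
  show "x \<oplus>\<^bsub>K p\<^esub> x' \<oplus>\<^bsub>K p\<^esub> (y \<oplus>\<^bsub>K p\<^esub> y') = x \<oplus>\<^bsub>K p\<^esub> y \<oplus>\<^bsub>K p\<^esub> (x' \<oplus>\<^bsub>K p\<^esub> y')"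
    using c by (simp add: Q.a_ac)
next
  fix p c x y assume p: "p \<in> Spec A" and c: "c \<in> carrier (K p)" "x \<in> carrier (K p)" "y \<in> carrier (K p)"
  interpret Q: cring "K p" using p by (rule R.stalk_cring)
  show "c \<otimes>\<^bsub>K p\<^esub> x \<oplus>\<^bsub>K p\<^esub> c \<otimes>\<^bsub>K p\<^esub> y = c \<otimes>\<^bsub>K p\<^esub> (x \<oplus>\<^bsub>K p\<^esub> y)" using c by (simp add: Q.r_distr)
qed (rule R.Osec_closed)

lemma cochain1_diff:
  assumes "\<phi> \<in> cochains A V U' 1" "\<psi> \<in> cochains A V U' 1"
  shows "\<exists>\<chi>\<in>cochains A V U' 1. \<phi> = \<chi> \<otimes>\<^bsub>cochain_group A V U' 1\<^esub> \<psi>"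
proof
  let ?\<chi> = "\<lambda>N\<in>opens_in A U'. \<lambda>ss\<in>tuples A V N 1. \<lambda>p\<in>N. \<phi> N ss p \<ominus>\<^bsub>K p\<^esub> \<psi> N ss p"
  show "?\<chi> \<in> cochains A V U' 1"
  proof (rule cochain_combine[OF assms])
    fix p x y x' y'
    assume p: "p \<in> Spec A" and c: "x \<in> carrier (K p)" "y \<in> carrier (K p)" "x' \<in> carrier (K p)" "y' \<in> carrier (K p)"
    interpret Q: cring "K p" using p by (rule R.stalk_cring)
    show "(x \<oplus>\<^bsub>K p\<^esub> x') \<ominus>\<^bsub>K p\<^esub> (y \<oplus>\<^bsub>K p\<^esub> y') = (x \<ominus>\<^bsub>K p\<^esub> y) \<oplus>\<^bsub>K p\<^esub> (x' \<ominus>\<^bsub>K p\<^esub> y')"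
      using c by (simp add: Q.minus_eq Q.minus_add Q.a_ac)
  next
    fix p c x y assume p: "p \<in> Spec A" and c: "c \<in> carrier (K p)" "x \<in> carrier (K p)" "y \<in> carrier (K p)"
    interpret Q: cring "K p" using p by (rule R.stalk_cring)
    show "c \<otimes>\<^bsub>K p\<^esub> x \<ominus>\<^bsub>K p\<^esub> c \<otimes>\<^bsub>K p\<^esub> y = c \<otimes>\<^bsub>K p\<^esub> (x \<ominus>\<^bsub>K p\<^esub> y)"
      using c by (simp add: Q.r_distr Q.minus_eq Q.r_minus)
  next
    fix N x y assume *: "zariski_open A N" "x \<in> sections A (reg_module A) N" "y \<in> sections A (reg_module A) N"
    have "(\<lambda>p\<in>N. x p \<oplus>\<^bsub>K p\<^esub> (\<lambda>p\<in>N. \<ominus>\<^bsub>K p\<^esub> y p) p) \<in> sections A (reg_module A) N"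
      using * by (intro R.Osec_closed)
    moreover have "(\<lambda>p\<in>N. x p \<oplus>\<^bsub>K p\<^esub> (\<lambda>p\<in>N. \<ominus>\<^bsub>K p\<^esub> y p) p) = (\<lambda>p\<in>N. x p \<ominus>\<^bsub>K p\<^esub> y p)"
      by (intro restrict_ext) (simp add: a_minus_def)
    ultimately show "(\<lambda>p\<in>N. x p \<ominus>\<^bsub>K p\<^esub> y p) \<in> sections A (reg_module A) N" by simp
  qed
  have E: "\<phi> \<in> (\<Pi>\<^sub>E N\<in>opens_in A U'. tuples A V N 1 \<rightarrow>\<^sub>E sections A (reg_module A) N)"
    using assms(1) by (simp add: cochains_def)
  show "\<phi> = ?\<chi> \<otimes>\<^bsub>cochain_group A V U' 1\<^esub> \<psi>"
    unfolding cochain_mult_apply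
  proof (rule ext, rule ext, rule ext)
    fix N ss p
    show "\<phi> N ss p = (\<lambda>N\<in>opens_in A U'. \<lambda>ss\<in>tuples A V N 1. \<lambda>p\<in>N. ?\<chi> N ss p \<oplus>\<^bsub>K p\<^esub> \<psi> N ss p) N ss p"
    proof (cases "N \<in> opens_in A U'")
      case False then show ?thesis using PiE_arb[OF E] by simp
    next
      case N: True
      note E' = PiE_mem[OF E N]
      show ?thesis
      proof (cases "ss \<in> tuples A V N 1")
        case False then show ?thesis using PiE_arb[OF E'] N by simp
      next
        case ss: True
        then obtain s where s: "s \<in> sections A V N" "ss = [s]" unfolding tuples1 by auto
        note sec = cochains_sections[OF assms(1) N s(1)] cochains_sections[OF assms(2) N s(1)]
        show ?thesis
        proof (cases "p \<in> N")
          case False then show ?thesis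
            using N ss s extensional_arb[OF R.sections_ext[OF sec(1)] False] by simp
        next
          case True
          then have "p \<in> Spec A" using opens_inD(1)[OF N] zariski_open_subset_Spec by blast
          then interpret Q: cring "K p" by (rule R.stalk_cring)
          have "\<phi> N ss p \<in> carrier (K p)" "\<psi> N ss p \<in> carrier (K p)"
            using sec True s by (auto intro: R.Osec_stalk)
          then show ?thesis using N ss True by (simp add: Q.minus_eq Q.a_assoc Q.l_neg)
        qed
      qed
    qed
  qed
qed

lemma cobd1_add:
  assumes \<phi>: "\<phi> \<in> cochains A V U' 1" and \<psi>: "\<psi> \<in> cochains A V U' 1"
  shows "cobd A V U' 1 (\<phi> \<otimes>\<^bsub>cochain_group A V U' 1\<^esub> \<psi>)
    = cobd A V U' 1 \<phi> \<otimes>\<^bsub>cochain_group A V U' 2\<^esub> cobd A V U' 1 \<psi>"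
proof -
  let ?\<chi> = "\<phi> \<otimes>\<^bsub>cochain_group A V U' 1\<^esub> \<psi>"
  have app: "?\<chi> N [x] = (\<lambda>p\<in>N. \<phi> N [x] p \<oplus>\<^bsub>K p\<^esub> \<psi> N [x] p)"
    if "N \<in> opens_in A U'" "x \<in> sections A V N" for N x
    unfolding cochain_mult_apply using that by (simp add: tuples1')
  have main: "cobd A V U' 1 ?\<chi> N ss = (\<lambda>p\<in>N. cobd A V U' 1 \<phi> N ss p \<oplus>\<^bsub>K p\<^esub> cobd A V U' 1 \<psi> N ss p)"
    if N: "N \<in> opens_in A U'" and ss: "ss \<in> tuples A V N 2" for N ss
  proof -
    obtain s t where st: "s \<in> sections A V N" "t \<in> sections A V N" "ss = [s, t]"
      using ss unfolding tuples2 by auto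
    have oN: "zariski_open A N" using N by (rule opens_inD)
    note sec = cochains_sections[OF \<phi> N] cochains_sections[OF \<psi> N]
    have sec\<chi>: "?\<chi> N [x] \<in> sections A (reg_module A) N" if "x \<in> sections A V N" for x
      unfolding app[OF N that] by (intro R.Osec_closed oN sec that)
    note b = sec_V_closed(3)[OF oN st(1,2)]
    note e = cobd1_apply[of N U' s t ?\<chi>, OF N st(1,2) sec\<chi>[OF st(1)] sec\<chi>[OF st(2)] sec\<chi>[OF b]]
      cobd1_apply[of N U' s t \<phi>, OF N st(1,2) sec(1)[OF st(1)] sec(1)[OF st(2)] sec(1)[OF b]]
      cobd1_apply[of N U' s t \<psi>, OF N st(1,2) sec(2)[OF st(1)] sec(2)[OF st(2)] sec(2)[OF b]]
    show ?thesis unfolding st(3)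
    proof (rule trans[OF e(1)], rule restrict_ext)
      fix p assume p: "p \<in> N"
      then have sp: "p \<in> Spec A" using oN zariski_open_subset_Spec by blast
      then interpret Q: cring "K p" by (rule R.stalk_cring)
      have c: "\<phi> N [x] p \<in> carrier (K p)" "\<psi> N [x] p \<in> carrier (K p)" if "x \<in> sections A V N" for x
        using sec that p by (auto intro: R.Osec_stalk)
      have v: "x p \<in> carrier (stalk A V p)" if "x \<in> sections A V N" for x
        using that p by (rule R.sections_stalk)
      note act = stalk_act_add(1)[OF sp v]
      have act_closed: "stalk_act A p (x p) y \<in> carrier (K p)"
        if "x \<in> sections A V N" "y \<in> carrier (K p)" for x y
        by (rule stalk_act_add(2)[OF sp v[OF that(1)] that(2) that(2)])
      show "(stalk_act A p (s p) (?\<chi> N [t] p) \<ominus>\<^bsub>K p\<^esub> stalk_act A p (t p) (?\<chi> N [s] p))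
          \<ominus>\<^bsub>K p\<^esub> ?\<chi> N [sec_bracket A V N s t] p
        = cobd A V U' 1 \<phi> N [s, t] p \<oplus>\<^bsub>K p\<^esub> cobd A V U' 1 \<psi> N [s, t] p"
        unfolding e(2,3) restrict_apply'[OF p]
        unfolding app[OF N st(1)] app[OF N st(2)] app[OF N b]
        using p st b c act act_closed
        by (simp add: Q.minus_eq Q.minus_add Q.a_ac)
    qed
  qed
  show ?thesis
  proof (rule ext)
    fix N
    show "cobd A V U' 1 ?\<chi> N = (cobd A V U' 1 \<phi> \<otimes>\<^bsub>cochain_group A V U' 2\<^esub> cobd A V U' 1 \<psi>) N"
    proof (cases "N \<in> opens_in A U'")
      case True
      show ?thesis
      proof (rule ext)
        fix ss
        show "cobd A V U' 1 ?\<chi> N ss = (cobd A V U' 1 \<phi> \<otimes>\<^bsub>cochain_group A V U' 2\<^esub> cobd A V U' 1 \<psi>) N ss"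
        proof (cases "ss \<in> tuples A V N 2")
          case ss: True
          show ?thesis unfolding main[OF True ss] unfolding cochain_mult_apply using True ss by simp
        next
          case False
          then have "ss \<notin> tuples A V N (Suc 1)" by (simp add: numeral_2_eq_2)
          then show ?thesis unfolding cochain_mult_apply using True False by (simp add: cobd_def)
        qed
      qed
    next
      case False
      then show ?thesis unfolding cochain_mult_apply by (simp add: cobd_def)
    qed
  qed
qed

text \<open>A coset of the coboundaries that is represented by a coboundary is the neutral element of the cohomology.\<close>

lemma coboundaries2_translate:
  assumes \<theta>: "\<theta> \<in> cochains A V U' 1"
  shows "coboundaries A V U' 2 #>\<^bsub>cochain_group A V U' 2\<^esub> cobd A V U' 1 \<theta> = coboundaries A V U' 2"
proof -
  have B: "coboundaries A V U' 2 = cobd A V U' 1 ` cochains A V U' 1"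
    by (simp add: coboundaries_def numeral_2_eq_2)
  show ?thesis unfolding B r_coset_def
  proof (intro equalityI subsetI)
    fix x assume "x \<in> (\<Union>h\<in>cobd A V U' 1 ` cochains A V U' 1. {h \<otimes>\<^bsub>cochain_group A V U' 2\<^esub> cobd A V U' 1 \<theta>})"
    then obtain \<phi> where \<phi>: "\<phi> \<in> cochains A V U' 1"
      "x = cobd A V U' 1 \<phi> \<otimes>\<^bsub>cochain_group A V U' 2\<^esub> cobd A V U' 1 \<theta>" by auto
    then have "x = cobd A V U' 1 (\<phi> \<otimes>\<^bsub>cochain_group A V U' 1\<^esub> \<theta>)" by (simp only: cobd1_add[OF \<phi>(1) \<theta>])
    then show "x \<in> cobd A V U' 1 ` cochains A V U' 1" using cochain1_add_closed[OF \<phi>(1) \<theta>] by (rule image_eqI)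
  next
    fix x assume "x \<in> cobd A V U' 1 ` cochains A V U' 1"
    then obtain \<phi> where \<phi>: "\<phi> \<in> cochains A V U' 1" "x = cobd A V U' 1 \<phi>" by auto
    obtain \<chi> where \<chi>: "\<chi> \<in> cochains A V U' 1" "\<phi> = \<chi> \<otimes>\<^bsub>cochain_group A V U' 1\<^esub> \<theta>"
      using cochain1_diff[OF \<phi>(1) \<theta>] by blast
    have "x = cobd A V U' 1 \<chi> \<otimes>\<^bsub>cochain_group A V U' 2\<^esub> cobd A V U' 1 \<theta>"
      unfolding \<phi>(2) by (subst \<chi>(2)) (rule cobd1_add[OF \<chi>(1) \<theta>])
    then show "x \<in> (\<Union>h\<in>cobd A V U' 1 ` cochains A V U' 1. {h \<otimes>\<^bsub>cochain_group A V U' 2\<^esub> cobd A V U' 1 \<theta>})"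
      using \<chi>(1) by auto
  qed
qed

text \<open>Since the curvature is bilinear, at \<open>\<delta>/s\<close> and \<open>\<eta>/t\<close> it is the curvature at \<open>\<delta>\<close> and \<open>\<eta>\<close> divided by \<open>s t\<close>.\<close>

lemma trace_stalk_curvature:
  assumes conn: "is_connection A W nab" and p: "p \<in> U"
    and c: "\<delta> \<in> carrier V" "s \<in> compl p" "\<eta> \<in> carrier V" "t \<in> compl p"
  shows "trace (K p) (stalk A W p) (stalk_curvature A W nab p (frV p \<delta> s) (frV p \<eta> t))
    = frA p \<one> (s \<otimes> t) \<otimes>\<^bsub>K p\<^esub> tau p (curvature A W nab \<delta> \<eta>)"
proof -
  obtain r w where "loc_free A (compl p) W r w" using p by (rule locus_loc_free)
  then interpret P: loc_free A "compl p" W r w .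
  note [simp del] = P.S_carrier
  have c': "s \<in> carrier A" if "s \<in> compl p" for s using that by simp
  note R = curvature_endo[OF conn]
  show ?thesis
  proof (rule P.trace_scaled[OF R[OF c(1,3)] P.mult_in_S[OF c(2,4)]])
    fix v u assume vu: "v \<in> carrier W" "u \<in> compl p"
    have inner: "(\<Union>(w, u)\<in>P.fm v u. P.fm (curvature A W nab \<delta> \<eta> w) ((s \<otimes> t) \<otimes> u))
        = P.fm (curvature A W nab \<delta> \<eta> v) ((s \<otimes> t) \<otimes> u)"
      if V: "\<delta> \<in> carrier V" "\<eta> \<in> carrier V" and st: "s \<in> compl p" "t \<in> compl p" for \<delta> s \<eta> t
    proof (rule P.frac_UN[OF P.module_M vu])
      fix x v u assume *: "x \<in> compl p" "v \<in> carrier W" "u \<in> compl p"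
      have e: "(s \<otimes> t) \<otimes> (x \<otimes> u) = x \<otimes> ((s \<otimes> t) \<otimes> u)"
        using c'[OF st(1)] c'[OF st(2)] c'[OF *(1)] c'[OF *(3)] by (simp add: R.m_ac)
      show "P.fm (curvature A W nab \<delta> \<eta> (x \<odot>\<^bsub>W\<^esub> v)) ((s \<otimes> t) \<otimes> (x \<otimes> u))
          = P.fm (curvature A W nab \<delta> \<eta> v) ((s \<otimes> t) \<otimes> u)"
        unfolding e module_endoD(3)[OF R[OF V] c'[OF *(1)] *(2)]
        by (rule P.frac_scale[OF P.module_M module_endoD(1)[OF R[OF V] *(2)] _ *(1)])
          (intro P.mult_in_S st *)
    qed
    have "(\<Union>(\<delta>, s)\<in>frV p \<delta> s. \<Union>(\<eta>, t)\<in>frV p \<eta> t. \<Union>(w, u)\<in>P.fm v u.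
        P.fm (curvature A W nab \<delta> \<eta> w) ((s \<otimes> t) \<otimes> u))
        = (\<Union>(w, u)\<in>P.fm v u. P.fm (curvature A W nab \<delta> \<eta> w) ((s \<otimes> t) \<otimes> u))"
    proof (rule P.frac_UN2[OF V_module c(1,2) V_module c(3,4)])
      fix x \<delta> s \<eta> t
      assume *: "x \<in> compl p" "\<delta> \<in> carrier V" "s \<in> compl p" "\<eta> \<in> carrier V" "t \<in> compl p"
      note ** = c'[OF *(1)] c'[OF *(3)] c'[OF *(5)] c'[OF vu(2)]
      note R' = module_endoD(1)[OF R[OF *(2,4)] vu(1)]
      have d: "(s \<otimes> t) \<otimes> u \<in> compl p" by (intro P.mult_in_S * vu)
      have e: "((x \<otimes> s) \<otimes> t) \<otimes> u = x \<otimes> ((s \<otimes> t) \<otimes> u)" "(s \<otimes> (x \<otimes> t)) \<otimes> u = x \<otimes> ((s \<otimes> t) \<otimes> u)"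
        using ** by (simp_all add: R.m_ac)
      show "(\<Union>(w, u)\<in>P.fm v u. P.fm (curvature A W nab (x \<odot>\<^bsub>V\<^esub> \<delta>) \<eta> w) (((x \<otimes> s) \<otimes> t) \<otimes> u))
          = (\<Union>(w, u)\<in>P.fm v u. P.fm (curvature A W nab \<delta> \<eta> w) ((s \<otimes> t) \<otimes> u))"
        unfolding inner[OF *(2,4,3,5)] inner[OF V_smult_closed[OF *(2) **(1)] *(4) P.mult_in_S[OF *(1,3)] *(5)]
          e curvature_smult_left[OF conn *(2,4) **(1) vu(1)]
        by (rule P.frac_scale[OF P.module_M R' d *(1)])
      show "(\<Union>(w, u)\<in>P.fm v u. P.fm (curvature A W nab \<delta> (x \<odot>\<^bsub>V\<^esub> \<eta>) w) ((s \<otimes> (x \<otimes> t)) \<otimes> u))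
          = (\<Union>(w, u)\<in>P.fm v u. P.fm (curvature A W nab \<delta> \<eta> w) ((s \<otimes> t) \<otimes> u))"
        unfolding inner[OF *(2,4,3,5)] inner[OF *(2) V_smult_closed[OF *(4) **(1)] *(3) P.mult_in_S[OF *(1,5)]]
          e curvature_smult_right[OF conn *(2,4) **(1) vu(1)]
        by (rule P.frac_scale[OF P.module_M R' d *(1)])
    qed
    then show "stalk_curvature A W nab p (frV p \<delta> s) (frV p \<eta> t) (P.fm v u)
        = P.fm (curvature A W nab \<delta> \<eta> v) ((s \<otimes> t) \<otimes> u)"
      unfolding stalk_curvature_def restrict_apply'[OF P.loc_module_carrierI[OF vu]]
        inner[OF c(1,3,2,4)] .
  qed
qed

lemma connection_diff_linear:
  assumes conn: "is_connection A W nab" and conn0: "is_connection A W nab0"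
  shows "linear_form (\<lambda>\<delta> w. nab \<delta> w \<ominus>\<^bsub>W\<^esub> nab0 \<delta> w)"
  unfolding linear_form_def
proof (intro conjI ballI)
  fix \<delta> assume d: "\<delta> \<in> carrier V"
  show "module_endo A W (\<lambda>w. nab \<delta> w \<ominus>\<^bsub>W\<^esub> nab0 \<delta> w)"
    by (rule module_endo_diff[OF d connection_along_nab[OF conn d] connection_along_nab[OF conn0 d]])
qed (auto simp: connection_add[OF conn] connection_add[OF conn0] connection_smult[OF conn]
    connection_smult[OF conn0] nab_closed[OF conn] nab_closed[OF conn0] M.minus_eq M.minus_add
    M.a_ac smult_r_distr smult_r_minus)

text \<open>Writing \<open>\<nabla> = \<nabla>\<^sub>0 + \<alpha>\<close> with \<open>\<nabla>\<^sub>0\<close> flat, the curvature of \<open>\<nabla>\<close> is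
  \<open>[\<nabla>\<^sub>0(\<delta>), \<alpha>(\<eta>)] - [\<nabla>\<^sub>0(\<eta>), \<alpha>(\<delta>)] - [\<alpha>(\<eta>), \<alpha>(\<delta>)] - \<alpha>([\<delta>, \<eta>])\<close>. Taking traces turns the first two
  brackets into \<open>\<delta> (trace \<alpha>(\<eta>))\<close> and \<open>\<eta> (trace \<alpha>(\<delta>))\<close> and kills the third.\<close>

lemma tau_curvature:
  assumes conn: "is_connection A W nab" and conn0: "is_connection A W nab0" and flat0: "flat A W nab0"
    and p: "p \<in> U" and V: "\<delta> \<in> carrier V" "\<eta> \<in> carrier V"
    and \<alpha>: "\<alpha> = (\<lambda>\<delta> w. nab \<delta> w \<ominus>\<^bsub>W\<^esub> nab0 \<delta> w)"
  shows "tau p (curvature A W nab \<delta> \<eta>)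
    = (mult_set.loc_der A (compl p) \<delta> (tau p (\<alpha> \<eta>)) \<ominus>\<^bsub>K p\<^esub> mult_set.loc_der A (compl p) \<eta> (tau p (\<alpha> \<delta>)))
      \<ominus>\<^bsub>K p\<^esub> tau p (\<alpha> (lie_bracket A \<delta> \<eta>))"
proof -
  obtain r w where "loc_free A (compl p) W r w" using p by (rule locus_loc_free)
  then interpret P: loc_free A "compl p" W r w .
  note [simp del] = P.S_carrier
  note b = V_bracket_closed[OF V]
  have lin: "linear_form \<alpha>" unfolding \<alpha> by (rule connection_diff_linear[OF conn conn0])
  note en = linear_formD(1)[OF lin]
  note [simp] = V b nab_closed[OF conn] nab_closed[OF conn0] linear_formD(4)[OF lin]
  note ca0 = connection_along_nab[OF conn0]
  have nab: "nab \<xi> v = nab0 \<xi> v \<oplus>\<^bsub>W\<^esub> \<alpha> \<xi> v" if "\<xi> \<in> carrier V" "v \<in> carrier W" for \<xi> v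
    using that unfolding \<alpha> by (simp add: M.minus_eq M.a_comm[of "nab \<xi> v"] M.r_neg2)
  let ?T1 = "\<lambda>v. nab0 \<delta> (\<alpha> \<eta> v) \<ominus>\<^bsub>W\<^esub> \<alpha> \<eta> (nab0 \<delta> v)"
  let ?T2 = "\<lambda>v. nab0 \<eta> (\<alpha> \<delta> v) \<ominus>\<^bsub>W\<^esub> \<alpha> \<delta> (nab0 \<eta> v)"
  let ?T3 = "\<lambda>v. \<alpha> \<eta> (\<alpha> \<delta> v) \<ominus>\<^bsub>W\<^esub> \<alpha> \<delta> (\<alpha> \<eta> v)"
  let ?T4 = "\<alpha> (lie_bracket A \<delta> \<eta>)"
  have "curvature A W nab \<delta> \<eta> v = ((?T1 v \<ominus>\<^bsub>W\<^esub> ?T2 v) \<ominus>\<^bsub>W\<^esub> ?T3 v) \<ominus>\<^bsub>W\<^esub> ?T4 v" if v: "v \<in> carrier W" for v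
  proof -
    have 1: "nab \<xi> (nab \<zeta> v) = (nab0 \<xi> (nab0 \<zeta> v) \<oplus>\<^bsub>W\<^esub> nab0 \<xi> (\<alpha> \<zeta> v)) \<oplus>\<^bsub>W\<^esub> (\<alpha> \<xi> (nab0 \<zeta> v) \<oplus>\<^bsub>W\<^esub> \<alpha> \<xi> (\<alpha> \<zeta> v))"
      if "\<xi> \<in> carrier V" "\<zeta> \<in> carrier V" for \<xi> \<zeta>
      using that v by (simp add: nab connection_alongD(2)[OF ca0] module_endoD(2)[OF en])
    have "curvature A W nab \<delta> \<eta> v = curvature A W nab0 \<delta> \<eta> v \<oplus>\<^bsub>W\<^esub>
        (((?T1 v \<ominus>\<^bsub>W\<^esub> ?T2 v) \<ominus>\<^bsub>W\<^esub> ?T3 v) \<ominus>\<^bsub>W\<^esub> ?T4 v)"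
      using v by (simp add: curvature_def 1) (simp add: nab M.minus_eq M.minus_add M.a_ac)
    then show ?thesis using flat0 v by (simp add: flat_def)
  qed
  then have "tau p (curvature A W nab \<delta> \<eta>) = tau p (\<lambda>v. ((?T1 v \<ominus>\<^bsub>W\<^esub> ?T2 v) \<ominus>\<^bsub>W\<^esub> ?T3 v) \<ominus>\<^bsub>W\<^esub> ?T4 v)"
    by (rule P.loc_trace_cong)
  also have "\<dots> = ((tau p ?T1 \<ominus>\<^bsub>K p\<^esub> tau p ?T2) \<ominus>\<^bsub>K p\<^esub> tau p ?T3) \<ominus>\<^bsub>K p\<^esub> tau p ?T4"
  proof -
    have T1: "module_endo A W ?T1" by (rule P.module_endo_commutator[OF V_derivation[OF V(1)] ca0[OF V(1)] en[OF V(2)]])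
    have T2: "module_endo A W ?T2" by (rule P.module_endo_commutator[OF V_derivation[OF V(2)] ca0[OF V(2)] en[OF V(1)]])
    have T3: "module_endo A W ?T3"
      by (rule P.module_endo_commutator[OF R.zero_derivation _ en[OF V(1)]]) (use en V in \<open>simp add: connection_along_zero\<close>)
    show ?thesis
      by (simp add: P.loc_trace_minus T1 T2 T3 en)
  qed
  also have "tau p ?T1 = mult_set.loc_der A (compl p) \<delta> (tau p (\<alpha> \<eta>))"
    by (rule P.loc_trace_commutator[OF V_derivation[OF V(1)] ca0[OF V(1)] en[OF V(2)]])
  also have "tau p ?T2 = mult_set.loc_der A (compl p) \<eta> (tau p (\<alpha> \<delta>))"
    by (rule P.loc_trace_commutator[OF V_derivation[OF V(2)] ca0[OF V(2)] en[OF V(1)]])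
  also have "tau p ?T3 = P.loc_der (\<lambda>_. \<zero>) (tau p (\<alpha> \<delta>))"
    by (rule P.loc_trace_commutator[OF R.zero_derivation _ en[OF V(1)]]) (use en V in \<open>simp add: connection_along_zero\<close>)
  also have "\<dots> = \<zero>\<^bsub>K p\<^esub>"
  proof -
    obtain a t where a: "a \<in> carrier A" "t \<in> compl p" "tau p (\<alpha> \<delta>) = frA p a t"
      using tau_closed[OF p en[OF V(1)]] by (rule P.loc_ring_carrierE)
    have "t \<in> carrier A" using a(2) by simp
    then show ?thesis using a P.fr_zero[OF P.mult_in_S[OF a(2) a(2)]]
      by (simp add: P.loc_der_fr[OF R.zero_derivation] R.minus_eq)
  qed
  finally show ?thesis
    using tau_closed[OF p en[OF V(1)]] tau_closed[OF p en[OF V(2)]]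
    by (simp add: P.loc_der_closed[OF V_derivation] P.Q.minus_eq)
qed

text \<open>Both sides are bilinear over the fractions, so the claim reduces to \<open>tau_curvature\<close> for the numerators. The terms
  in which the denominators are differentiated cancel, since they occur in the bracket and in the action with
  opposite signs.\<close>

lemma stalk_coboundary:
  assumes conn: "is_connection A W nab" and conn0: "is_connection A W nab0" and flat0: "flat A W nab0"
    and p: "p \<in> U" and x: "x \<in> carrier (stalk A V p)" "y \<in> carrier (stalk A V p)"
    and \<alpha>: "\<alpha> = (\<lambda>\<delta> w. nab \<delta> w \<ominus>\<^bsub>W\<^esub> nab0 \<delta> w)"
  shows "(stalk_act A p x (stalk_trace \<alpha> p y) \<ominus>\<^bsub>K p\<^esub> stalk_act A p y (stalk_trace \<alpha> p x))
      \<ominus>\<^bsub>K p\<^esub> stalk_trace \<alpha> p (stalk_bracket A V p x y)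
    = trace (K p) (stalk A W p) (stalk_curvature A W nab p x y)"
proof -
  obtain r w where "loc_free A (compl p) W r w" using p by (rule locus_loc_free)
  then interpret P: loc_free A "compl p" W r w .
  note [simp del] = P.S_carrier
  have sp: "p \<in> Spec A" using p locus_subset_Spec by auto
  obtain \<delta> s where d: "\<delta> \<in> carrier V" "s \<in> compl p" "x = frV p \<delta> s" using x(1) by (rule P.loc_module_carrierE)
  obtain \<eta> t where e: "\<eta> \<in> carrier V" "t \<in> compl p" "y = frV p \<eta> t" using x(2) by (rule P.loc_module_carrierE)
  have st: "s \<in> carrier A" "t \<in> carrier A" using d e by auto
  note b = V_bracket_closed[OF d(1) e(1)]
  have lin: "linear_form \<alpha>" unfolding \<alpha> by (rule connection_diff_linear[OF conn conn0])
  note en = linear_formD(1)[OF lin]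
  define td te tb where "td = tau p (\<alpha> \<delta>)" and "te = tau p (\<alpha> \<eta>)" and "tb = tau p (\<alpha> (lie_bracket A \<delta> \<eta>))"
  define D E where "D = P.loc_der \<delta>" and "E = P.loc_der \<eta>"
  have cl: "td \<in> carrier (K p)" "te \<in> carrier (K p)" "tb \<in> carrier (K p)"
    unfolding td_def te_def tb_def using d e b by (auto intro: tau_closed[OF p] en)
  note DE = V_derivation[OF d(1)] V_derivation[OF e(1)]
  have cD: "D u \<in> carrier (K p)" "E u \<in> carrier (K p)" if "u \<in> carrier (K p)" for u
    unfolding D_def E_def using P.loc_der_closed DE that by auto
  define si ti where "si = frA p \<one> s" and "ti = frA p \<one> t"
  have ci: "si \<in> carrier (K p)" "ti \<in> carrier (K p)"
    unfolding si_def ti_def using d e sp by (auto intro: frA_closed)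
  have ss: "s \<otimes> s \<in> compl p" "t \<otimes> t \<in> compl p" "s \<otimes> t \<in> compl p" "(s \<otimes> s) \<otimes> (t \<otimes> t) \<in> compl p"
    by (intro P.mult_in_S d(2) e(2))+
  have Dt: "\<delta> t \<in> carrier A" "\<eta> s \<in> carrier A" using d e st by auto
  note lm = P.loc_ring_mult
  define dt es where "dt = frA p (\<delta> t) \<one>" and "es = frA p (\<eta> s) \<one>"
  have cde: "dt \<in> carrier (K p)" "es \<in> carrier (K p)"
    unfolding dt_def es_def using Dt P.one_in_S sp by (auto intro!: frA_closed)
  have D1: "\<delta> \<one> = \<zero>" "\<eta> \<one> = \<zero>" by (rule derivation_one[OF DE(1)], rule derivation_one[OF DE(2)])
  have Dti: "D ti = \<ominus>\<^bsub>K p\<^esub> ((ti \<otimes>\<^bsub>K p\<^esub> ti) \<otimes>\<^bsub>K p\<^esub> dt)"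
    and Esi: "E si = \<ominus>\<^bsub>K p\<^esub> ((si \<otimes>\<^bsub>K p\<^esub> si) \<otimes>\<^bsub>K p\<^esub> es)"
    unfolding D_def E_def ti_def si_def dt_def es_def
    using P.loc_der_fr[OF DE(1) _ e(2), of \<one>] P.loc_der_fr[OF DE(2) _ d(2), of \<one>] ss(1,2) d(2) e(2) st Dt
      P.one_in_S D1 sp
    by (simp_all add: lm R.stalk_ring_ops R.minus_eq del: Diff_iff)
  have act: "stalk_act A p x (stalk_trace \<alpha> p y) = si \<otimes>\<^bsub>K p\<^esub> D (ti \<otimes>\<^bsub>K p\<^esub> te)"
    "stalk_act A p y (stalk_trace \<alpha> p x) = ti \<otimes>\<^bsub>K p\<^esub> E (si \<otimes>\<^bsub>K p\<^esub> td)"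
    unfolding d(3) e(3) stalk_trace_eq[OF lin p d(1,2)] stalk_trace_eq[OF lin p e(1,2)]
      td_def[symmetric] te_def[symmetric] si_def[symmetric] ti_def[symmetric] D_def E_def
    using stalk_act_eq[OF sp d(1,2), of "ti \<otimes>\<^bsub>K p\<^esub> te"] stalk_act_eq[OF sp e(1,2), of "si \<otimes>\<^bsub>K p\<^esub> td"] ci cl
    by (simp_all add: si_def ti_def)
  define i2 where "i2 = (si \<otimes>\<^bsub>K p\<^esub> si) \<otimes>\<^bsub>K p\<^esub> (ti \<otimes>\<^bsub>K p\<^esub> ti)"
  have tnum: "tau p (\<alpha> (bracket_num \<delta> s \<eta> t))
      = (frA p (s \<otimes> t) \<one> \<otimes>\<^bsub>K p\<^esub> tb \<ominus>\<^bsub>K p\<^esub> frA p (s \<otimes> \<delta> t) \<one> \<otimes>\<^bsub>K p\<^esub> te) \<oplus>\<^bsub>K p\<^esub> frA p (t \<otimes> \<eta> s) \<one> \<otimes>\<^bsub>K p\<^esub> td"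
  proof -
    let ?T = "\<lambda>v. (s \<otimes> t) \<odot>\<^bsub>W\<^esub> \<alpha> (lie_bracket A \<delta> \<eta>) v \<oplus>\<^bsub>W\<^esub> (\<ominus> (s \<otimes> \<delta> t)) \<odot>\<^bsub>W\<^esub> \<alpha> \<eta> v"
    have T: "module_endo A W ?T" using st Dt by (intro P.module_endo_lin en b e) auto
    have neg: "frA p (\<ominus> (s \<otimes> \<delta> t)) \<one> = \<ominus>\<^bsub>K p\<^esub> frA p (s \<otimes> \<delta> t) \<one>"
      using R.stalk_ring_ops(3)[OF sp _ _ P.one_in_S P.one_in_S, of "s \<otimes> \<delta> t" \<one>] st Dt by simp
    have c1: "frA p (s \<otimes> \<delta> t) \<one> \<in> carrier (K p)" using st Dt sp P.one_in_S by (intro frA_closed) auto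
    have "bracket_num \<delta> s \<eta> t = ((s \<otimes> t) \<odot>\<^bsub>V\<^esub> lie_bracket A \<delta> \<eta> \<oplus>\<^bsub>V\<^esub> (\<ominus> (s \<otimes> \<delta> t)) \<odot>\<^bsub>V\<^esub> \<eta>)
        \<oplus>\<^bsub>V\<^esub> (t \<otimes> \<eta> s) \<odot>\<^bsub>V\<^esub> \<delta>"
      unfolding bracket_num_def using V.smult_l_minus[of "s \<otimes> \<delta> t" \<eta>] d e st Dt b by (simp add: V.M.minus_eq)
    then have "tau p (\<alpha> (bracket_num \<delta> s \<eta> t)) = tau p (\<lambda>v. \<one> \<odot>\<^bsub>W\<^esub> ?T v \<oplus>\<^bsub>W\<^esub> (t \<otimes> \<eta> s) \<odot>\<^bsub>W\<^esub> \<alpha> \<delta> v)"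
      using d e st Dt b by (intro P.loc_trace_cong) (simp add: linear_formD[OF lin])
    also have "\<dots> = frA p \<one> \<one> \<otimes>\<^bsub>K p\<^esub> tau p ?T \<oplus>\<^bsub>K p\<^esub> frA p (t \<otimes> \<eta> s) \<one> \<otimes>\<^bsub>K p\<^esub> td"
      unfolding td_def using st Dt d by (intro P.loc_trace_lin T en) auto
    also have "tau p ?T = frA p (s \<otimes> t) \<one> \<otimes>\<^bsub>K p\<^esub> tb \<oplus>\<^bsub>K p\<^esub> frA p (\<ominus> (s \<otimes> \<delta> t)) \<one> \<otimes>\<^bsub>K p\<^esub> te"
      unfolding te_def tb_def using st Dt b e by (intro P.loc_trace_lin en) auto
    also have "frA p \<one> \<one> = \<one>\<^bsub>K p\<^esub>" by (simp add: P.loc_ring_one)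
    finally show ?thesis using c1 cl st P.one_in_S sp
      by (simp add: neg P.Q.l_minus P.Q.minus_eq frA_closed del: Diff_iff)
  qed
  have "stalk_trace \<alpha> p (stalk_bracket A V p x y) = frA p \<one> ((s \<otimes> s) \<otimes> (t \<otimes> t)) \<otimes>\<^bsub>K p\<^esub> tau p (\<alpha> (bracket_num \<delta> s \<eta> t))"
    unfolding d(3) e(3) stalk_bracket_eq[OF sp d(1) e(1) d(2) e(2)]
    using d e st by (intro stalk_trace_eq[OF lin p _ ss(4)] bracket_num_closed) auto
  also have "frA p \<one> ((s \<otimes> s) \<otimes> (t \<otimes> t)) = i2"
    unfolding i2_def si_def ti_def using lm d e ss st by simp
  also have "i2 \<otimes>\<^bsub>K p\<^esub> tau p (\<alpha> (bracket_num \<delta> s \<eta> t))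
      = (si \<otimes>\<^bsub>K p\<^esub> ti \<otimes>\<^bsub>K p\<^esub> tb \<ominus>\<^bsub>K p\<^esub> si \<otimes>\<^bsub>K p\<^esub> (ti \<otimes>\<^bsub>K p\<^esub> ti) \<otimes>\<^bsub>K p\<^esub> dt \<otimes>\<^bsub>K p\<^esub> te)
        \<oplus>\<^bsub>K p\<^esub> ti \<otimes>\<^bsub>K p\<^esub> (si \<otimes>\<^bsub>K p\<^esub> si) \<otimes>\<^bsub>K p\<^esub> es \<otimes>\<^bsub>K p\<^esub> td"
  proof -
    define js jt where "js = frA p s \<one>" and "jt = frA p t \<one>"
    have cj: "js \<in> carrier (K p)" "jt \<in> carrier (K p)"
      unfolding js_def jt_def using st sp P.one_in_S by (auto intro!: frA_closed)
    have unit: "frA p u \<one> \<otimes>\<^bsub>K p\<^esub> frA p \<one> u = \<one>\<^bsub>K p\<^esub>" if "u \<in> compl p" for u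
    proof -
      have "u \<in> carrier A" using that by simp
      then show ?thesis
        using lm[of u \<one> \<one> u] that P.one_in_S P.fr_scale[of \<one> \<one> u] by (simp add: P.loc_ring_one del: Diff_iff)
    qed
    have u: "js \<otimes>\<^bsub>K p\<^esub> si = \<one>\<^bsub>K p\<^esub>" "jt \<otimes>\<^bsub>K p\<^esub> ti = \<one>\<^bsub>K p\<^esub>"
      unfolding js_def jt_def si_def ti_def using unit d e by auto
    have u': "js \<otimes>\<^bsub>K p\<^esub> (si \<otimes>\<^bsub>K p\<^esub> z) = z" "jt \<otimes>\<^bsub>K p\<^esub> (ti \<otimes>\<^bsub>K p\<^esub> z) = z" if "z \<in> carrier (K p)" for z
      using u that cj ci by (simp_all flip: P.Q.m_assoc)
    have f: "frA p (s \<otimes> t) \<one> = js \<otimes>\<^bsub>K p\<^esub> jt" "frA p (s \<otimes> \<delta> t) \<one> = js \<otimes>\<^bsub>K p\<^esub> dt"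
      "frA p (t \<otimes> \<eta> s) \<one> = jt \<otimes>\<^bsub>K p\<^esub> es"
      unfolding js_def jt_def dt_def es_def using lm[of _ _ \<one> \<one>] st Dt P.one_in_S by simp_all
    have 1: "i2 \<otimes>\<^bsub>K p\<^esub> (js \<otimes>\<^bsub>K p\<^esub> jt \<otimes>\<^bsub>K p\<^esub> tb) = js \<otimes>\<^bsub>K p\<^esub> (si \<otimes>\<^bsub>K p\<^esub> (jt \<otimes>\<^bsub>K p\<^esub> (ti \<otimes>\<^bsub>K p\<^esub> (si \<otimes>\<^bsub>K p\<^esub> ti \<otimes>\<^bsub>K p\<^esub> tb))))"
      "i2 \<otimes>\<^bsub>K p\<^esub> (js \<otimes>\<^bsub>K p\<^esub> dt \<otimes>\<^bsub>K p\<^esub> te) = js \<otimes>\<^bsub>K p\<^esub> (si \<otimes>\<^bsub>K p\<^esub> (si \<otimes>\<^bsub>K p\<^esub> (ti \<otimes>\<^bsub>K p\<^esub> ti) \<otimes>\<^bsub>K p\<^esub> dt \<otimes>\<^bsub>K p\<^esub> te))"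
      "i2 \<otimes>\<^bsub>K p\<^esub> (jt \<otimes>\<^bsub>K p\<^esub> es \<otimes>\<^bsub>K p\<^esub> td) = jt \<otimes>\<^bsub>K p\<^esub> (ti \<otimes>\<^bsub>K p\<^esub> (ti \<otimes>\<^bsub>K p\<^esub> (si \<otimes>\<^bsub>K p\<^esub> si) \<otimes>\<^bsub>K p\<^esub> es \<otimes>\<^bsub>K p\<^esub> td))"
      unfolding i2_def using cj ci cl cde by (simp_all add: P.Q.m_ac)
    have ci2: "i2 \<in> carrier (K p)" unfolding i2_def using ci by simp
    show ?thesis
      unfolding tnum f using cj ci cl cde ci2
      by (simp add: P.Q.r_distr P.Q.minus_eq P.Q.r_minus 1 u')
  qed
  finally have br: "stalk_trace \<alpha> p (stalk_bracket A V p x y)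
      = (si \<otimes>\<^bsub>K p\<^esub> ti \<otimes>\<^bsub>K p\<^esub> tb \<ominus>\<^bsub>K p\<^esub> si \<otimes>\<^bsub>K p\<^esub> (ti \<otimes>\<^bsub>K p\<^esub> ti) \<otimes>\<^bsub>K p\<^esub> dt \<otimes>\<^bsub>K p\<^esub> te)
        \<oplus>\<^bsub>K p\<^esub> ti \<otimes>\<^bsub>K p\<^esub> (si \<otimes>\<^bsub>K p\<^esub> si) \<otimes>\<^bsub>K p\<^esub> es \<otimes>\<^bsub>K p\<^esub> td" .
  have lb: "si \<otimes>\<^bsub>K p\<^esub> D (ti \<otimes>\<^bsub>K p\<^esub> te) = \<ominus>\<^bsub>K p\<^esub> (si \<otimes>\<^bsub>K p\<^esub> (ti \<otimes>\<^bsub>K p\<^esub> ti) \<otimes>\<^bsub>K p\<^esub> dt \<otimes>\<^bsub>K p\<^esub> te) \<oplus>\<^bsub>K p\<^esub> si \<otimes>\<^bsub>K p\<^esub> ti \<otimes>\<^bsub>K p\<^esub> D te"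
    "ti \<otimes>\<^bsub>K p\<^esub> E (si \<otimes>\<^bsub>K p\<^esub> td) = \<ominus>\<^bsub>K p\<^esub> (ti \<otimes>\<^bsub>K p\<^esub> (si \<otimes>\<^bsub>K p\<^esub> si) \<otimes>\<^bsub>K p\<^esub> es \<otimes>\<^bsub>K p\<^esub> td) \<oplus>\<^bsub>K p\<^esub> si \<otimes>\<^bsub>K p\<^esub> ti \<otimes>\<^bsub>K p\<^esub> E td"
    using P.loc_der_mult[OF DE(1) ci(2) cl(2)] P.loc_der_mult[OF DE(2) ci(1) cl(1)] ci cl cde cD
    by (simp_all add: D_def[symmetric] E_def[symmetric] Dti Esi P.Q.r_distr P.Q.l_minus P.Q.r_minus P.Q.m_ac)
  have "(stalk_act A p x (stalk_trace \<alpha> p y) \<ominus>\<^bsub>K p\<^esub> stalk_act A p y (stalk_trace \<alpha> p x))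
      \<ominus>\<^bsub>K p\<^esub> stalk_trace \<alpha> p (stalk_bracket A V p x y)
      = (si \<otimes>\<^bsub>K p\<^esub> ti \<otimes>\<^bsub>K p\<^esub> D te \<ominus>\<^bsub>K p\<^esub> si \<otimes>\<^bsub>K p\<^esub> ti \<otimes>\<^bsub>K p\<^esub> E td) \<ominus>\<^bsub>K p\<^esub> si \<otimes>\<^bsub>K p\<^esub> ti \<otimes>\<^bsub>K p\<^esub> tb"
    unfolding act br lb using ci cl cde cD by (intro P.Q.coboundary_cancel) auto
  also have "\<dots> = (si \<otimes>\<^bsub>K p\<^esub> ti) \<otimes>\<^bsub>K p\<^esub> ((D te \<ominus>\<^bsub>K p\<^esub> E td) \<ominus>\<^bsub>K p\<^esub> tb)"
    using ci cl cD by (simp add: P.Q.r_distr P.Q.minus_eq P.Q.r_minus)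
  also have "(D te \<ominus>\<^bsub>K p\<^esub> E td) \<ominus>\<^bsub>K p\<^esub> tb = tau p (curvature A W nab \<delta> \<eta>)"
    unfolding D_def E_def td_def te_def tb_def
    by (rule tau_curvature[OF conn conn0 flat0 p d(1) e(1) \<alpha>, symmetric])
  also have "si \<otimes>\<^bsub>K p\<^esub> ti = frA p \<one> (s \<otimes> t)" unfolding si_def ti_def using lm d e by simp
  finally show ?thesis
    unfolding d(3) e(3) trace_stalk_curvature[OF conn p d(1,2) e(1,2)] .
qed

lemma trace_curvature_coboundary:
  assumes conn: "is_connection A W nab" and conn0: "is_connection A W nab0" and flat0: "flat A W nab0"
    and \<alpha>: "\<alpha> = (\<lambda>\<delta> w. nab \<delta> w \<ominus>\<^bsub>W\<^esub> nab0 \<delta> w)"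
  shows "trace_curvature A W nab U = cobd A V U 1 (trace_cochain \<alpha>)"
proof (rule ext, rule ext)
  have lin: "linear_form \<alpha>" unfolding \<alpha> by (rule connection_diff_linear[OF conn conn0])
  note co = trace_cochain_cochain[OF lin]
  fix N ss
  show "trace_curvature A W nab U N ss = cobd A V U 1 (trace_cochain \<alpha>) N ss"
  proof (cases "N \<in> opens_in A U \<and> ss \<in> tuples A V N 2")
    case False
    then show ?thesis by (cases "N \<in> opens_in A U") (auto simp: trace_curvature_def cobd_def numeral_2_eq_2)
  next
    case True
    then have N: "N \<in> opens_in A U" and ss: "ss \<in> tuples A V N 2" by auto
    obtain s t where st: "s \<in> sections A V N" "t \<in> sections A V N" "ss = [s, t]"
      using ss unfolding tuples2 by auto
    note sec = cochains_sections[OF co N]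
    note b = sec_V_closed(3)[OF opens_inD(1)[OF N] st(1,2)]
    have app: "trace_cochain \<alpha> N [x] = (\<lambda>p\<in>N. stalk_trace \<alpha> p (x p))" if "x \<in> sections A V N" for x
      using that N by (simp add: trace_cochain_def tuples1')
    have "cobd A V U 1 (trace_cochain \<alpha>) N ss = (\<lambda>p\<in>N.
        trace (K p) (stalk A W p) (stalk_curvature A W nab p (s p) (t p)))"
      unfolding st(3) cobd1_apply[of N U s t "trace_cochain \<alpha>", OF N st(1,2) sec[OF st(1)] sec[OF st(2)] sec[OF b]]
    proof (rule restrict_ext)
      fix p assume p: "p \<in> N"
      then have pU: "p \<in> U" using opens_inD(2)[OF N] by auto
      show "(stalk_act A p (s p) (trace_cochain \<alpha> N [t] p) \<ominus>\<^bsub>K p\<^esub> stalk_act A p (t p) (trace_cochain \<alpha> N [s] p))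
          \<ominus>\<^bsub>K p\<^esub> trace_cochain \<alpha> N [sec_bracket A V N s t] p
        = trace (K p) (stalk A W p) (stalk_curvature A W nab p (s p) (t p))"
        unfolding app[OF st(1)] app[OF st(2)] app[OF b] restrict_apply'[OF p]
        unfolding sec_bracket_def restrict_apply'[OF p]
        by (rule stalk_coboundary[OF conn conn0 flat0 pU R.sections_stalk[OF st(1) p] R.sections_stalk[OF st(2) p] \<alpha>])
    qed
    then show ?thesis using N ss by (simp add: trace_curvature_def st(3))
  qed
qed

text \<open>The trace of the curvature of any connection is the coboundary of the trace of its difference
  to the flat one.\<close>

theorem chern1_trivial:
  assumes conn0: "is_connection A W nab0" and flat0: "flat A W nab0"
  shows "chern1 A W = \<one>\<^bsub>cohomology A V U 2\<^esub>"
proof -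
  let ?nab = "SOME nab. is_connection A W nab"
  have conn: "is_connection A W ?nab" by (rule someI[of "\<lambda>nab. is_connection A W nab", OF conn0])
  let ?\<alpha> = "\<lambda>\<delta> w. ?nab \<delta> w \<ominus>\<^bsub>W\<^esub> nab0 \<delta> w"
  have "chern1 A W = coboundaries A V U 2 #>\<^bsub>cochain_group A V U 2\<^esub> cobd A V U 1 (trace_cochain ?\<alpha>)"
    unfolding chern1_def Let_def trace_curvature_coboundary[OF conn conn0 flat0 refl] ..
  also have "\<dots> = coboundaries A V U 2"
    by (rule coboundaries2_translate[OF trace_cochain_cochain[OF connection_diff_linear[OF conn conn0]]])
  finally show ?thesis by (simp add: cohomology_def FactGroup_def)
qed

text \<open>Acting on the coordinates in a basis is a flat connection.\<close>

lemma free_flat_connection: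
  assumes B: "is_basis A W r e"
  shows "\<exists>nab. is_connection A W nab \<and> flat A W nab"
proof -
  have e [simp]: "e i \<in> carrier W" if "i < r" for i using B that by (auto simp: is_basis_def)
  define c where "c w i = coords A W r e w i" for w i
  have c [simp]: "c w i \<in> carrier A" if "w \<in> carrier W" "i < r" for w i
    using coords_in(1)[OF B that(1)] that(2) by (auto simp: c_def)
  have we: "w = (\<Oplus>\<^bsub>W\<^esub>i\<in>{..<r}. c w i \<odot>\<^bsub>W\<^esub> e i)" if "w \<in> carrier W" for w
    unfolding c_def by (rule coords_in(2)[OF B that])
  have ceq: "c w i = d i" if "\<And>i. i < r \<Longrightarrow> d i \<in> carrier A" "w = (\<Oplus>\<^bsub>W\<^esub>i\<in>{..<r}. d i \<odot>\<^bsub>W\<^esub> e i)" "i < r" for w d i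
    unfolding c_def by (rule coords_eqI[OF B that])
  have comb [simp]: "(\<Oplus>\<^bsub>W\<^esub>i\<in>{..<r}. d i \<odot>\<^bsub>W\<^esub> e i) \<in> carrier W" if "\<And>i. i < r \<Longrightarrow> d i \<in> carrier A" for d
    using that by (auto intro!: M.finsum_closed)
  have cong: "(\<Oplus>\<^bsub>W\<^esub>i\<in>{..<r}. d i \<odot>\<^bsub>W\<^esub> e i) = (\<Oplus>\<^bsub>W\<^esub>i\<in>{..<r}. d' i \<odot>\<^bsub>W\<^esub> e i)"
    if "\<And>i. i < r \<Longrightarrow> d i = d' i" "\<And>i. i < r \<Longrightarrow> d' i \<in> carrier A" for d d'
    using that by (intro M.finsum_cong') auto
  have lin: "x \<odot>\<^bsub>W\<^esub> (\<Oplus>\<^bsub>W\<^esub>i\<in>{..<r}. d i \<odot>\<^bsub>W\<^esub> e i) \<oplus>\<^bsub>W\<^esub> y \<odot>\<^bsub>W\<^esub> (\<Oplus>\<^bsub>W\<^esub>i\<in>{..<r}. d' i \<odot>\<^bsub>W\<^esub> e i)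
      = (\<Oplus>\<^bsub>W\<^esub>i\<in>{..<r}. (x \<otimes> d i \<oplus> y \<otimes> d' i) \<odot>\<^bsub>W\<^esub> e i)"
    if "x \<in> carrier A" "y \<in> carrier A" "\<And>i. i < r \<Longrightarrow> d i \<in> carrier A" "\<And>i. i < r \<Longrightarrow> d' i \<in> carrier A" for x y d d'
    using that by (intro lin_comb2[symmetric]) auto
  have clin: "c (x \<odot>\<^bsub>W\<^esub> v \<oplus>\<^bsub>W\<^esub> y \<odot>\<^bsub>W\<^esub> w) i = x \<otimes> c v i \<oplus> y \<otimes> c w i"
    if "x \<in> carrier A" "y \<in> carrier A" "v \<in> carrier W" "w \<in> carrier W" "i < r" for x y v w i
  proof (rule ceq)
    show "x \<odot>\<^bsub>W\<^esub> v \<oplus>\<^bsub>W\<^esub> y \<odot>\<^bsub>W\<^esub> w = (\<Oplus>\<^bsub>W\<^esub>i\<in>{..<r}. (x \<otimes> c v i \<oplus> y \<otimes> c w i) \<odot>\<^bsub>W\<^esub> e i)"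
      using that by (subst we[OF that(3)], subst we[OF that(4)], subst lin) auto
  qed (use that in auto)
  have cadd: "c (v \<oplus>\<^bsub>W\<^esub> w) i = c v i \<oplus> c w i" if "v \<in> carrier W" "w \<in> carrier W" "i < r" for v w i
    using clin[of \<one> \<one> v w i] that by simp
  have csm: "c (x \<odot>\<^bsub>W\<^esub> v) i = x \<otimes> c v i" if "x \<in> carrier A" "v \<in> carrier W" "i < r" for x v i
    using clin[of x \<zero> v v i] that by simp
  define N where "N \<delta> w = (\<Oplus>\<^bsub>W\<^esub>i\<in>{..<r}. \<delta> (c w i) \<odot>\<^bsub>W\<^esub> e i)" for \<delta> :: "'a \<Rightarrow> 'a" and w
  define nab where "nab = (\<lambda>\<delta>\<in>carrier V. \<lambda>w\<in>carrier W. N \<delta> w)"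
  have N [simp]: "N \<delta> w \<in> carrier W" if "\<delta> \<in> carrier V" "w \<in> carrier W" for \<delta> w
    using that by (simp add: N_def)
  have cN: "c (N \<delta> w) i = \<delta> (c w i)" if "\<delta> \<in> carrier V" "w \<in> carrier W" "i < r" for \<delta> w i
    by (rule ceq) (use that in \<open>auto simp: N_def\<close>)
  have d: "\<delta> (a \<oplus> b) = \<delta> a \<oplus> \<delta> b" "\<delta> (a \<otimes> b) = \<delta> a \<otimes> b \<oplus> a \<otimes> \<delta> b"
    if "\<delta> \<in> carrier V" "a \<in> carrier A" "b \<in> carrier A" for \<delta> a b
    using is_derivationD(2,3)[OF V_derivation[OF that(1)] that(2,3)] by auto
  have ds: "\<delta> (k \<odot>\<^bsub>A\<^esub> \<one>) = \<zero>" if "\<delta> \<in> carrier V" for \<delta> k using that by (simp add: VW_iff Der_F_iff)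
  have add: "N \<delta> v \<oplus>\<^bsub>W\<^esub> N \<eta> w = (\<Oplus>\<^bsub>W\<^esub>i\<in>{..<r}. (\<delta> (c v i) \<oplus> \<eta> (c w i)) \<odot>\<^bsub>W\<^esub> e i)"
    if "\<delta> \<in> carrier V" "\<eta> \<in> carrier V" "v \<in> carrier W" "w \<in> carrier W" for \<delta> \<eta> v w
    using lin[of \<one> \<one> "\<lambda>i. \<delta> (c v i)" "\<lambda>i. \<eta> (c w i)"] that unfolding N_def by (auto intro: cong)
  have leib: "N \<delta> (a \<odot>\<^bsub>W\<^esub> w) = a \<odot>\<^bsub>W\<^esub> N \<delta> w \<oplus>\<^bsub>W\<^esub> \<delta> a \<odot>\<^bsub>W\<^esub> w"
    if "\<delta> \<in> carrier V" "a \<in> carrier A" "w \<in> carrier W" for \<delta> a w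
  proof -
    have "a \<odot>\<^bsub>W\<^esub> N \<delta> w \<oplus>\<^bsub>W\<^esub> \<delta> a \<odot>\<^bsub>W\<^esub> w = (\<Oplus>\<^bsub>W\<^esub>i\<in>{..<r}. (a \<otimes> \<delta> (c w i) \<oplus> \<delta> a \<otimes> c w i) \<odot>\<^bsub>W\<^esub> e i)"
      using that unfolding N_def by (subst (2) we[OF that(3)], subst lin) auto
    also have "\<dots> = N \<delta> (a \<odot>\<^bsub>W\<^esub> w)"
      unfolding N_def using that by (intro cong[symmetric]) (auto simp: csm d R.a_comm)
    finally show ?thesis ..
  qed
  have "is_connection A W nab"
    unfolding is_connection_def
  proof (intro conjI ballI)
    have "(\<lambda>w\<in>carrier W. N \<delta> w) \<in> End_F A W" if V: "\<delta> \<in> carrier V" for \<delta>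
    proof -
      have "N \<delta> (v \<oplus>\<^bsub>W\<^esub> w) = N \<delta> v \<oplus>\<^bsub>W\<^esub> N \<delta> w" if "v \<in> carrier W" "w \<in> carrier W" for v w
        unfolding add[OF V V that] unfolding N_def using V that by (intro cong) (auto simp: cadd d)
      moreover have "N \<delta> ((k \<odot>\<^bsub>A\<^esub> \<one>) \<odot>\<^bsub>W\<^esub> w) = (k \<odot>\<^bsub>A\<^esub> \<one>) \<odot>\<^bsub>W\<^esub> N \<delta> w" if "w \<in> carrier W" for k w
        using V that by (simp add: leib ds)
      ultimately show ?thesis using V by (simp add: End_F_def)
    qed
    then show "nab \<in> carrier V \<rightarrow>\<^sub>E End_F A W" by (auto simp: nab_def)
  next
    fix \<delta> \<eta> w assume *: "\<delta> \<in> carrier V" "\<eta> \<in> carrier V" "w \<in> carrier W"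
    then show "nab (\<delta> \<oplus>\<^bsub>V\<^esub> \<eta>) w = nab \<delta> w \<oplus>\<^bsub>W\<^esub> nab \<eta> w"
      unfolding nab_def using V_add_closed[OF *(1,2)]
      by (simp add: add) (simp add: N_def V_apply cong: M.finsum_cong)
  next
    fix a \<delta> w assume *: "a \<in> carrier A" "\<delta> \<in> carrier V" "w \<in> carrier W"
    have "a \<odot>\<^bsub>W\<^esub> N \<delta> w = N (a \<odot>\<^bsub>V\<^esub> \<delta>) w"
      using lin[of a \<zero> "\<lambda>i. \<delta> (c w i)" "\<lambda>i. \<delta> (c w i)"] *
      unfolding N_def by (auto simp: V_apply intro!: cong)
    then show "nab (a \<odot>\<^bsub>V\<^esub> \<delta>) w = a \<odot>\<^bsub>W\<^esub> nab \<delta> w"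
      using * V_smult_closed[OF *(2,1)] by (simp add: nab_def)
  next
    fix \<delta> a w assume *: "\<delta> \<in> carrier V" "a \<in> carrier A" "w \<in> carrier W"
    then show "nab \<delta> (a \<odot>\<^bsub>W\<^esub> w) = a \<odot>\<^bsub>W\<^esub> nab \<delta> w \<oplus>\<^bsub>W\<^esub> \<delta> a \<odot>\<^bsub>W\<^esub> w"
      by (simp add: nab_def leib)
  qed
  moreover have "flat A W nab"
    unfolding flat_def
  proof (intro ballI)
    fix \<delta> \<eta> w assume *: "\<delta> \<in> carrier V" "\<eta> \<in> carrier V" "w \<in> carrier W"
    note b = V_bracket_closed[OF *(1,2)]
    have NN: "N \<delta> (N \<eta> w) = (\<Oplus>\<^bsub>W\<^esub>i\<in>{..<r}. \<delta> (\<eta> (c w i)) \<odot>\<^bsub>W\<^esub> e i)"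
      if "\<delta> \<in> carrier V" "\<eta> \<in> carrier V" for \<delta> \<eta>
      unfolding N_def[of \<delta>] using that * by (intro cong) (auto simp: cN)
    have "N \<delta> (N \<eta> w) \<ominus>\<^bsub>W\<^esub> N \<eta> (N \<delta> w) = \<one> \<odot>\<^bsub>W\<^esub> N \<delta> (N \<eta> w) \<oplus>\<^bsub>W\<^esub> (\<ominus> \<one>) \<odot>\<^bsub>W\<^esub> N \<eta> (N \<delta> w)"
      using * by (simp add: M.minus_eq smult_l_minus)
    also have "\<dots> = (\<Oplus>\<^bsub>W\<^esub>i\<in>{..<r}. (\<one> \<otimes> \<delta> (\<eta> (c w i)) \<oplus> (\<ominus> \<one>) \<otimes> \<eta> (\<delta> (c w i))) \<odot>\<^bsub>W\<^esub> e i)"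
      unfolding NN[OF *(1,2)] NN[OF *(2,1)] using * by (intro lin) auto
    also have "\<dots> = N (lie_bracket A \<delta> \<eta>) w"
      unfolding N_def using * by (intro cong) (auto simp: V_apply R.minus_eq R.l_minus)
    finally show "curvature A W nab \<delta> \<eta> w = \<zero>\<^bsub>W\<^esub>"
      using * b by (simp add: curvature_def nab_def M.minus_eq M.r_neg)
  qed
  ultimately show ?thesis by blast
qed

end

section \<open>Power series in three variables\<close>

text \<open>With power series nested, an operation on an inner variable is applied coefficientwise.\<close>

definition coefmap :: "('b \<Rightarrow> 'c) \<Rightarrow> 'b fps \<Rightarrow> 'c fps" where
  "coefmap h p = Abs_fps (\<lambda>i. h (p $ i))"

lemma coefmap_nth [simp]: "coefmap h p $ i = h (p $ i)"
  by (simp add: coefmap_def)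

lemma coefmap_add:
  fixes h :: "'b :: comm_ring_1 \<Rightarrow> 'c :: comm_ring_1"
  shows "(\<And>a b. h (a + b) = h a + h b) \<Longrightarrow> coefmap h (p + q) = coefmap h p + coefmap h q"
  by (rule fps_ext) simp

lemma additive_sum:
  fixes h :: "'b :: comm_ring_1 \<Rightarrow> 'c :: comm_ring_1"
  assumes "\<And>a b. h (a + b) = h a + h b"
  shows "h 0 = 0" and "h (sum g I) = (\<Sum>i\<in>I. h (g i))"
proof -
  show 0: "h 0 = 0" using assms[of 0 0] by simp
  show "h (sum g I) = (\<Sum>i\<in>I. h (g i))" by (induction I rule: infinite_finite_induct) (simp_all add: 0 assms)
qed

lemma coefmap_mult:
  fixes h :: "'b :: comm_ring_1 \<Rightarrow> 'c :: comm_ring_1"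
  assumes "\<And>a b. h (a + b) = h a + h b" "\<And>a b. h (a * b) = h a * h b"
  shows "coefmap h (p * q) = coefmap h p * coefmap h q"
  by (rule fps_ext) (simp add: fps_mult_nth additive_sum(2)[of h] assms)

definition deriv_op :: "('b :: comm_ring_1 \<Rightarrow> 'b) \<Rightarrow> bool" where
  "deriv_op D \<longleftrightarrow> (\<forall>a b. D (a + b) = D a + D b) \<and> (\<forall>a b. D (a * b) = D a * b + a * D b)"

lemma deriv_opD:
  assumes "deriv_op D" shows "D (a + b) = D a + D b" "D (a * b) = D a * b + a * D b" "D 1 = 0" "D 0 = 0"
    "D (- a) = - D a" "D (a - b) = D a - D b"
proof -
  show 1: "D (a + b) = D a + D b" "D (a * b) = D a * b + a * D b" for a b
    using assms by (auto simp: deriv_op_def)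
  show "D 1 = 0" using 1(2)[of 1 1] by simp
  show 0: "D 0 = 0" using 1(1)[of 0 0] by simp
  show m: "D (- a) = - D a" for a using 1(1)[of a "- a"] by (simp add: 0 minus_unique)
  show "D (a - b) = D a - D b" using 1(1)[of a "- b"] by (simp add: m)
qed

lemma deriv_op_power:
  assumes "deriv_op D" shows "D (a ^ k) = of_nat k * a ^ (k - 1) * D a"
proof (induction k)
  case (Suc k)
  then show ?case by (cases k) (simp_all add: deriv_opD[OF assms] algebra_simps)
qed (simp add: deriv_opD[OF assms])

lemma deriv_op_mult_sum:
  assumes "deriv_op D" shows "D (sum g I) = (\<Sum>i\<in>I. D (g i))"
  by (rule additive_sum) (rule deriv_opD[OF assms])

lemma deriv_op_fps_deriv: "deriv_op (fps_deriv :: 'b :: comm_ring_1 fps \<Rightarrow> _)"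
  by (simp add: deriv_op_def algebra_simps)

lemma deriv_op_coefmap:
  assumes "deriv_op D" shows "deriv_op (coefmap D)"
  unfolding deriv_op_def
proof (intro conjI allI)
  fix p q :: "'a fps"
  show "coefmap D (p + q) = coefmap D p + coefmap D q" by (rule coefmap_add) (rule deriv_opD[OF assms])
  show "coefmap D (p * q) = coefmap D p * q + p * coefmap D q"
    by (rule fps_ext) (simp add: fps_mult_nth deriv_op_mult_sum[OF assms] deriv_opD[OF assms] sum.distrib)
qed

lemma coefmap_const:
  fixes h :: "'b :: comm_ring_1 \<Rightarrow> 'c :: comm_ring_1"
  shows "h 0 = 0 \<Longrightarrow> coefmap h (fps_const c) = fps_const (h c)"
  by (rule fps_ext) (simp add: fps_const_def)

lemma coefmap_X:
  fixes h :: "'b :: comm_ring_1 \<Rightarrow> 'c :: comm_ring_1"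
  shows "h 0 = 0 \<Longrightarrow> coefmap h fps_X = fps_const (h 1) * fps_X"
  by (rule fps_ext) (simp add: fps_X_def)

lemma d_x_eq: "d_x = coefmap (coefmap fps_deriv)" and d_y_eq: "d_y = coefmap fps_deriv"
  and d_z_eq: "d_z = fps_deriv"
  by (auto simp: d_x_def d_y_def d_z_def coefmap_def fun_eq_iff)

lemma deriv_op_d [simp]: "deriv_op d_x" "deriv_op d_y" "deriv_op d_z"
  unfolding d_x_eq d_y_eq d_z_eq by (intro deriv_op_coefmap deriv_op_fps_deriv)+

lemma coefmap_deriv_01:
  "coefmap fps_deriv (0 :: 'b :: comm_ring_1 fps fps) = 0" "coefmap fps_deriv (1 :: 'b fps fps) = 0"
  by (rule fps_ext, simp add: fps_one_nth)+

lemma d_values [simp]: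
  "d_x ps_x = 1" "d_x ps_y = 0" "d_x ps_z = 0" "d_y ps_x = 0" "d_y ps_y = 1" "d_y ps_z = 0"
  "d_z ps_x = 0" "d_z ps_y = 0" "d_z ps_z = 1"
  "d_x (ps_const c) = 0" "d_y (ps_const c) = 0" "d_z (ps_const c) = 0"
  unfolding d_x_eq d_y_eq d_z_eq ps_x_def ps_y_def ps_z_def ps_const_def
  by (simp_all add: coefmap_const coefmap_X coefmap_deriv_01)

definition vector_field :: "'a ps3 \<Rightarrow> 'a ps3 \<Rightarrow> 'a ps3 \<Rightarrow> 'a::field_char_0 ps3 \<Rightarrow> 'a ps3" where
  "vector_field a b c p = a * d_x p + b * d_y p + c * d_z p"

lemma deriv_op_vector_field [simp]: "deriv_op (vector_field a b c)"
  unfolding deriv_op_def vector_field_def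
  by (simp add: deriv_opD[OF deriv_op_d(1)] deriv_opD[OF deriv_op_d(2)] deriv_opD[OF deriv_op_d(3)] algebra_simps)

lemma vector_field_values [simp]:
  "vector_field a b c ps_x = a" "vector_field a b c ps_y = b" "vector_field a b c ps_z = c"
  "vector_field a b c (ps_const e) = 0"
  by (simp_all add: vector_field_def)

subsection \<open>Divisibility by powers of the variables\<close>

lemma fps_const_dvd_iff:
  fixes w :: "'b :: comm_ring_1 fps" shows "fps_const c dvd w \<longleftrightarrow> (\<forall>i. c dvd w $ i)"
proof
  assume "\<forall>i. c dvd w $ i"
  then obtain g where "\<forall>i. w $ i = c * g i" unfolding dvd_def by metis
  then have "w = fps_const c * Abs_fps g" by (intro fps_ext) simp
  then show "fps_const c dvd w" by simp
qed (auto simp: dvd_def)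

lemma fps_X_power_dvd_iff:
  fixes w :: "'b :: comm_ring_1 fps" shows "fps_X ^ k dvd w \<longleftrightarrow> (\<forall>i<k. w $ i = 0)"
proof
  assume *: "\<forall>i<k. w $ i = 0"
  have "w = fps_X ^ k * Abs_fps (\<lambda>i. w $ (i + k))"
    by (rule fps_ext) (use * in \<open>simp add: fps_X_power_mult_nth\<close>)
  then show "fps_X ^ k dvd w" by (rule dvdI)
qed (auto simp: dvd_def fps_X_power_mult_nth)

lemma fps_zero_iff: "w = 0 \<longleftrightarrow> (\<forall>i. w $ i = 0)" for w :: "'b :: zero fps"
  by (simp add: fps_eq_iff)

text \<open>The exponent of \<open>t\<close> in the monomial with index \<open>(i, j, a)\<close> is \<open>e i j a\<close>, so divisibility by
  \<open>t\<^sup>k\<close> can be read off the coefficients.\<close>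

definition variable_exponent :: "'a::field_char_0 ps3 \<Rightarrow> (nat \<Rightarrow> nat \<Rightarrow> nat \<Rightarrow> nat) \<Rightarrow> bool" where
  "variable_exponent t e \<longleftrightarrow> (\<forall>k w. t ^ k dvd w \<longleftrightarrow> (\<forall>i j a. e i j a < k \<longrightarrow> w $ i $ j $ a = 0))"

lemma variable_exponents:
  "variable_exponent (ps_x :: 'a :: field_char_0 ps3) (\<lambda>i j a. a)"
  "variable_exponent (ps_y :: 'a ps3) (\<lambda>i j a. j)" "variable_exponent (ps_z :: 'a ps3) (\<lambda>i j a. i)"
proof -
  have p: "(ps_x :: 'a ps3) ^ k = fps_const (fps_const (fps_X ^ k))" "(ps_y :: 'a ps3) ^ k = fps_const (fps_X ^ k)" for k
    by (simp_all add: ps_x_def ps_y_def fps_const_power)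
  show "variable_exponent (ps_x :: 'a ps3) (\<lambda>i j a. a)" "variable_exponent (ps_y :: 'a ps3) (\<lambda>i j a. j)"
    "variable_exponent (ps_z :: 'a ps3) (\<lambda>i j a. i)"
    unfolding variable_exponent_def p
    by (auto simp: fps_const_dvd_iff fps_X_power_dvd_iff ps_z_def fps_zero_iff)
qed

text \<open>If the quotient by \<open>t\<close> embeds into a domain in which \<open>f\<close> does not vanish, then \<open>f\<close> is a nonzero divisor modulo \<open>t\<close>.\<close>

lemma dvd_via_hom:
  fixes h :: "'b :: comm_ring_1 \<Rightarrow> 'c :: idom"
  assumes "\<And>a b. h (a * b) = h a * h b" "\<And>w. t dvd w \<longleftrightarrow> h w = 0" "h f \<noteq> 0" "t dvd f * v"
  shows "t dvd v"
  using assms by auto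

context
  fixes m n :: nat assumes mn: "1 \<le> m" "1 \<le> n"
begin

abbreviation "hf \<equiv> hyp_f m n :: 'a :: field_char_0 ps3"

text \<open>Setting one variable to zero leaves a domain in which \<open>f\<close> is not zero: one of the terms \<open>y\<^sup>n\<close> and \<open>z\<^sup>2\<close> survives.\<close>

lemma variable_regular:
  fixes v :: "'a :: field_char_0 ps3"
  shows "ps_x dvd hf * v \<Longrightarrow> ps_x dvd v" "ps_y dvd hf * v \<Longrightarrow> ps_y dvd v" "ps_z dvd hf * v \<Longrightarrow> ps_z dvd v"
proof -
  let ?h = "\<lambda>p :: 'a fps. p $ 0" and ?h2 = "\<lambda>p :: 'a fps fps. p $ 0" and ?h3 = "\<lambda>p :: 'a ps3. p $ 0"
  let ?ex = "coefmap (coefmap ?h)" and ?ey = "coefmap ?h2"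
  have dv: "t dvd w \<longleftrightarrow> (\<forall>i j a. e i j a < 1 \<longrightarrow> w $ i $ j $ a = 0)" if "variable_exponent t e" for t e and w :: "'a ps3"
    using that[unfolded variable_exponent_def, rule_format, of 1 w] by simp
  have c0: "(0 :: 'a) ^ m = 0" "(0 :: 'a fps) ^ n = 0" using mn by auto
  have Xn: "(fps_X :: 'a fps fps) ^ n $ n = 1" by (simp add: fps_X_power_nth)
  have f0: "(hf :: 'a ps3) $ i $ j $ a = (if i = 0 \<and> j = 0 \<and> a = m then 1 else 0) + (if i = 0 \<and> j = n \<and> a = 0 then 1 else 0)
      + (if i = 2 \<and> j = 0 \<and> a = 0 then 1 else 0)" for i j a
  proof -
    have "(ps_x ^ m :: 'a ps3) $ i $ j $ a = (if i = 0 \<and> j = 0 \<and> a = m then 1 else 0)"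
      "(ps_y ^ n :: 'a ps3) $ i $ j $ a = (if i = 0 \<and> j = n \<and> a = 0 then 1 else 0)"
      "(ps_z ^ 2 :: 'a ps3) $ i $ j $ a = (if i = 2 \<and> j = 0 \<and> a = 0 then 1 else 0)"
      by (auto simp: ps_x_def ps_y_def ps_z_def fps_const_power fps_X_power_nth fps_one_nth)
    then show ?thesis unfolding hyp_f_def fps_add_nth by (simp only:)
  qed
  show "ps_x dvd v" if "ps_x dvd hf * v"
  proof (rule dvd_via_hom[where h = ?ex and f = hf])
    show "?ex (a * b) = ?ex a * ?ex b" for a b by (intro coefmap_mult coefmap_add) simp_all
    show "ps_x dvd w \<longleftrightarrow> ?ex w = 0" for w by (auto simp: dv[OF variable_exponents(1)] fps_zero_iff)
    have "?ex (hf :: 'a ps3) $ 2 $ 0 = 1" using mn by (simp add: f0)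
    then show "?ex (hf :: 'a ps3) \<noteq> 0" by (metis fps_zero_nth zero_neq_one)
  qed fact
  show "ps_y dvd v" if "ps_y dvd hf * v"
  proof (rule dvd_via_hom[where h = ?ey and f = hf])
    show "?ey (a * b) = ?ey a * ?ey b" for a b by (intro coefmap_mult) simp_all
    show "ps_y dvd w \<longleftrightarrow> ?ey w = 0" for w by (auto simp: dv[OF variable_exponents(2)] fps_zero_iff)
    have "?ey (hf :: 'a ps3) $ 2 $ 0 = 1" using mn by (simp add: f0)
    then show "?ey (hf :: 'a ps3) \<noteq> 0" by (metis fps_zero_nth zero_neq_one)
  qed fact
  show "ps_z dvd v" if "ps_z dvd hf * v"
  proof (rule dvd_via_hom[where h = ?h3 and f = hf])
    show "?h3 (a * b) = ?h3 a * ?h3 b" for a b by simp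
    show "ps_z dvd w \<longleftrightarrow> ?h3 w = 0" for w by (auto simp: dv[OF variable_exponents(3)] fps_zero_iff)
    have "?h3 (hf :: 'a ps3) $ n $ 0 = 1" using mn by (simp add: f0)
    then show "?h3 (hf :: 'a ps3) \<noteq> 0" by (metis fps_zero_nth zero_neq_one)
  qed fact
qed

lemma variable_nonzero: "(ps_x :: 'a :: field_char_0 ps3) \<noteq> 0" "(ps_y :: 'a ps3) \<noteq> 0" "(ps_z :: 'a ps3) \<noteq> 0"
  by (auto simp: ps_x_def ps_y_def ps_z_def)

lemma f_dvd_cancel_variable:
  fixes w :: "'a :: field_char_0 ps3"
  shows "hf dvd ps_x * w \<Longrightarrow> hf dvd w" "hf dvd ps_y * w \<Longrightarrow> hf dvd w" "hf dvd ps_z * w \<Longrightarrow> hf dvd w"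
proof -
  have *: "hf dvd w" if t: "t \<noteq> 0" and reg: "\<And>v. t dvd hf * v \<Longrightarrow> t dvd v" and d: "hf dvd t * w" for t :: "'a ps3"
  proof -
    obtain v where v: "t * w = hf * v" using d by (auto simp: dvd_def)
    have "t dvd hf * v" unfolding v[symmetric] by (rule dvd_triv_left)
    then have "t dvd v" by (rule reg)
    then obtain v' where "v = t * v'" by (auto simp: dvd_def)
    then have "t * w = t * (hf * v')" using v by (simp add: mult_ac)
    then show ?thesis using t by simp
  qed
  show "hf dvd ps_x * w \<Longrightarrow> hf dvd w" "hf dvd ps_y * w \<Longrightarrow> hf dvd w" "hf dvd ps_z * w \<Longrightarrow> hf dvd w"
    by (rule *[OF variable_nonzero(1) variable_regular(1)], assumption+)
      (rule *[OF variable_nonzero(2) variable_regular(2)], assumption+,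
       rule *[OF variable_nonzero(3) variable_regular(3)], assumption+)
qed

text \<open>The ideal \<open>(f)\<close> is closed in the \<open>t\<close>-adic topology: the approximate quotients form a Cauchy
  sequence because \<open>t\<close> is prime to \<open>f\<close>, and the coefficients of their limit are read off term by
  term.\<close>

lemma f_ideal_closed:
  fixes p :: "'a :: field_char_0 ps3"
  assumes e: "variable_exponent t e" and t: "t \<noteq> 0" and reg: "\<And>v. t dvd hf * v \<Longrightarrow> t dvd v"
    and ap: "\<And>k. \<exists>v. t ^ k dvd p - hf * v"
  shows "hf dvd p"
proof -
  have reg_power: "t ^ k dvd hf * v \<Longrightarrow> t ^ k dvd v" for k v
  proof (induction k arbitrary: v)
    case (Suc k)
    then have "t dvd hf * v" by (metis dvd_trans dvd_triv_left power_Suc)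
    then obtain v' where v': "v = t * v'" using reg by (auto simp: dvd_def)
    have "t * t ^ k dvd t * (hf * v')" using Suc.prems by (simp add: v' mult_ac)
    then have "t = 0 \<or> t ^ k dvd hf * v'" by (simp only: dvd_mult_cancel_left)
    with t have "t ^ k dvd hf * v'" by blast
    then have "t ^ k dvd v'" by (rule Suc.IH)
    then show ?case by (simp add: v' mult_dvd_mono)
  qed simp
  obtain v where v: "\<And>k. t ^ k dvd p - hf * v k" using ap by metis
  define V where "V = Abs_fps (\<lambda>i. Abs_fps (\<lambda>j. Abs_fps (\<lambda>a. v (Suc (e i j a)) $ i $ j $ a)))"
  note dv = e[unfolded variable_exponent_def, rule_format]
  have cauchy: "t ^ k dvd v k' - v k''" if "k \<le> k'" "k \<le> k''" for k k' k''
  proof (rule reg_power)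
    have "t ^ k dvd p - hf * v k'" "t ^ k dvd p - hf * v k''"
      using dvd_trans[OF le_imp_power_dvd[OF that(1)] v] dvd_trans[OF le_imp_power_dvd[OF that(2)] v] .
    then have "t ^ k dvd (p - hf * v k'') - (p - hf * v k')" by (rule dvd_diff[rotated])
    then show "t ^ k dvd hf * (v k' - v k'')" by (simp add: algebra_simps)
  qed
  have lim: "t ^ k dvd v k - V" for k
    unfolding dv
  proof (intro allI impI)
    fix i j a assume "e i j a < k"
    then have "t ^ Suc (e i j a) dvd v k - v (Suc (e i j a))" by (intro cauchy) auto
    then have "(v k - v (Suc (e i j a))) $ i $ j $ a = 0" unfolding dv by blast
    then show "(v k - V) $ i $ j $ a = 0" by (simp add: V_def)
  qed
  have "t ^ k dvd p - hf * V" for k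
  proof -
    have "p - hf * V = (p - hf * v k) + hf * (v k - V)" by (simp add: algebra_simps)
    then show ?thesis using v[of k] lim[of k] by (metis dvd_add dvd_mult)
  qed
  then have "(p - hf * V) $ i $ j $ a = 0" for i j a
    using dv[of "Suc (e i j a)" "p - hf * V"] by blast
  then have "p - hf * V = 0" by (simp add: fps_zero_iff)
  then show ?thesis by simp
qed

lemma fps_split: "u = fps_const (u $ 0) + fps_X * fps_shift 1 u" for u :: "'b :: comm_ring_1 fps"
  by (rule fps_ext) (auto simp: fps_X_mult_nth)

text \<open>A derivation of \<open>F[[x, y, z]]/(f)\<close> over \<open>F\<close> that kills \<open>x\<close>, \<open>y\<close> and \<open>z\<close> is zero. No continuity is
  assumed: splitting off one variable at a time shows that its values are divisible by every
  power of that variable. Here \<open>E\<close> lifts the derivation to power series.\<close>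

lemma derivation_determined:
  fixes E :: "'a :: field_char_0 ps3 \<Rightarrow> 'a ps3"
  assumes add: "\<And>p q. hf dvd E (p + q) - (E p + E q)"
    and mult: "\<And>p q. hf dvd E (p * q) - (E p * q + p * E q)"
    and const: "\<And>c. hf dvd E (ps_const c)"
    and vars: "hf dvd E ps_x" "hf dvd E ps_y" "hf dvd E ps_z"
  shows "hf dvd E p"
proof -
  have step: "hf dvd E (c + t * q) - t * E q" if "hf dvd E c" "hf dvd E t" for c t q
  proof -
    have "E (c + t * q) - t * E q = (E (c + t * q) - (E c + E (t * q))) + E c + (E (t * q) - (E t * q + t * E q)) + E t * q"
      by (simp add: algebra_simps)
    then show ?thesis using add[of c "t * q"] mult[of t q] that by (metis dvd_add dvd_mult2)
  qed
  have closed: "hf dvd E u"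
    if t: "variable_exponent t e" "t \<noteq> 0" "\<And>v. t dvd hf * v \<Longrightarrow> t dvd v" "hf dvd E t"
    and T: "\<And>u. u \<in> T \<Longrightarrow> \<exists>c u'. u' \<in> T \<and> u = c + t * u' \<and> hf dvd E c" and u: "u \<in> T" for T u t e
  proof (rule f_ideal_closed[OF t(1-3)])
    fix k
    have "\<exists>u'\<in>T. hf dvd E u - t ^ k * E u'" if "u \<in> T" for u
      using that
    proof (induction k arbitrary: u)
      case 0 then show ?case by (auto intro!: bexI[of _ u])
    next
      case (Suc k)
      obtain u' where u': "u' \<in> T" "hf dvd E u - t ^ k * E u'" using Suc by blast
      obtain c u'' where c: "u'' \<in> T" "u' = c + t * u''" "hf dvd E c" using T[OF u'(1)] by blast
      have "hf dvd E u' - t * E u''" unfolding c(2) by (rule step[OF c(3) t(4)])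
      then have "hf dvd (E u - t ^ k * E u') + t ^ k * (E u' - t * E u'')"
        using u'(2) by (intro dvd_add dvd_mult)
      then have "hf dvd E u - t ^ Suc k * E u''" by (simp add: algebra_simps)
      then show ?case using c(1) by blast
    qed
    then obtain u' where "hf dvd E u - t ^ k * E u'" using u by blast
    then obtain v where "E u - t ^ k * E u' = hf * v" by (auto simp: dvd_def)
    then have "E u - hf * v = t ^ k * E u'" by (simp add: algebra_simps)
    then have "t ^ k dvd E u - hf * v" by simp
    then show "\<exists>v. t ^ k dvd E u - hf * v" by blast
  qed
  have 1: "hf dvd E (fps_const (fps_const u))" for u :: "'a fps"
  proof (rule closed[OF variable_exponents(1) variable_nonzero(1) variable_regular(1) vars(1)])
    show "fps_const (fps_const u) \<in> range (\<lambda>u. fps_const (fps_const u))" by blast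
    fix w :: "'a ps3" assume "w \<in> range (\<lambda>u. fps_const (fps_const u))"
    then obtain u where w: "w = fps_const (fps_const u)" by blast
    have "w = ps_const (u $ 0) + ps_x * fps_const (fps_const (fps_shift 1 u))"
      unfolding w by (subst fps_split[of u]) (simp add: ps_const_def ps_x_def)
    then show "\<exists>c u'. u' \<in> range (\<lambda>u. fps_const (fps_const u)) \<and> w = c + ps_x * u' \<and> hf dvd E c"
      using const by blast
  qed
  have 2: "hf dvd E (fps_const u)" for u :: "'a fps fps"
  proof (rule closed[OF variable_exponents(2) variable_nonzero(2) variable_regular(2) vars(2)])
    show "fps_const u \<in> range fps_const" by blast
    fix w :: "'a ps3" assume "w \<in> range fps_const"
    then obtain u where w: "w = fps_const u" by blast
    have "w = fps_const (fps_const (u $ 0)) + ps_y * fps_const (fps_shift 1 u)"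
      unfolding w by (subst fps_split[of u]) (simp add: ps_y_def)
    then show "\<exists>c u'. u' \<in> range fps_const \<and> w = c + ps_y * u' \<and> hf dvd E c" using 1 by blast
  qed
  show ?thesis
  proof (rule closed[OF variable_exponents(3) variable_nonzero(3) variable_regular(3) vars(3)])
    show "p \<in> UNIV" by simp
    fix u :: "'a ps3"
    have "u = fps_const (u $ 0) + ps_z * fps_shift 1 u" unfolding ps_z_def by (rule fps_split)
    then show "\<exists>c u'. u' \<in> UNIV \<and> u = c + ps_z * u' \<and> hf dvd E c" using 2 by blast
  qed
qed

end

section \<open>The hypersurface ring and the module of the matrix factorization\<close>

locale matrix_factorization =
  fixes m n k l :: nat and F :: "'a :: field_char_0 itself"
  assumes klmn: "1 \<le> k" "k \<le> m" "1 \<le> l" "l \<le> n"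
begin

abbreviation "f \<equiv> hyp_f m n :: 'a ps3"
abbreviation "A \<equiv> hyp_ring m n :: ('a, 'a ps3 set) module"
abbreviation "W \<equiv> mf_module m n k l :: ('a ps3 set, (nat \<Rightarrow> 'a ps3 set) set) module"
abbreviation "F4 \<equiv> free_module A 4"
abbreviation "cl \<equiv> cls m n :: 'a ps3 \<Rightarrow> 'a ps3 set"

lemma mn: "1 \<le> m" "1 \<le> n"
  using klmn by auto

lemma PS_sel: "carrier (PS :: 'a ps3 ring) = UNIV" "x \<otimes>\<^bsub>PS\<^esub> y = x * y" "x \<oplus>\<^bsub>PS\<^esub> y = x + y" for x y :: "'a ps3"
  by (simp_all add: PS_def ring_of_type_algebra_def)

lemma cl_def: "cl p = {q. f dvd q - p}"
proof -
  have "PIdl\<^bsub>PS\<^esub> f = {h * f | h. True}" by (simp add: cgenideal_def PS_sel)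
  then have "cl p = {h * f + p | h. True}"
    by (auto simp: cls_def a_r_coset_def' PS_sel)
  also have "\<dots> = {q. f dvd q - p}"
  proof (intro equalityI subsetI CollectI)
    fix q assume "q \<in> {q. f dvd q - p}"
    then obtain h where "q - p = f * h" by (auto simp: dvd_def)
    then have "q = h * f + p" by (metis diff_add_cancel mult.commute)
    then show "\<exists>h. q = h * f + p \<and> True" by blast
  next
    fix q assume "q \<in> {h * f + p | h. True}"
    then obtain h where "q = h * f + p" by blast
    then have "q - p = f * h" by (metis add_diff_cancel_right' mult.commute)
    then show "f dvd q - p" by (rule dvdI)
  qed
  finally show ?thesis .
qed

lemma cl_eq: "cl p = cl q \<longleftrightarrow> f dvd p - q"
proof
  assume "cl p = cl q"
  moreover have "p \<in> cl p" unfolding cl_def by simp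
  ultimately have "p \<in> cl q" by (rule subst)
  then show "f dvd p - q" unfolding cl_def by (rule CollectD)
next
  assume *: "f dvd p - q"
  have "f dvd r - p \<longleftrightarrow> f dvd r - q" for r
    using dvd_add_left_iff[OF *, of "r - p"] by simp
  then show "cl p = cl q" by (simp add: cl_def)
qed

lemma A_carrier: "carrier A = range cl"
  by (auto simp: hyp_ring_def Let_def FactRing_def A_RCOSETS_def' cls_def PS_sel)

lemma cl_closed [simp]: "cl p \<in> carrier A"
  by (simp add: A_carrier)

lemma A_ops [simp]:
  "cl p \<oplus>\<^bsub>A\<^esub> cl q = cl (p + q)" "cl p \<otimes>\<^bsub>A\<^esub> cl q = cl (p * q)"
  "\<one>\<^bsub>A\<^esub> = cl 1" "\<zero>\<^bsub>A\<^esub> = cl 0" "c \<odot>\<^bsub>A\<^esub> cl p = cl (ps_const c * p)"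
proof -
  have set_add: "cl p <+>\<^bsub>PS\<^esub> cl q = cl (p + q)" for p q
  proof -
    have "u + v \<in> cl (p + q)" if "u \<in> cl p" "v \<in> cl q" for u v
      using dvd_add[of f "u - p" "v - q"] that by (simp add: cl_def algebra_simps)
    moreover have "\<exists>u\<in>cl p. \<exists>v\<in>cl q. r = u + v" if "r \<in> cl (p + q)" for r
      using that by (intro bexI[of _ p] bexI[of _ "r - p"]) (auto simp: cl_def algebra_simps)
    ultimately show ?thesis by (auto simp: set_add_def' PS_sel)
  qed
  have mult: "rcoset_mult PS (PIdl\<^bsub>PS\<^esub> f) (cl p) (cl q) = cl (p * q)" for p q
  proof -
    have "cl (u * v) = cl (p * q)" if "u \<in> cl p" "v \<in> cl q" for u v
    proof -
      have "f dvd (u - p) * v + p * (v - q)" using that by (simp add: cl_def)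
      then show ?thesis by (simp add: cl_eq algebra_simps)
    qed
    moreover have "p \<in> cl p" "q \<in> cl q" by (auto simp: cl_def)
    ultimately show ?thesis unfolding rcoset_mult_def cls_def[symmetric] PS_sel by blast
  qed
  show "cl p \<oplus>\<^bsub>A\<^esub> cl q = cl (p + q)" by (simp add: hyp_ring_def Let_def FactRing_def set_add)
  show m: "cl p \<otimes>\<^bsub>A\<^esub> cl q = cl (p * q)" for p q by (simp add: hyp_ring_def Let_def FactRing_def mult)
  show "\<one>\<^bsub>A\<^esub> = cl 1"
    by (simp add: hyp_ring_def Let_def FactRing_def cls_def PS_def ring_of_type_algebra_def)
  have "PIdl\<^bsub>PS\<^esub> f = cl 0" by (auto simp: cl_def cgenideal_def PS_sel dvd_def mult.commute)
  then show "\<zero>\<^bsub>A\<^esub> = cl 0" by (simp add: hyp_ring_def Let_def FactRing_def)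
  show "c \<odot>\<^bsub>A\<^esub> cl p = cl (ps_const c * p)"
    using m[of "ps_const c" p] by (simp add: hyp_ring_def Let_def FactRing_def)
qed

lemma A_cring: "cring A"
proof (rule cringI)
  show "abelian_group A"
  proof (rule abelian_groupI)
    fix x assume "x \<in> carrier A"
    then obtain p where "x = cl p" by (auto simp: A_carrier)
    then show "\<exists>y\<in>carrier A. y \<oplus>\<^bsub>A\<^esub> x = \<zero>\<^bsub>A\<^esub>" by (intro bexI[of _ "cl (- p)"]) auto
  qed (auto simp: A_carrier algebra_simps)
  show "comm_monoid A" by (rule comm_monoidI) (auto simp: A_carrier algebra_simps)
qed (auto simp: A_carrier algebra_simps)

sublocale A: cring A by (rule A_cring)

lemma A_minus [simp]: "\<ominus>\<^bsub>A\<^esub> cl p = cl (- p)" "cl p \<ominus>\<^bsub>A\<^esub> cl q = cl (p - q)"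
proof -
  show 1: "\<ominus>\<^bsub>A\<^esub> cl p = cl (- p)" for p by (rule A.minus_equality) auto
  show "cl p \<ominus>\<^bsub>A\<^esub> cl q = cl (p - q)" by (simp add: a_minus_def 1)
qed

lemma A_finsum: "finite I \<Longrightarrow> (\<Oplus>\<^bsub>A\<^esub>i\<in>I. cl (g i)) = cl (\<Sum>i\<in>I. g i)"
proof (induction rule: finite_induct)
  case (insert i I)
  then show ?case by (subst A.finsum_insert) auto
qed simp

definition vec :: "(nat \<Rightarrow> 'a ps3) \<Rightarrow> nat \<Rightarrow> 'a ps3 set" where
  "vec v = (\<lambda>i\<in>{..<4}. cl (v i))"

text \<open>Matrices are lists of rows, and vectors are functions of which only the values at \<open>0, \<dots>, 3\<close> matter.\<close>

definition mat_app :: "'a ps3 list list \<Rightarrow> (nat \<Rightarrow> 'a ps3) \<Rightarrow> nat \<Rightarrow> 'a ps3" where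
  "mat_app B v i = (\<Sum>j<4. B ! i ! j * v j)"

abbreviation "ph \<equiv> mf_phi m n k l :: 'a ps3 list list"
abbreviation "ps \<equiv> mf_psi m n k l :: 'a ps3 list list"

lemma vec_eq: "vec u = vec v \<longleftrightarrow> (\<forall>i<4. f dvd u i - v i)"
  unfolding vec_def by (auto simp: fun_eq_iff cl_eq restrict_def)

lemma F4_sel:
  "carrier F4 = range vec" "vec u \<oplus>\<^bsub>F4\<^esub> vec v = vec (\<lambda>i. u i + v i)"
  "cl a \<odot>\<^bsub>F4\<^esub> vec v = vec (\<lambda>i. a * v i)"
proof -
  show "carrier F4 = range vec"
  proof (intro equalityI subsetI)
    fix x assume "x \<in> carrier F4"
    then have x: "x \<in> {..<4} \<rightarrow>\<^sub>E range cl" by (simp add: free_module_def A_carrier)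
    then have "\<forall>i<4. \<exists>p. x i = cl p" by (auto simp: PiE_iff)
    then obtain v where "\<forall>i<4. x i = cl (v i)" by metis
    then have "x = vec v" using x unfolding vec_def by (intro extensionalityI[of _ "{..<4}"]) (auto simp: PiE_iff)
    then show "x \<in> range vec" by simp
  qed (auto simp: free_module_def vec_def A_carrier)
qed (auto simp: free_module_def vec_def intro!: restrict_ext)

lemma mat_vec_vec: "mat_vec A 4 (mat_cls m n B) (vec v) = vec (mat_app B v)"
proof -
  have "(\<Oplus>\<^bsub>A\<^esub>j\<in>{..<4}. mat_cls m n B i j \<otimes>\<^bsub>A\<^esub> vec v j) = cl (mat_app B v i)" for i
  proof -
    have "(\<Oplus>\<^bsub>A\<^esub>j\<in>{..<4}. mat_cls m n B i j \<otimes>\<^bsub>A\<^esub> vec v j) = (\<Oplus>\<^bsub>A\<^esub>j\<in>{..<4}. cl (B ! i ! j * v j))"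
      by (intro A.finsum_cong') (auto simp: mat_cls_def vec_def)
    then show ?thesis by (simp add: A_finsum mat_app_def)
  qed
  then show ?thesis by (simp add: mat_vec_def vec_def)
qed

text \<open>The vectors that vanish in \<open>W\<close>. Since \<open>\<phi>\<psi> = \<psi>\<phi> = f\<close> and \<open>f\<close> is not a zero divisor, a vector lies in the image of
  \<open>\<phi>\<close> modulo \<open>f\<close> if and only if \<open>\<psi>\<close> maps it to multiples of \<open>f\<close>. In this form the condition is visibly inherited by
  \<open>v\<close> from \<open>z v\<close>, because \<open>z\<close> is not a zero divisor modulo \<open>f\<close>.\<close>

definition null :: "(nat \<Rightarrow> 'a ps3) \<Rightarrow> bool" where
  "null v \<longleftrightarrow> (\<forall>i<4. f dvd mat_app ps v i)"

lemma null_lin: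
  assumes "null u" "null v" shows "null (\<lambda>i. a * u i + b * v i)"
proof -
  have "mat_app ps (\<lambda>i. a * u i + b * v i) i = a * mat_app ps u i + b * mat_app ps v i" for i
    by (simp add: mat_app_def sum_distrib_left sum.distrib algebra_simps)
  then show ?thesis using assms by (simp add: null_def)
qed

lemma null_add: "null u \<Longrightarrow> null v \<Longrightarrow> null (\<lambda>i. u i + v i)"
  and null_diff: "null u \<Longrightarrow> null v \<Longrightarrow> null (\<lambda>i. u i - v i)"
  and null_mult: "null u \<Longrightarrow> null (\<lambda>i. a * u i)"
  using null_lin[of u v 1 1] null_lin[of u v 1 "-1"] null_lin[of u u a 0] by simp_all

lemma null_cong: "null u \<Longrightarrow> (\<And>i. i < 4 \<Longrightarrow> f dvd u i - v i) \<Longrightarrow> null v"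
proof -
  assume u: "null u" and uv: "\<And>i. i < 4 \<Longrightarrow> f dvd u i - v i"
  have "f dvd mat_app ps v i" if "i < 4" for i
  proof -
    have "f dvd (\<Sum>j<4. ps ! i ! j * (u j - v j))" using uv by (intro dvd_sum) auto
    then have "f dvd mat_app ps u i - mat_app ps v i"
      by (simp add: mat_app_def algebra_simps sum_subtractf)
    moreover have "f dvd mat_app ps u i" using u that by (simp add: null_def)
    ultimately have "f dvd mat_app ps u i - (mat_app ps u i - mat_app ps v i)" by (rule dvd_diff[rotated])
    then show ?thesis by simp
  qed
  then show "null v" by (simp add: null_def)
qed

lemma mat_app_comp: "mat_app B (mat_app C v) i = (\<Sum>t<4. (\<Sum>j<4. B ! i ! j * C ! j ! t) * v t)"
proof -
  have "mat_app B (mat_app C v) i = (\<Sum>j<4. \<Sum>t<4. B ! i ! j * C ! j ! t * v t)"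
    by (simp add: mat_app_def sum_distrib_left mult_ac)
  also have "\<dots> = (\<Sum>t<4. \<Sum>j<4. B ! i ! j * C ! j ! t * v t)" by (rule sum.swap)
  finally show ?thesis by (simp add: sum_distrib_right)
qed

lemma ph_ps: "i < 4 \<Longrightarrow> mat_app ph (mat_app ps v) i = f * v i"
  and ps_ph: "i < 4 \<Longrightarrow> mat_app ps (mat_app ph v) i = f * v i"
proof -
  have delta: "(\<Sum>t<4. (if i = t then f else 0) * v t) = f * v i" if "i < (4 :: nat)" for i
  proof -
    have "(\<Sum>t<4. (if i = t then f else 0) * v t) = (\<Sum>t<4. if t = i then f * v t else 0)" by (rule sum.cong) auto
    then show ?thesis using that by simp
  qed
  show "i < 4 \<Longrightarrow> mat_app ph (mat_app ps v) i = f * v i" "i < 4 \<Longrightarrow> mat_app ps (mat_app ph v) i = f * v i"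
    unfolding mat_app_comp using mf_phi_psi[OF klmn(2,4), of i, where 'a = 'a] delta[of i] by simp_all
qed

lemma f_nonzero: "f \<noteq> 0"
proof
  assume "f = 0"
  then have "ps_z dvd (1 :: 'a ps3)" using variable_regular(3)[OF mn, of "1 :: 'a ps3"] by simp
  then obtain h where "(1 :: 'a ps3) = ps_z * h" by (rule dvdE)
  then have "(1 :: 'a ps3) $ 0 = (ps_z * h) $ 0" by (rule arg_cong)
  then show False by (simp add: ps_z_def)
qed

text \<open>If \<open>\<psi> v = f q\<close>, then \<open>f v = \<phi> \<psi> v = f \<phi> q\<close>, and \<open>f\<close> can be cancelled.\<close>

lemma null_iff: "null v \<longleftrightarrow> (\<exists>q. \<forall>i<4. f dvd v i - mat_app ph q i)"
proof
  assume "null v"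
  then have "\<forall>i<4. \<exists>g. mat_app ps v i = f * g" by (auto simp: null_def dvd_def)
  then obtain q where q: "\<forall>i<4. mat_app ps v i = f * q i" by metis
  have "v i = mat_app ph q i" if "i < 4" for i
  proof -
    have "mat_app ph (mat_app ps v) i = f * mat_app ph q i"
      using q by (simp add: mat_app_def[of ph] sum_distrib_left mult_ac)
    then show ?thesis using ph_ps[OF that, of v] f_nonzero by simp
  qed
  then show "\<exists>q. \<forall>i<4. f dvd v i - mat_app ph q i" by (intro exI[of _ q]) simp
next
  assume "\<exists>q. \<forall>i<4. f dvd v i - mat_app ph q i"
  then obtain q where q: "\<forall>i<4. f dvd v i - mat_app ph q i" by blast
  have "null (mat_app ph q)" by (simp add: null_def ps_ph)
  then show "null v"
  proof (rule null_cong)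
    fix i :: nat assume "i < 4"
    then have "f dvd - (v i - mat_app ph q i)" using q unfolding dvd_minus_iff by blast
    then show "f dvd mat_app ph q i - v i" by simp
  qed
qed

text \<open>The class in \<open>W\<close> of a vector of power series. All computations in \<open>W\<close> are carried out with such representatives.\<close>

definition wc :: "(nat \<Rightarrow> 'a ps3) \<Rightarrow> (nat \<Rightarrow> 'a ps3 set) set" where
  "wc v = mf_cls m n k l (vec v)"

lemma wc_eq_set: "wc v = {vec u | u. null (\<lambda>i. u i - v i)}"
proof -
  have im: "mf_image m n k l = {vec (mat_app ph q) | q. True}"
    unfolding mf_image_def F4_sel image_image mat_vec_vec by blast
  have "wc v = {vec (mat_app ph q) \<oplus>\<^bsub>F4\<^esub> vec v | q. True}"
    unfolding wc_def mf_cls_def im a_r_coset_def' by blast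
  also have "\<dots> = {vec (\<lambda>i. mat_app ph q i + v i) | q. True}" by (simp add: F4_sel)
  also have "\<dots> = {vec u | u. null (\<lambda>i. u i - v i)}"
  proof (intro equalityI subsetI)
    fix x assume "x \<in> {vec (\<lambda>i. mat_app ph q i + v i) | q. True}"
    then obtain q where "x = vec (\<lambda>i. mat_app ph q i + v i)" by blast
    moreover have "null (mat_app ph q)" by (simp add: null_def ps_ph)
    ultimately show "x \<in> {vec u | u. null (\<lambda>i. u i - v i)}" by fastforce
  next
    fix x assume "x \<in> {vec u | u. null (\<lambda>i. u i - v i)}"
    then obtain u where x: "x = vec u" "null (\<lambda>i. u i - v i)" by blast
    then obtain q where "\<forall>i<4. f dvd u i - v i - mat_app ph q i" by (auto simp: null_iff)
    then have "x = vec (\<lambda>i. mat_app ph q i + v i)" unfolding x(1) vec_eq by (simp add: algebra_simps)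
    then show "x \<in> {vec (\<lambda>i. mat_app ph q i + v i) | q. True}" by blast
  qed
  finally show ?thesis .
qed

lemma dvd_swap: "f dvd p - q \<Longrightarrow> f dvd q - p"
  by (metis dvd_minus_iff minus_diff_eq)

lemma null_vec_cong: "vec u = vec u' \<Longrightarrow> null (\<lambda>i. u i - v i) \<longleftrightarrow> null (\<lambda>i. u' i - v i)"
proof -
  assume "vec u = vec u'"
  then have d: "f dvd u i - u' i" if "i < 4" for i using that unfolding vec_eq by blast
  have "f dvd (u i - v i) - (u' i - v i)" "f dvd (u' i - v i) - (u i - v i)" if "i < 4" for i
    using d[OF that] dvd_swap[OF d[OF that]] by simp_all
  then show ?thesis
    using null_cong[of "\<lambda>i. u i - v i" "\<lambda>i. u' i - v i"] null_cong[of "\<lambda>i. u' i - v i" "\<lambda>i. u i - v i"]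
    by blast
qed

lemma vec_in_wc: "vec u \<in> wc v \<longleftrightarrow> null (\<lambda>i. u i - v i)"
proof
  assume "vec u \<in> wc v"
  then obtain u' where u': "vec u = vec u'" "null (\<lambda>i. u' i - v i)" unfolding wc_eq_set by blast
  then show "null (\<lambda>i. u i - v i)" using null_vec_cong[OF u'(1), of v] by blast
next
  assume "null (\<lambda>i. u i - v i)"
  then show "vec u \<in> wc v" unfolding wc_eq_set by blast
qed

lemma wc_eq: "wc u = wc v \<longleftrightarrow> null (\<lambda>i. u i - v i)"
proof
  assume "wc u = wc v"
  moreover have "vec u \<in> wc u" unfolding vec_in_wc by (simp add: null_def mat_app_def)
  ultimately show "null (\<lambda>i. u i - v i)" by (simp add: vec_in_wc)
next
  assume uv: "null (\<lambda>i. u i - v i)"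
  have "null (\<lambda>i. w i - u i) \<longleftrightarrow> null (\<lambda>i. w i - v i)" for w
  proof
    assume "null (\<lambda>i. w i - u i)"
    from null_add[OF this uv] show "null (\<lambda>i. w i - v i)" by simp
  next
    assume "null (\<lambda>i. w i - v i)"
    from null_diff[OF this uv] show "null (\<lambda>i. w i - u i)" by simp
  qed
  then show "wc u = wc v" by (simp add: wc_eq_set)
qed

lemma W_carrier: "carrier W = range wc"
  by (auto simp: mf_module_def quot_module_def A_RCOSETS_def' F4_sel wc_def mf_cls_def)

lemma wc_closed [simp]: "wc v \<in> carrier W"
  by (simp add: W_carrier)

lemma null_zero: "null (\<lambda>i. 0)"
  by (simp add: null_def mat_app_def)

lemma W_ops [simp]:
  "wc u \<oplus>\<^bsub>W\<^esub> wc v = wc (\<lambda>i. u i + v i)" "\<zero>\<^bsub>W\<^esub> = wc (\<lambda>i. 0)" "cl a \<odot>\<^bsub>W\<^esub> wc v = wc (\<lambda>i. a * v i)"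
proof -
  have "wc u <+>\<^bsub>F4\<^esub> wc v = wc (\<lambda>i. u i + v i)"
  proof (intro equalityI subsetI)
    fix x assume "x \<in> wc u <+>\<^bsub>F4\<^esub> wc v"
    then obtain u' v' where "x = vec u' \<oplus>\<^bsub>F4\<^esub> vec v'" "null (\<lambda>i. u' i - u i)" "null (\<lambda>i. v' i - v i)"
      by (auto simp: set_add_def' wc_eq_set)
    then show "x \<in> wc (\<lambda>i. u i + v i)"
      using null_add[of "\<lambda>i. u' i - u i" "\<lambda>i. v' i - v i"] by (simp add: F4_sel vec_in_wc algebra_simps)
  next
    fix x assume "x \<in> wc (\<lambda>i. u i + v i)"
    then obtain w where w: "x = vec w" "null (\<lambda>i. w i - (u i + v i))" by (auto simp: wc_eq_set)
    have "x = vec u \<oplus>\<^bsub>F4\<^esub> vec (\<lambda>i. w i - u i)" by (simp add: F4_sel w(1))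
    moreover have "vec u \<in> wc u" using null_zero by (simp add: vec_in_wc)
    moreover have "vec (\<lambda>i. w i - u i) \<in> wc v" using w(2) by (simp add: vec_in_wc algebra_simps)
    ultimately show "x \<in> wc u <+>\<^bsub>F4\<^esub> wc v" unfolding set_add_def' by blast
  qed
  then show "wc u \<oplus>\<^bsub>W\<^esub> wc v = wc (\<lambda>i. u i + v i)" by (simp add: mf_module_def quot_module_def)
  have "vec v \<in> mf_image m n k l \<longleftrightarrow> null v" for v
  proof -
    have "vec v \<in> mf_image m n k l \<longleftrightarrow> (\<exists>q. vec v = vec (mat_app ph q))"
      unfolding mf_image_def F4_sel image_image mat_vec_vec by blast
    then show ?thesis by (simp add: vec_eq null_iff)
  qed
  moreover have "mf_image m n k l \<subseteq> range vec" unfolding mf_image_def F4_sel image_image mat_vec_vec by blast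
  ultimately have "mf_image m n k l = wc (\<lambda>i. 0)" by (auto simp: wc_eq_set)
  then show "\<zero>\<^bsub>W\<^esub> = wc (\<lambda>i. 0)" by (simp add: mf_module_def quot_module_def)
  have "mf_image m n k l +>\<^bsub>F4\<^esub> (cl a \<odot>\<^bsub>F4\<^esub> x) = wc (\<lambda>i. a * v i)" if x: "x \<in> wc v" for x
  proof -
    obtain u where u: "x = vec u" "null (\<lambda>i. u i - v i)" using x by (auto simp: wc_eq_set)
    have "mf_image m n k l +>\<^bsub>F4\<^esub> (cl a \<odot>\<^bsub>F4\<^esub> x) = wc (\<lambda>i. a * u i)" by (simp add: F4_sel u(1) wc_def mf_cls_def)
    also have "\<dots> = wc (\<lambda>i. a * v i)"
      using null_mult[OF u(2), of a] by (simp add: wc_eq algebra_simps)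
    finally show ?thesis .
  qed
  moreover have "wc v \<noteq> {}" using null_zero vec_in_wc[of v v] by auto
  ultimately show "cl a \<odot>\<^bsub>W\<^esub> wc v = wc (\<lambda>i. a * v i)" by (simp add: mf_module_def quot_module_def)
qed

lemma W_module: "module A W"
proof (rule moduleI[OF A_cring])
  show "abelian_group W"
  proof (rule abelian_groupI)
    fix x assume "x \<in> carrier W"
    then obtain v where "x = wc v" by (auto simp: W_carrier)
    then show "\<exists>y\<in>carrier W. y \<oplus>\<^bsub>W\<^esub> x = \<zero>\<^bsub>W\<^esub>" by (intro bexI[of _ "wc (\<lambda>i. - v i)"]) auto
  qed (auto simp: W_carrier algebra_simps)
qed (auto simp: W_carrier A_carrier algebra_simps)

sublocale algebra_module A W
proof -
  interpret module A W by (rule W_module)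
  show "algebra_module A W"
  proof unfold_locales
    show "c \<odot>\<^bsub>A\<^esub> \<one>\<^bsub>A\<^esub> \<in> carrier A" for c by simp
    show "c \<odot>\<^bsub>A\<^esub> a = c \<odot>\<^bsub>A\<^esub> \<one>\<^bsub>A\<^esub> \<otimes>\<^bsub>A\<^esub> a" if "a \<in> carrier A" for a c
      using that by (auto simp: A_carrier)
  qed
qed

lemma W_minus [simp]: "\<ominus>\<^bsub>W\<^esub> wc u = wc (\<lambda>i. - u i)" "wc u \<ominus>\<^bsub>W\<^esub> wc v = wc (\<lambda>i. u i - v i)"
proof -
  show 1: "\<ominus>\<^bsub>W\<^esub> wc u = wc (\<lambda>i. - u i)" for u by (rule M.minus_equality) auto
  show "wc u \<ominus>\<^bsub>W\<^esub> wc v = wc (\<lambda>i. u i - v i)" by (simp add: M.minus_eq 1)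
qed

lemma null_cancel_variable:
  "null (\<lambda>i. ps_x * v i) \<Longrightarrow> null v" "null (\<lambda>i. ps_y * v i) \<Longrightarrow> null v" "null (\<lambda>i. ps_z * v i) \<Longrightarrow> null v"
proof -
  have "mat_app ps (\<lambda>i. t * v i) i = t * mat_app ps v i" for t i
    by (simp add: mat_app_def sum_distrib_left mult_ac)
  then have *: "null (\<lambda>i. t * v i) \<longleftrightarrow> (\<forall>i<4. f dvd t * mat_app ps v i)" for t by (simp add: null_def)
  show "null (\<lambda>i. ps_x * v i) \<Longrightarrow> null v" unfolding * null_def using f_dvd_cancel_variable(1)[OF mn] by blast
  show "null (\<lambda>i. ps_y * v i) \<Longrightarrow> null v" unfolding * null_def using f_dvd_cancel_variable(2)[OF mn] by blast
  show "null (\<lambda>i. ps_z * v i) \<Longrightarrow> null v" unfolding * null_def using f_dvd_cancel_variable(3)[OF mn] by blast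
qed

end

section \<open>The derivations of the hypersurface ring\<close>

context matrix_factorization
begin

abbreviation "vf \<equiv> vector_field :: 'a ps3 \<Rightarrow> _"

lemma vf_f: "vf a b c f = of_nat m * ps_x ^ (m - 1) * a + of_nat n * ps_y ^ (n - 1) * b + 2 * ps_z * c"
  by (simp add: hyp_f_def deriv_opD[OF deriv_op_vector_field] deriv_op_power[OF deriv_op_vector_field])

lemma ps_delta_vf:
  "ps_delta m n 0 = vf (2 * of_nat n * ps_x) (2 * of_nat m * ps_y) (of_nat m * of_nat n * ps_z)"
  "ps_delta m n 1 = vf (- (of_nat n * ps_y ^ (n - 1))) (of_nat m * ps_x ^ (m - 1)) 0"
  "ps_delta m n 2 = vf (- (2 * ps_z)) 0 (of_nat m * ps_x ^ (m - 1))"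
  "ps_delta m n 3 = vf 0 (- (2 * ps_z)) (of_nat n * ps_y ^ (n - 1))"
  by (simp_all add: fun_eq_iff ps_delta_def vector_field_def numeral_2_eq_2 numeral_3_eq_3)

lemma x_power: "ps_x * ps_x ^ (m - 1) = (ps_x ^ m :: 'a ps3)" and y_power: "ps_y * ps_y ^ (n - 1) = (ps_y ^ n :: 'a ps3)"
  using mn by (simp_all flip: power_Suc)

lemma less_4_cases: "i < 4 \<Longrightarrow> i = 0 \<or> i = 1 \<or> i = 2 \<or> i = (3 :: nat)"
  by auto

lemma ps_delta_f: "i < 4 \<Longrightarrow> f dvd ps_delta m n i f"
proof -
  have "vf (2 * of_nat n * ps_x) (2 * of_nat m * ps_y) (of_nat m * of_nat n * ps_z) f
      = 2 * of_nat m * of_nat n * ((ps_x * ps_x ^ (m - 1)) + ps_y * ps_y ^ (n - 1) + ps_z ^ 2)"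
    unfolding vf_f by (simp add: algebra_simps power2_eq_square)
  then have "ps_delta m n 0 f = 2 * of_nat m * of_nat n * f"
    unfolding ps_delta_vf x_power y_power by (simp add: hyp_f_def)
  moreover have "ps_delta m n 1 f = 0" "ps_delta m n 2 f = 0" "ps_delta m n 3 f = 0"
    unfolding ps_delta_vf vf_f by (simp_all add: algebra_simps)
  ultimately show "i < 4 \<Longrightarrow> f dvd ps_delta m n i f" by (auto dest!: less_4_cases)
qed

lemma deriv_op_ps_delta: "i < 4 \<Longrightarrow> deriv_op (ps_delta m n i :: 'a ps3 \<Rightarrow> _)"
  unfolding less_4_cases[of i] using deriv_op_vector_field ps_delta_vf less_4_cases by metis

lemma ps_delta_const: "i < 4 \<Longrightarrow> ps_delta m n i (ps_const c :: 'a ps3) = 0"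
  using less_4_cases[of i] by (auto simp: ps_delta_vf[simplified] ps_delta_vf)

lemma ps_delta_ideal: "i < 4 \<Longrightarrow> f dvd p \<Longrightarrow> f dvd ps_delta m n i p"
proof -
  assume i: "i < 4" and "f dvd p"
  then obtain h where "p = f * h" by (auto elim: dvdE)
  then have "ps_delta m n i p = ps_delta m n i f * h + f * ps_delta m n i h"
    by (simp add: deriv_opD[OF deriv_op_ps_delta[OF i]])
  then show ?thesis using ps_delta_f[OF i] by (simp add: dvd_add)
qed

lemma delta_cl: assumes i: "i < 4" shows "delta m n i (cl p) = cl (ps_delta m n i p)"
proof -
  have "cl (ps_delta m n i q) = cl (ps_delta m n i p)" if "q \<in> cl p" for q
  proof -
    have "f dvd q - p" using that by (simp add: cl_def)
    then show ?thesis
      using ps_delta_ideal[OF i, of "q - p"] by (simp add: cl_eq deriv_opD[OF deriv_op_ps_delta[OF i]])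
  qed
  moreover have "p \<in> cl p" unfolding cl_def by simp
  ultimately have "(\<Union>q\<in>cl p. cl (ps_delta m n i q)) = cl (ps_delta m n i p)" by blast
  then show ?thesis by (simp add: delta_def)
qed

lemma delta_Der: assumes i: "i < 4" shows "delta m n i \<in> Der_F A"
  unfolding Der_F_iff
proof (intro conjI allI)
  show "delta m n i \<in> extensional (carrier A)" by (simp add: delta_def)
  show "is_derivation A (delta m n i)"
    unfolding is_derivation_def
    by (auto simp: A_carrier delta_cl[OF i] deriv_opD[OF deriv_op_ps_delta[OF i]])
  show "delta m n i (c \<odot>\<^bsub>A\<^esub> \<one>\<^bsub>A\<^esub>) = \<zero>\<^bsub>A\<^esub>" for c
    by (simp add: delta_cl[OF i] ps_delta_const[OF i])
qed

text \<open>The vector field with the same values at \<open>x\<close>, \<open>y\<close> and \<open>z\<close> agrees with \<open>\<delta>\<close> modulo \<open>f\<close>, by \<open>derivation_determined\<close>.\<close>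

lemma Der_vector_field:
  assumes D: "\<delta> \<in> Der_F A"
  obtains a b c where "f dvd vf a b c f" "\<And>p. \<delta> (cl p) = cl (vf a b c p)"
proof -
  have d: "is_derivation A \<delta>" and dc: "\<delta> (e \<odot>\<^bsub>A\<^esub> \<one>\<^bsub>A\<^esub>) = \<zero>\<^bsub>A\<^esub>" for e using D by (auto simp: Der_F_iff)
  have "\<exists>q. \<delta> (cl p) = cl q" for p using is_derivationD(1)[OF d, of "cl p"] by (auto simp: A_carrier)
  then obtain g where g: "\<And>p. \<delta> (cl p) = cl (g p)" by metis
  define a b c where "a = g ps_x" and "b = g ps_y" and "c = g ps_z"
  define E where "E p = g p - vf a b c p" for p
  note v = deriv_opD[OF deriv_op_vector_field]
  have "f dvd E p" for p
  proof (rule derivation_determined[OF mn, where E = E])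
    fix p q
    have "cl (g (p + q)) = cl (g p + g q)"
      using is_derivationD(2)[OF d, of "cl p" "cl q"] by (simp add: g)
    then show "f dvd E (p + q) - (E p + E q)" by (simp add: cl_eq E_def v algebra_simps)
    have "cl (g (p * q)) = cl (g p * q + p * g q)"
      using is_derivationD(3)[OF d, of "cl p" "cl q"] by (simp add: g)
    then show "f dvd E (p * q) - (E p * q + p * E q)" by (simp add: cl_eq E_def v algebra_simps)
  next
    fix e
    have "cl (g (ps_const e)) = cl 0" using dc[of e] by (simp add: g)
    then show "f dvd E (ps_const e)" by (simp add: cl_eq E_def)
  qed (simp_all add: E_def a_def b_def c_def)
  then have dv: "\<delta> (cl p) = cl (vf a b c p)" for p by (simp add: g cl_eq E_def)
  have "cl (vf a b c f) = \<delta> (cl 0)" unfolding dv[symmetric] by (rule arg_cong[of _ _ \<delta>]) (simp add: cl_eq)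
  also have "\<dots> = cl 0" unfolding dv by (simp add: v)
  finally show ?thesis using that dv by (simp add: cl_eq)
qed

text \<open>The partial derivatives of \<open>f\<close> are, up to nonzero constants, powers of three different variables, so the
  relations between them are generated by the Koszul relations. The proof splits off the terms without \<open>z\<close>, for which
  a relation between powers of \<open>x\<close> and \<open>y\<close> remains.\<close>

lemma koszul_relations:
  fixes a b c :: "'a ps3"
  assumes eq: "of_nat m * ps_x ^ (m - 1) * a + of_nat n * ps_y ^ (n - 1) * b + 2 * ps_z * c = 0"
  obtains s t u where "a = - (of_nat n * ps_y ^ (n - 1)) * s - 2 * ps_z * t"
    "b = of_nat m * ps_x ^ (m - 1) * s - 2 * ps_z * u"
    "c = of_nat m * ps_x ^ (m - 1) * t + of_nat n * ps_y ^ (n - 1) * u"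
proof -
  define fx fy :: "'a fps fps" where "fx = of_nat m * fps_const (fps_X ^ (m - 1))" and "fy = of_nat n * fps_X ^ (n - 1)"
  have cfx: "fps_const fx = (of_nat m * ps_x ^ (m - 1) :: 'a ps3)" and cfy: "fps_const fy = (of_nat n * ps_y ^ (n - 1) :: 'a ps3)"
    by (simp_all add: fx_def fy_def ps_x_def ps_y_def fps_const_power fps_const_mult[symmetric] fps_of_nat[symmetric] del: fps_const_mult)
  have mn0: "(of_nat m :: 'a fps) \<noteq> 0" "(of_nat n :: 'a fps fps) \<noteq> 0" using mn by auto
  have half: "2 * ps_const (1 / 2) = (1 :: 'a ps3)"
    by (simp add: ps_const_def fps_numeral_fps_const)
  have inv: "of_nat n * ps_const (1 / of_nat n) = (1 :: 'a ps3)"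
    using mn by (simp add: ps_const_def fps_of_nat[symmetric])
  define a0 a1 b0 b1 where "a0 = a $ 0" and "a1 = fps_shift 1 a" and "b0 = b $ 0" and "b1 = fps_shift 1 b"
  have a: "a = fps_const a0 + ps_z * a1" and b: "b = fps_const b0 + ps_z * b1"
    unfolding a0_def a1_def b0_def b1_def ps_z_def by (rule fps_split[OF mn])+
  have "(fps_const fx * a + fps_const fy * b + 2 * ps_z * c) $ 0 = 0" unfolding cfx cfy eq by simp
  then have eq0: "fx * a0 + fy * b0 = 0" by (simp add: a0_def b0_def ps_z_def)
  have "a0 $ j = 0" if "j < n - 1" for j
  proof -
    have "(fx * a0) $ j = of_nat m * fps_X ^ (m - 1) * a0 $ j"
      by (simp add: fx_def fps_of_nat[symmetric] mult.assoc)
    moreover have "(fy * b0) $ j = 0" using that by (simp add: fy_def fps_of_nat[symmetric] mult.assoc fps_X_power_mult_nth)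
    moreover have "(fx * a0 + fy * b0) $ j = 0" unfolding eq0 by simp
    ultimately show ?thesis using mn0 by simp
  qed
  then have "fps_X ^ (n - 1) dvd a0" by (simp add: fps_X_power_dvd_iff)
  then obtain s0' where s0': "a0 = fps_X ^ (n - 1) * s0'" by (rule dvdE)
  define e :: "'a fps fps" where "e = fps_const (fps_const (1 / of_nat n))"
  have ne: "of_nat n * e = 1" using mn by (simp add: e_def fps_of_nat[symmetric])
  define s0 where "s0 = - e * s0'"
  have a0: "a0 = - fy * s0"
  proof -
    have "- fy * s0 = (of_nat n * e) * (fps_X ^ (n - 1) * s0')" unfolding fy_def s0_def by (simp add: mult_ac)
    then show ?thesis unfolding ne s0' by simp
  qed
  have "fy * (b0 - fx * s0) = 0" using eq0 unfolding a0 by (simp add: algebra_simps)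
  moreover have "fy \<noteq> 0" using mn0(2) by (simp add: fy_def)
  ultimately have b0: "b0 = fx * s0" by simp
  have "ps_z * (fps_const fx * a1 + fps_const fy * b1 + 2 * c) = 0"
  proof -
    have "fps_const fx * a + fps_const fy * b + 2 * ps_z * c
        = fps_const (fx * a0 + fy * b0) + ps_z * (fps_const fx * a1 + fps_const fy * b1 + 2 * c)"
      unfolding a b by (simp add: algebra_simps fps_const_add[symmetric] fps_const_mult[symmetric] del: fps_const_add fps_const_mult)
    then show ?thesis using eq unfolding eq0 cfx cfy by simp
  qed
  then have c2: "fps_const fx * a1 + fps_const fy * b1 + 2 * c = 0" using variable_nonzero(3)[OF mn, where 'a = 'a] by (metis mult_eq_0_iff)
  let ?h = "ps_const (1 / 2) :: 'a ps3"
  show ?thesis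
  proof (rule that[of "fps_const s0" "- ?h * a1" "- ?h * b1"])
    have "- (of_nat n * ps_y ^ (n - 1)) * fps_const s0 - 2 * ps_z * (- ?h * a1)
        = fps_const (- fy * s0) + (2 * ?h) * (ps_z * a1)"
      unfolding cfy[symmetric] by (simp add: mult_ac fps_const_mult[symmetric] fps_const_neg[symmetric] del: fps_const_mult fps_const_neg)
    then show "a = - (of_nat n * ps_y ^ (n - 1)) * fps_const s0 - 2 * ps_z * (- ?h * a1)"
      unfolding half a0[symmetric] using a by simp
    have "of_nat m * ps_x ^ (m - 1) * fps_const s0 - 2 * ps_z * (- ?h * b1)
        = fps_const (fx * s0) + (2 * ?h) * (ps_z * b1)"
      unfolding cfx[symmetric] by (simp add: mult_ac fps_const_mult[symmetric] del: fps_const_mult)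
    then show "b = of_nat m * ps_x ^ (m - 1) * fps_const s0 - 2 * ps_z * (- ?h * b1)"
      unfolding half b0[symmetric] using b by simp
    have "c = ?h * (2 * c)" using half by (metis mult.assoc mult.commute mult_1)
    also have "2 * c = - (fps_const fx * a1 + fps_const fy * b1)" using c2 by (metis add_eq_0_iff)
    finally show "c = of_nat m * ps_x ^ (m - 1) * (- ?h * a1) + of_nat n * ps_y ^ (n - 1) * (- ?h * b1)"
      unfolding cfx cfy by (simp add: algebra_simps)
  qed
qed

text \<open>If a vector field maps \<open>f\<close> to \<open>h f\<close>, subtracting the multiple \<open>h/(2mn) \<delta>\<^sub>0\<close> of the Euler field gives one that kills
  \<open>f\<close>. This is a relation between the partial derivatives of \<open>f\<close>, and the Koszul relations are \<open>\<delta>\<^sub>1\<close>, \<open>\<delta>\<^sub>2\<close> and \<open>\<delta>\<^sub>3\<close>.\<close>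

lemma Der_generated:
  assumes D: "\<delta> \<in> Der_F A"
  obtains g s t u where "\<And>p. \<delta> (cl p) =
    cl (g * ps_delta m n 0 p + s * ps_delta m n 1 p + t * ps_delta m n 2 p + u * ps_delta m n 3 p)"
proof -
  obtain a b c where abc: "f dvd vf a b c f" "\<And>p. \<delta> (cl p) = cl (vf a b c p)" using D by (rule Der_vector_field) blast
  obtain h where h: "vf a b c f = f * h" using abc(1) by (rule dvdE)
  define e :: "'a ps3" where "e = ps_const (1 / (2 * of_nat m * of_nat n))"
  have e: "2 * of_nat m * of_nat n * e = 1"
    using mn by (simp add: e_def ps_const_def fps_of_nat[symmetric] fps_numeral_fps_const)
  define g where "g = e * h"
  have "vf (2 * of_nat n * ps_x) (2 * of_nat m * ps_y) (of_nat m * of_nat n * ps_z) f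
      = 2 * of_nat m * of_nat n * ((ps_x * ps_x ^ (m - 1)) + ps_y * ps_y ^ (n - 1) + ps_z ^ 2)"
    unfolding vf_f by (simp add: algebra_simps power2_eq_square)
  then have euler: "g * vf (2 * of_nat n * ps_x) (2 * of_nat m * ps_y) (of_nat m * of_nat n * ps_z) f = (2 * of_nat m * of_nat n * e) * (h * f)"
    unfolding x_power y_power by (simp add: hyp_f_def g_def mult_ac)
  let ?a = "a - g * (2 * of_nat n * ps_x)" and ?b = "b - g * (2 * of_nat m * ps_y)" and ?c = "c - g * (of_nat m * of_nat n * ps_z)"
  have "vf ?a ?b ?c f = vf a b c f - g * vf (2 * of_nat n * ps_x) (2 * of_nat m * ps_y) (of_nat m * of_nat n * ps_z) f"
    by (simp add: vector_field_def algebra_simps)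
  also have "\<dots> = 0" unfolding euler e h by simp
  finally obtain s t u where stu: "?a = - (of_nat n * ps_y ^ (n - 1)) * s - 2 * ps_z * t"
    "?b = of_nat m * ps_x ^ (m - 1) * s - 2 * ps_z * u"
    "?c = of_nat m * ps_x ^ (m - 1) * t + of_nat n * ps_y ^ (n - 1) * u"
    unfolding vf_f by (rule koszul_relations)
  have "vf a b c p = g * vf (2 * of_nat n * ps_x) (2 * of_nat m * ps_y) (of_nat m * of_nat n * ps_z) p + vf ?a ?b ?c p" for p
    by (simp add: vector_field_def algebra_simps)
  then have "vf a b c p = g * ps_delta m n 0 p + s * ps_delta m n 1 p + t * ps_delta m n 2 p + u * ps_delta m n 3 p" for p
    unfolding stu ps_delta_vf by (simp add: vector_field_def algebra_simps)
  then show ?thesis using that abc(2) by metis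
qed

end

section \<open>The connection matrices\<close>

lemma ps_const_hom:
  "ps_const (a + b) = ps_const a + ps_const b" "ps_const (a - b) = ps_const a - ps_const b"
  "ps_const (a * b) = ps_const a * ps_const b" "ps_const (of_nat i) = of_nat i"
  "ps_const (numeral w) = numeral w" "ps_const 0 = 0" "ps_const 1 = 1"
  by (simp_all add: ps_const_def fps_of_nat fps_numeral_fps_const)

text \<open>The power series of a monomial replaces an exponent \<open>-1\<close> by \<open>0\<close>, so for a nonzero coefficient these identities need the integrality condition.\<close>

lemma scale_monomial:
  assumes "2 * of_nat e * c = d" "integral_monomial (c, i, j)"
  shows "i = int a - 1 \<Longrightarrow> j = 0 \<Longrightarrow> 2 * of_nat e * ps_x * ps_monomial (c, i, j) = ps_const d * ps_x ^ a"
    and "i = 0 \<Longrightarrow> j = int b - 1 \<Longrightarrow> 2 * of_nat e * ps_y * ps_monomial (c, i, j) = ps_const d * ps_y ^ b"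
proof -
  have d: "ps_const d = 2 * of_nat e * ps_const c" unfolding assms(1)[symmetric] by (simp add: ps_const_hom)
  show "2 * of_nat e * ps_x * ps_monomial (c, i, j) = ps_const d * ps_x ^ a" if "i = int a - 1" "j = 0"
  proof (cases "c = 0")
    case False
    then have a: "1 \<le> a" using assms(2) that by (auto simp: integral_monomial_def)
    then have "ps_x * ps_x ^ nat i = (ps_x ^ a :: 'a ps3)" using that by (simp add: nat_diff_distrib flip: power_Suc)
    then show ?thesis using that unfolding d ps_monomial_def by (simp add: mult_ac)
  qed (simp add: d ps_monomial_def ps_const_hom)
  show "2 * of_nat e * ps_y * ps_monomial (c, i, j) = ps_const d * ps_y ^ b" if "i = 0" "j = int b - 1"
  proof (cases "c = 0")
    case False
    then have b: "1 \<le> b" using assms(2) that by (auto simp: integral_monomial_def)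
    then have "ps_y * ps_y ^ nat j = (ps_y ^ b :: 'a ps3)" using that by (simp add: nat_diff_distrib flip: power_Suc)
    then show ?thesis using that unfolding d ps_monomial_def by (simp add: mult_ac)
  qed (simp add: d ps_monomial_def ps_const_hom)
qed

lemma scale_monomial2:
  assumes "4 * c = d" "integral_monomial (c, i, j)" "i = int a - 1" "j = int b - 1"
  shows "4 * ps_x * ps_y * ps_monomial (c, i, j) = ps_const d * ps_x ^ a * ps_y ^ b"
proof (cases "c = 0")
  case False
  have d: "ps_const d = 4 * ps_const c" unfolding assms(1)[symmetric] by (simp add: ps_const_hom)
  have ab: "1 \<le> a" "1 \<le> b" using False assms by (auto simp: integral_monomial_def)
  then have "ps_x * ps_x ^ nat i = (ps_x ^ a :: 'a ps3)" "ps_y * ps_y ^ nat j = (ps_y ^ b :: 'a ps3)"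
    using assms by (simp_all add: nat_diff_distrib flip: power_Suc)
  then have "4 * ps_const c * (ps_x * ps_x ^ nat i) * (ps_y * ps_y ^ nat j) = ps_const d * ps_x ^ a * (ps_y ^ b :: 'a ps3)"
    unfolding d by simp
  then show ?thesis unfolding ps_monomial_def by (simp add: mult_ac)
next
  case True
  then show ?thesis using assms(1) by (simp add: ps_monomial_def ps_const_hom)
qed

lemma sum_less_4: "(\<Sum>i<4. g i) = g 0 + g 1 + g 2 + (g (3 :: nat) :: 'b :: comm_monoid_add)"
  by (simp add: eval_nat_numeral)

locale integral_matrix_factorization = matrix_factorization m n k l F
  for m n k l and F :: "'a :: field_char_0 itself" +
  assumes integral: "conn_mats_integral TYPE('a) m n k l"
begin

abbreviation (input) "xk \<equiv> ps_x ^ k :: 'a ps3"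
abbreviation (input) "xm \<equiv> ps_x ^ (m - k) :: 'a ps3"
abbreviation (input) "yl \<equiv> ps_y ^ l :: 'a ps3"
abbreviation (input) "yn \<equiv> ps_y ^ (n - l) :: 'a ps3"
abbreviation (input) "nm \<equiv> of_nat m :: 'a ps3"
abbreviation (input) "nn \<equiv> of_nat n :: 'a ps3"
abbreviation (input) "nk \<equiv> of_nat k :: 'a ps3"
abbreviation (input) "nl \<equiv> of_nat l :: 'a ps3"
abbreviation "Cm i \<equiv> conn_mat m n k l i :: 'a ps3 list list"

text \<open>The matrices \<open>2 A\<^sub>0\<close>, \<open>4 x y A\<^sub>1\<close>, \<open>2 n x A\<^sub>2\<close> and \<open>2 m y A\<^sub>3\<close>. In contrast to the \<open>A\<^sub>i\<close> their entries are
  polynomials in \<open>x\<^sup>k\<close>, \<open>x\<^sup>m\<^sup>-\<^sup>k\<close>, \<open>y\<^sup>l\<close> and \<open>y\<^sup>n\<^sup>-\<^sup>l\<close> with integral coefficients, also for \<open>k = m\<close> or \<open>l = n\<close>;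
  nothing is lost, since \<open>x\<close> and \<open>y\<close> are not zero divisors modulo \<open>f\<close>.\<close>

definition S0 :: "'a ps3 list list" where
  "S0 = [[2 * nn * nk + 2 * nm * nl - nm * nn, 0, 0, 0], [0, 3 * nm * nn - 2 * nm * nl - 2 * nn * nk, 0, 0],
    [0, 0, nm * nn + 2 * nm * nl - 2 * nn * nk, 0], [0, 0, 0, nm * nn + 2 * nn * nk - 2 * nm * nl]]"
definition S1 :: "'a ps3 list list" where
  "S1 = [[0, (3 * nm * nn - 2 * nm * nl - 2 * nn * nk) * xm * yn, 0, 0],
    [(nm * nn - 2 * nn * nk - 2 * nm * nl) * xk * yl, 0, 0, 0],
    [0, 0, 0, (2 * nn * nk - 2 * nm * nl + nm * nn) * xk * yn],
    [0, 0, (2 * nn * nk - nm * nn - 2 * nm * nl) * xm * yl, 0]]"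
definition S2 :: "'a ps3 list list" where
  "S2 = [[0, 0, (nm * nn + 2 * nm * nl - 2 * nn * nk) * xm, 0], [0, 0, 0, (2 * nm * nl - 2 * nn * nk - nm * nn) * xk],
    [(nm * nn - 2 * nm * nl - 2 * nn * nk) * xk, 0, 0, 0], [0, (3 * nm * nn - 2 * nm * nl - 2 * nn * nk) * xm, 0, 0]]"
definition S3 :: "'a ps3 list list" where
  "S3 = [[0, 0, 0, (nm * nn - 2 * nm * nl + 2 * nn * nk) * yn], [0, 0, (nm * nn + 2 * nm * nl - 2 * nn * nk) * yl, 0],
    [0, (2 * nm * nl + 2 * nn * nk - 3 * nm * nn) * yn, 0, 0], [(nm * nn - 2 * nm * nl - 2 * nn * nk) * yl, 0, 0, 0]]"

lemma all_less_4: "(\<forall>i<4. P i) \<longleftrightarrow> P 0 \<and> P 1 \<and> P 2 \<and> P (3 :: nat)"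
  by (auto dest!: less_4_cases)

lemma ps_monomial_zero: "ps_monomial (0, i, j) = 0"
  by (simp add: ps_monomial_def ps_const_hom)

lemma nat_nonzero: "(of_nat m :: 'a) \<noteq> 0" "(of_nat n :: 'a) \<noteq> 0"
  using mn by auto

lemma exponents: "int m - int k - 1 = int (m - k) - 1" "int n - int l - 1 = int (n - l) - 1"
  using klmn by (simp_all add: of_nat_diff)

lemma scaled0: "\<forall>i<4. \<forall>j<4. 2 * Cm 0 ! i ! j = S0 ! i ! j"
proof -
  have half: "2 * ps_monomial (c, 0, 0) = ps_const d" if "2 * c = d" for c d :: 'a
    unfolding that[symmetric] by (simp add: ps_monomial_def ps_const_hom)
  show ?thesis
    unfolding all_less_4
    by (simp add: conn_mat_def conn_monomials_def Let_def S0_def ps_monomial_zero)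
      (intro conjI; subst half[OF refl]; simp add: ps_const_hom algebra_simps)
qed

lemma scaled2: "\<forall>i<4. \<forall>j<4. 2 * nn * ps_x * Cm 2 ! i ! j = S2 ! i ! j"
  and scaled3: "\<forall>i<4. \<forall>j<4. 2 * nm * ps_y * Cm 3 ! i ! j = S3 ! i ! j"
  and scaled1: "\<forall>i<4. \<forall>j<4. 4 * ps_x * ps_y * Cm 1 ! i ! j = S1 ! i ! j"
proof -
  have int: "\<forall>i<4. \<forall>row\<in>set (conn_monomials m n k l i :: 'a monomial list list). \<forall>t\<in>set row. integral_monomial t"
    using integral by (simp add: conn_mats_integral_def)
  let ?M = "of_nat m :: 'a" and ?N = "of_nat n :: 'a"
  note ent = nth_Cons_0 nth_Cons_Suc numeral_2_eq_2 numeral_3_eq_3 One_nat_def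
  have i1: "\<forall>row\<in>set (conn_monomials m n k l 1 :: 'a monomial list list). \<forall>t\<in>set row. integral_monomial t"
    and i2: "\<forall>row\<in>set (conn_monomials m n k l 2 :: 'a monomial list list). \<forall>t\<in>set row. integral_monomial t"
    and i3: "\<forall>row\<in>set (conn_monomials m n k l 3 :: 'a monomial list list). \<forall>t\<in>set row. integral_monomial t"
    by (rule int[THEN spec, THEN mp], simp)+
  note i1 = i1[unfolded conn_monomials_def Let_def ent list.set ball_simps]
  note i2 = i2[unfolded conn_monomials_def Let_def ent list.set ball_simps]
  note i3 = i3[unfolded conn_monomials_def Let_def ent list.set ball_simps]
  have N: "2 * ?N * (e / ?N) = 2 * e" "2 * ?M * (e / ?M) = 2 * e" "4 * (e / 4) = e" for e using nat_nonzero by simp_all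
  have X: "integral_monomial (e / ?N, int m - int k - 1, 0) \<Longrightarrow>
      2 * nn * ps_x * ps_monomial (e / ?N, int m - int k - 1, 0) = ps_const (2 * e) * xm"
    "integral_monomial (e / ?N, int k - 1, 0) \<Longrightarrow>
      2 * nn * ps_x * ps_monomial (e / ?N, int k - 1, 0) = ps_const (2 * e) * xk" for e :: 'a
    by (rule scale_monomial(1)[OF N(1)]; simp add: exponents)+
  have Y: "integral_monomial (e / ?M, 0, int n - int l - 1) \<Longrightarrow>
      2 * nm * ps_y * ps_monomial (e / ?M, 0, int n - int l - 1) = ps_const (2 * e) * yn"
    "integral_monomial (e / ?M, 0, int l - 1) \<Longrightarrow>
      2 * nm * ps_y * ps_monomial (e / ?M, 0, int l - 1) = ps_const (2 * e) * yl" for e :: 'a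
    by (rule scale_monomial(2)[OF N(2)]; simp add: exponents)+
  have Z: "integral_monomial (e / 4, int m - int k - 1, int n - int l - 1) \<Longrightarrow>
      4 * ps_x * ps_y * ps_monomial (e / 4, int m - int k - 1, int n - int l - 1) = ps_const e * xm * yn"
    "integral_monomial (e / 4, int m - int k - 1, int l - 1) \<Longrightarrow>
      4 * ps_x * ps_y * ps_monomial (e / 4, int m - int k - 1, int l - 1) = ps_const e * xm * yl"
    "integral_monomial (e / 4, int k - 1, int n - int l - 1) \<Longrightarrow>
      4 * ps_x * ps_y * ps_monomial (e / 4, int k - 1, int n - int l - 1) = ps_const e * xk * yn"
    "integral_monomial (e / 4, int k - 1, int l - 1) \<Longrightarrow>
      4 * ps_x * ps_y * ps_monomial (e / 4, int k - 1, int l - 1) = ps_const e * xk * yl" for e :: 'a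
    by (rule scale_monomial2[OF N(3)]; simp add: exponents)+
  show "\<forall>i<4. \<forall>j<4. 2 * nn * ps_x * Cm 2 ! i ! j = S2 ! i ! j"
    unfolding all_less_4 conn_mat_def conn_monomials_def Let_def S2_def ent list.map ps_monomial_zero mult_zero_right
    by (intro conjI;
        (rule refl | rule X[THEN trans], (insert i2, elim conjE, assumption), simp add: ps_const_hom algebra_simps))
  show "\<forall>i<4. \<forall>j<4. 2 * nm * ps_y * Cm 3 ! i ! j = S3 ! i ! j"
    unfolding all_less_4 conn_mat_def conn_monomials_def Let_def S3_def ent list.map ps_monomial_zero mult_zero_right
    by (intro conjI;
        (rule refl | rule Y[THEN trans], (insert i3, elim conjE, assumption), simp add: ps_const_hom algebra_simps))
  show "\<forall>i<4. \<forall>j<4. 4 * ps_x * ps_y * Cm 1 ! i ! j = S1 ! i ! j"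
    unfolding all_less_4 conn_mat_def conn_monomials_def Let_def S1_def ent list.map ps_monomial_zero mult_zero_right
    by (intro conjI;
        (rule refl | rule Z[THEN trans], (insert i1, elim conjE, assumption), simp add: ps_const_hom algebra_simps))
qed

lemma scaled_app:
  assumes "\<forall>i<4. \<forall>j<4. c * Cm e ! i ! j = S ! i ! j" "i < 4"
  shows "c * mat_app (Cm e) v i = mat_app S v i"
  using assms by (simp add: mat_app_def sum_distrib_left flip: mult.assoc)

text \<open>A vector \<open>\<phi> B v\<close> is in the image of \<open>\<phi>\<close>; the statements below exhibit \<open>B\<close>.\<close>

lemma null_factor:
  assumes "\<forall>i<4. \<forall>j<4. C ! i ! j = (\<Sum>t<4. ph ! i ! t * B ! t ! j)" "\<And>i. i < 4 \<Longrightarrow> w i = mat_app C v i"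
  shows "null w"
  unfolding null_iff
proof (intro exI[of _ "mat_app B v"] allI impI)
  fix i :: nat assume i: "i < 4"
  have "w i = mat_app ph (mat_app B v) i"
    using assms i by (simp add: mat_app_comp mat_app_def[of C])
  then show "f dvd w i - mat_app ph (mat_app B v) i" by simp
qed

lemma null_cancel_nat: "0 < a \<Longrightarrow> null (\<lambda>i. of_nat a * v i) \<Longrightarrow> null v"
proof -
  assume a: "0 < a" and v: "null (\<lambda>i. of_nat a * v i)"
  have *: "ps_const (1 / of_nat a) * (of_nat a * u) = (u :: 'a ps3)" for u
  proof -
    have "ps_const (1 / of_nat a) * of_nat a = (ps_const (1 / of_nat a * of_nat a) :: 'a ps3)" by (simp only: ps_const_hom)
    also have "\<dots> = 1" using a by (simp add: ps_const_hom)
    finally show ?thesis by (simp only: mult.assoc[symmetric] mult_1)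
  qed
  from null_mult[OF v, of "ps_const (1 / of_nat a)"] show "null v" by (simp only: *)
qed

text \<open>The operators \<open>\<delta>\<^sub>i + A\<^sub>i\<close> on vectors of power series.\<close>

definition dop :: "nat \<Rightarrow> (nat \<Rightarrow> 'a ps3) \<Rightarrow> nat \<Rightarrow> 'a ps3" where
  "dop i v j = ps_delta m n i (v j) + mat_app (Cm i) v j"

lemma dop_add: "i < 4 \<Longrightarrow> dop i (\<lambda>j. u j + v j) j = dop i u j + dop i v j"
  by (simp add: dop_def deriv_opD[OF deriv_op_ps_delta] mat_app_def algebra_simps sum.distrib)

lemma dop_mult: "i < 4 \<Longrightarrow> dop i (\<lambda>j. a * v j) j = a * dop i v j + ps_delta m n i a * v j"
  by (simp add: dop_def deriv_opD[OF deriv_op_ps_delta] mat_app_def algebra_simps sum_distrib_left)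

lemma dop_diff: "i < 4 \<Longrightarrow> dop i (\<lambda>j. u j - v j) j = dop i u j - dop i v j"
  by (simp add: dop_def deriv_opD[OF deriv_op_ps_delta] mat_app_def algebra_simps sum_subtractf)

text \<open>\<open>\<delta>\<^sub>i + A\<^sub>i\<close> descends to \<open>W\<close> if it maps the columns of \<open>\<phi>\<close>, up to a regular factor \<open>c\<close>, to combinations
  of columns of \<open>\<phi>\<close>.\<close>

lemma null_dop:
  assumes e: "e < 4" and S: "\<forall>i<4. \<forall>j<4. c * Cm e ! i ! j = S ! i ! j"
    and B: "\<forall>i<4. \<forall>j<4. c * ps_delta m n e (ph ! i ! j) + (\<Sum>t<4. S ! i ! t * ph ! t ! j) = (\<Sum>t<4. ph ! i ! t * B ! t ! j)"
    and cancel: "\<And>w. null (\<lambda>j. c * w j) \<Longrightarrow> null w" and v: "null v"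
  shows "null (dop e v)"
proof -
  obtain q where q: "\<forall>i<4. f dvd v i - mat_app ph q i" using v by (auto simp: null_iff)
  have "c * dop e (mat_app ph q) j = mat_app ph (\<lambda>t. c * ps_delta m n e (q t) + mat_app B q t) j" if j: "j < 4" for j
  proof -
    have "ps_delta m n e (mat_app ph q j) = (\<Sum>t<4. ps_delta m n e (ph ! j ! t) * q t + ph ! j ! t * ps_delta m n e (q t))"
      by (simp add: mat_app_def deriv_op_mult_sum[OF deriv_op_ps_delta[OF e]] deriv_opD[OF deriv_op_ps_delta[OF e]])
    moreover have "c * mat_app (Cm e) (mat_app ph q) j = (\<Sum>t<4. (\<Sum>s<4. S ! j ! s * ph ! s ! t) * q t)"
      unfolding scaled_app[OF S j] unfolding mat_app_comp ..
    ultimately have "c * dop e (mat_app ph q) j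
        = (\<Sum>t<4. (c * ps_delta m n e (ph ! j ! t) + (\<Sum>s<4. S ! j ! s * ph ! s ! t)) * q t) + mat_app ph (\<lambda>t. c * ps_delta m n e (q t)) j"
      by (simp add: dop_def mat_app_def sum_distrib_left sum.distrib algebra_simps)
    also have "\<dots> = mat_app ph (mat_app B q) j + mat_app ph (\<lambda>t. c * ps_delta m n e (q t)) j"
      using B j by (simp add: mat_app_comp)
    finally show ?thesis by (simp add: mat_app_def algebra_simps sum.distrib)
  qed
  then have "null (\<lambda>j. c * dop e (mat_app ph q) j)" unfolding null_iff
    by (intro exI[of _ "\<lambda>t. c * ps_delta m n e (q t) + mat_app B q t"]) simp
  then have "null (dop e (mat_app ph q))" by (rule cancel)
  then show ?thesis
  proof (rule null_cong)
    fix j :: nat assume j: "j < 4"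
    have 1: "f dvd mat_app ph q i - v i" if "i < 4" for i using q that dvd_swap by blast
    have "f dvd ps_delta m n e (mat_app ph q j - v j)" by (rule ps_delta_ideal[OF e 1[OF j]])
    moreover have "f dvd mat_app (Cm e) (\<lambda>i. mat_app ph q i - v i) j"
      unfolding mat_app_def[of "Cm e"] using 1 by (intro dvd_sum dvd_mult) auto
    ultimately have "f dvd dop e (\<lambda>i. mat_app ph q i - v i) j" unfolding dop_def by (rule dvd_add)
    then show "f dvd dop e (mat_app ph q) j - dop e v j" by (simp only: dop_diff[OF e])
  qed
qed

lemma xm_split: "(ps_x ^ m :: 'a ps3) = xk * xm" and yn_split: "(ps_y ^ n :: 'a ps3) = yl * yn"
  using klmn by (simp_all flip: power_add)

lemma dx_power: "ps_x * vf a 0 c (ps_x ^ e) = of_nat e * a * ps_x ^ e" and dx_y: "vf a 0 c (ps_y ^ e) = 0"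
  and dy_power: "ps_y * vf 0 a c (ps_y ^ e) = of_nat e * a * ps_y ^ e" and dy_x: "vf 0 a c (ps_x ^ e) = 0"
proof -
  have p: "t * (of_nat e * t ^ (e - 1) * b) = of_nat e * b * t ^ e" for t b :: "'a ps3"
    by (cases e) (simp_all add: mult_ac del: of_nat_Suc)
  show "ps_x * vf a 0 c (ps_x ^ e) = of_nat e * a * ps_x ^ e" "ps_y * vf 0 a c (ps_y ^ e) = of_nat e * a * ps_y ^ e"
    by (simp_all only: deriv_op_power[OF deriv_op_vector_field] vector_field_values p)
  show "vf a 0 c (ps_y ^ e) = 0" "vf 0 a c (ps_x ^ e) = 0"
    by (simp_all add: deriv_op_power[OF deriv_op_vector_field])
qed

lemma null_dop2: "null v \<Longrightarrow> null (dop 2 v)"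
proof (rule null_dop[where e = 2, OF _ scaled2, where B = "[[0, 0, 0, (nm * nn - 2 * nm * nl + 2 * nn * nk) * xk],
    [0, 0, (2 * nn * nk - nm * nn - 2 * nm * nl) * xm, 0], [0, (2 * nm * nl + 2 * nn * nk - nm * nn) * xk, 0, 0],
    [(2 * nm * nl + 2 * nn * nk - 3 * nm * nn) * xm, 0, 0, 0]]"])
  (* As psi phi = f, the matrix B is psi times the left-hand side of its equation, divided by f. *)
  have km: "of_nat (m - k) = nm - nk" using klmn by (simp add: of_nat_diff)
  have d: "2 * nn * ps_x * ps_delta m n 2 (ps_x ^ e) = - (4 * nn * of_nat e * ps_z * ps_x ^ e :: 'a ps3)" for e
  proof -
    have "2 * nn * ps_x * ps_delta m n 2 (ps_x ^ e) = 2 * nn * (ps_x * ps_delta m n 2 (ps_x ^ e))" by (simp only: mult.assoc)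
    then show ?thesis unfolding ps_delta_vf dx_power by simp
  qed
  have dz: "2 * nn * ps_x * ps_delta m n 2 ps_z = 2 * nn * nm * (xk * xm)"
  proof -
    have "2 * nn * ps_x * ps_delta m n 2 ps_z = 2 * nn * nm * (ps_x * ps_x ^ (m - 1))"
      unfolding ps_delta_vf vector_field_values by (simp only: mult_ac)
    then show ?thesis unfolding x_power xm_split .
  qed
  have d0: "ps_delta m n 2 (ps_y ^ e) = (0 :: 'a ps3)" for e unfolding ps_delta_vf by (rule dx_y)
  show "\<forall>i<4. \<forall>j<4. 2 * nn * ps_x * ps_delta m n 2 (ph ! i ! j) + (\<Sum>t<4. S2 ! i ! t * ph ! t ! j)
      = (\<Sum>t<4. ph ! i ! t * [[0, 0, 0, (nm * nn - 2 * nm * nl + 2 * nn * nk) * xk],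
    [0, 0, (2 * nn * nk - nm * nn - 2 * nm * nl) * xm, 0], [0, (2 * nm * nl + 2 * nn * nk - nm * nn) * xk, 0, 0],
    [(2 * nm * nl + 2 * nn * nk - 3 * nm * nn) * xm, 0, 0, 0]] ! t ! j)"
    unfolding all_less_4 sum_less_4
    by (simp add: mf_phi_def S2_def deriv_opD[OF deriv_op_ps_delta] d dz d0 km) (simp add: algebra_simps)
  show "null w" if "null (\<lambda>j. 2 * nn * ps_x * w j)" for w
  proof -
    have "null (\<lambda>j. of_nat (2 * n) * (ps_x * w j))" using that by (simp add: mult.assoc)
    then have "null (\<lambda>j. ps_x * w j)" by (rule null_cancel_nat[rotated]) (use mn in simp)
    then show ?thesis by (rule null_cancel_variable(1))
  qed
qed simp_all

lemma null_dop3: "null v \<Longrightarrow> null (dop 3 v)"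
proof (rule null_dop[where e = 3, OF _ scaled3, where B = "[[0, 0, (nm * nn - 2 * nm * nl + 2 * nn * nk) * yn, 0],
    [0, 0, 0, (nm * nn + 2 * nm * nl - 2 * nn * nk) * yl], [(nm * nn - 2 * nm * nl - 2 * nn * nk) * yl, 0, 0, 0],
    [0, (2 * nm * nl + 2 * nn * nk - 3 * nm * nn) * yn, 0, 0]]"])
  (* As psi phi = f, the matrix B is psi times the left-hand side of its equation, divided by f. *)
  have ln: "of_nat (n - l) = nn - nl" using klmn by (simp add: of_nat_diff)
  have d: "2 * nm * ps_y * ps_delta m n 3 (ps_y ^ e) = - (4 * nm * of_nat e * ps_z * ps_y ^ e :: 'a ps3)" for e
  proof -
    have "2 * nm * ps_y * ps_delta m n 3 (ps_y ^ e) = 2 * nm * (ps_y * ps_delta m n 3 (ps_y ^ e))" by (simp only: mult.assoc)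
    then show ?thesis unfolding ps_delta_vf dy_power by simp
  qed
  have dz: "2 * nm * ps_y * ps_delta m n 3 ps_z = 2 * nn * nm * (yl * yn)"
  proof -
    have "2 * nm * ps_y * ps_delta m n 3 ps_z = 2 * nn * nm * (ps_y * ps_y ^ (n - 1))"
      unfolding ps_delta_vf vector_field_values by (simp only: mult_ac)
    then show ?thesis unfolding y_power yn_split .
  qed
  have d0: "ps_delta m n 3 (ps_x ^ e) = (0 :: 'a ps3)" for e unfolding ps_delta_vf by (rule dy_x)
  show "\<forall>i<4. \<forall>j<4. 2 * nm * ps_y * ps_delta m n 3 (ph ! i ! j) + (\<Sum>t<4. S3 ! i ! t * ph ! t ! j)
      = (\<Sum>t<4. ph ! i ! t * [[0, 0, (nm * nn - 2 * nm * nl + 2 * nn * nk) * yn, 0],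
    [0, 0, 0, (nm * nn + 2 * nm * nl - 2 * nn * nk) * yl], [(nm * nn - 2 * nm * nl - 2 * nn * nk) * yl, 0, 0, 0],
    [0, (2 * nm * nl + 2 * nn * nk - 3 * nm * nn) * yn, 0, 0]] ! t ! j)"
    unfolding all_less_4 sum_less_4
    by (simp add: mf_phi_def S3_def deriv_opD[OF deriv_op_ps_delta] d dz d0 ln) (simp add: algebra_simps)
  show "null w" if "null (\<lambda>j. 2 * nm * ps_y * w j)" for w
  proof -
    have "null (\<lambda>j. of_nat (2 * m) * (ps_y * w j))" using that by (simp add: mult.assoc)
    then have "null (\<lambda>j. ps_y * w j)" by (rule null_cancel_nat[rotated]) (use mn in simp)
    then show ?thesis by (rule null_cancel_variable(2))
  qed
qed simp_all

text \<open>In the derivations of \<open>A\<close> one has \<open>2z \<delta>\<^sub>0 = -2nx \<delta>\<^sub>2 - 2my \<delta>\<^sub>3\<close> and \<open>2z \<delta>\<^sub>1 = n y\<^sup>n\<^sup>-\<^sup>1 \<delta>\<^sub>2 - m x\<^sup>m\<^sup>-\<^sup>1 \<delta>\<^sub>3\<close>; the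
  operators on \<open>W\<close> satisfy the same relations.\<close>

lemma dop_relation0:
  "null (\<lambda>j. 2 * ps_z * dop 0 v j + 2 * nn * ps_x * dop 2 v j + 2 * nm * ps_y * dop 3 v j)"
proof (rule null_cong)
  (* ?C is the scaled combination of connection matrices, and ?C = phi ?B. *)
  let ?B = "[[0, 0, nm * nn + 2 * nm * nl - 2 * nn * nk, 0], [0, 0, 0, nm * nn - 2 * nm * nl + 2 * nn * nk],
    [0, 3 * nm * nn - 2 * nm * nl - 2 * nn * nk, 0, 0], [2 * nm * nl + 2 * nn * nk - nm * nn, 0, 0, 0]]"
  let ?C = "map (\<lambda>i. map (\<lambda>j. ps_z * S0 ! i ! j + S2 ! i ! j + S3 ! i ! j) [0..<4]) [0..<4]"
  let ?w = "\<lambda>i. ps_z * (2 * mat_app (Cm 0) v i) + 2 * nn * ps_x * mat_app (Cm 2) v i + 2 * nm * ps_y * mat_app (Cm 3) v i"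
  show "null ?w"
  proof (rule null_factor[of ?C ?B])
    show "\<forall>i<4. \<forall>j<4. ?C ! i ! j = (\<Sum>t<4. ph ! i ! t * ?B ! t ! j)"
      unfolding all_less_4 sum_less_4
      by (simp add: mf_phi_def S0_def S2_def S3_def) (simp add: algebra_simps)
    show "?w i = mat_app ?C v i" if "i < 4" for i
      unfolding scaled_app[OF scaled0 that] scaled_app[OF scaled2 that] scaled_app[OF scaled3 that]
      using that by (simp add: mat_app_def algebra_simps sum.distrib sum_distrib_left)
  qed
  fix i :: nat
  have "2 * ps_z * ps_delta m n 0 p + 2 * nn * ps_x * ps_delta m n 2 p + 2 * nm * ps_y * ps_delta m n 3 p
      = 2 * nm * nn * (ps_x * ps_x ^ (m - 1) + ps_y * ps_y ^ (n - 1) + ps_z ^ 2) * d_z p" for p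
    unfolding ps_delta_vf by (simp add: vector_field_def algebra_simps power2_eq_square)
  then have "2 * ps_z * ps_delta m n 0 p + 2 * nn * ps_x * ps_delta m n 2 p + 2 * nm * ps_y * ps_delta m n 3 p
      = f * (2 * nm * nn * d_z p)" for p
    unfolding x_power y_power by (simp add: hyp_f_def mult_ac)
  then have "(2 * ps_z * dop 0 v i + 2 * nn * ps_x * dop 2 v i + 2 * nm * ps_y * dop 3 v i)
      = ?w i + f * (2 * nm * nn * d_z (v i))"
    unfolding dop_def by (simp add: algebra_simps)
  then have "?w i - (2 * ps_z * dop 0 v i + 2 * nn * ps_x * dop 2 v i + 2 * nm * ps_y * dop 3 v i)
      = f * - (2 * nm * nn * d_z (v i))" by simp
  then show "f dvd ?w i - (2 * ps_z * dop 0 v i + 2 * nn * ps_x * dop 2 v i + 2 * nm * ps_y * dop 3 v i)"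
    by (rule dvdI)
qed

lemma dop_relation1:
  "null (\<lambda>j. nn * ps_y ^ (n - 1) * dop 2 v j - nm * ps_x ^ (m - 1) * dop 3 v j - 2 * ps_z * dop 1 v j)"
proof -
  (* ?C is the scaled combination of connection matrices, and ?C = phi ?B. *)
  let ?B = "[[0, 0, 0, (2 * nm * nl - 2 * nn * nk - nm * nn) * (xk * yn)],
    [0, 0, (nm * nn + 2 * nm * nl - 2 * nn * nk) * (xm * yl), 0],
    [(2 * nm * nl + 2 * nn * nk - nm * nn) * (xk * yl), 0, 0, 0],
    [0, (2 * nm * nl + 2 * nn * nk - 3 * nm * nn) * (xm * yn), 0, 0]]"
  let ?C = "map (\<lambda>i. map (\<lambda>j. yl * yn * S2 ! i ! j - xk * xm * S3 ! i ! j - ps_z * S1 ! i ! j) [0..<4]) [0..<4]"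
  let ?w = "\<lambda>i. nn * ps_y ^ (n - 1) * mat_app (Cm 2) v i - nm * ps_x ^ (m - 1) * mat_app (Cm 3) v i - 2 * ps_z * mat_app (Cm 1) v i"
  have "null (\<lambda>i. of_nat 2 * (ps_x * (ps_y * ?w i)))"
  proof (rule null_factor[of ?C ?B])
    show "\<forall>i<4. \<forall>j<4. ?C ! i ! j = (\<Sum>t<4. ph ! i ! t * ?B ! t ! j)"
      unfolding all_less_4 sum_less_4
      by (simp add: mf_phi_def S1_def S2_def S3_def) (simp add: algebra_simps)
    fix i :: nat assume i: "i < 4"
    have "of_nat 2 * (ps_x * (ps_y * ?w i)) = (ps_y * ps_y ^ (n - 1)) * (2 * nn * ps_x * mat_app (Cm 2) v i)
        - (ps_x * ps_x ^ (m - 1)) * (2 * nm * ps_y * mat_app (Cm 3) v i) - ps_z * (4 * ps_x * ps_y * mat_app (Cm 1) v i)"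
      by (simp add: algebra_simps)
    also have "\<dots> = yl * yn * mat_app S2 v i - xk * xm * mat_app S3 v i - ps_z * mat_app S1 v i"
      unfolding x_power y_power xm_split yn_split scaled_app[OF scaled1 i] scaled_app[OF scaled2 i] scaled_app[OF scaled3 i] ..
    also have "\<dots> = mat_app ?C v i"
      using i by (simp add: mat_app_def algebra_simps sum.distrib sum_subtractf sum_distrib_left)
    finally show "of_nat 2 * (ps_x * (ps_y * ?w i)) = mat_app ?C v i" .
  qed
  then have "null (\<lambda>i. ps_x * (ps_y * ?w i))" by (rule null_cancel_nat[rotated]) simp
  then have "null (\<lambda>i. ps_y * ?w i)" by (rule null_cancel_variable(1)[of "\<lambda>i. ps_y * ?w i"])
  then have "null ?w" by (rule null_cancel_variable(2)[of ?w])
  moreover have "nn * ps_y ^ (n - 1) * ps_delta m n 2 p - nm * ps_x ^ (m - 1) * ps_delta m n 3 p - 2 * ps_z * ps_delta m n 1 p = 0" for p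
    unfolding ps_delta_vf by (simp add: vector_field_def algebra_simps)
  then have "nn * ps_y ^ (n - 1) * dop 2 v j - nm * ps_x ^ (m - 1) * dop 3 v j - 2 * ps_z * dop 1 v j = ?w j" for j
    unfolding dop_def by (simp add: algebra_simps)
  ultimately show ?thesis by simp
qed

lemma conn_mat_commutator:
  assumes "i < 4" "j < 4"
  shows "(\<Sum>t<4. Cm 2 ! i ! t * Cm 3 ! t ! j) - (\<Sum>t<4. Cm 3 ! i ! t * Cm 2 ! t ! j) + 2 * Cm 1 ! i ! j = 0"
proof -
  let ?c = "2 * nn * ps_x" and ?d = "2 * nm * ps_y"
  have "(?c * ?d) * ((\<Sum>t<4. Cm 2 ! i ! t * Cm 3 ! t ! j) - (\<Sum>t<4. Cm 3 ! i ! t * Cm 2 ! t ! j) + 2 * Cm 1 ! i ! j)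
      = (\<Sum>t<4. (?c * Cm 2 ! i ! t) * (?d * Cm 3 ! t ! j)) - (\<Sum>t<4. (?d * Cm 3 ! i ! t) * (?c * Cm 2 ! t ! j))
        + 2 * nm * nn * (4 * ps_x * ps_y * Cm 1 ! i ! j)"
    by (simp add: sum_distrib_left algebra_simps)
  also have "\<dots> = (\<Sum>t<4. S2 ! i ! t * S3 ! t ! j) - (\<Sum>t<4. S3 ! i ! t * S2 ! t ! j) + 2 * nm * nn * S1 ! i ! j"
    using scaled1 scaled2 scaled3 assms by simp
  also have "\<dots> = 0"
  proof -
    have "\<forall>i<4. \<forall>j<4. (\<Sum>t<4. S2 ! i ! t * S3 ! t ! j) - (\<Sum>t<4. S3 ! i ! t * S2 ! t ! j) + 2 * nm * nn * S1 ! i ! j = 0"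
      unfolding all_less_4 sum_less_4
      by (simp add: S1_def S2_def S3_def) (simp add: algebra_simps)
    then show ?thesis using assms by blast
  qed
  finally show ?thesis using mn variable_nonzero[OF mn, where 'a = 'a] by simp
qed

end

section \<open>The connection on the cokernel\<close>

context matrix_factorization
begin

lemma vf_scalar: "vf a b c (of_nat i) = 0" "vf a b c (numeral w) = 0"
proof -
  show "vf a b c (of_nat i) = 0" unfolding ps_const_hom(4)[symmetric] by simp
  show "vf a b c (numeral w) = 0" unfolding ps_const_hom(5)[symmetric] by simp
qed

definition rep :: "'a ps3 set \<Rightarrow> 'a ps3" where
  "rep \<alpha> = (SOME p. cl p = \<alpha>)"

lemma cl_rep: "\<alpha> \<in> carrier A \<Longrightarrow> cl (rep \<alpha>) = \<alpha>"
  unfolding rep_def A_carrier by (rule someI_ex) blast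

text \<open>Representatives of the coefficients of \<open>\<partial>\<^sub>x\<close> and \<open>\<partial>\<^sub>y\<close> in \<open>\<delta>\<close>.\<close>

abbreviation "cx \<delta> \<equiv> rep (\<delta> (cl ps_x))"
abbreviation "cy \<delta> \<equiv> rep (\<delta> (cl ps_y))"

lemma cl_cx: assumes "\<delta> \<in> Der_F A" shows "cl (cx \<delta>) = \<delta> (cl ps_x)" "cl (cy \<delta>) = \<delta> (cl ps_y)"
  using assms by (simp_all add: cl_rep Der_F_iff is_derivationD)

text \<open>The coefficient of \<open>\<partial>\<^sub>z\<close> in a derivation of \<open>A\<close> is determined by the other two, because \<open>2z\<close> is not a zero
  divisor. So \<open>-2z \<delta> = \<delta>(x) \<delta>\<^sub>2 + \<delta>(y) \<delta>\<^sub>3\<close>.\<close>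

lemma Der_scaled:
  assumes D: "\<delta> \<in> Der_F A" and e: "\<delta> (cl p) = cl e"
  shows "f dvd 2 * ps_z * e + cx \<delta> * ps_delta m n 2 p + cy \<delta> * ps_delta m n 3 p"
proof -
  obtain a b c where abc: "f dvd vf a b c f" "\<And>p. \<delta> (cl p) = cl (vf a b c p)" using D by (rule Der_vector_field) blast
  have a: "f dvd cx \<delta> - a" "f dvd cy \<delta> - b" using cl_cx[OF D] by (simp_all add: abc(2) cl_eq)
  have e: "f dvd e - vf a b c p" using e by (simp add: abc(2) cl_eq[symmetric])
  have "2 * ps_z * e + cx \<delta> * ps_delta m n 2 p + cy \<delta> * ps_delta m n 3 p
    = 2 * ps_z * (e - vf a b c p) + ps_delta m n 2 p * (cx \<delta> - a) + ps_delta m n 3 p * (cy \<delta> - b) + d_z p * vf a b c f"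
    unfolding vf_f ps_delta_vf by (simp add: vector_field_def algebra_simps)
  then show ?thesis using e a abc(1) by (simp add: dvd_add dvd_mult)
qed

end

context integral_matrix_factorization
begin

text \<open>Since \<open>-2z \<delta> = a \<delta>\<^sub>2 + b \<delta>\<^sub>3\<close> with \<open>a = \<delta>(x)\<close>, \<open>b = \<delta>(y)\<close>, the value \<open>w\<close> of \<open>\<nabla>\<^sub>\<delta>\<close> at \<open>v\<close> has to
  satisfy \<open>2z w + a \<nabla>\<^sub>2 v + b \<nabla>\<^sub>3 v = 0\<close> in \<open>W\<close>. As \<open>W\<close> has no \<open>z\<close>-torsion, this determines \<open>w\<close>. It is a definition
  of \<open>\<nabla>\<^sub>\<delta>\<close> that is independent of how \<open>\<delta>\<close> is written in the generators.\<close>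

definition lift :: "'a ps3 \<Rightarrow> 'a ps3 \<Rightarrow> (nat \<Rightarrow> 'a ps3) \<Rightarrow> (nat \<Rightarrow> 'a ps3) \<Rightarrow> bool" where
  "lift a b v w \<longleftrightarrow> null (\<lambda>j. 2 * ps_z * w j + a * dop 2 v j + b * dop 3 v j)"

lemma lift_cong:
  assumes "lift a b v w" "f dvd a - a'" "f dvd b - b'" shows "lift a' b' v w"
  using assms(1) unfolding lift_def
proof (rule null_cong)
  fix i :: nat
  have "2 * ps_z * w i + a * dop 2 v i + b * dop 3 v i - (2 * ps_z * w i + a' * dop 2 v i + b' * dop 3 v i)
    = dop 2 v i * (a - a') + dop 3 v i * (b - b')" by (simp add: algebra_simps)
  then show "f dvd 2 * ps_z * w i + a * dop 2 v i + b * dop 3 v i - (2 * ps_z * w i + a' * dop 2 v i + b' * dop 3 v i)"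
    using assms(2,3) by (simp add: dvd_add dvd_mult)
qed

lemma null_cancel_2z: "null (\<lambda>j. 2 * ps_z * w j) \<Longrightarrow> null w"
proof -
  assume "null (\<lambda>j. 2 * ps_z * w j)"
  then have "null (\<lambda>j. of_nat 2 * (ps_z * w j))" by (simp add: mult.assoc)
  then have "null (\<lambda>j. ps_z * w j)" by (rule null_cancel_nat[rotated]) simp
  then show "null w" by (rule null_cancel_variable(3)[of w])
qed

lemma lift_unique:
  assumes w: "lift a b v w" "lift a b v' w'" and v: "null (\<lambda>j. v j - v' j)"
  shows "null (\<lambda>j. w j - w' j)"
proof (rule null_cancel_2z)
  have "dop i (\<lambda>j. v j - v' j) = (\<lambda>j. dop i v j - dop i v' j)" if "i < 4" for i
    by (rule ext) (rule dop_diff[OF that])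
  then have "null (\<lambda>j. dop 2 v j - dop 2 v' j)" "null (\<lambda>j. dop 3 v j - dop 3 v' j)"
    using null_dop2[OF v] null_dop3[OF v] by simp_all
  then have "null (\<lambda>j. a * (dop 2 v j - dop 2 v' j) + b * (dop 3 v j - dop 3 v' j))" by (rule null_lin)
  from null_diff[OF null_diff[OF w[unfolded lift_def]] this]
  show "null (\<lambda>j. 2 * ps_z * (w j - w' j))" by (simp add: algebra_simps)
qed

text \<open>For a combination of the generators the corresponding combination of the operators is a solution, since the operators
  satisfy the relations between the generators.\<close>

lemma lift_generators:
  "lift (g * ps_delta m n 0 ps_x + s * ps_delta m n 1 ps_x + t * ps_delta m n 2 ps_x + u * ps_delta m n 3 ps_x)
    (g * ps_delta m n 0 ps_y + s * ps_delta m n 1 ps_y + t * ps_delta m n 2 ps_y + u * ps_delta m n 3 ps_y)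
    v (\<lambda>j. g * dop 0 v j + s * dop 1 v j + t * dop 2 v j + u * dop 3 v j)"
  using null_lin[OF dop_relation0[of v] dop_relation1[of v], of g "- s"]
  unfolding lift_def ps_delta_vf vector_field_values by (simp add: algebra_simps)

lemma lift_exists:
  assumes D: "\<delta> \<in> Der_F A" shows "\<exists>w. lift (cx \<delta>) (cy \<delta>) v w"
proof -
  obtain g s t u where E: "\<And>p. \<delta> (cl p) =
      cl (g * ps_delta m n 0 p + s * ps_delta m n 1 p + t * ps_delta m n 2 p + u * ps_delta m n 3 p)"
    using Der_generated[OF D] by blast
  have "f dvd g * ps_delta m n 0 ps_x + s * ps_delta m n 1 ps_x + t * ps_delta m n 2 ps_x + u * ps_delta m n 3 ps_x - cx \<delta>"
    "f dvd g * ps_delta m n 0 ps_y + s * ps_delta m n 1 ps_y + t * ps_delta m n 2 ps_y + u * ps_delta m n 3 ps_y - cy \<delta>"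
    using cl_cx[OF D] unfolding E by (simp_all add: cl_eq dvd_swap)
  from lift_cong[OF lift_generators this] show ?thesis by blast
qed

lemma lift_delta:
  assumes i: "i < 4" shows "lift (cx (delta m n i)) (cy (delta m n i)) v (dop i v)"
proof -
  have "lift (ps_delta m n i ps_x) (ps_delta m n i ps_y) v (dop i v)"
    using less_4_cases[OF i] lift_generators[of 1 0 0 0 v] lift_generators[of 0 1 0 0 v]
      lift_generators[of 0 0 1 0 v] lift_generators[of 0 0 0 1 v] by auto
  moreover have "f dvd ps_delta m n i ps_x - cx (delta m n i)" "f dvd ps_delta m n i ps_y - cy (delta m n i)"
    using cl_cx[OF delta_Der[OF i]] unfolding delta_cl[OF i] by (simp_all add: cl_eq dvd_swap)
  ultimately show ?thesis by (rule lift_cong)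
qed

definition nab_at :: "('a ps3 set \<Rightarrow> 'a ps3 set) \<Rightarrow> (nat \<Rightarrow> 'a ps3 set) set \<Rightarrow> (nat \<Rightarrow> 'a ps3 set) set" where
  "nab_at \<delta> \<omega> = wc (SOME w. \<exists>v. \<omega> = wc v \<and> lift (cx \<delta>) (cy \<delta>) v w)"

lemma nab_at_eq: assumes "lift (cx \<delta>) (cy \<delta>) v w" shows "nab_at \<delta> (wc v) = wc w"
proof -
  define w' where "w' = (SOME w. \<exists>v'. wc v = wc v' \<and> lift (cx \<delta>) (cy \<delta>) v' w)"
  have "\<exists>v'. wc v = wc v' \<and> lift (cx \<delta>) (cy \<delta>) v' w'"
    unfolding w'_def by (rule someI[of _ w]) (use assms in blast)
  then obtain v' where "wc v' = wc v" "lift (cx \<delta>) (cy \<delta>) v' w'" by metis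
  then have "wc w' = wc w" using lift_unique[OF _ assms] by (simp add: wc_eq)
  then show ?thesis unfolding nab_at_def w'_def .
qed

lemma connection_along_nab_at:
  assumes D: "\<delta> \<in> Der_F A" shows "connection_along A W \<delta> (nab_at \<delta>)"
  unfolding connection_along_def
proof (intro conjI ballI)
  show "nab_at \<delta> \<in> carrier W \<rightarrow> carrier W" by (simp add: nab_at_def)
next
  fix \<alpha> \<beta> assume "\<alpha> \<in> carrier W" "\<beta> \<in> carrier W"
  then obtain v v' where v: "\<alpha> = wc v" "\<beta> = wc v'" by (auto simp: W_carrier)
  obtain w w' where w: "lift (cx \<delta>) (cy \<delta>) v w" "lift (cx \<delta>) (cy \<delta>) v' w'" using lift_exists[OF D] by metis
  have "lift (cx \<delta>) (cy \<delta>) (\<lambda>j. v j + v' j) (\<lambda>j. w j + w' j)"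
    using null_add[OF w[unfolded lift_def]] unfolding lift_def by (simp add: dop_add algebra_simps)
  then show "nab_at \<delta> (\<alpha> \<oplus>\<^bsub>W\<^esub> \<beta>) = nab_at \<delta> \<alpha> \<oplus>\<^bsub>W\<^esub> nab_at \<delta> \<beta>"
    by (simp add: v nab_at_eq[OF w(1)] nab_at_eq[OF w(2)] nab_at_eq)
next
  fix \<alpha> \<beta> assume "\<alpha> \<in> carrier A" "\<beta> \<in> carrier W"
  then obtain p v where v: "\<alpha> = cl p" "\<beta> = wc v" by (auto simp: W_carrier A_carrier)
  obtain w where w: "lift (cx \<delta>) (cy \<delta>) v w" using lift_exists[OF D] by metis
  have "\<delta> (cl p) \<in> carrier A" using D by (simp add: Der_F_iff is_derivationD)
  then obtain e where e: "\<delta> (cl p) = cl e" by (auto simp: A_carrier)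
  have "lift (cx \<delta>) (cy \<delta>) (\<lambda>j. p * v j) (\<lambda>j. p * w j + e * v j)"
    unfolding lift_def
  proof (rule null_cong[OF null_mult[OF w[unfolded lift_def], of p]])
    fix j :: nat
    have "p * (2 * ps_z * w j + cx \<delta> * dop 2 v j + cy \<delta> * dop 3 v j) - (2 * ps_z * (p * w j + e * v j)
        + cx \<delta> * dop 2 (\<lambda>j. p * v j) j + cy \<delta> * dop 3 (\<lambda>j. p * v j) j)
      = - v j * (2 * ps_z * e + cx \<delta> * ps_delta m n 2 p + cy \<delta> * ps_delta m n 3 p)"
      by (simp add: dop_mult algebra_simps)
    then show "f dvd p * (2 * ps_z * w j + cx \<delta> * dop 2 v j + cy \<delta> * dop 3 v j) - (2 * ps_z * (p * w j + e * v j)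
        + cx \<delta> * dop 2 (\<lambda>j. p * v j) j + cy \<delta> * dop 3 (\<lambda>j. p * v j) j)"
      using dvd_mult[OF Der_scaled[OF D e], of "- v j"] by (simp only:)
  qed
  then show "nab_at \<delta> (\<alpha> \<odot>\<^bsub>W\<^esub> \<beta>) = \<alpha> \<odot>\<^bsub>W\<^esub> nab_at \<delta> \<beta> \<oplus>\<^bsub>W\<^esub> \<delta> \<alpha> \<odot>\<^bsub>W\<^esub> \<beta>"
    by (simp add: v e nab_at_eq[OF w] nab_at_eq)
qed

text \<open>The Kodaira-Spencer map of \<open>W\<close> is zero.\<close>

lemma V_eq_Der: "\<delta> \<in> carrier V \<longleftrightarrow> \<delta> \<in> Der_F A"
  using connection_along_nab_at by (auto simp: VW_iff)

definition conn :: "('a ps3 set \<Rightarrow> 'a ps3 set) \<Rightarrow> (nat \<Rightarrow> 'a ps3 set) set \<Rightarrow> (nat \<Rightarrow> 'a ps3 set) set" where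
  "conn = (\<lambda>\<delta>\<in>carrier V. \<lambda>w\<in>carrier W. nab_at \<delta> w)"

lemma conn_connection: "is_connection A W conn"
  unfolding is_connection_def
proof (intro conjI ballI)
  show "conn \<in> carrier V \<rightarrow>\<^sub>E End_F A W"
  proof (unfold conn_def, intro restrict_PiE_iff[THEN iffD2] ballI)
    fix \<delta> assume d: "\<delta> \<in> carrier V"
    then have D: "\<delta> \<in> Der_F A" by (simp add: V_eq_Der)
    note N = connection_alongD[OF connection_along_nab_at[OF D]]
    have "\<delta> (c \<odot>\<^bsub>A\<^esub> \<one>\<^bsub>A\<^esub>) = \<zero>\<^bsub>A\<^esub>" for c using D unfolding Der_F_iff by blast
    then show "(\<lambda>w\<in>carrier W. nab_at \<delta> w) \<in> End_F A W"
      using N by (auto simp: End_F_def smult_closed M.add.m_closed simp del: A_ops W_ops)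
  qed
next
  fix \<delta> \<eta> \<omega> assume d: "\<delta> \<in> carrier V" "\<eta> \<in> carrier V" and w: "\<omega> \<in> carrier W"
  obtain v where v: "\<omega> = wc v" using w by (auto simp: W_carrier)
  note D = d[unfolded V_eq_Der] V_add_closed[OF d, unfolded V_eq_Der]
  obtain w w' where w: "lift (cx \<delta>) (cy \<delta>) v w" "lift (cx \<eta>) (cy \<eta>) v w'" using lift_exists D by metis
  have "cl (cx (\<delta> \<oplus>\<^bsub>V\<^esub> \<eta>)) = cl (cx \<delta> + cx \<eta>)" "cl (cy (\<delta> \<oplus>\<^bsub>V\<^esub> \<eta>)) = cl (cy \<delta> + cy \<eta>)"
    using cl_cx[OF D(3)] cl_cx[OF D(1)] cl_cx[OF D(2)] by (simp_all add: V_apply flip: A_ops)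
  then have c: "f dvd cx \<delta> + cx \<eta> - cx (\<delta> \<oplus>\<^bsub>V\<^esub> \<eta>)" "f dvd cy \<delta> + cy \<eta> - cy (\<delta> \<oplus>\<^bsub>V\<^esub> \<eta>)"
    by (simp_all add: cl_eq dvd_swap)
  have "lift (cx \<delta> + cx \<eta>) (cy \<delta> + cy \<eta>) v (\<lambda>j. w j + w' j)"
    using null_add[OF w[unfolded lift_def]] unfolding lift_def by (simp add: algebra_simps)
  from lift_cong[OF this c] have "lift (cx (\<delta> \<oplus>\<^bsub>V\<^esub> \<eta>)) (cy (\<delta> \<oplus>\<^bsub>V\<^esub> \<eta>)) v (\<lambda>j. w j + w' j)" .
  then show "conn (\<delta> \<oplus>\<^bsub>V\<^esub> \<eta>) \<omega> = conn \<delta> \<omega> \<oplus>\<^bsub>W\<^esub> conn \<eta> \<omega>"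
    using d V_add_closed[OF d] by (simp add: conn_def v nab_at_eq[OF w(1)] nab_at_eq[OF w(2)] nab_at_eq)
next
  fix \<alpha> \<delta> \<omega> assume a: "\<alpha> \<in> carrier A" and d: "\<delta> \<in> carrier V" and w: "\<omega> \<in> carrier W"
  obtain v p where v: "\<omega> = wc v" "\<alpha> = cl p" using w a by (auto simp: W_carrier A_carrier)
  note D = d[unfolded V_eq_Der] V_smult_closed[OF d a, unfolded V_eq_Der v]
  obtain w where w: "lift (cx \<delta>) (cy \<delta>) v w" using lift_exists D by metis
  have "cl (cx (cl p \<odot>\<^bsub>V\<^esub> \<delta>)) = cl (p * cx \<delta>)" "cl (cy (cl p \<odot>\<^bsub>V\<^esub> \<delta>)) = cl (p * cy \<delta>)"
    using cl_cx[OF D(2)] cl_cx[OF D(1)] by (simp_all add: V_apply flip: A_ops)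
  then have c: "f dvd p * cx \<delta> - cx (cl p \<odot>\<^bsub>V\<^esub> \<delta>)" "f dvd p * cy \<delta> - cy (cl p \<odot>\<^bsub>V\<^esub> \<delta>)"
    by (simp_all add: cl_eq dvd_swap)
  have "lift (p * cx \<delta>) (p * cy \<delta>) v (\<lambda>j. p * w j)"
    using null_mult[OF w[unfolded lift_def], of p] unfolding lift_def by (simp add: algebra_simps)
  from lift_cong[OF this c] have "lift (cx (cl p \<odot>\<^bsub>V\<^esub> \<delta>)) (cy (cl p \<odot>\<^bsub>V\<^esub> \<delta>)) v (\<lambda>j. p * w j)" .
  then show "conn (\<alpha> \<odot>\<^bsub>V\<^esub> \<delta>) \<omega> = \<alpha> \<odot>\<^bsub>W\<^esub> conn \<delta> \<omega>"
    using d V_smult_closed[OF d a] by (simp add: conn_def v nab_at_eq[OF w] nab_at_eq)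
next
  fix \<delta> \<alpha> \<omega> assume a: "\<delta> \<in> carrier V" "\<alpha> \<in> carrier A" "\<omega> \<in> carrier W"
  then show "conn \<delta> (\<alpha> \<odot>\<^bsub>W\<^esub> \<omega>) = \<alpha> \<odot>\<^bsub>W\<^esub> conn \<delta> \<omega> \<oplus>\<^bsub>W\<^esub> \<delta> \<alpha> \<odot>\<^bsub>W\<^esub> \<omega>"
    using connection_alongD(3)[OF connection_along_nab_at, of \<delta> \<alpha> \<omega>]
    by (simp add: conn_def V_eq_Der smult_closed)
qed

lemma conn_op_vec: assumes i: "i < 4" shows "conn_op m n k l i (vec v) = vec (dop i v)"
proof -
  have "(\<lambda>j\<in>{..<4}. delta m n i (vec v j)) = vec (\<lambda>j. ps_delta m n i (v j))"
    unfolding vec_def by (intro restrict_ext) (simp add: delta_cl[OF i])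
  then show ?thesis by (simp add: conn_op_def mat_vec_vec F4_sel dop_def[abs_def])
qed

lemma induced_iff:
  "induced_by_conn_op m n k l nab \<longleftrightarrow> (\<forall>i<4. \<forall>v. nab (delta m n i) (wc v) = wc (dop i v))"
  by (simp add: induced_by_conn_op_def F4_sel conn_op_vec wc_def)

lemma delta_V [simp]: "i < 4 \<Longrightarrow> delta m n i \<in> carrier V"
  by (simp add: V_eq_Der delta_Der)

lemma conn_induced: "induced_by_conn_op m n k l conn"
  by (simp add: induced_iff conn_def nab_at_eq[OF lift_delta])

lemma V_scaled:
  assumes d: "\<delta> \<in> carrier V"
  shows "cl (2 * ps_z) \<odot>\<^bsub>V\<^esub> \<delta> = cl (- cx \<delta>) \<odot>\<^bsub>V\<^esub> delta m n 2 \<oplus>\<^bsub>V\<^esub> cl (- cy \<delta>) \<odot>\<^bsub>V\<^esub> delta m n 3"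
proof (rule V_eqI)
  fix \<alpha> assume "\<alpha> \<in> carrier A"
  then obtain p where p: "\<alpha> = cl p" by (auto simp: A_carrier)
  obtain e where e: "\<delta> (cl p) = cl e" using V_closed[OF d cl_closed[of p]] unfolding A_carrier by blast
  have "f dvd 2 * ps_z * e - (- cx \<delta> * ps_delta m n 2 p + - cy \<delta> * ps_delta m n 3 p)"
    using Der_scaled[OF d[unfolded V_eq_Der] e] by (simp add: algebra_simps)
  then show "(cl (2 * ps_z) \<odot>\<^bsub>V\<^esub> \<delta>) \<alpha> = (cl (- cx \<delta>) \<odot>\<^bsub>V\<^esub> delta m n 2 \<oplus>\<^bsub>V\<^esub> cl (- cy \<delta>) \<odot>\<^bsub>V\<^esub> delta m n 3) \<alpha>"
    by (simp add: p V_apply e delta_cl cl_eq)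
qed (simp_all add: d V_add_closed V_smult_closed)

text \<open>The equation in \<open>lift\<close> is forced by linearity of the connection.\<close>

lemma induced_lift:
  assumes c: "is_connection A W nab" and i: "induced_by_conn_op m n k l nab"
    and d: "\<delta> \<in> carrier V" and w: "nab \<delta> (wc v) = wc w"
  shows "lift (cx \<delta>) (cy \<delta>) v w"
proof -
  have "nab (cl (2 * ps_z) \<odot>\<^bsub>V\<^esub> \<delta>) (wc v) = wc (\<lambda>j. 2 * ps_z * w j)"
    using d by (simp add: connection_smult[OF c] w)
  moreover have "nab (cl (2 * ps_z) \<odot>\<^bsub>V\<^esub> \<delta>) (wc v) = wc (\<lambda>j. - cx \<delta> * dop 2 v j + - cy \<delta> * dop 3 v j)"
    using i[unfolded induced_iff]
    by (simp add: V_scaled[OF d] connection_add[OF c] connection_smult[OF c] V_smult_closed)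
  ultimately show ?thesis by (simp add: lift_def wc_eq algebra_simps)
qed

lemma induced_unique:
  assumes c: "is_connection A W nab" and i: "induced_by_conn_op m n k l nab" shows "nab = conn"
proof (rule PiE_ext)
  show nab: "nab \<in> carrier V \<rightarrow>\<^sub>E End_F A W" using c unfolding is_connection_def by (rule conjunct1)
  show conn: "conn \<in> carrier V \<rightarrow>\<^sub>E End_F A W"
    using conn_connection unfolding is_connection_def by (rule conjunct1)
  fix \<delta> assume d: "\<delta> \<in> carrier V"
  show "nab \<delta> = conn \<delta>"
  proof (rule PiE_ext)
    have "nab \<delta> \<in> End_F A W" "conn \<delta> \<in> End_F A W"
      by (rule PiE_mem[OF nab d], rule PiE_mem[OF conn d])
    then show "nab \<delta> \<in> carrier W \<rightarrow>\<^sub>E carrier W" "conn \<delta> \<in> carrier W \<rightarrow>\<^sub>E carrier W"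
      by (auto simp: End_F_def)
    fix \<omega> assume "\<omega> \<in> carrier W"
    then obtain v where v: "\<omega> = wc v" by (auto simp: W_carrier)
    have "nab \<delta> (wc v) \<in> carrier W" using d by (simp add: nab_closed[OF c])
    then obtain w where w: "nab \<delta> (wc v) = wc w" by (auto simp: W_carrier)
    show "nab \<delta> \<omega> = conn \<delta> \<omega>"
      using nab_at_eq[OF induced_lift[OF c i d w]] d by (simp add: v w conn_def)
  qed
qed

section \<open>Flatness\<close>

text \<open>Both sides of \<open>[\<delta>\<^sub>2, \<delta>\<^sub>3] = -2 \<delta>\<^sub>1\<close> are derivations, so it suffices to compare them at \<open>x\<close>, \<open>y\<close> and \<open>z\<close>.\<close>

lemma delta_bracket:
  "f dvd ps_delta m n 2 (ps_delta m n 3 p) - ps_delta m n 3 (ps_delta m n 2 p) + 2 * ps_delta m n 1 p"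
proof -
  let ?E = "\<lambda>p :: 'a ps3. ps_delta m n 2 (ps_delta m n 3 p) - ps_delta m n 3 (ps_delta m n 2 p) + 2 * ps_delta m n 1 p"
  note D = deriv_opD[OF deriv_op_ps_delta]
  note v = deriv_opD[OF deriv_op_vector_field]
  show ?thesis
  proof (rule derivation_determined[OF mn, where E = ?E])
    show "f dvd ?E (p + q) - (?E p + ?E q)" for p q by (simp add: D algebra_simps)
    show "f dvd ?E (p * q) - (?E p * q + p * ?E q)" for p q by (simp add: D algebra_simps)
    show "f dvd ?E (ps_const c)" for c by (simp add: ps_delta_const D)
    have "?E ps_x = 0" "?E ps_y = 0" "?E ps_z = 0"
      unfolding ps_delta_vf vector_field_values by (simp_all add: v dx_y dy_x vf_scalar)
    then show "f dvd ?E ps_x" "f dvd ?E ps_y" "f dvd ?E ps_z" by (simp_all only: dvd_0_right)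
  qed
qed

lemma lie_bracket_23: "lie_bracket A (delta m n 2) (delta m n 3) = cl (- 2) \<odot>\<^bsub>V\<^esub> delta m n 1"
proof (rule V_eqI)
  fix \<alpha> assume "\<alpha> \<in> carrier A"
  then obtain p where p: "\<alpha> = cl p" by (auto simp: A_carrier)
  show "lie_bracket A (delta m n 2) (delta m n 3) \<alpha> = (cl (- 2) \<odot>\<^bsub>V\<^esub> delta m n 1) \<alpha>"
    using delta_bracket[of p] by (simp add: p V_apply(2,4) delta_cl cl_eq)
qed (simp_all add: V_bracket_closed V_smult_closed)

text \<open>\<open>A\<^sub>3\<close> depends on \<open>y\<close> only and \<open>A\<^sub>2\<close> on \<open>x\<close> only, while \<open>\<delta>\<^sub>2\<close> does not differentiate with respect to \<open>y\<close> nor \<open>\<delta>\<^sub>3\<close> with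
  respect to \<open>x\<close>.\<close>

lemma ps_delta_conn_mat:
  "\<forall>i<4. \<forall>j<4. ps_delta m n 2 (Cm 3 ! i ! j) = 0" "\<forall>i<4. \<forall>j<4. ps_delta m n 3 (Cm 2 ! i ! j) = 0"
proof -
  note ent = nth_Cons_0 nth_Cons_Suc numeral_2_eq_2 numeral_3_eq_3 One_nat_def
  have "ps_delta m n 2 (ps_monomial (c, 0, j)) = (0 :: 'a ps3)" "ps_delta m n 3 (ps_monomial (c, j, 0)) = (0 :: 'a ps3)" for c j
    unfolding ps_delta_vf by (simp_all add: ps_monomial_def deriv_opD[OF deriv_op_vector_field] dx_y dy_x)
  note k = this[unfolded ent]
  show "\<forall>i<4. \<forall>j<4. ps_delta m n 2 (Cm 3 ! i ! j) = 0"
    unfolding all_less_4 conn_mat_def conn_monomials_def Let_def ent list.map by (intro conjI; rule k)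
  show "\<forall>i<4. \<forall>j<4. ps_delta m n 3 (Cm 2 ! i ! j) = 0"
    unfolding all_less_4 conn_mat_def conn_monomials_def Let_def ent list.map by (intro conjI; rule k)
qed

lemma dop_commutator:
  assumes j: "j < 4" shows "f dvd dop 2 (dop 3 v) j - dop 3 (dop 2 v) j + 2 * dop 1 v j"
proof -
  note D = deriv_opD[OF deriv_op_ps_delta]
  have 1: "ps_delta m n 2 (mat_app (Cm 3) v j) = mat_app (Cm 3) (\<lambda>t. ps_delta m n 2 (v t)) j"
    "ps_delta m n 3 (mat_app (Cm 2) v j) = mat_app (Cm 2) (\<lambda>t. ps_delta m n 3 (v t)) j"
    using ps_delta_conn_mat j by (simp_all add: mat_app_def deriv_op_mult_sum[OF deriv_op_ps_delta] D)
  have 2: "mat_app B (\<lambda>t. u t + w t) j = mat_app B u j + mat_app B w j" for B u w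
    by (simp add: mat_app_def algebra_simps sum.distrib)
  have "mat_app (Cm 2) (mat_app (Cm 3) v) j - mat_app (Cm 3) (mat_app (Cm 2) v) j + 2 * mat_app (Cm 1) v j
    = (\<Sum>t<4. ((\<Sum>s<4. Cm 2 ! j ! s * Cm 3 ! s ! t) - (\<Sum>s<4. Cm 3 ! j ! s * Cm 2 ! s ! t) + 2 * Cm 1 ! j ! t) * v t)"
    unfolding mat_app_comp unfolding mat_app_def by (simp add: algebra_simps sum.distrib sum_subtractf sum_distrib_left)
  also have "\<dots> = 0" using conn_mat_commutator[OF j] by simp
  finally have 3: "mat_app (Cm 2) (mat_app (Cm 3) v) j - mat_app (Cm 3) (mat_app (Cm 2) v) j + 2 * mat_app (Cm 1) v j = 0" .
  have "dop 2 (dop 3 v) j - dop 3 (dop 2 v) j + 2 * dop 1 v j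
      = (ps_delta m n 2 (ps_delta m n 3 (v j)) - ps_delta m n 3 (ps_delta m n 2 (v j)) + 2 * ps_delta m n 1 (v j))
        + (mat_app (Cm 2) (mat_app (Cm 3) v) j - mat_app (Cm 3) (mat_app (Cm 2) v) j + 2 * mat_app (Cm 1) v j)"
    unfolding dop_def[abs_def] by (simp add: D 1 2 algebra_simps)
  then show ?thesis unfolding 3 using delta_bracket[of "v j"] by simp
qed

lemma W_cancel_2z: assumes "\<omega> \<in> carrier W" "cl (2 * ps_z) \<odot>\<^bsub>W\<^esub> \<omega> = \<zero>\<^bsub>W\<^esub>" shows "\<omega> = \<zero>\<^bsub>W\<^esub>"
proof -
  obtain v where v: "\<omega> = wc v" using assms(1) by (auto simp: W_carrier)
  show ?thesis using assms(2) null_cancel_2z[of v] by (simp add: v wc_eq)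
qed

text \<open>Up to the factor \<open>2z\<close> every derivation is a combination of \<open>\<delta>\<^sub>2\<close> and \<open>\<delta>\<^sub>3\<close>. The curvature is bilinear and
  \<open>W\<close> has no \<open>z\<close>-torsion, so only the curvature at \<open>(\<delta>\<^sub>2, \<delta>\<^sub>3)\<close> matters. There it is
  \<open>[A\<^sub>2, A\<^sub>3] + 2 A\<^sub>1 = 0\<close> by \<open>dop_commutator\<close>.\<close>

lemma induced_flat:
  assumes c: "is_connection A W nab" and i: "induced_by_conn_op m n k l nab" shows "flat A W nab"
  unfolding flat_def
proof (intro ballI)
  fix \<delta> \<eta> \<omega> assume d: "\<delta> \<in> carrier V" "\<eta> \<in> carrier V" and w: "\<omega> \<in> carrier W"
  let ?R = "\<lambda>\<delta> \<eta>. curvature A W nab \<delta> \<eta> \<omega>"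
  have R_closed: "?R \<delta> \<eta> \<in> carrier W" if "\<delta> \<in> carrier V" "\<eta> \<in> carrier V" for \<delta> \<eta>
    using module_endoD(1)[OF curvature_endo[OF c that] w] .
  have z: "cl a \<odot>\<^bsub>W\<^esub> \<zero>\<^bsub>W\<^esub> = \<zero>\<^bsub>W\<^esub>" "\<zero>\<^bsub>W\<^esub> \<oplus>\<^bsub>W\<^esub> \<zero>\<^bsub>W\<^esub> = \<zero>\<^bsub>W\<^esub>" "\<ominus>\<^bsub>W\<^esub> \<zero>\<^bsub>W\<^esub> = \<zero>\<^bsub>W\<^esub>" for a by simp_all
  have left: "?R \<delta> \<eta> = \<zero>\<^bsub>W\<^esub>" if d: "\<delta> \<in> carrier V" "\<eta> \<in> carrier V"
    and 0: "?R (delta m n 2) \<eta> = \<zero>\<^bsub>W\<^esub>" "?R (delta m n 3) \<eta> = \<zero>\<^bsub>W\<^esub>" for \<delta> \<eta>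
  proof (rule W_cancel_2z[OF R_closed[OF d]])
    have "cl (2 * ps_z) \<odot>\<^bsub>W\<^esub> ?R \<delta> \<eta> = ?R (cl (2 * ps_z) \<odot>\<^bsub>V\<^esub> \<delta>) \<eta>"
      using curvature_smult_left[OF c d cl_closed w] by simp
    also have "\<dots> = cl (- cx \<delta>) \<odot>\<^bsub>W\<^esub> ?R (delta m n 2) \<eta> \<oplus>\<^bsub>W\<^esub> cl (- cy \<delta>) \<odot>\<^bsub>W\<^esub> ?R (delta m n 3) \<eta>"
      unfolding V_scaled[OF d(1)] using d w
      by (simp add: curvature_add_left[OF c] curvature_smult_left[OF c] V_smult_closed)
    also have "\<dots> = \<zero>\<^bsub>W\<^esub>" unfolding 0 z ..
    finally show "cl (2 * ps_z) \<odot>\<^bsub>W\<^esub> ?R \<delta> \<eta> = \<zero>\<^bsub>W\<^esub>" .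
  qed
  have swap: "?R \<eta> \<delta> = \<zero>\<^bsub>W\<^esub>" if "\<delta> \<in> carrier V" "\<eta> \<in> carrier V" "?R \<delta> \<eta> = \<zero>\<^bsub>W\<^esub>" for \<delta> \<eta>
    using curvature_swap[OF c that(1,2) w] unfolding that(3) z .
  have 23: "?R (delta m n 2) (delta m n 3) = \<zero>\<^bsub>W\<^esub>"
  proof -
    obtain v where v: "\<omega> = wc v" using w by (auto simp: W_carrier)
    have "?R (delta m n 2) (delta m n 3) = wc (\<lambda>j. dop 2 (dop 3 v) j - dop 3 (dop 2 v) j - - 2 * dop 1 v j)"
      using i[unfolded induced_iff] by (simp add: curvature_def v lie_bracket_23 connection_smult[OF c])
    moreover have "null (\<lambda>j. dop 2 (dop 3 v) j - dop 3 (dop 2 v) j - - 2 * dop 1 v j)"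
    proof (rule null_cong[OF null_zero])
      fix j :: nat assume "j < 4"
      then have "f dvd - (dop 2 (dop 3 v) j - dop 3 (dop 2 v) j + 2 * dop 1 v j)"
        unfolding dvd_minus_iff by (rule dop_commutator)
      then show "f dvd 0 - (dop 2 (dop 3 v) j - dop 3 (dop 2 v) j - - 2 * dop 1 v j)" by simp
    qed
    ultimately show ?thesis by (simp add: wc_eq)
  qed
  have self: "?R \<delta> \<delta> = \<zero>\<^bsub>W\<^esub>" if "\<delta> \<in> carrier V" for \<delta> by (rule curvature_self[OF c that w])
  have V2: "delta m n 2 \<in> carrier V" and V3: "delta m n 3 \<in> carrier V" by simp_all
  have e2: "?R \<eta> (delta m n 2) = \<zero>\<^bsub>W\<^esub>" by (rule left[OF d(2) V2 self[OF V2] swap[OF V2 V3 23]])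
  have e3: "?R \<eta> (delta m n 3) = \<zero>\<^bsub>W\<^esub>" by (rule left[OF d(2) V3 23 self[OF V3]])
  show "?R \<delta> \<eta> = \<zero>\<^bsub>W\<^esub>" by (rule left[OF d swap[OF d(2) V2 e2] swap[OF d(2) V3 e3]])
qed

end

section \<open>The free modules\<close>

context matrix_factorization
begin

lemma two_basis:
  assumes span: "\<And>v. null (\<lambda>i. v i - (c0 v * e0 i + c1 v * e1 i))"
    and indep: "\<And>a b. null (\<lambda>i. a * e0 i + b * e1 i) \<Longrightarrow> f dvd a \<and> f dvd b"
  shows "is_basis A W 2 (\<lambda>i. wc (if i = 0 then e0 else e1))"
proof -
  let ?e = "\<lambda>i :: nat. wc (if i = 0 then e0 else e1)"
  have two: "{..<2} = {0, 1 :: nat}" by auto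
  have comb: "(\<Oplus>\<^bsub>W\<^esub>i\<in>{..<2}. c i \<odot>\<^bsub>W\<^esub> ?e i) = wc (\<lambda>i. a * e0 i + b * e1 i)"
    if "c 0 = cl a" "c 1 = cl b" for c a b
    unfolding two using that by (subst M.finsum_insert) (auto simp: M.finsum_insert)
  show ?thesis
    unfolding is_basis_def
  proof (intro conjI ballI)
    show "?e \<in> {..<2} \<rightarrow> carrier W" by simp
    fix \<omega> assume "\<omega> \<in> carrier W"
    then obtain v where v: "\<omega> = wc v" by (auto simp: W_carrier)
    show "\<exists>!c. c \<in> {..<2} \<rightarrow>\<^sub>E carrier A \<and> \<omega> = (\<Oplus>\<^bsub>W\<^esub>i\<in>{..<2}. c i \<odot>\<^bsub>W\<^esub> ?e i)"
    proof (rule ex_ex1I)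
      let ?c = "\<lambda>i\<in>{..<2 :: nat}. if i = 0 then cl (c0 v) else cl (c1 v)"
      have "\<omega> = (\<Oplus>\<^bsub>W\<^esub>i\<in>{..<2}. ?c i \<odot>\<^bsub>W\<^esub> ?e i)"
        using span[of v] by (subst comb[of _ "c0 v" "c1 v"]) (simp_all add: v wc_eq)
      then show "\<exists>c. c \<in> {..<2} \<rightarrow>\<^sub>E carrier A \<and> \<omega> = (\<Oplus>\<^bsub>W\<^esub>i\<in>{..<2}. c i \<odot>\<^bsub>W\<^esub> ?e i)"
        by (intro exI[of _ ?c]) auto
      fix c c' assume c: "c \<in> {..<2} \<rightarrow>\<^sub>E carrier A \<and> \<omega> = (\<Oplus>\<^bsub>W\<^esub>i\<in>{..<2}. c i \<odot>\<^bsub>W\<^esub> ?e i)"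
        and c': "c' \<in> {..<2} \<rightarrow>\<^sub>E carrier A \<and> \<omega> = (\<Oplus>\<^bsub>W\<^esub>i\<in>{..<2}. c' i \<odot>\<^bsub>W\<^esub> ?e i)"
      have "c 0 \<in> carrier A" "c 1 \<in> carrier A" "c' 0 \<in> carrier A" "c' 1 \<in> carrier A" using c c' by auto
      then obtain a b a' b' where ab: "c 0 = cl a" "c 1 = cl b" "c' 0 = cl a'" "c' 1 = cl b'"
        unfolding A_carrier by blast
      have "wc (\<lambda>i. a * e0 i + b * e1 i) = wc (\<lambda>i. a' * e0 i + b' * e1 i)"
        using c c' unfolding comb[OF ab(1,2)] comb[OF ab(3,4)] by simp
      then have "null (\<lambda>i. (a - a') * e0 i + (b - b') * e1 i)" by (simp add: wc_eq algebra_simps)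
      from indep[OF this] have "c 0 = c' 0" "c 1 = c' 1" unfolding ab cl_eq by simp_all
      then show "c = c'" using c c' by (intro PiE_ext[of c "{..<2}" "\<lambda>_. carrier A" c']) (auto simp: two)
    qed
  qed
qed

text \<open>For \<open>k = m\<close> or \<open>l = n\<close> one of the entries \<open>x\<^sup>m\<^sup>-\<^sup>k\<close>, \<open>y\<^sup>n\<^sup>-\<^sup>l\<close> of \<open>\<phi>\<close> is a unit. Two of the four unit vectors
  can then be eliminated, and the other two are a basis of \<open>W\<close>.\<close>

lemma basis_boundary:
  assumes "k = m \<or> l = n" shows "\<exists>e. is_basis A W 2 e"
proof -
  let ?u = "\<lambda>s i. if i = s then 1 else 0 :: 'a ps3"
  have row: "f dvd mat_app ps v i" if "null v" "i < 4" for v i using that by (simp add: null_def)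
  from assms show ?thesis
  proof
    assume k: "k = m"
    show ?thesis
    proof (rule exI, rule two_basis[where ?e0.0 = "?u 1" and ?e1.0 = "?u 2"
          and ?c0.0 = "\<lambda>v. v 1 - ps_y ^ l * v 0 - ps_z * v 3" and ?c1.0 = "\<lambda>v. v 2 - ps_z * v 0 + ps_y ^ (n - l) * v 3"])
      show "null (\<lambda>i. v i - ((v 1 - ps_y ^ l * v 0 - ps_z * v 3) * ?u 1 i
          + (v 2 - ps_z * v 0 + ps_y ^ (n - l) * v 3) * ?u 2 i))" for v
        unfolding null_iff
      proof (rule exI[of _ "\<lambda>i. if i = 0 then v 0 else if i = 2 then v 3 else 0"], intro allI impI)
        fix i :: nat assume "i < 4"
        then show "f dvd v i - ((v 1 - ps_y ^ l * v 0 - ps_z * v 3) * ?u 1 i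
            + (v 2 - ps_z * v 0 + ps_y ^ (n - l) * v 3) * ?u 2 i) - mat_app ph (\<lambda>i. if i = 0 then v 0 else if i = 2 then v 3 else 0) i"
          by (auto dest!: less_4_cases simp: mat_app_def sum_less_4 mf_phi_def k algebra_simps)
      qed
      show "f dvd a \<and> f dvd b" if "null (\<lambda>i. a * ?u 1 i + b * ?u 2 i)" for a b
        using row[OF that, of 1] row[OF that, of 3] by (simp add: mat_app_def sum_less_4 mf_psi_def k)
    qed
  next
    assume l: "l = n"
    show ?thesis
    proof (rule exI, rule two_basis[where ?e0.0 = "?u 1" and ?e1.0 = "?u 3"
          and ?c0.0 = "\<lambda>v. v 1 + ps_x ^ k * v 0 + ps_z * v 2" and ?c1.0 = "\<lambda>v. v 3 - ps_z * v 0 + ps_x ^ (m - k) * v 2"])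
      show "null (\<lambda>i. v i - ((v 1 + ps_x ^ k * v 0 + ps_z * v 2) * ?u 1 i
          + (v 3 - ps_z * v 0 + ps_x ^ (m - k) * v 2) * ?u 3 i))" for v
        unfolding null_iff
      proof (rule exI[of _ "\<lambda>i. if i = 1 then v 0 else if i = 2 then - v 2 else 0"], intro allI impI)
        fix i :: nat assume "i < 4"
        then show "f dvd v i - ((v 1 + ps_x ^ k * v 0 + ps_z * v 2) * ?u 1 i
            + (v 3 - ps_z * v 0 + ps_x ^ (m - k) * v 2) * ?u 3 i) - mat_app ph (\<lambda>i. if i = 1 then v 0 else if i = 2 then - v 2 else 0) i"
          by (auto dest!: less_4_cases simp: mat_app_def sum_less_4 mf_phi_def l algebra_simps)
      qed
      show "f dvd a \<and> f dvd b" if "null (\<lambda>i. a * ?u 1 i + b * ?u 3 i)" for a b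
        using row[OF that, of 0] row[OF that, of 3] by (simp add: mat_app_def sum_less_4 mf_psi_def l)
    qed
  qed
qed

text \<open>When the matrices \<open>A\<^sub>i\<close> are not integral, \<open>k = m\<close> or \<open>l = n\<close> and the module is free.\<close>

lemma flat_connection_exists: "\<exists>nab. is_connection A W nab \<and> flat A W nab"
proof (cases "conn_mats_integral TYPE('a) m n k l")
  case True
  then interpret integral_matrix_factorization m n k l F by unfold_locales
  show ?thesis using conn_connection conn_induced induced_flat by blast
next
  case False
  then have "k = m \<or> l = n" using conn_mats_integralI[of k m l n, where 'a = 'a] klmn by linarith
  then obtain e where "is_basis A W 2 e" using basis_boundary by blast
  then show ?thesis by (rule free_flat_connection)
qed

end

theorem theorem3p3:
  fixes m n k l :: nat
    and A :: "('a::field_char_0, 'a fps fps fps set) module"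
    and W :: "('a fps fps fps set, (nat \<Rightarrow> 'a fps fps fps set) set) module"
  assumes "1 \<le> k" and "k \<le> m" and "1 \<le> l" and "l \<le> n"
    and "A = hyp_ring m n" and "W = mf_module m n k l"
  shows "(conn_mats_integral TYPE('a) m n k l \<longrightarrow>
            (\<exists>!nab. is_connection A W nab \<and> induced_by_conn_op m n k l nab) \<and>
            (\<forall>nab. is_connection A W nab \<and> induced_by_conn_op m n k l nab \<longrightarrow> flat A W nab)) \<and>
         chern1 A W = \<one>\<^bsub>cohomology A (VW A W) (locally_free_locus A W) 2\<^esub>"
proof -
  interpret M: matrix_factorization m n k l "TYPE('a)"
    using assms by unfold_locales
  have 1: "(\<exists>!nab. is_connection A W nab \<and> induced_by_conn_op m n k l nab) \<and>
      (\<forall>nab. is_connection A W nab \<and> induced_by_conn_op m n k l nab \<longrightarrow> flat A W nab)"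
    if "conn_mats_integral TYPE('a) m n k l"
  proof -
    interpret I: integral_matrix_factorization m n k l "TYPE('a)"
      using that by unfold_locales
    show ?thesis unfolding assms(5,6)
      using I.conn_connection I.conn_induced I.induced_unique I.induced_flat by blast
  qed
  obtain nab where "is_connection A W nab" "flat A W nab"
    using M.flat_connection_exists unfolding assms(5,6) by blast
  then have "chern1 A W = \<one>\<^bsub>cohomology A (VW A W) (locally_free_locus A W) 2\<^esub>"
    unfolding assms(5,6) by (rule M.chern1_trivial)
  with 1 show ?thesis by blast
qed

end
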